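(* Let $T$ be a non-empty finite subset of $\{\nu\in\mathbb N\mid\nu\ge2\}$ and let $\rho$ be a probability measure on $T$ with full support. Let $\{L_w(\cdot)\}_{w\in W_*}$ be a family of i.i.d. $T$-valued random variables with distribution $\rho$ defined on a probability space $(\hat\Omega,\hat{\mathcal B},\hat P)$, and for $\hat\omega\in\hat\Omega$ let $L(\hat\omega)=\{L_w(\hat\omega)\}_{w\in W_*}$ and let $G(L(\hat\omega))$ be the associated inhomogeneous Sierpinski gasket (a random recursive Sierpinski gasket). Then, for $\hat P$-a.s. $\hat\omega$, with $\tilde W_m$, $\lambda_q$, $\mu_q$, $\mathcal F$, $\mu_{\langle f\rangle}$ denoting the objects associated with $L=L(\hat\omega)$, the following Condition (B) is satisfied for all $q\in\mathcal A$. (B) For each $l_0,l_1\in\mathbb N$ there exists $l_2\in\mathbb N$ such that, for $\lambda_q$-a.e. $\omega\in\Sigma$, there exist infinitely many $k\in\mathbb Z_+$ such that, for every $i,j\in S_0$, the relation $$[\omega]_k\, i^{\nu_{k+1}}\cdots i^{\nu_{k+l_0}}\,j^{\nu_{k+l_0+1}}\cdots j^{\nu_{k+l_0+l_1}}\,j^{\nu_{k+l_0+l_1+1}}\cdots j^{\nu_{k+l_0+l_1+l_2}}\in \tilde W_{k+l_0+l_1+l_2}$$ (with $\nu_{k+1},\dots,\nu_{k+l_0+l_1+l_2}\in T$) implies $$\{\nu_{m}\mid k+l_0+1\le m\le k+l_0+l_1\}\subset \{\nu_{m}\mid k+l_0+l_1+1\le m\le k+l_0+l_1+l_2\}.$$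 Consequently, for $\hat P$-a.s. $\hat\omega$, for all $q\in\mathcal A$ and all $f\in\mathcal F$, the energy measure $\mu_{\langle f\rangle}$ and $\mu_q$ on $G(L(\hat\omega))$ are mutually singular.
   Context: Notation: $\mathbb Z_+=\mathbb N\cup\{0\}$; $l(X)$ is the set of real-valued functions on a set $X$; $C(X)$ the real-valued continuous functions. Level-$\nu$ data. Let $\tilde K\subset\mathbb R^2$ be a (filled) equilateral triangle with vertex set $V_0=\{p_1,p_2,p_3\}$, and $S_0=\{1,2,3\}$. For $\nu\ge2$ let $N(\nu)=\nu(\nu+1)/2$. Divide each side of $\tilde K$ into $\nu$ equal parts, giving a subdivision of $\tilde K$ into triangles of side ratio $1/\nu$; let $K^{(\nu)}_1,\dots,K^{(\nu)}_{N(\nu)}$ be the (filled) small triangles with the same orientation as $\tilde K$, and $\psi^{(\nu)}_i$ the map $z\mapsto \nu^{-1}z+\alpha^{(\nu)}_i$ taking $\tilde K$ onto $K^{(\nu)}_i$. (Equivalently, these are the maps $z\mapsto \nu^{-1}(z+ap_1+bp_2+cp_3)$ with $a,b,c\in\mathbb Z_+$, $a+b+c=\nu-1$.) Labels are chosen so that for $i\in S_0$, $K_i^{(\nu)}$ contains $p_i$, i.e. $\psi^{(\nu)}_i(p_i)=p_i$. Let $V_1^{(\nu)}=\bigcup_{i}\psi_i^{(\nu)}(V_0)$. For $x,y\in l(V_0)$ let $Q(x,y)=\sum_{(a,b)\in\{(1,2),(2,3),(3,1)\}}(x(p_a)-x(p_b))(y(p_a)-y(p_b))$. There is a unique $r^{(\nu)}>0$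 such that for every $x\in l(V_0)$, $Q(x,x)=\inf\{\sum_{i=1}^{N(\nu)}\frac1{r^{(\nu)}}Q(y\circ\psi_i^{(\nu)}|_{V_0},y\circ\psi_i^{(\nu)}|_{V_0})\mid y\in l(V_1^{(\nu)}),\ y|_{V_0}=x\}$; this $r^{(\nu)}$ is fixed. Words. For $\nu\in T$, $S^{(\nu)}$ is the set of formal letters $i^\nu$, $i=1,\dots,N(\nu)$ (the $\nu$ is a label, not a power; different $\nu$ give different letters), and $S=\bigcup_{\nu\in T}S^{(\nu)}$. $\Sigma=S^{\mathbb N}$; $W_0=\{\emptyset\}$, $W_m=S^m$, $W_*=\bigcup_{m\in\mathbb Z_+}W_m$. For $\omega\in\Sigma$, $[\omega]_n=\omega_1\cdots\omega_n$, $[\omega]_0=\emptyset$. For $w\in W_m$, $\Sigma_w=\{\omega\in\Sigma\mid[\omega]_m=w\}$. Put $\psi_{i^\nu}=\psi_i^{(\nu)}$, $r_{i^\nu}=r^{(\nu)}$, and for $w=w_1\cdots w_m$: $\psi_w=\psi_{w_1}\circ\cdots\circ\psi_{w_m}$, $r_w=r_{w_1}\cdots r_{w_m}$ ($\psi_\emptyset=\mathrm{id}$, $r_\emptyset=1$). $\pi:\Sigma\to\tilde K$ sends $\omega$ to the unique point of $\bigcap_{m}\psi_{[\omega]_m}(\tilde K)$. The gasket. Given $L=\{L_w\}_{w\in W_*}\in T^{W_*}$, set $\tilde W_0=\{\emptyset\}$, $\tilde W_m=\bigcup_{w\in\tilde W_{m-1}}\{wv\mid v\in S^{(L_w)}\}$,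 $\tilde W_*=\bigcup_m\tilde W_m$, $\tilde\Sigma=\{\omega\in\Sigma\mid[\omega]_m\in\tilde W_m\ \forall m\in\mathbb Z_+\}$, and $G(L)=\pi(\tilde\Sigma)$ with the relative topology of $\mathbb R^2$. Let $V_m=\bigcup_{w\in\tilde W_m}\psi_w(V_0)$. Reference measures. $\mathcal A$ is the set of $q=\{q_v\}_{v\in S}$ with $q_v>0$ for all $v\in S$ and $\sum_{v\in S^{(\nu)}}q_v=1$ for each $\nu\in T$. For $q\in\mathcal A$, $\lambda_q$ is the unique Borel probability measure on $\Sigma$ with $\lambda_q(\Sigma_w)=q_{w_1}\cdots q_{w_m}$ if $w=w_1\cdots w_m\in\tilde W_m$ and $\lambda_q(\Sigma_w)=0$ if $w\notin\tilde W_*$ (so $\lambda_q(\Sigma\setminus\tilde\Sigma)=0$); $\mu_q$ is the image measure of $\lambda_q$ under $\pi|_{\tilde\Sigma}:\tilde\Sigma\to G(L)$. Dirichlet form. For $x,y\in l(V_m)$ let $\mathcal E^{(m)}(x,y)=\sum_{w\in\tilde W_m}\frac1{r_w}Q(x\circ\psi_w|_{V_0},y\circ\psi_w|_{V_0})$. For $f\in C(G(L))$ the sequence $\mathcal E^{(m)}(f|_{V_m},f|_{V_m})$ is non-decreasing in $m$; $\mathcal F=\{f\in C(G(L))\mid\lim_{m}\mathcal E^{(m)}(f|_{V_m},f|_{V_m})<\infty\}$ and $\mathcal E(f,g)=\lim_m\mathcal E^{(m)}(f|_{V_m},g|_{V_m})$ for $f,g\in\mathcal F$. It is known that $(\mathcal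 E,\mathcal F)$ is a strongly local regular Dirichlet form on $L^2(G(L),\mu_q)$ for every $q\in\mathcal A$. The energy measure $\mu_{\langle f\rangle}$ of $f\in\mathcal F$ is the finite Borel measure on $G(L)$ characterized by $\int_{G(L)}g\,d\mu_{\langle f\rangle}=2\mathcal E(f,fg)-\mathcal E(f^2,g)$ for all $g\in\mathcal F$. *)

theory Defs
  imports "HOL-Probability.Probability"
begin

type_synonym plane = "real ^ 2"

(* The letter i^nu is the pair (nu, i). *)
type_synonym letter = "nat \<times> nat"

definition S0 :: "nat set" where
  "S0 = {1, 2, 3}"

definition V0 :: "(nat \<Rightarrow> plane) \<Rightarrow> plane set" where
  "V0 p = p ` S0"

definition equilateral :: "(nat \<Rightarrow> plane) \<Rightarrow> bool" where
  "equilateral p \<longleftrightarrow>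
     p 1 \<noteq> p 2 \<and> dist (p 1) (p 2) = dist (p 2) (p 3) \<and> dist (p 2) (p 3) = dist (p 3) (p 1)"

definition triangle :: "(nat \<Rightarrow> plane) \<Rightarrow> plane set" where
  "triangle p = convex hull (V0 p)"

definition Nlet :: "nat \<Rightarrow> nat" where
  "Nlet \<nu> = \<nu> * (\<nu> + 1) div 2"

definition psi :: "(nat \<Rightarrow> nat \<Rightarrow> plane) \<Rightarrow> letter \<Rightarrow> plane \<Rightarrow> plane" where
  "psi \<alpha> v z = (1 / real (fst v)) *\<^sub>R z + \<alpha> (fst v) (snd v)"

(* \<alpha> \<nu> 1, ..., \<alpha> \<nu> (Nlet \<nu>) enumerates, without repetition, the translation parts of the maps
   z \<mapsto> (z + a p1 + b p2 + c p3) / \<nu> with a + b + c = \<nu> - 1; these carry the big triangle onto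
   the equally oriented triangles of the \<nu>-fold subdivision. The enumeration is arbitrary
   except that the i-th small triangle contains p i for i in S0. *)
definition labelling :: "(nat \<Rightarrow> plane) \<Rightarrow> (nat \<Rightarrow> nat \<Rightarrow> plane) \<Rightarrow> bool" where
  "labelling p \<alpha> \<longleftrightarrow> (\<forall>\<nu>\<ge>2.
     bij_betw (\<alpha> \<nu>) {1..Nlet \<nu>}
       {(1 / real \<nu>) *\<^sub>R (real a *\<^sub>R p 1 + real b *\<^sub>R p 2 + real c *\<^sub>R p 3) | a b c. a + b + c = \<nu> - 1} \<and>
     (\<forall>i\<in>S0. psi \<alpha> (\<nu>, i) (p i) = p i))"

(* Functions on V0, on V_m and on the gasket are represented by functions on the whole plane
   of which only the values on the set in question are used. *)
definition Q :: "(nat \<Rightarrow> plane) \<Rightarrow> (plane \<Rightarrow> real) \<Rightarrow> (plane \<Rightarrow> real) \<Rightarrow> real" where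
  "Q p x y = (\<Sum>(a, b)\<in>{(1, 2), (2, 3), (3, 1)}. (x (p a) - x (p b)) * (y (p a) - y (p b)))"

definition renorm :: "(nat \<Rightarrow> plane) \<Rightarrow> (nat \<Rightarrow> nat \<Rightarrow> plane) \<Rightarrow> nat \<Rightarrow> real" where
  "renorm p \<alpha> \<nu> = (THE r. r > 0 \<and> (\<forall>x :: plane \<Rightarrow> real.
     Q p x x = Inf {(\<Sum>i = 1..Nlet \<nu>. (1 / r) * Q p (y \<circ> psi \<alpha> (\<nu>, i)) (y \<circ> psi \<alpha> (\<nu>, i))) | y.
                      \<forall>z\<in>V0 p. y z = x z}))"

definition letters :: "nat \<Rightarrow> letter set" where
  "letters \<nu> = {(\<nu>, i) | i. i \<in> {1..Nlet \<nu>}}"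

definition alphabet :: "nat set \<Rightarrow> letter set" where
  "alphabet T = (\<Union>\<nu>\<in>T. letters \<nu>)"

definition Words :: "nat set \<Rightarrow> letter list set" where
  "Words T = lists (alphabet T)"

definition Sigma_sp :: "nat set \<Rightarrow> (nat \<Rightarrow> letter) set" where
  "Sigma_sp T = {\<omega>. \<forall>n. \<omega> n \<in> alphabet T}"

(* Sequences are indexed from 0, so that \<omega>_n in the usual notation is \<omega> (n - 1). *)
definition prefix_of :: "(nat \<Rightarrow> letter) \<Rightarrow> nat \<Rightarrow> letter list" where
  "prefix_of \<omega> n = map \<omega> [0..<n]"

definition cylinder :: "nat set \<Rightarrow> letter list \<Rightarrow> (nat \<Rightarrow> letter) set" where
  "cylinder T w = {\<omega> \<in> Sigma_sp T. prefix_of \<omega> (length w) = w}"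

primrec psi_word :: "(nat \<Rightarrow> nat \<Rightarrow> plane) \<Rightarrow> letter list \<Rightarrow> plane \<Rightarrow> plane" where
  "psi_word \<alpha> [] = id"
| "psi_word \<alpha> (v # w) = psi \<alpha> v \<circ> psi_word \<alpha> w"

definition r_word :: "(nat \<Rightarrow> plane) \<Rightarrow> (nat \<Rightarrow> nat \<Rightarrow> plane) \<Rightarrow> letter list \<Rightarrow> real" where
  "r_word p \<alpha> w = prod_list (map (\<lambda>v. renorm p \<alpha> (fst v)) w)"

definition proj :: "(nat \<Rightarrow> plane) \<Rightarrow> (nat \<Rightarrow> nat \<Rightarrow> plane) \<Rightarrow> (nat \<Rightarrow> letter) \<Rightarrow> plane" where
  "proj p \<alpha> \<omega> = (THE z. z \<in> (\<Inter>m. psi_word \<alpha> (prefix_of \<omega> m) ` triangle p))"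

primrec Wt :: "(letter list \<Rightarrow> nat) \<Rightarrow> nat \<Rightarrow> letter list set" where
  "Wt L 0 = {[]}"
| "Wt L (Suc m) = (\<Union>w\<in>Wt L m. {w @ [v] | v. v \<in> letters (L w)})"

definition Wt_all :: "(letter list \<Rightarrow> nat) \<Rightarrow> letter list set" where
  "Wt_all L = (\<Union>m. Wt L m)"

definition Sigma_t :: "nat set \<Rightarrow> (letter list \<Rightarrow> nat) \<Rightarrow> (nat \<Rightarrow> letter) set" where
  "Sigma_t T L = {\<omega> \<in> Sigma_sp T. \<forall>m. prefix_of \<omega> m \<in> Wt L m}"

definition gasket ::
  "(nat \<Rightarrow> plane) \<Rightarrow> (nat \<Rightarrow> nat \<Rightarrow> plane) \<Rightarrow> nat set \<Rightarrow> (letter list \<Rightarrow> nat) \<Rightarrow> plane set" where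
  "gasket p \<alpha> T L = proj p \<alpha> ` Sigma_t T L"

definition weights :: "nat set \<Rightarrow> (letter \<Rightarrow> real) set" where
  "weights T = {q. (\<forall>v\<in>alphabet T. q v > 0) \<and> (\<forall>\<nu>\<in>T. (\<Sum>v\<in>letters \<nu>. q v) = 1)}"

(* The alphabet being finite and discrete, the product sigma-algebra below is the Borel
   sigma-algebra of the sequence space. *)
definition lambda_q ::
  "nat set \<Rightarrow> (letter list \<Rightarrow> nat) \<Rightarrow> (letter \<Rightarrow> real) \<Rightarrow> (nat \<Rightarrow> letter) measure" where
  "lambda_q T L q = (THE M. sets M = sets (\<Pi>\<^sub>M n\<in>UNIV. count_space (alphabet T)) \<and> prob_space M \<and>
     (\<forall>w\<in>Words T. measure M (cylinder T w) = (if w \<in> Wt_all L then prod_list (map q w) else 0)))"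

definition mu_q ::
  "(nat \<Rightarrow> plane) \<Rightarrow> (nat \<Rightarrow> nat \<Rightarrow> plane) \<Rightarrow> nat set \<Rightarrow> (letter list \<Rightarrow> nat) \<Rightarrow> (letter \<Rightarrow> real)
     \<Rightarrow> plane measure" where
  "mu_q p \<alpha> T L q =
     distr (restrict_space (lambda_q T L q) (Sigma_t T L)) (restrict_space borel (gasket p \<alpha> T L)) (proj p \<alpha>)"

definition energy_lvl ::
  "(nat \<Rightarrow> plane) \<Rightarrow> (nat \<Rightarrow> nat \<Rightarrow> plane) \<Rightarrow> (letter list \<Rightarrow> nat) \<Rightarrow> nat
     \<Rightarrow> (plane \<Rightarrow> real) \<Rightarrow> (plane \<Rightarrow> real) \<Rightarrow> real" where
  "energy_lvl p \<alpha> L m x y =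
     (\<Sum>w\<in>Wt L m. (1 / r_word p \<alpha> w) * Q p (x \<circ> psi_word \<alpha> w) (y \<circ> psi_word \<alpha> w))"

(* For continuous f the level energies are non-decreasing, so finiteness of the limit is
   convergence in the reals. *)
definition dom_F ::
  "(nat \<Rightarrow> plane) \<Rightarrow> (nat \<Rightarrow> nat \<Rightarrow> plane) \<Rightarrow> nat set \<Rightarrow> (letter list \<Rightarrow> nat)
     \<Rightarrow> (plane \<Rightarrow> real) set" where
  "dom_F p \<alpha> T L =
     {f. continuous_on (gasket p \<alpha> T L) f \<and> convergent (\<lambda>m. energy_lvl p \<alpha> L m f f)}"

definition energy ::
  "(nat \<Rightarrow> plane) \<Rightarrow> (nat \<Rightarrow> nat \<Rightarrow> plane) \<Rightarrow> (letter list \<Rightarrow> nat)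
     \<Rightarrow> (plane \<Rightarrow> real) \<Rightarrow> (plane \<Rightarrow> real) \<Rightarrow> real" where
  "energy p \<alpha> L f g = lim (\<lambda>m. energy_lvl p \<alpha> L m f g)"

definition energy_measure ::
  "(nat \<Rightarrow> plane) \<Rightarrow> (nat \<Rightarrow> nat \<Rightarrow> plane) \<Rightarrow> nat set \<Rightarrow> (letter list \<Rightarrow> nat) \<Rightarrow> (plane \<Rightarrow> real)
     \<Rightarrow> plane measure" where
  "energy_measure p \<alpha> T L f = (THE \<mu>.
     sets \<mu> = sets (restrict_space borel (gasket p \<alpha> T L)) \<and> finite_measure \<mu> \<and>
     (\<forall>g\<in>dom_F p \<alpha> T L.
        (\<integral>z. g z \<partial>\<mu>) = 2 * energy p \<alpha> L f (\<lambda>z. f z * g z) - energy p \<alpha> L (\<lambda>z. (f z)\<^sup>2) g))"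

definition mutually_singular :: "'a measure \<Rightarrow> 'a measure \<Rightarrow> bool" where
  "mutually_singular M N \<longleftrightarrow> sets M = sets N \<and>
     (\<exists>A\<in>sets M. emeasure M A = 0 \<and> emeasure N (space N - A) = 0)"

(* The word [\<omega>]_k i^{\<nu>(k+1)} ... i^{\<nu>(k+l0)} j^{\<nu>(k+l0+1)} ... j^{\<nu>(k+l0+l1+l2)}. *)
definition test_word ::
  "(nat \<Rightarrow> letter) \<Rightarrow> nat \<Rightarrow> nat \<Rightarrow> nat \<Rightarrow> nat \<Rightarrow> nat \<Rightarrow> nat \<Rightarrow> (nat \<Rightarrow> nat) \<Rightarrow> letter list" where
  "test_word \<omega> k l0 l1 l2 i j \<nu> =
     prefix_of \<omega> k
     @ map (\<lambda>m. (\<nu> m, i)) [k + 1..<k + l0 + 1]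
     @ map (\<lambda>m. (\<nu> m, j)) [k + l0 + 1..<k + l0 + l1 + 1]
     @ map (\<lambda>m. (\<nu> m, j)) [k + l0 + l1 + 1..<k + l0 + l1 + l2 + 1]"

definition condition_B ::
  "nat set \<Rightarrow> (letter list \<Rightarrow> nat) \<Rightarrow> (letter \<Rightarrow> real) \<Rightarrow> bool" where
  "condition_B T L q \<longleftrightarrow> (\<forall>l0\<ge>1. \<forall>l1\<ge>1. \<exists>l2\<ge>1. AE \<omega> in lambda_q T L q. \<exists>\<^sub>\<infinity>k.
     \<forall>i\<in>S0. \<forall>j\<in>S0. \<forall>\<nu> :: nat \<Rightarrow> nat.
       (\<forall>m\<in>{k + 1..k + l0 + l1 + l2}. \<nu> m \<in> T) \<longrightarrow>
       test_word \<omega> k l0 l1 l2 i j \<nu> \<in> Wt L (k + l0 + l1 + l2) \<longrightarrow>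
       \<nu> ` {k + l0 + 1..k + l0 + l1} \<subseteq> \<nu> ` {k + l0 + l1 + 1..k + l0 + l1 + l2})"

end

theory Submission
  imports Defs
begin

text \<open>Fix weights \<open>q\<close>, let \<open>\<lambda>\<close> be the associated measure on sequences and let \<open>\<mu>\<close> be the energy
  measure of a function \<open>f\<close>, lifted to sequences. The Hellinger affinity, the sum over the admissible words
  \<open>w\<close> of length \<open>m\<close> of the square roots of \<open>\<lambda>(w) \<mu>(w)\<close>, does not increase with \<open>m\<close>, and \<open>\<lambda>\<close> and \<open>\<mu>\<close> are
  mutually singular once it becomes arbitrarily small. For a function that is harmonic below some word, \<open>\<lambda>(w)\<close> and
  \<open>\<mu>(w)\<close> do not depend on the environment; only the set of admissible words does. Where the environment is constant
  on the two levels below \<open>w\<close>, the affinity contracts by a factor less than 1, since otherwise the energy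
  of the function would be multiplied by the same ratio twice in a row at each of the three corners, which forces
  the function to be constant. Such places occur with positive probability independently of the past, so the expected affinity
  decays geometrically. General \<open>f\<close> are approximated in energy by piecewise harmonic functions.

  The exponential rate leaves room to enlarge \<open>q\<close> slightly to weights with rational values, so that one null set of
  environments serves all \<open>q\<close>. Condition (B) follows from the same argument, with the mass of the words along which
  the required pattern never occurs in place of the affinity.\<close>

section \<open>Barycentric coordinates\<close>

text \<open>Passing to sequences is exact only up to the overlaps of cells, which are vertices.
  There are countably many of them and the reference measure charges no point, so the separating set
  is built from cells and the vertices are removed from it. The measures and constants of the
  statement are definite descriptions. Existence of the energy measure comes from additivity of the
  limit energy over subcells, which gives consistent cylinder masses. Uniqueness needs the domain of
  the form to be uniformly dense in the continuous functions, hence functions of finite energy that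
  separate points; piecewise harmonic functions provide them. Independence enters in one form: the
  mass of a word and its admissibility depend on the environment at strictly shorter words, the good
  event at the word only on levels from the word on. Weights that dominate \<open>q\<close> with the
  same sums would equal \<open>q\<close>, so the rational weights are not normalized. The resulting
  loss per level has to be beaten by the gain at good places; this fixes the constants near the end.
  Singularity is proved directly, parallel to Condition (B) rather than through it.\<close>

lemma sum_S0: "(\<Sum>a\<in>S0. f a) = f 1 + f 2 + f (3::nat)"
  by (simp add: S0_def add.assoc)

lemma finite_S0 [simp]: "finite S0" by (simp add: S0_def)

lemma S0_cases: "a \<in> S0 \<Longrightarrow> (a = 1 \<Longrightarrow> P) \<Longrightarrow> (a = 2 \<Longrightarrow> P) \<Longrightarrow> (a = 3 \<Longrightarrow> P) \<Longrightarrow> P"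
  by (auto simp: S0_def)

text \<open>Values at the three corners are indexed by the labels in \<open>S0\<close> rather than
  by points, so that the restriction of a function to any cell of any level is an object of the same
  type.\<close>

definition qf :: "(nat \<Rightarrow> real) \<Rightarrow> (nat \<Rightarrow> real) \<Rightarrow> real" where
  "qf x y = (x 1 - x 2) * (y 1 - y 2) + (x 2 - x 3) * (y 2 - y 3) + (x 3 - x 1) * (y 3 - y 1)"

lemma Q_eq_qf: "Q p x y = qf (\<lambda>a. x (p a)) (\<lambda>a. y (p a))"
  by (simp add: Q_def qf_def)

lemma qf_cong: "(\<And>a. a \<in> S0 \<Longrightarrow> x a = x' a) \<Longrightarrow> (\<And>a. a \<in> S0 \<Longrightarrow> y a = y' a) \<Longrightarrow> qf x y = qf x' y'"
  by (simp add: qf_def S0_def)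

lemma qf_sym: "qf x y = qf y x"
  by (simp add: qf_def)

lemma qf_nonneg: "0 \<le> qf x x"
  by (simp add: qf_def)

lemma qf_eq_0D: "qf x x = 0 \<Longrightarrow> a \<in> S0 \<Longrightarrow> b \<in> S0 \<Longrightarrow> x a = x b"
proof -
  assume "qf x x = 0" and ab: "a \<in> S0" "b \<in> S0"
  then have "(x 1 - x 2)\<^sup>2 + (x 2 - x 3)\<^sup>2 + (x 3 - x 1)\<^sup>2 = 0"
    by (simp add: qf_def power2_eq_square)
  then have "(x 1 - x 2)\<^sup>2 = 0" "(x 2 - x 3)\<^sup>2 = 0"
    using zero_le_power2[of "x 1 - x 2"] zero_le_power2[of "x 2 - x 3"] zero_le_power2[of "x 3 - x 1"]
    by linarith+
  then have "x 1 = x 2 \<and> x 2 = x 3" by simp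
  with ab show ?thesis by (auto simp: S0_def)
qed

lemma qf_add_left: "qf (\<lambda>a. x a + x' a) y = qf x y + qf x' y"
  and qf_diff_left: "qf (\<lambda>a. x a - x' a) y = qf x y - qf x' y"
  and qf_scale_left: "qf (\<lambda>a. c * x a) y = c * qf x y"
  and qf_add_right: "qf y (\<lambda>a. x a + x' a) = qf y x + qf y x'"
  and qf_diff_right: "qf y (\<lambda>a. x a - x' a) = qf y x - qf y x'"
  and qf_scale_right: "qf y (\<lambda>a. c * x a) = c * qf y x"
  by (simp_all add: qf_def algebra_simps)

lemmas qf_linear = qf_add_left qf_diff_left qf_scale_left qf_add_right qf_diff_right qf_scale_right

section \<open>Letters of a fixed type\<close>

lemma finite_letters [simp]: "finite (letters \<nu>)"
proof -
  have "letters \<nu> = Pair \<nu> ` {1..Nlet \<nu>}" by (auto simp: letters_def)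
  then show ?thesis by simp
qed

lemma letters_fst: "v \<in> letters \<nu> \<Longrightarrow> fst v = \<nu>"
  by (auto simp: letters_def)

lemma Nlet_ge_3: "\<nu> \<ge> 2 \<Longrightarrow> Nlet \<nu> \<ge> 3"
proof -
  assume "\<nu> \<ge> 2"
  then have "2 * 3 \<le> \<nu> * (\<nu> + 1)" by (intro mult_mono) auto
  then show ?thesis unfolding Nlet_def by linarith
qed

lemma S0_letters: "\<nu> \<ge> 2 \<Longrightarrow> i \<in> S0 \<Longrightarrow> (\<nu>, i) \<in> letters \<nu>"
  using Nlet_ge_3[of \<nu>] by (auto simp: letters_def S0_def)

lemma sum_letters: "(\<Sum>v\<in>letters \<nu>. f v) = (\<Sum>i = 1..Nlet \<nu>. f (\<nu>, i))"
proof -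
  have "letters \<nu> = Pair \<nu> ` {1..Nlet \<nu>}" by (auto simp: letters_def)
  then show ?thesis by (simp add: sum.reindex inj_on_def)
qed

locale gasket_geometry =
  fixes p :: "nat \<Rightarrow> plane" and \<alpha> :: "nat \<Rightarrow> nat \<Rightarrow> plane"
  assumes equilateral: "equilateral p" and labelling: "labelling p \<alpha>"
begin

definition bary_point :: "(nat \<Rightarrow> real) \<Rightarrow> plane" where
  "bary_point t = (\<Sum>a\<in>S0. t a *\<^sub>R p a)"

text \<open>With c the centroid and s the side length, the vector from c to \<open>p a\<close> has
  squared length s^2/3, and its inner product with the vector from c to another corner is -s^2/6.
  The factor 2/s^2 and the shift 1/3 therefore give 1 at \<open>p a\<close> and 0 at the other
  corners.\<close>

definition bary_coord :: "nat \<Rightarrow> plane \<Rightarrow> real" where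
  "bary_coord a z = 1/3 + (2 / (dist (p 1) (p 2))\<^sup>2) *
     ((z - (1/3) *\<^sub>R (p 1 + p 2 + p 3)) \<bullet> (p a - (1/3) *\<^sub>R (p 1 + p 2 + p 3)))"

lemma bary_point_cong: "(\<And>a. a \<in> S0 \<Longrightarrow> t a = t' a) \<Longrightarrow> bary_point t = bary_point t'"
  by (simp add: bary_point_def)

lemma bary_point_vertex: "a \<in> S0 \<Longrightarrow> bary_point (\<lambda>b. if b = a then 1 else 0) = p a"
  by (auto simp: bary_point_def sum_S0 S0_def)

lemma bary_coord_p:
  assumes "a \<in> S0" "b \<in> S0"
  shows "bary_coord a (p b) = (if a = b then 1 else 0)"
proof -
  define s where "s = dist (p 1) (p 2)"
  have s0: "s > 0" and d: "dist (p 2) (p 3) = s" "dist (p 3) (p 1) = s"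
    using equilateral by (auto simp: equilateral_def s_def)
  define u v where "u = p 2 - p 1" and "v = p 3 - p 1"
  have uu: "u \<bullet> u = s\<^sup>2"
    unfolding u_def s_def dist_norm by (simp add: dot_square_norm norm_minus_commute)
  have vv: "v \<bullet> v = s\<^sup>2"
    using d unfolding v_def dist_norm by (simp add: dot_square_norm)
  \<comment> \<open>Expanding the third side determines the angle: \<open>u\<close> and
    \<open>v\<close> have inner product s^2/2.\<close>
  have "(v - u) \<bullet> (v - u) = s\<^sup>2"
    using d unfolding u_def v_def dist_norm by (simp add: dot_square_norm norm_minus_commute)
  then have uv: "u \<bullet> v = s\<^sup>2 / 2"
    using uu vv by (simp add: inner_diff_left inner_diff_right inner_commute)
  have uv': "v \<bullet> u = s\<^sup>2 / 2" using uv by (simp add: inner_commute)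
  have p: "p 2 = p 1 + u" "p 3 = p 1 + v" by (simp_all add: u_def v_def)
  have c: "(1/3::real) *\<^sub>R (p 1 + p 2 + p 3) = p 1 + (1/3) *\<^sub>R (u + v)"
    unfolding p by (simp add: algebra_simps flip: scaleR_add_left)
  have c': "p 1 + x - (p 1 + y) = x - y" "p 1 - (p 1 + y) = - y" for x y by simp_all
  have s2: "s \<noteq> 0" using s0 by simp
  show ?thesis using assms
    unfolding bary_coord_def c s_def[symmetric]
    by (elim S0_cases; simp only: p c')
       (simp_all add: inner_simps uu vv uv uv' s2 field_simps)
qed

lemma bary_coord_affine:
  assumes "sum t S0 = 1" shows "bary_coord a (bary_point t) = (\<Sum>b\<in>S0. t b * bary_coord a (p b))"
proof -
  define c d K where "c = (1/3) *\<^sub>R (p 1 + p 2 + p 3)" and "d = p a - c"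
    and "K = 2 / (dist (p 1) (p 2))\<^sup>2"
  have t: "t 1 = 1 - t 2 - t 3" using assms by (simp add: sum_S0)
  show ?thesis
    unfolding bary_coord_def bary_point_def sum_S0 c_def[symmetric] d_def[symmetric] K_def[symmetric] t
    by (simp add: inner_simps algebra_simps)
qed

lemma bary_coord_pt:
  assumes "sum t S0 = 1" "a \<in> S0" shows "bary_coord a (bary_point t) = t a"
proof -
  have "bary_coord a (bary_point t) = (\<Sum>b\<in>S0. if b = a then t b else 0)"
    unfolding bary_coord_affine[OF assms(1)] by (rule sum.cong) (auto simp: bary_coord_p assms(2))
  then show ?thesis using assms by simp
qed

lemma continuous_bary: "continuous_on A (bary_coord a)"
  unfolding bary_coord_def by (intro continuous_intros)

lemma bary_point_eq_iff:
  assumes "sum t S0 = 1" "sum t' S0 = 1"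
  shows "bary_point t = bary_point t' \<longleftrightarrow> (\<forall>a\<in>S0. t a = t' a)"
  using bary_coord_pt[OF assms(1)] bary_coord_pt[OF assms(2)] by (metis bary_point_cong)

lemma bary_point_eqD: "bary_point t = bary_point t' \<Longrightarrow> sum t S0 = 1 \<Longrightarrow> sum t' S0 = 1 \<Longrightarrow> a \<in> S0 \<Longrightarrow> t a = t' a"
  using bary_point_eq_iff by blast

lemma p_inj: "a \<in> S0 \<Longrightarrow> b \<in> S0 \<Longrightarrow> p a = p b \<longleftrightarrow> a = b"
  using bary_coord_p[of a a] bary_coord_p[of a b] by (auto split: if_splits)

lemma triangle_eq: "triangle p = {bary_point t | t. (\<forall>a\<in>S0. 0 \<le> t a) \<and> sum t S0 = 1}" (is "_ = ?R")
proof
  have V: "V0 p = {p 1, p 2, p 3}" by (auto simp: V0_def S0_def)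
  show "triangle p \<subseteq> ?R"
  proof
    fix z assume "z \<in> triangle p"
    then obtain u v w where "0 \<le> u" "0 \<le> v" "0 \<le> w" "u + v + w = 1"
      "z = u *\<^sub>R p 1 + v *\<^sub>R p 2 + w *\<^sub>R p 3"
      unfolding triangle_def V convex_hull_3 by blast
    then show "z \<in> ?R"
      by (intro CollectI exI[of _ "\<lambda>a. if a = 1 then u else if a = 2 then v else w"])
         (auto simp: bary_point_def sum_S0)
  qed
  show "?R \<subseteq> triangle p"
  proof
    fix z assume "z \<in> ?R"
    then obtain t where "\<forall>a\<in>S0. 0 \<le> t a" "sum t S0 = 1" "z = bary_point t" by blast
    then have "0 \<le> t 1" "0 \<le> t 2" "0 \<le> t 3" "t 1 + t 2 + t 3 = 1"
      "z = t 1 *\<^sub>R p 1 + t 2 *\<^sub>R p 2 + t 3 *\<^sub>R p 3"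
      by (auto simp: bary_point_def sum_S0 S0_def)
    then show "z \<in> triangle p"
      unfolding triangle_def V convex_hull_3 by blast
  qed
qed

lemma triangle_iff: "bary_point t \<in> triangle p \<longleftrightarrow> (\<forall>a\<in>S0. 0 \<le> t a)" if "sum t S0 = 1"
proof
  assume "bary_point t \<in> triangle p"
  then obtain t' where "\<forall>a\<in>S0. 0 \<le> t' a" "sum t' S0 = 1" "bary_point t = bary_point t'"
    unfolding triangle_eq by blast
  then show "\<forall>a\<in>S0. 0 \<le> t a" using bary_point_eq_iff[OF that, of t'] by simp
next
  assume "\<forall>a\<in>S0. 0 \<le> t a"
  then show "bary_point t \<in> triangle p" unfolding triangle_eq using that by blast
qed

lemma triangle_obtain:
  assumes "z \<in> triangle p"
  obtains t where "z = bary_point t" "\<And>a. a \<in> S0 \<Longrightarrow> 0 \<le> t a" "sum t S0 = 1"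
  using assms unfolding triangle_eq by blast

lemma compact_triangle: "compact (triangle p)"
  unfolding triangle_def V0_def by (intro compact_convex_hull finite_imp_compact) simp

lemma p_in_triangle: "a \<in> S0 \<Longrightarrow> p a \<in> triangle p"
  unfolding triangle_def V0_def by (rule hull_inc) simp

section \<open>Cells of the subdivisions\<close>

lemma labelling_image:
  assumes "\<nu> \<ge> 2"
  shows "\<alpha> \<nu> ` {1..Nlet \<nu>} = {(1 / real \<nu>) *\<^sub>R (real a *\<^sub>R p 1 + real b *\<^sub>R p 2 + real c *\<^sub>R p 3) | a b c. a + b + c = \<nu> - 1}"
  and "inj_on (\<alpha> \<nu>) {1..Nlet \<nu>}"
  using labelling assms unfolding labelling_def bij_betw_def by blast+

lemma psi_fix: "\<nu> \<ge> 2 \<Longrightarrow> i \<in> S0 \<Longrightarrow> psi \<alpha> (\<nu>, i) (p i) = p i"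
  using labelling unfolding labelling_def by blast

text \<open>The integer triple behind the translation vector of a cell. It replaces the arbitrary
  enumeration of the letters by lattice coordinates, in which overlaps, corners and reflections
  become arithmetic. Only its values on \<open>S0\<close> are meaningful.\<close>

definition cell_offset :: "letter \<Rightarrow> nat \<Rightarrow> nat" where
  "cell_offset v = (SOME n. sum n S0 = fst v - 1 \<and>
     \<alpha> (fst v) (snd v) = (1 / real (fst v)) *\<^sub>R bary_point (\<lambda>a. real (n a)))"

lemma cell_offset:
  assumes "\<nu> \<ge> 2" "v \<in> letters \<nu>"
  shows "sum (cell_offset v) S0 = \<nu> - 1" "\<alpha> \<nu> (snd v) = (1 / real \<nu>) *\<^sub>R bary_point (\<lambda>a. real (cell_offset v a))"
proof -
  have "snd v \<in> {1..Nlet \<nu>}" using assms by (auto simp: letters_def)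
  then have "\<alpha> \<nu> (snd v) \<in> {(1 / real \<nu>) *\<^sub>R (real a *\<^sub>R p 1 + real b *\<^sub>R p 2 + real c *\<^sub>R p 3) | a b c. a + b + c = \<nu> - 1}"
    using labelling_image[OF assms(1)] by blast
  then obtain a b c where abc: "a + b + c = \<nu> - 1"
    "\<alpha> \<nu> (snd v) = (1 / real \<nu>) *\<^sub>R (real a *\<^sub>R p 1 + real b *\<^sub>R p 2 + real c *\<^sub>R p 3)" by blast
  have "\<exists>n. sum n S0 = fst v - 1 \<and> \<alpha> (fst v) (snd v) = (1 / real (fst v)) *\<^sub>R bary_point (\<lambda>a. real (n a))"
    using abc by (intro exI[of _ "\<lambda>k. if k = 1 then a else if k = 2 then b else c"])
      (auto simp: letters_fst[OF assms(2)] bary_point_def sum_S0)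
  from someI_ex[OF this] show "sum (cell_offset v) S0 = \<nu> - 1" "\<alpha> \<nu> (snd v) = (1 / real \<nu>) *\<^sub>R bary_point (\<lambda>a. real (cell_offset v a))"
    unfolding cell_offset_def[symmetric] by (auto simp: letters_fst[OF assms(2)])
qed

lemma psi_pt:
  assumes "\<nu> \<ge> 2" "v \<in> letters \<nu>"
  shows "psi \<alpha> v (bary_point t) = bary_point (\<lambda>a. (t a + cell_offset v a) / \<nu>)"
  unfolding psi_def letters_fst[OF assms(2)] cell_offset(2)[OF assms]
  by (simp add: bary_point_def sum_S0 algebra_simps add_divide_distrib)

lemma sum_psi:
  fixes t :: "nat \<Rightarrow> real"
  assumes "\<nu> \<ge> 2" "v \<in> letters \<nu>" "sum t S0 = 1"
  shows "(\<Sum>a\<in>S0. (t a + cell_offset v a) / \<nu>) = 1"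
proof -
  have "(\<Sum>a\<in>S0. (t a + cell_offset v a) / \<nu>) = (sum t S0 + real (sum (cell_offset v) S0)) / \<nu>"
    by (simp add: sum_S0 add_divide_distrib)
  then show ?thesis using assms cell_offset(1)[OF assms(1,2)] by (simp add: of_nat_diff)
qed

lemma cell_offset_inj:
  assumes "\<nu> \<ge> 2" "v \<in> letters \<nu>" "v' \<in> letters \<nu>" "\<And>a. a \<in> S0 \<Longrightarrow> cell_offset v a = cell_offset v' a"
  shows "v = v'"
proof -
  have "\<alpha> \<nu> (snd v) = \<alpha> \<nu> (snd v')"
    unfolding cell_offset(2)[OF assms(1,2)] cell_offset(2)[OF assms(1,3)] using assms(4) by (simp cong: bary_point_cong)
  moreover note labelling_image(2)[OF assms(1)]
  moreover have "snd v \<in> {1..Nlet \<nu>}" "snd v' \<in> {1..Nlet \<nu>}"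
    using assms(2,3) by (auto simp: letters_def)
  ultimately have "snd v = snd v'" by (metis inj_onD)
  then show ?thesis using letters_fst[OF assms(2)] letters_fst[OF assms(3)] by (simp add: prod_eq_iff)
qed

lemma cell_offset_surj:
  assumes "\<nu> \<ge> 2" "sum n S0 = \<nu> - 1"
  obtains v where "v \<in> letters \<nu>" "\<And>a. a \<in> S0 \<Longrightarrow> cell_offset v a = n a"
proof -
  have "(1 / real \<nu>) *\<^sub>R (real (n 1) *\<^sub>R p 1 + real (n 2) *\<^sub>R p 2 + real (n 3) *\<^sub>R p 3) \<in> \<alpha> \<nu> ` {1..Nlet \<nu>}"
    unfolding labelling_image(1)[OF assms(1)] using assms(2) unfolding sum_S0 by blast
  then obtain i where i: "i \<in> {1..Nlet \<nu>}" "\<alpha> \<nu> i = (1 / real \<nu>) *\<^sub>R bary_point (\<lambda>a. real (n a))"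
    by (auto simp: bary_point_def sum_S0)
  then have v: "(\<nu>, i) \<in> letters \<nu>" by (auto simp: letters_def)
  \<comment> \<open>The offsets sum to \<nu> - 1 and are not barycentric coordinates themselves.
    Adding the corner \<open>p 1\<close> and dividing by \<nu> gives genuine coordinates, which are
    unique and can be compared.\<close>
  have e: "psi \<alpha> (\<nu>, i) (p 1) = bary_point (\<lambda>a. ((if a = 1 then 1 else 0) + real (n a)) / \<nu>)"
    by (simp add: psi_def i(2) bary_point_def sum_S0 algebra_simps add_divide_distrib)
  have "psi \<alpha> (\<nu>, i) (p 1) = bary_point (\<lambda>a. ((if a = 1 then 1 else 0) + real (cell_offset (\<nu>, i) a)) / \<nu>)"
    using psi_pt[OF assms(1) v, of "\<lambda>a. if a = 1 then 1 else 0"] bary_point_vertex[of 1] by (simp add: S0_def)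
  then have eq: "bary_point (\<lambda>a. ((if a = 1 then 1 else 0) + real (n a)) / \<nu>) = bary_point (\<lambda>a. ((if a = 1 then 1 else 0) + real (cell_offset (\<nu>, i) a)) / \<nu>)"
    using e by simp
  have "(\<Sum>a\<in>S0. ((if a = 1 then 1 else 0) + real (n a)) / \<nu>) = (1 + real (sum n S0)) / \<nu>"
    by (simp add: sum_S0 add_divide_distrib)
  then have s1: "(\<Sum>a\<in>S0. ((if a = 1 then 1 else 0) + real (n a)) / \<nu>) = 1"
    using assms by (simp add: of_nat_diff)
  have s2: "(\<Sum>a\<in>S0. ((if a = 1 then 1 else 0) + real (cell_offset (\<nu>, i) a)) / \<nu>) = 1"
    by (rule sum_psi[OF assms(1) v]) (simp add: sum_S0)
  have "cell_offset (\<nu>, i) a = n a" if "a \<in> S0" for a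
    using bary_point_eqD[OF eq s1 s2 that] assms(1) by simp
  with v that show ?thesis by blast
qed

lemma cell_offset_corner:
  assumes "\<nu> \<ge> 2" "i \<in> S0" "a \<in> S0"
  shows "cell_offset (\<nu>, i) a = (if a = i then \<nu> - 1 else 0)"
proof -
  note v = S0_letters[OF assms(1,2)]
  have "psi \<alpha> (\<nu>, i) (p i) = p i" by (rule psi_fix[OF assms(1,2)])
  then have eq: "bary_point (\<lambda>a. ((if a = i then 1 else 0) + real (cell_offset (\<nu>, i) a)) / \<nu>) = bary_point (\<lambda>a. if a = i then 1 else 0)"
    using psi_pt[OF assms(1) v, of "\<lambda>a. if a = i then 1 else 0"] bary_point_vertex[OF assms(2)] by simp
  have s1: "(\<Sum>a\<in>S0. (if a = i then 1 else (0::real))) = 1" using assms by simp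
  have "((if a = i then 1 else 0) + real (cell_offset (\<nu>, i) a)) / \<nu> = (if a = i then 1 else 0)"
    using bary_point_eqD[OF eq sum_psi[OF assms(1) v s1] s1 assms(3)] .
  then show ?thesis using assms(1) by (auto split: if_splits simp: field_simps of_nat_diff)
qed

lemma psi_inj: "\<nu> \<ge> 2 \<Longrightarrow> v \<in> letters \<nu> \<Longrightarrow> psi \<alpha> v z = psi \<alpha> v z' \<longleftrightarrow> z = z'"
  by (simp add: psi_def letters_fst)

lemma psi_triangle: "\<nu> \<ge> 2 \<Longrightarrow> v \<in> letters \<nu> \<Longrightarrow> z \<in> triangle p \<Longrightarrow> psi \<alpha> v z \<in> triangle p"
  by (erule triangle_obtain) (simp add: psi_pt triangle_iff sum_psi)

text \<open>If two cells differ, some barycentric coordinate of a common point is maximal in the one cell,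
  which leaves only a vertex.\<close>

lemma cell_inter_aux:
  assumes \<nu>: "\<nu> \<ge> 2" and v: "v \<in> letters \<nu>" "v' \<in> letters \<nu>" and ne: "v \<noteq> v'"
    and z: "z \<in> triangle p" "z' \<in> triangle p" "psi \<alpha> v z = psi \<alpha> v' z'"
  shows "\<exists>a\<in>S0. z = p a"
proof -
  obtain t where t: "z = bary_point t" "\<And>a. a \<in> S0 \<Longrightarrow> 0 \<le> t a" "sum t S0 = 1" using z(1) by (rule triangle_obtain) blast
  obtain t' where t': "z' = bary_point t'" "\<And>a. a \<in> S0 \<Longrightarrow> 0 \<le> t' a" "sum t' S0 = 1" using z(2) by (rule triangle_obtain) blast
  have "\<forall>a\<in>S0. (t a + cell_offset v a) / \<nu> = (t' a + cell_offset v' a) / \<nu>"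
    using z(3) bary_point_eq_iff[OF sum_psi[OF \<nu> v(1) t(3)] sum_psi[OF \<nu> v(2) t'(3)]]
    by (simp add: t t' psi_pt[OF \<nu> v(1)] psi_pt[OF \<nu> v(2)])
  then have eq: "t a + cell_offset v a = t' a + cell_offset v' a" if "a \<in> S0" for a using that \<nu> by auto
  have "\<exists>a\<in>S0. cell_offset v a < cell_offset v' a"
  proof (rule ccontr)
    assume "\<not> ?thesis"
    then have le: "cell_offset v' a \<le> cell_offset v a" if "a \<in> S0" for a using that by (auto simp: not_less)
    have "sum (cell_offset v) S0 = sum (cell_offset v') S0" using cell_offset(1)[OF \<nu>] v by simp
    then have "cell_offset v a = cell_offset v' a" if "a \<in> S0" for a
      using le[of 1] le[of 2] le[of 3] that unfolding sum_S0 by (auto simp: S0_def)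
    then show False using cell_offset_inj[OF \<nu> v] ne by blast
  qed
  then obtain a where a: "a \<in> S0" "cell_offset v a < cell_offset v' a" by blast
  have "t a \<ge> 1" using eq[OF a(1)] a(2) t'(2)[OF a(1)] by linarith
  then have "\<forall>b\<in>S0. t b = (if b = a then 1 else 0)"
    using a(1) t(3) t(2)[of 1] t(2)[of 2] t(2)[of 3] unfolding sum_S0 S0_def by auto
  then have "z = p a" using t(1) bary_point_vertex[OF a(1)] bary_point_cong[of t "\<lambda>b. if b = a then 1 else 0"] by simp
  then show ?thesis using a(1) by blast
qed

lemma cell_inter:
  assumes "\<nu> \<ge> 2" "v \<in> letters \<nu>" "v' \<in> letters \<nu>" "v \<noteq> v'"
    and "z \<in> triangle p" "z' \<in> triangle p" "psi \<alpha> v z = psi \<alpha> v' z'"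
  obtains a b where "a \<in> S0" "b \<in> S0" "z = p a" "z' = p b"
  using cell_inter_aux[OF assms] cell_inter_aux[OF assms(1,3,2) assms(4)[symmetric] assms(6,5) assms(7)[symmetric]] that by blast

text \<open>A corner of the big triangle is extreme: all of its barycentric coordinates but one
  vanish. The nonnegative coordinates and offsets that add up to them vanish as well, which leaves
  only the cell labelled by that corner.\<close>

lemma cell_corner:
  assumes \<nu>: "\<nu> \<ge> 2" and v: "v \<in> letters \<nu>" and z: "z \<in> triangle p" and a: "a \<in> S0" and eq: "psi \<alpha> v z = p a"
  shows "v = (\<nu>, a)" "z = p a"
proof -
  have c: "psi \<alpha> (\<nu>, a) (p a) = p a" by (rule psi_fix[OF \<nu> a])
  show v': "v = (\<nu>, a)"
  proof (rule ccontr)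
    assume ne: "v \<noteq> (\<nu>, a)"
    obtain t where t: "z = bary_point t" "\<And>a. a \<in> S0 \<Longrightarrow> 0 \<le> t a" "sum t S0 = 1" using z by (rule triangle_obtain) blast
    have "\<forall>b\<in>S0. (t b + cell_offset v b) / \<nu> = (if b = a then 1 else 0)"
      using eq bary_point_eq_iff[OF sum_psi[OF \<nu> v t(3)], of "\<lambda>b. if b = a then 1 else 0"] a
      by (simp add: t psi_pt[OF \<nu> v] bary_point_vertex[OF a])
    then have "cell_offset v b = 0" if "b \<in> S0" "b \<noteq> a" for b using that \<nu> t(2)[of b]
      by (smt (verit) divide_eq_0_iff of_nat_0_le_iff of_nat_eq_0_iff not_numeral_le_zero)
    moreover from this have "cell_offset v a = \<nu> - 1" using cell_offset(1)[OF \<nu> v] a by (auto simp: sum_S0 S0_def)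
    ultimately have "cell_offset v b = cell_offset (\<nu>, a) b" if "b \<in> S0" for b
      using that cell_offset_corner[OF \<nu> a that] by auto
    then show False using cell_offset_inj[OF \<nu> v S0_letters[OF \<nu> a]] ne by blast
  qed
  show "z = p a" using eq c psi_inj[OF \<nu> v] v' by metis
qed

end

section \<open>Harmonic functions on one subdivision\<close>

lemma psd_isotropic:
  fixes B :: "('a \<Rightarrow> real) \<Rightarrow> ('a \<Rightarrow> real) \<Rightarrow> real"
  assumes lin: "\<And>x y z c. B (\<lambda>t. x t + c * y t) z = B x z + c * B y z"
    and sym: "\<And>x y. B x y = B y x" and pos: "\<And>x. 0 \<le> B x x" and 0: "B y y = 0"
  shows "B x y = 0"
proof (rule ccontr)
  assume ne: "B x y \<noteq> 0"
  \<comment> \<open>The expansion below has no quadratic term in \<open>c\<close>, so this value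
    makes it equal to -1.\<close>
  define c where "c = - (B x x + 1) / (2 * B x y)"
  have "0 \<le> B (\<lambda>t. x t + c * y t) (\<lambda>t. x t + c * y t)" by (rule pos)
  also have "\<dots> = B x x + 2 * c * B x y"
    unfolding lin sym[of x "\<lambda>t. x t + c * y t"] sym[of y "\<lambda>t. x t + c * y t"]
    using 0 by (simp add: sym[of y x])
  also have "\<dots> = -1" using ne by (simp add: c_def field_simps)
  finally show False by simp
qed

text \<open>Gram-Schmidt for a form that may be degenerate. When \<open>k\<close> is adjoined,
  \<open>y\<close> and \<open>\<phi> k\<close> are both made orthogonal to the old family, and then
  the residual of \<open>\<phi> k\<close> is split off from that of \<open>y\<close>. This yields
  harmonic functions without discussing the solvability of a linear system.\<close>

lemma psd_projection:
  fixes B :: "('a \<Rightarrow> real) \<Rightarrow> ('a \<Rightarrow> real) \<Rightarrow> real" and \<phi> :: "'b \<Rightarrow> 'a \<Rightarrow> real"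
  assumes lin: "\<And>x y z c. B (\<lambda>t. x t + c * y t) z = B x z + c * B y z"
    and sym: "\<And>x y. B x y = B y x" and pos: "\<And>x. 0 \<le> B x x"
    and Z: "finite Z"
  shows "\<exists>c. \<forall>j\<in>Z. B (\<lambda>t. y t - (\<Sum>i\<in>Z. c i * \<phi> i t)) (\<phi> j) = 0"
  using Z
proof (induction Z arbitrary: y)
  case empty then show ?case by simp
next
  case (insert k Z)
  have linr: "B z (\<lambda>t. x t + c * y t) = B z x + c * B z y" for x y z c
    using lin sym by metis
  have zero: "B z (\<lambda>t. 0) = 0" for z
    using linr[of z "\<lambda>t. 0" 1 "\<lambda>t. 0"] by simp
  have sumr: "B z (\<lambda>t. \<Sum>i\<in>Z. c i * \<phi> i t) = (\<Sum>i\<in>Z. c i * B z (\<phi> i))" for z c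
    using \<open>finite Z\<close>
  proof (induction Z)
    case (insert j Z)
    then show ?case using linr[of z "\<lambda>t. \<Sum>i\<in>Z. c i * \<phi> i t" "c j" "\<phi> j"]
      by (simp add: add.commute)
  qed (simp add: zero)
  obtain c1 where c1: "\<And>j. j \<in> Z \<Longrightarrow> B (\<lambda>t. \<phi> k t - (\<Sum>i\<in>Z. c1 i * \<phi> i t)) (\<phi> j) = 0"
    using insert.IH[of "\<phi> k"] by blast
  obtain c2 where c2: "\<And>j. j \<in> Z \<Longrightarrow> B (\<lambda>t. y t - (\<Sum>i\<in>Z. c2 i * \<phi> i t)) (\<phi> j) = 0"
    using insert.IH[of y] by blast
  define \<psi> where "\<psi> = (\<lambda>t. \<phi> k t - (\<Sum>i\<in>Z. c1 i * \<phi> i t))"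
  define e where "e = (\<lambda>t. y t - (\<Sum>i\<in>Z. c2 i * \<phi> i t))"
  \<comment> \<open>If the residual of \<open>\<phi> k\<close> is isotropic,
    \<open>psd_isotropic\<close> makes it orthogonal to everything, and the coefficient 0
    serves.\<close>
  define l where "l = (if B \<psi> \<psi> = 0 then 0 else B e \<psi> / B \<psi> \<psi>)"
  define e' where "e' = (\<lambda>t. e t + (- l) * \<psi> t)"
  have o: "B e' (\<phi> j) = 0" if "j \<in> Z" for j
    unfolding e'_def lin using c1[OF that] c2[OF that] by (simp add: \<psi>_def e_def)
  have "B e' \<psi> = 0"
    unfolding e'_def lin l_def using psd_isotropic[of B \<psi> e, OF lin sym pos] by simp
  moreover have "B e' (\<phi> k) = B e' \<psi> + (\<Sum>i\<in>Z. c1 i * B e' (\<phi> i))"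
    using linr[of e' \<psi> 1 "\<lambda>t. \<Sum>i\<in>Z. c1 i * \<phi> i t"] sumr[of e' c1]
    by (simp add: \<psi>_def)
  ultimately have ek: "B e' (\<phi> k) = 0" using o by simp
  have "e' = (\<lambda>t. y t - (\<Sum>i\<in>insert k Z. (if i = k then l else c2 i - l * c1 i) * \<phi> i t))"
  proof
    fix t
    have *: "(\<Sum>i\<in>insert k Z. (if i = k then l else c2 i - l * c1 i) * \<phi> i t)
      = l * \<phi> k t + (\<Sum>i\<in>Z. (c2 i - l * c1 i) * \<phi> i t)"
      using insert.hyps by (auto intro!: sum.cong)
    show "e' t = y t - (\<Sum>i\<in>insert k Z. (if i = k then l else c2 i - l * c1 i) * \<phi> i t)"
      unfolding * by (simp add: e'_def e_def \<psi>_def algebra_simps sum_subtractf sum_distrib_left sum_negf)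
  qed
  then show ?case using o ek by (intro exI[of _ "\<lambda>i. if i = k then l else c2 i - l * c1 i"]) auto
qed

text \<open>Summation by parts: \<open>y\<close> is paired with the graph Laplacian of
  \<open>x\<close> on the three corners. The minimum principle reads off the Laplacian from this
  form.\<close>

lemma qf_alt: "qf x y = (\<Sum>a\<in>S0. y a * (\<Sum>b\<in>S0. x a - x b))"
  unfolding qf_def sum_S0 by algebra

lemma S0_perm_sum:
  assumes "\<And>a. a \<in> S0 \<Longrightarrow> \<tau> a \<in> S0" "\<And>a. a \<in> S0 \<Longrightarrow> \<tau> (\<tau> a) = a"
  shows "(\<Sum>a\<in>S0. f (\<tau> a)) = (\<Sum>a\<in>S0. f a)"
  by (rule sum.reindex_bij_witness[of _ \<tau> \<tau>]) (use assms in auto)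

lemma qf_perm:
  assumes "\<And>a. a \<in> S0 \<Longrightarrow> \<tau> a \<in> S0" "\<And>a. a \<in> S0 \<Longrightarrow> \<tau> (\<tau> a) = a"
  shows "qf (\<lambda>a. x (\<tau> a)) (\<lambda>a. y (\<tau> a)) = qf x y"
  unfolding qf_alt S0_perm_sum[OF assms, of x]
  using S0_perm_sum[OF assms, of "\<lambda>a. y a * (\<Sum>b\<in>S0. x a - x b)"] S0_perm_sum[OF assms, of x]
  by (simp add: sum_subtractf)

context gasket_geometry
begin

definition D :: "nat \<Rightarrow> (plane \<Rightarrow> real) \<Rightarrow> (plane \<Rightarrow> real) \<Rightarrow> real" where
  "D \<nu> y y' = (\<Sum>v\<in>letters \<nu>. qf (\<lambda>a. y (psi \<alpha> v (p a))) (\<lambda>a. y' (psi \<alpha> v (p a))))"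

definition vertices :: "nat \<Rightarrow> plane set" where
  "vertices \<nu> = (\<lambda>(v, a). psi \<alpha> v (p a)) ` (letters \<nu> \<times> S0)"

text \<open>Weak form of the Laplace equation at the vertices other than the three corners. Since
  \<open>D\<close> sees only values on \<open>vertices \<nu>\<close>, uniqueness can be claimed only
  there.\<close>

definition harmonic :: "nat \<Rightarrow> (plane \<Rightarrow> real) \<Rightarrow> bool" where
  "harmonic \<nu> y \<longleftrightarrow> (\<forall>\<phi>. (\<forall>a\<in>S0. \<phi> (p a) = 0) \<longrightarrow> D \<nu> y \<phi> = 0)"

lemma finite_vert: "finite (vertices \<nu>)"
  unfolding vertices_def by simp

lemma vertI: "v \<in> letters \<nu> \<Longrightarrow> a \<in> S0 \<Longrightarrow> psi \<alpha> v (p a) \<in> vertices \<nu>"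
  unfolding vertices_def by auto

lemma D_cong: "(\<And>z. z \<in> vertices \<nu> \<Longrightarrow> y z = y' z) \<Longrightarrow> (\<And>z. z \<in> vertices \<nu> \<Longrightarrow> x z = x' z) \<Longrightarrow> D \<nu> x y = D \<nu> x' y'"
  unfolding D_def by (intro sum.cong refl qf_cong) (auto simp: vertI)

lemma D_sym: "D \<nu> x y = D \<nu> y x"
  unfolding D_def by (simp add: qf_sym)

lemma D_nonneg: "0 \<le> D \<nu> x x"
  unfolding D_def by (intro sum_nonneg qf_nonneg)

lemma D_add_left: "D \<nu> (\<lambda>t. x t + y t) z = D \<nu> x z + D \<nu> y z"
  and D_diff_left: "D \<nu> (\<lambda>t. x t - y t) z = D \<nu> x z - D \<nu> y z"
  and D_scale_left: "D \<nu> (\<lambda>t. c * y t) z = c * D \<nu> y z"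
  unfolding D_def qf_linear
  by (simp_all add: sum.distrib sum_subtractf sum_distrib_left)

lemma D_add_right: "D \<nu> z (\<lambda>t. x t + y t) = D \<nu> z x + D \<nu> z y"
  and D_diff_right: "D \<nu> z (\<lambda>t. x t - y t) = D \<nu> z x - D \<nu> z y"
  and D_scale_right: "D \<nu> z (\<lambda>t. c * y t) = c * D \<nu> z y"
  using D_add_left[of \<nu> x y z] D_diff_left[of \<nu> x y z] D_scale_left[of \<nu> c y z] by (simp_all add: D_sym)

lemma D_zero_right: "D \<nu> x (\<lambda>t. 0) = 0"
  by (simp add: D_def qf_def)

lemma D_const_right: "D \<nu> x (\<lambda>t. c) = 0"
  by (simp add: D_def qf_def)

lemma D_sum_left: "finite A \<Longrightarrow> D \<nu> (\<lambda>t. \<Sum>i\<in>A. f i t) z = (\<Sum>i\<in>A. D \<nu> (f i) z)"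
  by (induction A rule: finite_induct) (simp_all add: D_add_left D_zero_right D_sym[of \<nu> "\<lambda>t. 0"])

lemma D_sum_right: "finite A \<Longrightarrow> D \<nu> z (\<lambda>t. \<Sum>i\<in>A. f i t) = (\<Sum>i\<in>A. D \<nu> z (f i))"
  using D_sum_left[of A \<nu> f z] by (simp add: D_sym)

lemma harmI_indicator:
  assumes "\<And>z. z \<in> vertices \<nu> - V0 p \<Longrightarrow> D \<nu> y (indicator {z}) = 0"
  shows "harmonic \<nu> y"
  unfolding harmonic_def
proof (intro allI impI)
  fix \<phi> :: "plane \<Rightarrow> real" assume 0: "\<forall>a\<in>S0. \<phi> (p a) = 0"
  have "D \<nu> y \<phi> = D \<nu> y (\<lambda>t. \<Sum>z\<in>vertices \<nu> - V0 p. \<phi> z * indicator {z} t)"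
  proof (rule D_cong)
    fix t assume t: "t \<in> vertices \<nu>"
    have "(\<Sum>z\<in>vertices \<nu> - V0 p. \<phi> z * indicator {z} t) = (\<Sum>z\<in>vertices \<nu> - V0 p. if z = t then \<phi> z else 0)"
      by (intro sum.cong) (auto simp: indicator_def)
    also have "\<dots> = \<phi> t" using t 0 finite_vert by (auto simp: V0_def)
    finally show "\<phi> t = (\<Sum>z\<in>vertices \<nu> - V0 p. \<phi> z * indicator {z} t)" by simp
  qed simp
  also have "\<dots> = 0"
    unfolding D_sum_right[OF finite_Diff[OF finite_vert]] D_scale_right
    using assms by (intro sum.neutral) simp
  finally show "D \<nu> y \<phi> = 0" .
qed

text \<open>Start from the affine interpolation of the corner values and subtract its projection
  onto the span of the indicators of the remaining vertices. These indicators vanish at the corners,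
  so the boundary values survive.\<close>

lemma harmonic_exists: "\<exists>y. harmonic \<nu> y \<and> (\<forall>a\<in>S0. y (p a) = x a)"
proof -
  define y where "y z = (\<Sum>a\<in>S0. x a * bary_coord a z)" for z
  have y: "y (p b) = x b" if "b \<in> S0" for b
  proof -
    have "y (p b) = (\<Sum>a\<in>S0. if a = b then x a else 0)"
      unfolding y_def using that by (intro sum.cong) (auto simp: bary_coord_p)
    then show ?thesis using that by simp
  qed
  let ?Z = "vertices \<nu> - V0 p"
  obtain c where c: "\<forall>j\<in>?Z. D \<nu> (\<lambda>t. y t - (\<Sum>i\<in>?Z. c i * indicator {i} t)) (indicator {j}) = 0"
    using psd_projection[of "D \<nu>" ?Z y "\<lambda>z. indicator {z}"] finite_vert
    by (auto simp: D_add_left D_scale_left D_sym D_nonneg)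
  show ?thesis
  proof (intro exI[of _ "\<lambda>t. y t - (\<Sum>i\<in>?Z. c i * indicator {i} t)"] conjI ballI)
    show "harmonic \<nu> (\<lambda>t. y t - (\<Sum>i\<in>?Z. c i * indicator {i} t))"
      using c by (intro harmI_indicator) auto
    fix a assume a: "a \<in> S0"
    have "(\<Sum>i\<in>?Z. c i * indicator {i} (p a)) = 0"
      using a by (intro sum.neutral) (auto simp: indicator_def V0_def)
    then show "y (p a) - (\<Sum>i\<in>?Z. c i * indicator {i} (p a)) = x a"
      using y[OF a] by simp
  qed
qed

definition harm_basis :: "nat \<Rightarrow> nat \<Rightarrow> plane \<Rightarrow> real" where
  "harm_basis \<nu> a = (SOME y. harmonic \<nu> y \<and> (\<forall>b\<in>S0. y (p b) = (if b = a then 1 else 0)))"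

lemma harm_basis: "harmonic \<nu> (harm_basis \<nu> a)" "b \<in> S0 \<Longrightarrow> harm_basis \<nu> a (p b) = (if b = a then 1 else 0)"
  using someI_ex[OF harmonic_exists[of \<nu> "\<lambda>b. if b = a then 1 else 0"]] unfolding harm_basis_def[symmetric] by auto

definition H :: "nat \<Rightarrow> (nat \<Rightarrow> real) \<Rightarrow> plane \<Rightarrow> real" where
  "H \<nu> x z = (\<Sum>a\<in>S0. x a * harm_basis \<nu> a z)"

lemma H_p: "a \<in> S0 \<Longrightarrow> H \<nu> x (p a) = x a"
proof -
  assume a: "a \<in> S0"
  have "H \<nu> x (p a) = (\<Sum>b\<in>S0. if b = a then x b else 0)"
    unfolding H_def using a by (intro sum.cong) (auto simp: harm_basis)
  then show ?thesis using a by simp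
qed

lemma harmonic_lin: "harmonic \<nu> y \<Longrightarrow> harmonic \<nu> y' \<Longrightarrow> harmonic \<nu> (\<lambda>z. c * y z + c' * y' z)"
  unfolding harmonic_def by (simp add: D_add_left D_scale_left)

lemma harmonic_H: "harmonic \<nu> (H \<nu> x)"
  using harm_basis(1) unfolding harmonic_def H_def by (simp add: D_sum_left D_scale_left)

lemma harmonic_diff: "harmonic \<nu> y \<Longrightarrow> harmonic \<nu> y' \<Longrightarrow> harmonic \<nu> (\<lambda>z. y z - y' z)"
  using harmonic_lin[of \<nu> y y' 1 "-1"] by simp

lemma harmonic_const: "harmonic \<nu> (\<lambda>z. c)"
  unfolding harmonic_def D_sym[of \<nu> "\<lambda>z. c"] by (simp add: D_const_right)

text \<open>Testing harmonicity with the indicator of \<open>z\<close> says that the differences to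
  \<open>y z\<close> along all edges at \<open>z\<close> add up to 0. At a minimum they are
  nonnegative, hence all zero, and the value spreads over every cell that contains
  \<open>z\<close>.\<close>

lemma harmonic_local_min:
  assumes \<nu>: "\<nu> \<ge> 2" and h: "harmonic \<nu> y" and z: "z \<in> vertices \<nu> - V0 p" and min: "\<And>z'. z' \<in> vertices \<nu> \<Longrightarrow> y z \<le> y z'"
    and v: "v \<in> letters \<nu>" "a \<in> S0" "b \<in> S0" "psi \<alpha> v (p a) = z"
  shows "y (psi \<alpha> v (p b)) = y z"
proof -
  let ?g = "\<lambda>v a. (indicator {z} (psi \<alpha> v (p a)) :: real) * (\<Sum>b\<in>S0. y (psi \<alpha> v (p a)) - y (psi \<alpha> v (p b)))"
  have "D \<nu> y (indicator {z}) = 0"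
    using z h[unfolded harmonic_def, rule_format, of "indicator {z}"] by (force simp: indicator_def V0_def)
  then have s: "(\<Sum>v\<in>letters \<nu>. \<Sum>a\<in>S0. - ?g v a) = 0"
    unfolding D_def qf_alt by (simp add: sum_negf)
  have pos1: "0 \<le> y (psi \<alpha> v (p b)) - y z" if "v \<in> letters \<nu>" "b \<in> S0" for v b
    using min[OF vertI[OF that]] by simp
  have pos: "0 \<le> - ?g v a" if "v \<in> letters \<nu>" "a \<in> S0" for v a
    using pos1[OF that(1)] by (auto simp: indicator_def intro!: sum_nonpos)
  have "(\<Sum>a\<in>S0. - ?g v a) = 0"
    using s v(1) sum_nonneg_eq_0_iff[of "letters \<nu>" "\<lambda>v. \<Sum>a\<in>S0. - ?g v a"] pos by (simp add: sum_nonneg)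
  then have "- ?g v a = 0"
    using sum_nonneg_eq_0_iff[of S0 "\<lambda>a. - ?g v a"] pos[OF v(1)] v(2) by simp
  then have "(\<Sum>b\<in>S0. y (psi \<alpha> v (p b)) - y z) = 0"
    using v(4) by (simp add: sum_subtractf)
  then have "y (psi \<alpha> v (p b)) - y z = 0"
    using sum_nonneg_eq_0_iff[of S0 "\<lambda>b. y (psi \<alpha> v (p b)) - y z"] pos1[OF v(1)] v(3) by simp
  then show ?thesis by simp
qed

lemma psi_p:
  assumes "\<nu> \<ge> 2" "v \<in> letters \<nu>" "a \<in> S0"
  shows "psi \<alpha> v (p a) = bary_point (\<lambda>b. ((if b = a then 1 else 0) + real (cell_offset v b)) / \<nu>)"
  using psi_pt[OF assms(1,2), of "\<lambda>b. if b = a then 1 else 0"] bary_point_vertex[OF assms(3)] by simp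

lemma bary_point_corner:
  assumes "\<nu> \<ge> 2" "sum n S0 = \<nu>" "j \<in> S0" "n j = \<nu>"
  shows "bary_point (\<lambda>b. real (n b) / \<nu>) = p j"
proof -
  have "n b = 0" if "b \<in> S0" "b \<noteq> j" for b
    using assms that by (auto simp: sum_S0 S0_def)
  then have "bary_point (\<lambda>b. real (n b) / \<nu>) = bary_point (\<lambda>b. if b = j then 1 else 0)"
    using assms by (intro bary_point_cong) auto
  then show ?thesis using bary_point_vertex[OF assms(3)] by simp
qed

lemma bary_point_not_corner:
  assumes "\<nu> \<ge> 2" "sum n S0 = \<nu>" "\<And>b. b \<in> S0 \<Longrightarrow> n b < \<nu>"
  shows "bary_point (\<lambda>b. real (n b) / \<nu>) \<notin> V0 p"
proof
  assume "bary_point (\<lambda>b. real (n b) / \<nu>) \<in> V0 p"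
  then obtain j where j: "j \<in> S0" "bary_point (\<lambda>b. real (n b) / \<nu>) = bary_point (\<lambda>b. if b = j then 1 else 0)"
    unfolding V0_def using bary_point_vertex by auto
  have "(\<Sum>b\<in>S0. real (n b) / \<nu>) = real (sum n S0) / \<nu>"
    by (simp add: sum_divide_distrib)
  then have s: "(\<Sum>b\<in>S0. real (n b) / \<nu>) = 1" using assms by simp
  have "real (n j) / \<nu> = (if j = j then 1 else 0)"
    by (rule bary_point_eqD[OF j(2) s _ j(1)]) (use j in simp)
  then show False using assms(3)[OF j(1)] assms(1) by simp
qed

text \<open>A path from an interior vertex to \<open>p j\<close> avoiding the other two corners: decrease some
  coordinate other than the \<open>j\<close>-th one and increase the \<open>j\<close>-th one.\<close>

lemma harmonic_walk:
  assumes \<nu>: "\<nu> \<ge> 2" and h: "harmonic \<nu> y" and j: "j \<in> S0"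
    and n: "sum n S0 = \<nu>" "\<And>b. b \<in> S0 \<Longrightarrow> n b < \<nu>"
    and m: "\<And>z'. z' \<in> vertices \<nu> \<Longrightarrow> y (bary_point (\<lambda>b. real (n b) / \<nu>)) \<le> y z'"
  shows "y (p j) = y (bary_point (\<lambda>b. real (n b) / \<nu>))"
  using n m
proof (induction "\<nu> - n j" arbitrary: n rule: less_induct)
  case less
  obtain k where k: "k \<in> S0" "k \<noteq> j" "n k > 0"
  proof (rule ccontr)
    assume "\<not> thesis"
    then have "n b = 0" if "b \<in> S0" "b \<noteq> j" for b using that \<open>\<And>k. \<lbrakk>k \<in> S0; k \<noteq> j; 0 < n k\<rbrakk> \<Longrightarrow> thesis\<close> by blast
    then have "sum n S0 = n j" using j by (auto simp: sum_S0 S0_def)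
    then show False using less.prems(1,2) j by force
  qed
  have "sum (n(k := n k - 1)) S0 = \<nu> - 1" using less.prems(1) k by (auto simp: sum_S0 S0_def)
  then obtain v where v: "v \<in> letters \<nu>" "\<And>a. a \<in> S0 \<Longrightarrow> cell_offset v a = (n(k := n k - 1)) a"
    using cell_offset_surj[OF \<nu>] by metis
  define n' where "n' = (n(k := n k - 1))(j := n j + 1)"
  have z: "psi \<alpha> v (p k) = bary_point (\<lambda>b. real (n b) / \<nu>)"
    unfolding psi_p[OF \<nu> v(1) k(1)] using k by (intro bary_point_cong) (auto simp: v(2) of_nat_diff)
  have z': "psi \<alpha> v (p j) = bary_point (\<lambda>b. real (n' b) / \<nu>)"
    unfolding psi_p[OF \<nu> v(1) j] using k by (intro bary_point_cong) (auto simp: v(2) n'_def)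
  have n': "sum n' S0 = \<nu>" using less.prems(1) k j by (auto simp: sum_S0 S0_def n'_def)
  have zv: "bary_point (\<lambda>b. real (n b) / \<nu>) \<in> vertices \<nu> - V0 p"
    using vertI[OF v(1) k(1)] z bary_point_not_corner[OF \<nu> less.prems(1,2)] by simp
  have e: "y (bary_point (\<lambda>b. real (n' b) / \<nu>)) = y (bary_point (\<lambda>b. real (n b) / \<nu>))"
    using harmonic_local_min[OF \<nu> h zv less.prems(3) v(1) k(1) j z] z' by simp
  show ?case
  proof (cases "n' j = \<nu>")
    case True
    then show ?thesis using e bary_point_corner[OF \<nu> n' j True] by simp
  next
    case False
    have "n' b < \<nu>" if "b \<in> S0" for b
    proof (cases "b = j")
      case True
      have "n' j \<le> sum n' S0" using j by (intro member_le_sum) auto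
      then show ?thesis using False n' True by simp
    next
      case bj: False
      have "n' b + n' j \<le> sum n' S0" using that j bj by (auto simp: sum_S0 S0_def)
      moreover have "n' j > 0" by (simp add: n'_def)
      ultimately show ?thesis using n' by simp
    qed
    moreover have "\<nu> - n' j < \<nu> - n j" using less.prems(2)[OF j] by (simp add: n'_def)
    ultimately show ?thesis
      using less.hyps[of n'] n' e less.prems(3) by simp
  qed
qed

lemma vertices_interior:
  assumes "\<nu> \<ge> 2" "z \<in> vertices \<nu> - V0 p"
  obtains n where "z = bary_point (\<lambda>b. real (n b) / \<nu>)" "sum n S0 = \<nu>" "\<And>b. b \<in> S0 \<Longrightarrow> n b < \<nu>"
proof -
  obtain v a where v: "v \<in> letters \<nu>" "a \<in> S0" "z = psi \<alpha> v (p a)"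
    using assms(2) unfolding vertices_def by auto
  define n where "n b = (if b = a then 1 else 0) + cell_offset v b" for b
  have z: "z = bary_point (\<lambda>b. real (n b) / \<nu>)"
    unfolding v(3) psi_p[OF assms(1) v(1,2)] n_def by (intro bary_point_cong) auto
  have n: "sum n S0 = \<nu>"
    using cell_offset(1)[OF assms(1) v(1)] v(2) assms(1) by (auto simp: n_def sum_S0 S0_def)
  have "n b < \<nu>" if b: "b \<in> S0" for b
  proof -
    have "n b \<le> sum n S0" using b by (intro member_le_sum) auto
    moreover have "n b \<noteq> \<nu>"
      using bary_point_corner[OF assms(1) n b] z assms(2) b by (auto simp: V0_def)
    ultimately show ?thesis using n by simp
  qed
  with z n that show ?thesis by blast
qed

lemma harmonic_interior_min:
  assumes "\<nu> \<ge> 2" "harmonic \<nu> y" "z \<in> vertices \<nu> - V0 p" "\<And>z'. z' \<in> vertices \<nu> \<Longrightarrow> y z \<le> y z'" "j \<in> S0"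
  shows "y (p j) = y z"
  using vertices_interior[OF assms(1,3)] harmonic_walk[OF assms(1,2,5)] assms(4) by metis

lemma harmonic_min_principle:
  assumes \<nu>: "\<nu> \<ge> 2" and h: "harmonic \<nu> y" and z: "z \<in> vertices \<nu>" and c: "\<And>a. a \<in> S0 \<Longrightarrow> c \<le> y (p a)"
  shows "c \<le> y z"
proof -
  obtain z0 where z0: "z0 \<in> vertices \<nu>" "\<And>z'. z' \<in> vertices \<nu> \<Longrightarrow> y z0 \<le> y z'"
    using finite_vert z by (metis arg_min_if_finite(1) arg_min_least empty_iff)
  have "c \<le> y z0"
  proof (cases "z0 \<in> V0 p")
    case True then show ?thesis using c by (auto simp: V0_def)
  next
    case False
    then have "y (p 1) = y z0" using harmonic_interior_min[OF \<nu> h _ z0(2), of 1] z0(1) by (auto simp: S0_def)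
    then show ?thesis using c[of 1] by (simp add: S0_def)
  qed
  then show ?thesis using z0(2)[OF z] by simp
qed

text \<open>A zero at a vertex other than a corner would be a minimum, and the minimal value would
  spread to \<open>p j\<close>.\<close>

lemma harmonic_positive:
  assumes \<nu>: "\<nu> \<ge> 2" and h: "harmonic \<nu> y" and z: "z \<in> vertices \<nu> - V0 p"
    and c: "\<And>a. a \<in> S0 \<Longrightarrow> 0 \<le> y (p a)" and j: "j \<in> S0" "0 < y (p j)"
  shows "0 < y z"
proof (rule ccontr)
  assume "\<not> 0 < y z"
  moreover have nn: "0 \<le> y z'" if "z' \<in> vertices \<nu>" for z' by (rule harmonic_min_principle[OF \<nu> h that c])
  ultimately have "y z = 0" using z by force
  then have "y (p j) = y z" using nn by (intro harmonic_interior_min[OF \<nu> h z _ j(1)]) simp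
  with \<open>y z = 0\<close> j(2) show False by simp
qed

lemma harmonic_unique:
  assumes "\<nu> \<ge> 2" "harmonic \<nu> y" "harmonic \<nu> y'" "\<And>a. a \<in> S0 \<Longrightarrow> y (p a) = y' (p a)" "z \<in> vertices \<nu>"
  shows "y z = y' z"
  using harmonic_min_principle[OF assms(1) harmonic_diff[OF assms(2,3)] assms(5), of 0]
    harmonic_min_principle[OF assms(1) harmonic_diff[OF assms(3,2)] assms(5), of 0] assms(4) by force

lemma harm_basis_nonneg: "\<nu> \<ge> 2 \<Longrightarrow> z \<in> vertices \<nu> \<Longrightarrow> 0 \<le> harm_basis \<nu> a z"
  by (rule harmonic_min_principle[OF _ harm_basis(1)]) (auto simp: harm_basis(2))

lemma harm_basis_pos: "\<nu> \<ge> 2 \<Longrightarrow> z \<in> vertices \<nu> - V0 p \<Longrightarrow> a \<in> S0 \<Longrightarrow> 0 < harm_basis \<nu> a z"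
  by (rule harmonic_positive[OF _ harm_basis(1)]) (auto simp: harm_basis(2))

lemma harm_basis_sum: "\<nu> \<ge> 2 \<Longrightarrow> z \<in> vertices \<nu> \<Longrightarrow> (\<Sum>a\<in>S0. harm_basis \<nu> a z) = 1"
  using harmonic_unique[OF _ harmonic_H[of \<nu> "\<lambda>_. 1"] harmonic_const[of \<nu> 1], of z] H_p[of _ \<nu> "\<lambda>_. 1"]
  by (simp add: H_def)

end

section \<open>Symmetry and the renormalization constant\<close>

context gasket_geometry
begin

text \<open>Permuting barycentric coordinates realizes the symmetries of the triangle as maps of the
  plane. The permutations inserted later are the transpositions
  \<open>swap_vertices\<close>.\<close>

definition reflect :: "(nat \<Rightarrow> nat) \<Rightarrow> plane \<Rightarrow> plane" where
  "reflect \<tau> z = bary_point (\<lambda>b. bary_coord (\<tau> b) z)"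

definition involution :: "(nat \<Rightarrow> nat) \<Rightarrow> bool" where
  "involution \<tau> \<longleftrightarrow> (\<forall>a\<in>S0. \<tau> a \<in> S0 \<and> \<tau> (\<tau> a) = a)"

lemma involution_iff: "involution \<tau> \<Longrightarrow> a \<in> S0 \<Longrightarrow> b \<in> S0 \<Longrightarrow> \<tau> a = b \<longleftrightarrow> a = \<tau> b"
  unfolding involution_def by metis

lemma involution_sum: "involution \<tau> \<Longrightarrow> (\<Sum>a\<in>S0. f (\<tau> a)) = (\<Sum>a\<in>S0. f a)"
  by (rule S0_perm_sum) (auto simp: involution_def)

lemma reflect_pt: "involution \<tau> \<Longrightarrow> sum t S0 = 1 \<Longrightarrow> reflect \<tau> (bary_point t) = bary_point (\<lambda>b. t (\<tau> b))"
  unfolding reflect_def by (intro bary_point_cong bary_coord_pt) (auto simp: involution_def)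

lemma reflect_p: "involution \<tau> \<Longrightarrow> a \<in> S0 \<Longrightarrow> reflect \<tau> (p a) = p (\<tau> a)"
proof -
  assume \<tau>: "involution \<tau>" and a: "a \<in> S0"
  have "reflect \<tau> (p a) = bary_point (\<lambda>b. if \<tau> b = a then 1 else 0)"
    using reflect_pt[OF \<tau>, of "\<lambda>b. if b = a then 1 else 0"] bary_point_vertex[OF a] a by simp
  also have "\<dots> = bary_point (\<lambda>b. if b = \<tau> a then 1 else 0)"
    using involution_iff[OF \<tau> _ a] by (intro bary_point_cong) auto
  finally show ?thesis using bary_point_vertex \<tau> a by (simp add: involution_def)
qed

definition reflect_cell :: "nat \<Rightarrow> (nat \<Rightarrow> nat) \<Rightarrow> letter \<Rightarrow> letter" where
  "reflect_cell \<nu> \<tau> v = (SOME v'. v' \<in> letters \<nu> \<and> (\<forall>a\<in>S0. cell_offset v' a = cell_offset v (\<tau> a)))"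

lemma reflect_cell:
  assumes "\<nu> \<ge> 2" "involution \<tau>" "v \<in> letters \<nu>"
  shows "reflect_cell \<nu> \<tau> v \<in> letters \<nu>" "a \<in> S0 \<Longrightarrow> cell_offset (reflect_cell \<nu> \<tau> v) a = cell_offset v (\<tau> a)"
proof -
  have "sum (\<lambda>a. cell_offset v (\<tau> a)) S0 = \<nu> - 1"
    using involution_sum[OF assms(2), of "cell_offset v"] cell_offset(1)[OF assms(1,3)] by simp
  then have "\<exists>v'. v' \<in> letters \<nu> \<and> (\<forall>a\<in>S0. cell_offset v' a = cell_offset v (\<tau> a))"
    using cell_offset_surj[OF assms(1)] by metis
  from someI_ex[OF this] show "reflect_cell \<nu> \<tau> v \<in> letters \<nu>" "a \<in> S0 \<Longrightarrow> cell_offset (reflect_cell \<nu> \<tau> v) a = cell_offset v (\<tau> a)"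
    unfolding reflect_cell_def[symmetric] by auto
qed

lemma reflect_cell_involutive: "\<nu> \<ge> 2 \<Longrightarrow> involution \<tau> \<Longrightarrow> v \<in> letters \<nu> \<Longrightarrow> reflect_cell \<nu> \<tau> (reflect_cell \<nu> \<tau> v) = v"
  by (rule cell_offset_inj[of \<nu>]) (auto simp: reflect_cell involution_def)

lemma reflect_psi:
  assumes "\<nu> \<ge> 2" "involution \<tau>" "v \<in> letters \<nu>" "a \<in> S0"
  shows "reflect \<tau> (psi \<alpha> v (p a)) = psi \<alpha> (reflect_cell \<nu> \<tau> v) (p (\<tau> a))"
proof -
  have \<tau>a: "\<tau> a \<in> S0" using assms by (simp add: involution_def)
  have s: "(\<Sum>b\<in>S0. ((if b = a then 1 else 0) + real (cell_offset v b)) / \<nu>) = 1"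
    by (rule sum_psi[OF assms(1,3)]) (use assms(4) in simp)
  show ?thesis
    unfolding psi_p[OF assms(1,3,4)] psi_p[OF assms(1) reflect_cell(1)[OF assms(1-3)] \<tau>a] reflect_pt[OF assms(2) s]
    using involution_iff[OF assms(2) _ assms(4)] by (intro bary_point_cong) (auto simp: reflect_cell(2)[OF assms(1-3)])
qed

lemma reflect_sw: "\<nu> \<ge> 2 \<Longrightarrow> involution \<tau> \<Longrightarrow> z \<in> vertices \<nu> \<Longrightarrow> reflect \<tau> (reflect \<tau> z) = z"
  unfolding vertices_def by (auto simp: reflect_psi reflect_cell reflect_cell_involutive) (auto simp: reflect_psi reflect_cell reflect_cell_involutive involution_def)

lemma D_sw:
  assumes "\<nu> \<ge> 2" "involution \<tau>"
  shows "D \<nu> (\<lambda>z. y (reflect \<tau> z)) (\<lambda>z. y' (reflect \<tau> z)) = D \<nu> y y'"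
proof -
  have "D \<nu> (\<lambda>z. y (reflect \<tau> z)) (\<lambda>z. y' (reflect \<tau> z)) =
    (\<Sum>v\<in>letters \<nu>. qf (\<lambda>a. y (psi \<alpha> (reflect_cell \<nu> \<tau> v) (p (\<tau> a)))) (\<lambda>a. y' (psi \<alpha> (reflect_cell \<nu> \<tau> v) (p (\<tau> a)))))"
    unfolding D_def by (intro sum.cong refl qf_cong) (simp_all add: reflect_psi[OF assms])
  also have "\<dots> = (\<Sum>v\<in>letters \<nu>. qf (\<lambda>a. y (psi \<alpha> (reflect_cell \<nu> \<tau> v) (p a))) (\<lambda>a. y' (psi \<alpha> (reflect_cell \<nu> \<tau> v) (p a))))"
    by (intro sum.cong refl qf_perm[of \<tau> "\<lambda>a. y (psi \<alpha> (reflect_cell \<nu> \<tau> _) (p a))"]) (use assms(2) in \<open>auto simp: involution_def\<close>)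
  also have "\<dots> = D \<nu> y y'"
    unfolding D_def
    by (rule sum.reindex_bij_witness[of _ "reflect_cell \<nu> \<tau>" "reflect_cell \<nu> \<tau>"])
       (use assms in \<open>auto simp: reflect_cell reflect_cell_involutive\<close>)
  finally show ?thesis .
qed

lemma harmonic_sw:
  assumes "\<nu> \<ge> 2" "involution \<tau>" "harmonic \<nu> y"
  shows "harmonic \<nu> (\<lambda>z. y (reflect \<tau> z))"
  unfolding harmonic_def
proof (intro allI impI)
  fix \<phi> :: "plane \<Rightarrow> real" assume 0: "\<forall>a\<in>S0. \<phi> (p a) = 0"
  have "D \<nu> (\<lambda>z. y (reflect \<tau> z)) \<phi> = D \<nu> (\<lambda>z. y (reflect \<tau> z)) (\<lambda>z. \<phi> (reflect \<tau> (reflect \<tau> z)))"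
    by (rule D_cong) (simp_all add: reflect_sw[OF assms(1,2)])
  also have "\<dots> = D \<nu> y (\<lambda>z. \<phi> (reflect \<tau> z))"
    by (rule D_sw[OF assms(1,2)])
  also have "\<dots> = 0"
    using assms(3) 0 assms(2) unfolding harmonic_def by (simp add: reflect_p involution_def)
  finally show "D \<nu> (\<lambda>z. y (reflect \<tau> z)) \<phi> = 0" .
qed

lemma harm_basis_sw:
  assumes "\<nu> \<ge> 2" "involution \<tau>" "a \<in> S0" "z \<in> vertices \<nu>"
  shows "harm_basis \<nu> a (reflect \<tau> z) = harm_basis \<nu> (\<tau> a) z"
proof (rule harmonic_unique[OF assms(1) harmonic_sw[OF assms(1,2) harm_basis(1)] harm_basis(1) _ assms(4)])
  fix b assume b: "b \<in> S0"
  then have "\<tau> b \<in> S0" using assms(2) by (simp add: involution_def)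
  then show "harm_basis \<nu> a (reflect \<tau> (p b)) = harm_basis \<nu> (\<tau> a) (p b)"
    using involution_iff[OF assms(2) b assms(3)] b by (simp add: reflect_p[OF assms(2)] harm_basis(2))
qed

lemma D_hb_sw:
  assumes "\<nu> \<ge> 2" "involution \<tau>" "a \<in> S0" "b \<in> S0"
  shows "D \<nu> (harm_basis \<nu> (\<tau> a)) (harm_basis \<nu> (\<tau> b)) = D \<nu> (harm_basis \<nu> a) (harm_basis \<nu> b)"
proof -
  have "D \<nu> (harm_basis \<nu> (\<tau> a)) (harm_basis \<nu> (\<tau> b)) = D \<nu> (\<lambda>z. harm_basis \<nu> a (reflect \<tau> z)) (\<lambda>z. harm_basis \<nu> b (reflect \<tau> z))"
    by (intro D_cong) (simp_all add: harm_basis_sw assms)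
  then show ?thesis using D_sw[OF assms(1,2)] by simp
qed

section \<open>The effective resistance of one subdivision\<close>

definition swap_vertices :: "nat \<Rightarrow> nat \<Rightarrow> nat \<Rightarrow> nat" where
  "swap_vertices j k a = (if a = j then k else if a = k then j else a)"

lemma involution_tr: "j \<in> S0 \<Longrightarrow> k \<in> S0 \<Longrightarrow> involution (swap_vertices j k)"
  by (auto simp: involution_def swap_vertices_def)

text \<open>The renormalization constant in computable form: \<open>qf\<close> of a unit vector is
  2, hence the division by 2. \<open>renorm_eq\<close> identifies it with
  \<open>renorm\<close>.\<close>

definition resistance :: "nat \<Rightarrow> real" where
  "resistance \<nu> = D \<nu> (harm_basis \<nu> 1) (harm_basis \<nu> 1) / 2"

text \<open>The Gram matrix of the harmonic basis is invariant under transpositions of the corners,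
  so its diagonal entries agree and so do the others. Its rows sum to 0, because the basis functions
  add up to a constant. What remains is a multiple of the matrix of \<open>qf\<close>.\<close>

lemma D_H:
  assumes \<nu>: "\<nu> \<ge> 2"
  shows "D \<nu> (H \<nu> x) (H \<nu> y) = resistance \<nu> * qf x y"
proof -
  let ?R = "\<lambda>a b. D \<nu> (harm_basis \<nu> a) (harm_basis \<nu> b)"
  have S: "1 \<in> S0" "2 \<in> S0" "3 \<in> S0" by (auto simp: S0_def)
  note dsw = D_hb_sw[OF \<nu> involution_tr]
  have d: "?R 2 2 = ?R 1 1" "?R 3 3 = ?R 1 1"
    using dsw[of 1 2 1 1] dsw[of 1 3 1 1] S by (simp_all add: swap_vertices_def)
  have o: "?R 1 3 = ?R 1 2" "?R 2 3 = ?R 1 2"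
    using dsw[of 2 3 1 2] dsw[of 1 2 1 3] S by (simp_all add: swap_vertices_def)
  have o': "?R 2 1 = ?R 1 2" "?R 3 1 = ?R 1 2" "?R 3 2 = ?R 1 2"
    using o by (simp_all add: D_sym)
  have "D \<nu> (harm_basis \<nu> 1) (\<lambda>z. \<Sum>a\<in>S0. harm_basis \<nu> a z) = D \<nu> (harm_basis \<nu> 1) (\<lambda>z. 1)"
    by (rule D_cong) (simp_all add: harm_basis_sum[OF \<nu>])
  then have "?R 1 1 + ?R 1 2 + ?R 1 3 = 0"
    by (simp add: D_sum_right D_const_right) (simp add: sum_S0)
  then have b: "?R 1 2 = - ?R 1 1 / 2" using o by simp
  have "D \<nu> (H \<nu> x) (H \<nu> y) = (\<Sum>a\<in>S0. \<Sum>b\<in>S0. x a * (y b * ?R a b))"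
    unfolding H_def by (simp add: D_sum_left D_sum_right D_scale_left D_scale_right sum_distrib_left)
  also have "\<dots> = resistance \<nu> * qf x y"
    unfolding sum_S0 o o' d b resistance_def qf_def by (simp add: field_simps)
  finally show ?thesis .
qed

lemma corner_vert:
  assumes "\<nu> \<ge> 2" "i \<in> S0" "j \<in> S0" "j \<noteq> i"
  shows "psi \<alpha> (\<nu>, i) (p j) \<in> vertices \<nu> - V0 p"
proof
  show "psi \<alpha> (\<nu>, i) (p j) \<in> vertices \<nu>" using assms by (intro vertI S0_letters)
  show "psi \<alpha> (\<nu>, i) (p j) \<notin> V0 p"
  proof
    assume "psi \<alpha> (\<nu>, i) (p j) \<in> V0 p"
    then obtain a where a: "a \<in> S0" "psi \<alpha> (\<nu>, i) (p j) = p a" by (auto simp: V0_def)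
    from cell_corner[OF assms(1) S0_letters[OF assms(1,2)] p_in_triangle[OF assms(3)] a]
    show False using assms a p_inj by auto
  qed
qed

text \<open>Vanishing energy would make the basis function of corner 1 equal to 1 on the whole cell
  at that corner. At a further vertex of the cell the other two basis functions are positive and all
  three sum to 1, which is impossible.\<close>

lemma resistance_pos:
  assumes \<nu>: "\<nu> \<ge> 2" shows "0 < resistance \<nu>"
proof (rule ccontr)
  assume "\<not> 0 < resistance \<nu>"
  then have "D \<nu> (harm_basis \<nu> 1) (harm_basis \<nu> 1) = 0"
    using D_nonneg[of \<nu> "harm_basis \<nu> 1"] by (simp add: resistance_def)
  then have "\<forall>v\<in>letters \<nu>. qf (\<lambda>a. harm_basis \<nu> 1 (psi \<alpha> v (p a))) (\<lambda>a. harm_basis \<nu> 1 (psi \<alpha> v (p a))) = 0"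
    unfolding D_def by (subst (asm) sum_nonneg_eq_0_iff) (auto simp: qf_nonneg)
  then have "qf (\<lambda>a. harm_basis \<nu> 1 (psi \<alpha> (\<nu>, 1) (p a))) (\<lambda>a. harm_basis \<nu> 1 (psi \<alpha> (\<nu>, 1) (p a))) = 0"
    using S0_letters[OF \<nu>, of 1] by (simp add: S0_def)
  from qf_eq_0D[OF this, of 1 2] have e: "harm_basis \<nu> 1 (psi \<alpha> (\<nu>, 1) (p 2)) = 1"
    using psi_fix[OF \<nu>, of 1] harm_basis(2)[of 1 \<nu> 1] by (simp add: S0_def)
  have v: "psi \<alpha> (\<nu>, 1) (p 2) \<in> vertices \<nu> - V0 p" using corner_vert[OF \<nu>, of 1 2] by (simp add: S0_def)
  have "(\<Sum>a\<in>S0. harm_basis \<nu> a (psi \<alpha> (\<nu>, 1) (p 2))) = 1" by (rule harm_basis_sum[OF \<nu>]) (use v in simp)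
  moreover have "harm_basis \<nu> 2 (psi \<alpha> (\<nu>, 1) (p 2)) > 0" "harm_basis \<nu> 3 (psi \<alpha> (\<nu>, 1) (p 2)) > 0"
    using harm_basis_pos[OF \<nu> v] by (auto simp: S0_def)
  ultimately show False using e by (simp add: sum_S0)
qed

lemma D_H_ext:
  assumes \<nu>: "\<nu> \<ge> 2" shows "D \<nu> (H \<nu> x) y = resistance \<nu> * qf x (\<lambda>a. y (p a))"
proof -
  have "D \<nu> (H \<nu> x) (\<lambda>z. y z - H \<nu> (\<lambda>a. y (p a)) z) = 0"
    using harmonic_H[of \<nu> x] H_p[of _ \<nu> "\<lambda>a. y (p a)"] unfolding harmonic_def by simp
  then show ?thesis using D_H[OF \<nu>] by (simp add: D_diff_right)
qed

text \<open>Dirichlet principle: the energy of \<open>y\<close> exceeds that of the harmonic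
  function with the same corner values by exactly the energy of their difference.\<close>

lemma D_ge:
  assumes \<nu>: "\<nu> \<ge> 2" shows "resistance \<nu> * qf (\<lambda>a. y (p a)) (\<lambda>a. y (p a)) \<le> D \<nu> y y"
proof -
  let ?h = "H \<nu> (\<lambda>a. y (p a))"
  have "0 \<le> D \<nu> (\<lambda>z. y z - ?h z) (\<lambda>z. y z - ?h z)" by (rule D_nonneg)
  also have "\<dots> = D \<nu> y y - 2 * D \<nu> ?h y + D \<nu> ?h ?h"
    by (simp add: D_diff_left D_diff_right D_sym[of \<nu> y ?h])
  finally show ?thesis using D_H_ext[OF \<nu>, of "\<lambda>a. y (p a)" y] D_H[OF \<nu>] by simp
qed

lemma renorm_eq:
  assumes \<nu>: "\<nu> \<ge> 2" shows "renorm p \<alpha> \<nu> = resistance \<nu>"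
proof -
  have inf: "Inf {(\<Sum>i = 1..Nlet \<nu>. (1 / r) * Q p (y \<circ> psi \<alpha> (\<nu>, i)) (y \<circ> psi \<alpha> (\<nu>, i))) | y. \<forall>z\<in>V0 p. y z = x z}
      = resistance \<nu> / r * Q p x x" if r: "r > 0" for r and x :: "plane \<Rightarrow> real"
  proof (rule cInf_eq_minimum)
    have e: "(\<Sum>i = 1..Nlet \<nu>. (1 / r) * Q p (y \<circ> psi \<alpha> (\<nu>, i)) (y \<circ> psi \<alpha> (\<nu>, i))) = D \<nu> y y / r" for y
      unfolding D_def Q_eq_qf sum_letters by (simp add: sum_divide_distrib)
    show "resistance \<nu> / r * Q p x x \<in> {(\<Sum>i = 1..Nlet \<nu>. (1 / r) * Q p (y \<circ> psi \<alpha> (\<nu>, i)) (y \<circ> psi \<alpha> (\<nu>, i))) | y. \<forall>z\<in>V0 p. y z = x z}"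
      unfolding e unfolding Q_eq_qf
      by (intro CollectI exI[of _ "H \<nu> (\<lambda>a. x (p a))"]) (auto simp: D_H[OF \<nu>] V0_def H_p)
    fix c assume "c \<in> {(\<Sum>i = 1..Nlet \<nu>. (1 / r) * Q p (y \<circ> psi \<alpha> (\<nu>, i)) (y \<circ> psi \<alpha> (\<nu>, i))) | y. \<forall>z\<in>V0 p. y z = x z}"
    then obtain y where y: "c = D \<nu> y y / r" "\<forall>a\<in>S0. y (p a) = x (p a)" unfolding e by (auto simp: V0_def)
    have "qf (\<lambda>a. y (p a)) (\<lambda>a. y (p a)) = Q p x x"
      unfolding Q_eq_qf using y(2) by (intro qf_cong) auto
    then show "resistance \<nu> / r * Q p x x \<le> c"
      unfolding y(1) using D_ge[OF \<nu>, of y] r by (simp add: divide_right_mono)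
  qed
  let ?P = "\<lambda>r. r > 0 \<and> (\<forall>x :: plane \<Rightarrow> real. Q p x x = Inf {(\<Sum>i = 1..Nlet \<nu>. (1 / r) * Q p (y \<circ> psi \<alpha> (\<nu>, i)) (y \<circ> psi \<alpha> (\<nu>, i))) | y. \<forall>z\<in>V0 p. y z = x z})"
  have eq: "?P r \<longleftrightarrow> r > 0 \<and> (\<forall>x :: plane \<Rightarrow> real. Q p x x = resistance \<nu> / r * Q p x x)" for r
    using inf by (cases "r > 0") simp_all
  show ?thesis unfolding renorm_def
  proof (rule the_equality)
    show "?P (resistance \<nu>)" unfolding eq using resistance_pos[OF \<nu>] by simp
    fix r assume "?P r"
    \<comment> \<open>The infimum scales with 1/r, so a single function of nonzero energy determines
      \<open>r\<close>.\<close>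
    then have r: "r > 0" "Q p (indicator {p 1}) (indicator {p 1}) = resistance \<nu> / r * Q p (indicator {p 1}) (indicator {p 1})"
      unfolding eq by blast+
    have "Q p (indicator {p 1}) (indicator {p 1}) = 2"
      using p_inj[of 1 2] p_inj[of 1 3] p_inj[of 2 1] p_inj[of 3 1]
      by (simp add: Q_eq_qf qf_def indicator_def S0_def)
    with r show "r = resistance \<nu>" by (simp add: field_simps)
  qed
qed

section \<open>Restriction of harmonic functions to subcells\<close>

definition harm_restr :: "letter \<Rightarrow> (nat \<Rightarrow> real) \<Rightarrow> nat \<Rightarrow> real" where
  "harm_restr v x a = H (fst v) x (psi \<alpha> v (p a))"

lemma harm_restr_lin: "harm_restr v (\<lambda>a. c * x a + c' * y a) = (\<lambda>a. c * harm_restr v x a + c' * harm_restr v y a)"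
  unfolding harm_restr_def H_def sum_S0 by (simp add: algebra_simps)

lemma harm_restr_scale: "harm_restr v (\<lambda>a. c * x a) = (\<lambda>a. c * harm_restr v x a)"
  using harm_restr_lin[of v c x 0 x] by simp

lemma harm_restr_cong: "(\<And>a. a \<in> S0 \<Longrightarrow> x a = y a) \<Longrightarrow> harm_restr v x = harm_restr v y"
  unfolding harm_restr_def H_def by (intro ext sum.cong) auto

lemma harm_restr_fix: "\<nu> \<ge> 2 \<Longrightarrow> i \<in> S0 \<Longrightarrow> harm_restr (\<nu>, i) x i = x i"
  by (simp add: harm_restr_def psi_fix H_p)

text \<open>Green's identity on one subdivision. Harmonicity of one argument suffices to collapse
  the sum to corner values of the other, so the second function may be arbitrary. Comparisons of
  energies at different levels rest on this.\<close>

lemma sum_qf_Hm_ext: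
  assumes \<nu>: "\<nu> \<ge> 2"
  shows "(\<Sum>v\<in>letters \<nu>. qf (harm_restr v x) (\<lambda>a. y (psi \<alpha> v (p a)))) = renorm p \<alpha> \<nu> * qf x (\<lambda>a. y (p a))"
proof -
  have "(\<Sum>v\<in>letters \<nu>. qf (harm_restr v x) (\<lambda>a. y (psi \<alpha> v (p a)))) = D \<nu> (H \<nu> x) y"
    unfolding D_def harm_restr_def by (intro sum.cong) (auto simp: letters_fst)
  then show ?thesis using D_H_ext[OF \<nu>] renorm_eq[OF \<nu>] by simp
qed

lemma sum_qf_Hm:
  assumes \<nu>: "\<nu> \<ge> 2"
  shows "(\<Sum>v\<in>letters \<nu>. qf (harm_restr v x) (harm_restr v y)) = renorm p \<alpha> \<nu> * qf x y"
proof -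
  have "(\<Sum>v\<in>letters \<nu>. qf (harm_restr v x) (harm_restr v y)) = (\<Sum>v\<in>letters \<nu>. qf (harm_restr v x) (\<lambda>a. H \<nu> y (psi \<alpha> v (p a))))"
    by (intro sum.cong refl qf_cong) (auto simp: harm_restr_def letters_fst)
  also have "\<dots> = renorm p \<alpha> \<nu> * qf x y"
    unfolding sum_qf_Hm_ext[OF \<nu>] by (simp add: H_p cong: qf_cong)
  finally show ?thesis .
qed

lemma renorm_pos: "\<nu> \<ge> 2 \<Longrightarrow> 0 < renorm p \<alpha> \<nu>"
  by (simp add: renorm_eq resistance_pos)

lemma harm_restr_ge:
  assumes "\<nu> \<ge> 2" "v \<in> letters \<nu>" "a \<in> S0" "\<And>b. b \<in> S0 \<Longrightarrow> m \<le> x b"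
  shows "m \<le> harm_restr v x a"
  unfolding harm_restr_def letters_fst[OF assms(2)]
  by (rule harmonic_min_principle[OF assms(1) harmonic_H vertI[OF assms(2,3)]]) (simp add: H_p assms(4))

lemma harm_restr_neg: "harm_restr v (\<lambda>a. - x a) = (\<lambda>a. - harm_restr v x a)"
  using harm_restr_scale[of v "-1" x] by simp

lemma harm_restr_le:
  assumes "\<nu> \<ge> 2" "v \<in> letters \<nu>" "a \<in> S0" "\<And>b. b \<in> S0 \<Longrightarrow> x b \<le> M"
  shows "harm_restr v x a \<le> M"
  using harm_restr_ge[OF assms(1-3), of "- M" "\<lambda>b. - x b"] assms(4) by (simp add: harm_restr_neg)

lemma H_interior_ge:
  assumes "\<nu> \<ge> 2" "z \<in> vertices \<nu>" "b \<in> S0" "d \<le> harm_basis \<nu> b z" "\<And>a. a \<in> S0 \<Longrightarrow> m \<le> x a"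
  shows "m + d * (x b - m) \<le> H \<nu> x z"
proof -
  have "m + d * (x b - m) \<le> m + harm_basis \<nu> b z * (x b - m)"
    using assms by (simp add: mult_right_mono)
  also have "harm_basis \<nu> b z * (x b - m) \<le> (\<Sum>a\<in>S0. harm_basis \<nu> a z * (x a - m))"
    using assms by (intro member_le_sum) (auto simp: harm_basis_nonneg)
  also have "(\<Sum>a\<in>S0. harm_basis \<nu> a z * (x a - m)) = H \<nu> x z - m"
  proof -
    have "(\<Sum>a\<in>S0. harm_basis \<nu> a z * (x a - m)) = H \<nu> x z - m * (\<Sum>a\<in>S0. harm_basis \<nu> a z)"
      unfolding H_def sum_distrib_left sum_subtractf[symmetric] by (intro sum.cong) (auto simp: algebra_simps)
    then show ?thesis using harm_basis_sum[OF assms(1,2)] by simp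
  qed
  finally show ?thesis by simp
qed

text \<open>Of two distinct vertices of a small cell at most one is a corner of the big triangle. At
  the other vertex every basis function is at least \<open>d\<close>, so the value there is an
  average that gives weight at least \<open>d\<close> to the far extreme of the corner
  values.\<close>

lemma harm_restr_contract:
  assumes \<nu>: "\<nu> \<ge> 2"
  obtains d where "0 < d" "d < 1"
    "\<And>v x a b c. v \<in> letters \<nu> \<Longrightarrow> a \<in> S0 \<Longrightarrow> b \<in> S0 \<Longrightarrow>
       (\<And>a b. a \<in> S0 \<Longrightarrow> b \<in> S0 \<Longrightarrow> \<bar>x a - x b\<bar> \<le> c) \<Longrightarrow> \<bar>harm_restr v x a - harm_restr v x b\<bar> \<le> (1 - d) * c"
proof -
  \<comment> \<open>The entry 1/2 keeps the minimum below 1.\<close>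
  define I where "I = insert (1/2) ((\<lambda>(a, z). harm_basis \<nu> a z) ` (S0 \<times> (vertices \<nu> - V0 p)))"
  have fn: "finite I" unfolding I_def using finite_vert by auto
  have pos: "\<And>i. i \<in> I \<Longrightarrow> 0 < i" unfolding I_def using harm_basis_pos[OF \<nu>] by auto
  define d where "d = Min I"
  have d: "0 < d" unfolding d_def using fn pos Min_in[OF fn] by (auto simp: I_def)
  have "1/2 \<in> I" by (simp add: I_def)
  then have d1: "d < 1" unfolding d_def using Min_le[OF fn] by fastforce
  have le: "d \<le> harm_basis \<nu> a z" if "a \<in> S0" "z \<in> vertices \<nu> - V0 p" for a z
    unfolding d_def by (intro Min_le fn) (use that in \<open>auto simp: I_def\<close>)
  have main: "harm_restr v x a - harm_restr v x b \<le> (1 - d) * c"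
    if v: "v \<in> letters \<nu>" and ab: "a \<in> S0" "b \<in> S0" and c: "\<And>a b. a \<in> S0 \<Longrightarrow> b \<in> S0 \<Longrightarrow> \<bar>x a - x b\<bar> \<le> c" for v x a b c
  proof (cases "a = b")
    case True
    have "0 \<le> c" using c[of 1 1] by (simp add: S0_def)
    then show ?thesis using True d1 by simp
  next
    case False
    obtain m where m: "m \<in> S0" "\<And>b. b \<in> S0 \<Longrightarrow> x m \<le> x b"
      using finite_S0 ab(1) by (metis arg_min_if_finite(1) arg_min_least empty_iff)
    obtain M where M: "M \<in> S0" "\<And>b. b \<in> S0 \<Longrightarrow> - x M \<le> - x b"
      using finite_S0 ab(1) arg_min_if_finite(1)[of S0 "\<lambda>b. - x b"] arg_min_least[of S0 _ "\<lambda>b. - x b"] by (metis empty_iff)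
    have Mm: "x M - x m \<le> c" using c[OF M(1) m(1)] by linarith
    have bounds: "harm_restr v x b \<ge> x m" "harm_restr v x a \<le> x M"
      using harm_restr_ge[OF \<nu> v ab(2), of "x m" x] m harm_restr_le[OF \<nu> v ab(1), of x "x M"] M by auto
    have fv: "fst v = \<nu>" using v by (rule letters_fst)
    have Mm': "(1 - d) * (x M - x m) \<le> (1 - d) * c" using Mm d1 by simp
    show ?thesis
    proof (cases "psi \<alpha> v (p b) \<in> V0 p")
      case False
      have "x m + d * (x M - x m) \<le> harm_restr v x b"
        unfolding harm_restr_def fv using False vertI[OF v ab(2)] le[OF M(1)] m
        by (intro H_interior_ge[OF \<nu> _ M(1)]) auto
      then have "harm_restr v x a - harm_restr v x b \<le> x M - (x m + d * (x M - x m))" using bounds by linarith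
      also have "\<dots> = (1 - d) * (x M - x m)" by (simp add: algebra_simps)
      finally show ?thesis using Mm' by simp
    next
      case True
      then obtain i where i: "i \<in> S0" "psi \<alpha> v (p b) = p i" by (auto simp: V0_def)
      note ib = cell_corner[OF \<nu> v p_in_triangle[OF ab(2)] i]
      have "psi \<alpha> v (p a) \<notin> V0 p"
      proof
        assume "psi \<alpha> v (p a) \<in> V0 p"
        then obtain k where k: "k \<in> S0" "psi \<alpha> v (p a) = p k" by (auto simp: V0_def)
        note ka = cell_corner[OF \<nu> v p_in_triangle[OF ab(1)] k]
        show False using ib ka False p_inj[OF ab] by auto
      qed
      then have "- x M + d * (- x m - - x M) \<le> H \<nu> (\<lambda>a. - x a) (psi \<alpha> v (p a))"
        using vertI[OF v ab(1)] le[OF m(1)] M by (intro H_interior_ge[OF \<nu> _ m(1)]) auto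
      then have "- x M + d * (- x m - - x M) \<le> - harm_restr v x a"
        using harm_restr_neg[of v x] unfolding harm_restr_def fv by metis
      then have "harm_restr v x a - harm_restr v x b \<le> x M - d * (x M - x m) - x m"
        using bounds by (simp add: algebra_simps)
      also have "\<dots> = (1 - d) * (x M - x m)" by (simp add: algebra_simps)
      finally show ?thesis using Mm' by simp
    qed
  qed
  show ?thesis
    by (rule that[OF d d1]) (metis (no_types, lifting) main abs_if minus_diff_eq)
qed

text \<open>The reflection that exchanges \<open>j\<close> and \<open>k\<close> maps the cell at
  corner \<open>i\<close> to itself. Relative to the fixed value \<open>x i\<close>, the harmonic
  restriction is therefore a symmetric 2 by 2 matrix with equal diagonal entries; both parameters
  are positive because they are values of basis functions away from the corners.\<close>

lemma harm_restr_corner: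
  assumes \<nu>: "\<nu> \<ge> 2" and S: "i \<in> S0" "j \<in> S0" "k \<in> S0" and d: "i \<noteq> j" "i \<noteq> k" "j \<noteq> k"
  obtains u w where "0 < u" "0 < w"
    "\<And>x. harm_restr (\<nu>, i) x j - x i = u * (x j - x i) + w * (x k - x i)"
    "\<And>x. harm_restr (\<nu>, i) x k - x i = w * (x j - x i) + u * (x k - x i)"
proof -
  let ?J = "psi \<alpha> (\<nu>, i) (p j)" and ?K = "psi \<alpha> (\<nu>, i) (p k)"
  have J: "?J \<in> vertices \<nu> - V0 p" and K: "?K \<in> vertices \<nu> - V0 p"
    using corner_vert[OF \<nu>] S d by auto
  have \<tau>: "involution (swap_vertices j k)" using involution_tr S by simp
  have "reflect_cell \<nu> (swap_vertices j k) (\<nu>, i) = (\<nu>, i)"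
    using S d by (intro cell_offset_inj[OF \<nu>]) (auto simp: reflect_cell[OF \<nu> \<tau>] S0_letters[OF \<nu>] cell_offset_corner[OF \<nu> S(1)] swap_vertices_def)
  then have JK: "reflect (swap_vertices j k) ?K = ?J"
    using reflect_psi[OF \<nu> \<tau> S0_letters[OF \<nu> S(1)] S(3)] d by (simp add: swap_vertices_def)
  have e: "harm_basis \<nu> k ?K = harm_basis \<nu> j ?J" "harm_basis \<nu> j ?K = harm_basis \<nu> k ?J"
  proof -
    have K': "?K \<in> vertices \<nu>" using K by simp
    have t: "swap_vertices j k j = k" "swap_vertices j k k = j" by (simp_all add: swap_vertices_def)
    show "harm_basis \<nu> k ?K = harm_basis \<nu> j ?J" using harm_basis_sw[OF \<nu> \<tau> S(2) K'] unfolding JK t by (rule sym)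
    show "harm_basis \<nu> j ?K = harm_basis \<nu> k ?J" using harm_basis_sw[OF \<nu> \<tau> S(3) K'] unfolding JK t by (rule sym)
  qed
  have sum: "(\<Sum>a\<in>S0. f a) = f i + f j + f k" for f :: "nat \<Rightarrow> real"
  proof -
    have e: "S0 = {i, j, k}" using S d by (auto simp: S0_def)
    show ?thesis unfolding e using d by simp
  qed
  have 1: "harm_basis \<nu> i z = 1 - harm_basis \<nu> j z - harm_basis \<nu> k z" if "z \<in> vertices \<nu>" for z
    using harm_basis_sum[OF \<nu> that] unfolding sum by simp
  show ?thesis
  proof (rule that[of "harm_basis \<nu> j ?J" "harm_basis \<nu> k ?J"])
    show "harm_restr (\<nu>, i) x j - x i = harm_basis \<nu> j ?J * (x j - x i) + harm_basis \<nu> k ?J * (x k - x i)" for x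
      using J by (simp add: harm_restr_def H_def sum 1 algebra_simps)
    show "harm_restr (\<nu>, i) x k - x i = harm_basis \<nu> k ?J * (x j - x i) + harm_basis \<nu> j ?J * (x k - x i)" for x
      using K by (simp add: harm_restr_def H_def sum 1 e algebra_simps)
  qed (use harm_basis_pos[OF \<nu> J] S in auto)
qed

text \<open>On the cell at the corner \<open>i\<close> the differences split into a symmetric and an antisymmetric part,
  which are multiplied by \<open>u + w\<close> and \<open>u - w\<close>; geometric decay of the energy
  over two steps is possible only for a pure part.\<close>

lemma corner_pure:
  assumes \<nu>: "\<nu> \<ge> 2" and S: "i \<in> S0" "j \<in> S0" "k \<in> S0" and d: "i \<noteq> j" "i \<noteq> k" "j \<noteq> k"
    and 1: "qf (harm_restr (\<nu>, i) x) (harm_restr (\<nu>, i) x) = c * qf x x"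
    and 2: "qf (harm_restr (\<nu>, i) (harm_restr (\<nu>, i) x)) (harm_restr (\<nu>, i) (harm_restr (\<nu>, i) x)) = c\<^sup>2 * qf x x"
  shows "x j = x k \<or> x j + x k = 2 * x i"
proof -
  obtain u w where uw: "0 < u" "0 < w"
    "\<And>x. harm_restr (\<nu>, i) x j - x i = u * (x j - x i) + w * (x k - x i)"
    "\<And>x. harm_restr (\<nu>, i) x k - x i = w * (x j - x i) + u * (x k - x i)"
    using harm_restr_corner[OF \<nu> S d] by blast
  define s t where "s = (\<lambda>x. (x j - x i) + (x k - x i) :: real)" and "t = (\<lambda>x. (x j - x i) - (x k - x i) :: real)"
  have q: "2 * qf x x = (s x)\<^sup>2 + 3 * (t x)\<^sup>2" for x :: "nat \<Rightarrow> real"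
  proof -
    have "(i, j, k) \<in> {(1,2,3), (1,3,2), (2,1,3), (2,3,1), (3,1,2), (3,2,1)}"
      using S d by (auto simp: S0_def)
    then show ?thesis by (auto simp: qf_def s_def t_def power2_eq_square algebra_simps)
  qed
  have fx: "harm_restr (\<nu>, i) x i = x i" for x using harm_restr_fix[OF \<nu> S(1)] .
  have sH: "s (harm_restr (\<nu>, i) x) = (u + w) * s x" and tH: "t (harm_restr (\<nu>, i) x) = (u - w) * t x" for x
    unfolding s_def t_def fx uw(3,4) by (simp_all add: algebra_simps)
  define A B a b where "A = (s x)\<^sup>2" and "B = 3 * (t x)\<^sup>2" and "a = (u + w)\<^sup>2" and "b = (u - w)\<^sup>2"
  have AB: "A + B = 2 * qf x x" unfolding q by (simp add: A_def B_def)
  have "c * (A + B) = 2 * qf (harm_restr (\<nu>, i) x) (harm_restr (\<nu>, i) x)" unfolding AB 1 by simp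
  also have "\<dots> = a * A + b * B"
    unfolding q sH tH A_def B_def a_def b_def power_mult_distrib by simp
  finally have e1: "a * A + b * B = c * (A + B)" by simp
  have "c\<^sup>2 * (A + B) = 2 * qf (harm_restr (\<nu>, i) (harm_restr (\<nu>, i) x)) (harm_restr (\<nu>, i) (harm_restr (\<nu>, i) x))" unfolding AB 2 by simp
  also have "\<dots> = a\<^sup>2 * A + b\<^sup>2 * B"
    unfolding q sH tH A_def B_def a_def b_def power_mult_distrib by (simp add: power2_eq_square)
  finally have e2: "a\<^sup>2 * A + b\<^sup>2 * B = c\<^sup>2 * (A + B)" by simp
  \<comment> \<open>The right side is a variance of the values \<open>a\<close> and \<open>b\<close>
    under the weights \<open>A\<close> and \<open>B\<close>. It vanishes because the second moment
    is the square of the first.\<close>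
  have "A * B * (a - b)\<^sup>2 = (A + B) * (a\<^sup>2 * A + b\<^sup>2 * B) - (a * A + b * B)\<^sup>2" by algebra
  also have "\<dots> = 0" unfolding e1 e2 by algebra
  finally have "A * B * (a - b)\<^sup>2 = 0" .
  moreover have "a - b = 4 * u * w" by (simp add: a_def b_def power2_eq_square algebra_simps)
  ultimately have "A = 0 \<or> B = 0" using uw(1,2) by simp
  then show ?thesis by (auto simp: A_def B_def s_def t_def)
qed

text \<open>Each corner admits only functions that are symmetric or antisymmetric with respect to
  it, and these alternatives at the different corners are compatible only for constants. All
  strictness in the contraction of the affinity comes from here.\<close>

lemma energy_ratios_not_multiplicative:
  assumes \<nu>: "\<nu> \<ge> 2"
    and 1: "\<And>i. i \<in> S0 \<Longrightarrow> qf (harm_restr (\<nu>, i) x) (harm_restr (\<nu>, i) x) = c i * qf x x"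
    and 2: "\<And>i. i \<in> S0 \<Longrightarrow> qf (harm_restr (\<nu>, i) (harm_restr (\<nu>, i) x)) (harm_restr (\<nu>, i) (harm_restr (\<nu>, i) x)) = (c i)\<^sup>2 * qf x x"
  shows "qf x x = 0"
proof -
  have S: "1 \<in> S0" "2 \<in> S0" "3 \<in> S0" by (auto simp: S0_def)
  have "x 2 = x 3 \<or> x 2 + x 3 = 2 * x 1"
    by (rule corner_pure[OF \<nu> S(1,2,3) _ _ _ 1[OF S(1)] 2[OF S(1)]]) auto
  moreover have "x 1 = x 3 \<or> x 1 + x 3 = 2 * x 2"
    by (rule corner_pure[OF \<nu> S(2,1,3) _ _ _ 1[OF S(2)] 2[OF S(2)]]) auto
  moreover have "x 1 = x 2 \<or> x 1 + x 2 = 2 * x 3"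
    by (rule corner_pure[OF \<nu> S(3,1,2) _ _ _ 1[OF S(3)] 2[OF S(3)]]) auto
  ultimately have "x 1 = x 2 \<and> x 2 = x 3" by (elim disjE) linarith+
  then show ?thesis by (simp add: qf_def)
qed

end

section \<open>Words, cells and the gasket\<close>

declare split_paired_Ex [simp del] split_paired_All [simp del]

text \<open>The environment seen from \<open>w\<close>. The part of the gasket in the cell of
  \<open>w\<close> is a copy of the gasket of this environment, which makes induction on the level
  possible although the gasket is not self-similar.\<close>

definition subenv :: "('a list \<Rightarrow> 'b) \<Rightarrow> 'a list \<Rightarrow> 'a list \<Rightarrow> 'b" where
  "subenv L w = (\<lambda>v. L (w @ v))"

lemma subenv_Nil [simp]: "subenv L [] = L"
  and subenv_sh [simp]: "subenv (subenv L w) w' = subenv L (w @ w')"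
  and subenv_apply: "subenv L w v = L (w @ v)"
  and subenv_apply_Nil [simp]: "subenv L w [] = L w"
  by (simp_all add: subenv_def)

section \<open>Admissible words\<close>

lemma Wt_length: "w \<in> Wt L m \<Longrightarrow> length w = m"
  by (induction m arbitrary: w) auto

lemma finite_Wt [simp]: "finite (Wt L m)"
proof (induction m)
  case (Suc m)
  have "{w @ [v] | v. v \<in> letters (L w)} = (\<lambda>v. w @ [v]) ` letters (L w)" for w by auto
  with Suc show ?case by simp
qed simp

lemma Wt_snoc_iff: "w @ [v] \<in> Wt L (Suc m) \<longleftrightarrow> w \<in> Wt L m \<and> v \<in> letters (L w)"
  by auto

lemma Wt_append_iff: "length w = m \<Longrightarrow> w @ w' \<in> Wt L (m + n) \<longleftrightarrow> w \<in> Wt L m \<and> w' \<in> Wt (subenv L w) n"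
proof (induction n arbitrary: w')
  case 0
  then show ?case using Wt_length[of "w @ w'" L m] by auto
next
  case (Suc n)
  show ?case
  proof (cases w' rule: rev_cases)
    case Nil
    then show ?thesis using Suc.prems Wt_length[of w L "m + Suc n"] Wt_length[of "[]" "subenv L w" "Suc n"] by auto
  next
    case (snoc u v)
    then show ?thesis using Suc.IH[OF Suc.prems, of u] Wt_snoc_iff[of "w @ u" v L "m + n"]
      Wt_snoc_iff[of u v "subenv L w" n] by (simp add: subenv_apply)
  qed
qed

lemma Wt_add: "Wt L (m + n) = (\<lambda>(w, w'). w @ w') ` (SIGMA w:Wt L m. Wt (subenv L w) n)"
proof (intro equalityI subsetI)
  fix x assume x: "x \<in> Wt L (m + n)"
  have l: "length (take m x) = m" using Wt_length[OF x] by simp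
  then have "take m x \<in> Wt L m \<and> drop m x \<in> Wt (subenv L (take m x)) n"
    using Wt_append_iff[OF l, of "drop m x" L n] x by simp
  then show "x \<in> (\<lambda>(w, w'). w @ w') ` (SIGMA w:Wt L m. Wt (subenv L w) n)"
    by (intro image_eqI[of _ _ "(take m x, drop m x)"]) auto
qed (auto simp: Wt_append_iff Wt_length)

lemma sum_Wt_add: "(\<Sum>w\<in>Wt L (m + n). f w) = (\<Sum>w\<in>Wt L m. \<Sum>w'\<in>Wt (subenv L w) n. f (w @ w'))"
proof -
  have "inj_on (\<lambda>(w, w'). w @ w') (SIGMA w:Wt L m. Wt (subenv L w) n)"
  proof (rule inj_onI, clarify)
    fix a b c d assume "a \<in> Wt L m" "c \<in> Wt L m" "a @ b = c @ d"
    then show "a = c \<and> b = d" using Wt_length[of a L m] Wt_length[of c L m] by simp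
  qed
  then show ?thesis unfolding Wt_add
    by (simp add: sum.reindex sum.Sigma split_def)
qed

lemma Wt_1: "Wt L (Suc 0) = (\<lambda>v. [v]) ` letters (L [])"
  by auto

lemma sum_Wt_1: "(\<Sum>w\<in>Wt L (Suc 0). f w) = (\<Sum>v\<in>letters (L []). f [v])"
  unfolding Wt_1 by (simp add: sum.reindex inj_on_def)

lemma sum_Wt_Suc: "(\<Sum>w\<in>Wt L (Suc m). f w) = (\<Sum>w\<in>Wt L m. \<Sum>v\<in>letters (L w). f (w @ [v]))"
  using sum_Wt_add[of f L m "Suc 0"] by (simp only: sum_Wt_1) simp

lemma Wt_Cons_iff: "v # w \<in> Wt L (Suc m) \<longleftrightarrow> v \<in> letters (L []) \<and> w \<in> Wt (subenv L [v]) m"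
  using Wt_append_iff[of "[v]" "Suc 0" w L m] by auto

lemma Wt_SucE:
  assumes "w \<in> Wt L (Suc m)"
  obtains v w' where "w = v # w'" "v \<in> letters (L [])" "w' \<in> Wt (subenv L [v]) m"
proof -
  obtain v w' where "w = v # w'" using Wt_length[OF assms] by (cases w) auto
  with assms that show ?thesis by (auto simp: Wt_Cons_iff simp del: Wt.simps)
qed

lemma Wt_all_iff: "w \<in> Wt_all L \<longleftrightarrow> w \<in> Wt L (length w)"
  unfolding Wt_all_def using Wt_length by auto

section \<open>Prefixes and composed similarities\<close>

lemma prefix_of_length [simp]: "length (prefix_of \<omega> n) = n"
  by (simp add: prefix_of_def)

lemma prefix_of_0 [simp]: "prefix_of \<omega> 0 = []"
  by (simp add: prefix_of_def)

lemma prefix_of_Suc: "prefix_of \<omega> (Suc n) = prefix_of \<omega> n @ [\<omega> n]"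
  by (simp add: prefix_of_def)

lemma prefix_of_add: "prefix_of \<omega> (m + n) = prefix_of \<omega> m @ prefix_of (\<lambda>i. \<omega> (m + i)) n"
  by (induction n) (simp_all add: prefix_of_Suc)

lemma take_prefix_of: "m \<le> n \<Longrightarrow> take m (prefix_of \<omega> n) = prefix_of \<omega> m"
  by (simp add: prefix_of_def take_map take_upt)

lemma psi_word_append: "psi_word \<alpha> (w @ w') = psi_word \<alpha> w \<circ> psi_word \<alpha> w'"
  by (induction w) (simp_all add: comp_assoc)

lemma r_word_append: "r_word p \<alpha> (w @ w') = r_word p \<alpha> w * r_word p \<alpha> w'"
  by (simp add: r_word_def)

lemma r_word_Nil [simp]: "r_word p \<alpha> [] = 1" by (simp add: r_word_def)

lemma r_word_single [simp]: "r_word p \<alpha> [v] = renorm p \<alpha> (fst v)" by (simp add: r_word_def)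

locale gasket_letters = gasket_geometry +
  fixes T :: "nat set"
  assumes finT: "finite T" and neT: "T \<noteq> {}" and geT: "T \<subseteq> {\<nu>. \<nu> \<ge> 2}"
begin

text \<open>Only words over the alphabet of \<open>T\<close> are constrained, because only there the
  random environment is assumed to be measurable with values in \<open>T\<close>.\<close>

definition T_valued :: "(letter list \<Rightarrow> nat) \<Rightarrow> bool" where
  "T_valued L \<longleftrightarrow> (\<forall>w\<in>Words T. L w \<in> T)"

abbreviation K :: "letter list \<Rightarrow> plane set" where
  "K w \<equiv> psi_word \<alpha> w ` triangle p"

lemma T2: "\<nu> \<in> T \<Longrightarrow> \<nu> \<ge> 2" using geT by auto

lemma finite_alphabet: "finite (alphabet T)"
  unfolding alphabet_def using finT by auto

lemma letters_alphabet: "\<nu> \<in> T \<Longrightarrow> v \<in> letters \<nu> \<Longrightarrow> v \<in> alphabet T"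
  unfolding alphabet_def by auto

lemma alphabet_letters: "v \<in> alphabet T \<Longrightarrow> fst v \<in> T \<and> v \<in> letters (fst v)"
  unfolding alphabet_def using letters_fst by blast

lemma Nil_Words [simp]: "[] \<in> Words T"
  and Cons_Words [simp]: "v # w \<in> Words T \<longleftrightarrow> v \<in> alphabet T \<and> w \<in> Words T"
  and append_Words [simp]: "w @ w' \<in> Words T \<longleftrightarrow> w \<in> Words T \<and> w' \<in> Words T"
  by (auto simp: Words_def)

lemma T_valued_sh: "T_valued L \<Longrightarrow> w \<in> Words T \<Longrightarrow> T_valued (subenv L w)"
  unfolding T_valued_def by (simp add: subenv_apply)

lemma T_valued_T: "T_valued L \<Longrightarrow> w \<in> Words T \<Longrightarrow> L w \<in> T"
  unfolding T_valued_def by simp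

lemma Wt_Words: "T_valued L \<Longrightarrow> w \<in> Wt L m \<Longrightarrow> w \<in> Words T"
proof (induction m arbitrary: w)
  case (Suc m)
  then obtain u v where "w = u @ [v]" "u \<in> Wt L m" "v \<in> letters (L u)" by auto
  then show ?case using Suc letters_alphabet[OF T_valued_T[OF Suc.prems(1)], of u v] by simp
qed simp

lemma T_valued_Wt: "T_valued L \<Longrightarrow> w \<in> Wt L m \<Longrightarrow> L w \<in> T"
  by (rule T_valued_T[OF _ Wt_Words])

lemma T_valued_sh_Wt: "T_valued L \<Longrightarrow> w \<in> Wt L m \<Longrightarrow> T_valued (subenv L w)"
  by (rule T_valued_sh[OF _ Wt_Words])

lemma T_valued_alphabet: "T_valued L \<Longrightarrow> v \<in> letters (L []) \<Longrightarrow> v \<in> alphabet T"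
  using letters_alphabet[OF T_valued_T[of L "[]"]] by simp

lemma T_valued_sh1: "T_valued L \<Longrightarrow> v \<in> letters (L []) \<Longrightarrow> T_valued (subenv L [v])"
  using T_valued_sh[of L "[v]"] T_valued_alphabet by simp

lemma T_valued_2: "T_valued L \<Longrightarrow> L [] \<ge> 2"
  using T_valued_T[of L "[]"] T2 by simp

lemma psi_alph: "v \<in> alphabet T \<Longrightarrow> psi \<alpha> v z = psi \<alpha> v z' \<longleftrightarrow> z = z'"
  using alphabet_letters[of v] T2 psi_inj by blast

lemma psi_word_inj: "w \<in> Words T \<Longrightarrow> psi_word \<alpha> w z = psi_word \<alpha> w z' \<longleftrightarrow> z = z'"
  by (induction w) (auto simp: psi_alph)

lemma psi_word_triangle: "w \<in> Words T \<Longrightarrow> z \<in> triangle p \<Longrightarrow> psi_word \<alpha> w z \<in> triangle p"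
proof (induction w)
  case (Cons v w)
  then show ?case using alphabet_letters[of v] T2 psi_triangle[of "fst v" v] by auto
qed simp

lemma K_append: "w' \<in> Words T \<Longrightarrow> K (w @ w') \<subseteq> K w"
  by (auto simp: psi_word_append psi_word_triangle)

section \<open>Contraction and the coding map\<close>

lemma psi_dist: "v \<in> alphabet T \<Longrightarrow> dist (psi \<alpha> v x) (psi \<alpha> v y) \<le> (1/2) * dist x y"
proof -
  assume "v \<in> alphabet T"
  then have "fst v \<ge> 2" using alphabet_letters T2 by blast
  then have "1 / real (fst v) \<le> 1 / 2" by (intro divide_left_mono) auto
  moreover have "dist (psi \<alpha> v x) (psi \<alpha> v y) = 1 / real (fst v) * dist x y"
    unfolding psi_def dist_norm by (simp flip: scaleR_diff_right)
  ultimately show ?thesis by (metis mult_right_mono zero_le_dist)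
qed

lemma psi_word_dist: "w \<in> Words T \<Longrightarrow> dist (psi_word \<alpha> w x) (psi_word \<alpha> w y) \<le> (1/2) ^ length w * dist x y"
proof (induction w)
  case (Cons v w)
  have "dist (psi_word \<alpha> (v # w) x) (psi_word \<alpha> (v # w) y) \<le> (1/2) * dist (psi_word \<alpha> w x) (psi_word \<alpha> w y)"
    using Cons.prems psi_dist by simp
  also have "\<dots> \<le> (1/2) * ((1/2) ^ length w * dist x y)"
    using Cons by (intro mult_left_mono) auto
  finally show ?case by simp
qed simp

lemma continuous_psi: "continuous_on A (psi \<alpha> v)"
  unfolding psi_def by (intro continuous_intros)

lemma continuous_psi_word: "continuous_on A (psi_word \<alpha> w)"
proof (induction w arbitrary: A)
  case (Cons v w)
  show ?case unfolding psi_word.simps by (intro continuous_on_compose Cons.IH continuous_psi)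
qed simp

lemma compact_K: "compact (K w)"
  by (intro compact_continuous_image continuous_psi_word compact_triangle)

lemma diam_K: "w \<in> Words T \<Longrightarrow> x \<in> K w \<Longrightarrow> y \<in> K w \<Longrightarrow> dist x y \<le> (1/2) ^ length w * diameter (triangle p)"
proof -
  assume w: "w \<in> Words T" and "x \<in> K w" "y \<in> K w"
  then obtain x' y' where *: "x = psi_word \<alpha> w x'" "y = psi_word \<alpha> w y'" "x' \<in> triangle p" "y' \<in> triangle p" by auto
  have "dist x' y' \<le> diameter (triangle p)"
    using diameter_bounded_bound[OF compact_imp_bounded[OF compact_triangle] *(3,4)] .
  then have "(1/2) ^ length w * dist x' y' \<le> (1/2) ^ length w * diameter (triangle p)"
    by (intro mult_left_mono) auto
  then show ?thesis unfolding *(1,2) by (rule order_trans[OF psi_word_dist[OF w]])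
qed

lemma eventually_small: "0 < e \<Longrightarrow> \<exists>n. (1/2::real) ^ n * c < e"
proof -
  assume "0 < e"
  have "(\<lambda>n. (1/2::real) ^ n * c) \<longlonglongrightarrow> 0 * c" by (intro tendsto_mult LIMSEQ_power_zero) auto
  then have "eventually (\<lambda>n. (1/2::real) ^ n * c < e) sequentially"
    using \<open>0 < e\<close> by (intro order_tendstoD(2)) auto
  then show ?thesis by (auto simp: eventually_sequentially)
qed

lemma Sigma_sp_prefix: "\<omega> \<in> Sigma_sp T \<Longrightarrow> prefix_of \<omega> n \<in> Words T"
  by (auto simp: Sigma_sp_def Words_def prefix_of_def)

lemma K_prefix_mono: "\<omega> \<in> Sigma_sp T \<Longrightarrow> m \<le> n \<Longrightarrow> K (prefix_of \<omega> n) \<subseteq> K (prefix_of \<omega> m)"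
  using K_append[of "prefix_of (\<lambda>i. \<omega> (m + i)) (n - m)" "prefix_of \<omega> m"]
    prefix_of_add[of \<omega> m "n - m"] Sigma_sp_prefix[of "\<lambda>i. \<omega> (m + i)" "n - m"]
  by (auto simp: Sigma_sp_def)

lemma proj_ex: "\<omega> \<in> Sigma_sp T \<Longrightarrow> \<exists>a. (\<Inter>m. K (prefix_of \<omega> m)) = {a}"
proof -
  assume \<omega>: "\<omega> \<in> Sigma_sp T"
  have "\<exists>a. \<Inter>(range (\<lambda>m. K (prefix_of \<omega> m))) = {a}"
  proof (rule decreasing_closed_nest_sing)
    show "closed (K (prefix_of \<omega> n))" for n by (rule compact_imp_closed[OF compact_K])
    show "K (prefix_of \<omega> n) \<noteq> {}" for n using p_in_triangle[of 1] by (auto simp: S0_def)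
    show "m \<le> n \<Longrightarrow> K (prefix_of \<omega> n) \<subseteq> K (prefix_of \<omega> m)" for m n by (rule K_prefix_mono[OF \<omega>])
    fix e :: real assume "0 < e"
    then obtain n where n: "(1/2) ^ n * diameter (triangle p) < e" using eventually_small by blast
    show "\<exists>n. \<forall>x\<in>K (prefix_of \<omega> n). \<forall>y\<in>K (prefix_of \<omega> n). dist x y < e"
      using diam_K[OF Sigma_sp_prefix[OF \<omega>, of n]] n by (intro exI[of _ n]) (fastforce simp del: image_iff)
  qed
  then show ?thesis .
qed

lemma proj_mem: "\<omega> \<in> Sigma_sp T \<Longrightarrow> proj p \<alpha> \<omega> \<in> K (prefix_of \<omega> m)"
proof -
  assume "\<omega> \<in> Sigma_sp T"
  then obtain a where a: "(\<Inter>m. K (prefix_of \<omega> m)) = {a}" using proj_ex by blast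
  then have "proj p \<alpha> \<omega> = a" unfolding proj_def by simp
  then show ?thesis using a by blast
qed

lemma proj_unique: "\<omega> \<in> Sigma_sp T \<Longrightarrow> (\<And>m. z \<in> K (prefix_of \<omega> m)) \<Longrightarrow> proj p \<alpha> \<omega> = z"
proof -
  assume \<omega>: "\<omega> \<in> Sigma_sp T" and z: "\<And>m. z \<in> K (prefix_of \<omega> m)"
  obtain a where a: "(\<Inter>m. K (prefix_of \<omega> m)) = {a}" using proj_ex[OF \<omega>] by blast
  have "proj p \<alpha> \<omega> \<in> (\<Inter>m. K (prefix_of \<omega> m))" "z \<in> (\<Inter>m. K (prefix_of \<omega> m))"
    using proj_mem[OF \<omega>] z by auto
  then show ?thesis unfolding a by simp
qed

lemma proj_tendsto: "\<omega> \<in> Sigma_sp T \<Longrightarrow> z \<in> triangle p \<Longrightarrow> (\<lambda>m. psi_word \<alpha> (prefix_of \<omega> m) z) \<longlonglongrightarrow> proj p \<alpha> \<omega>"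
proof (rule metric_LIMSEQ_I)
  fix e :: real assume \<omega>: "\<omega> \<in> Sigma_sp T" and z: "z \<in> triangle p" and "0 < e"
  have "(\<lambda>n. (1/2::real) ^ n * diameter (triangle p)) \<longlonglongrightarrow> 0 * diameter (triangle p)"
    by (intro tendsto_mult LIMSEQ_power_zero) auto
  then have "eventually (\<lambda>n. (1/2::real) ^ n * diameter (triangle p) < e) sequentially"
    using \<open>0 < e\<close> by (intro order_tendstoD(2)) auto
  then obtain N where N: "\<And>n. n \<ge> N \<Longrightarrow> (1/2::real) ^ n * diameter (triangle p) < e"
    unfolding eventually_sequentially by blast
  have "dist (psi_word \<alpha> (prefix_of \<omega> n) z) (proj p \<alpha> \<omega>) \<le> (1/2) ^ n * diameter (triangle p)" for n
    using diam_K[OF Sigma_sp_prefix[OF \<omega>, of n] imageI[OF z] proj_mem[OF \<omega>]] by simp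
  then show "\<exists>no. \<forall>n\<ge>no. dist (psi_word \<alpha> (prefix_of \<omega> n) z) (proj p \<alpha> \<omega>) < e"
    using N by (meson le_less_trans)
qed

section \<open>The gasket as a decreasing intersection of unions of cells\<close>

definition level_cells :: "(letter list \<Rightarrow> nat) \<Rightarrow> nat \<Rightarrow> plane set" where
  "level_cells L m = (\<Union>w\<in>Wt L m. K w)"

text \<open>A form of the gasket for which compactness is immediate. \<open>gasket_eq\<close>
  identifies it with the image of the coding map.\<close>

definition G :: "(letter list \<Rightarrow> nat) \<Rightarrow> plane set" where
  "G L = (\<Inter>m. level_cells L m)"

lemma compact_Bset: "compact (level_cells L m)"
  unfolding level_cells_def by (intro compact_UN compact_K) auto

lemma level_cells_0: "level_cells L 0 = triangle p"
  by (simp add: level_cells_def)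

lemma compact_G: "compact (G L)"
proof -
  have "closed (G L)" unfolding G_def by (intro closed_INT ballI compact_imp_closed compact_Bset)
  moreover have "G L = triangle p \<inter> G L" using level_cells_0 unfolding G_def by blast
  ultimately show ?thesis using compact_Int_closed[OF compact_triangle] by metis
qed

lemma level_cells_Suc: "level_cells L (Suc m) = (\<Union>v\<in>letters (L []). psi \<alpha> v ` level_cells (subenv L [v]) m)"
proof (intro equalityI subsetI)
  fix z assume "z \<in> level_cells L (Suc m)"
  then obtain w y where w: "w \<in> Wt L (Suc m)" "z = psi_word \<alpha> w y" "y \<in> triangle p" unfolding level_cells_def by blast
  from w(1) obtain v w' where "w = v # w'" "v \<in> letters (L [])" "w' \<in> Wt (subenv L [v]) m" by (rule Wt_SucE)
  with w show "z \<in> (\<Union>v\<in>letters (L []). psi \<alpha> v ` level_cells (subenv L [v]) m)" unfolding level_cells_def by auto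
next
  fix z assume "z \<in> (\<Union>v\<in>letters (L []). psi \<alpha> v ` level_cells (subenv L [v]) m)"
  then obtain v w y where "v \<in> letters (L [])" "w \<in> Wt (subenv L [v]) m" "y \<in> triangle p" "z = psi \<alpha> v (psi_word \<alpha> w y)"
    unfolding level_cells_def by blast
  then have "v # w \<in> Wt L (Suc m)" "z \<in> K (v # w)" by (auto simp: Wt_Cons_iff simp del: Wt.simps)
  then show "z \<in> level_cells L (Suc m)" unfolding level_cells_def by blast
qed

lemma level_cells_mono: "T_valued L \<Longrightarrow> level_cells L (Suc m) \<subseteq> level_cells L m"
proof
  fix z assume L: "T_valued L" and "z \<in> level_cells L (Suc m)"
  then obtain w where w: "w \<in> Wt L (Suc m)" "z \<in> K w" unfolding level_cells_def by blast
  then obtain u v where u: "w = u @ [v]" "u \<in> Wt L m" "v \<in> letters (L u)" by auto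
  then have "[v] \<in> Words T" using L letters_alphabet[OF T_valued_Wt[OF L u(2)]] by simp
  then have "z \<in> K u" using K_append[of "[v]" u] u(1) w(2) by blast
  then show "z \<in> level_cells L m" using u(2) unfolding level_cells_def by blast
qed

text \<open>A point that meets the first-level cells at every depth stays in one of them for all
  depths: there are finitely many letters and the sets decrease, so one failing depth per letter
  would give a common failing depth.\<close>

lemma G_step:
  assumes L: "T_valued L" and z: "z \<in> G L"
  obtains v y where "v \<in> letters (L [])" "y \<in> G (subenv L [v])" "z = psi \<alpha> v y"
proof -
  have "\<exists>v\<in>letters (L []). \<forall>m. z \<in> psi \<alpha> v ` level_cells (subenv L [v]) m"
  proof (rule ccontr)
    assume "\<not> ?thesis"
    then obtain f where f: "\<And>v. v \<in> letters (L []) \<Longrightarrow> z \<notin> psi \<alpha> v ` level_cells (subenv L [v]) (f v)" by metis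
    define M where "M = Max (f ` letters (L []))"
    have "z \<in> level_cells L (Suc M)" using z unfolding G_def by blast
    then obtain v where v: "v \<in> letters (L [])" "z \<in> psi \<alpha> v ` level_cells (subenv L [v]) M" unfolding level_cells_Suc by blast
    have okv: "T_valued (subenv L [v])" using T_valued_sh1[OF L v(1)] .
    have "f v \<le> M" unfolding M_def using v(1) by (intro Max_ge) auto
    then have "level_cells (subenv L [v]) M \<subseteq> level_cells (subenv L [v]) (f v)"
      using lift_Suc_antimono_le[of "level_cells (subenv L [v])"] level_cells_mono[OF okv] by blast
    then show False using f[OF v(1)] v(2) by blast
  qed
  then obtain v where v: "v \<in> letters (L [])" "\<And>m. z \<in> psi \<alpha> v ` level_cells (subenv L [v]) m" by blast
  obtain y where y: "z = psi \<alpha> v y" using v(2)[of 0] by blast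
  have "y \<in> level_cells (subenv L [v]) m" for m
    using v(2)[of m] y psi_inj[OF T_valued_2[OF L] v(1)] by auto
  then have "y \<in> G (subenv L [v])" unfolding G_def by blast
  with v(1) y that show ?thesis by blast
qed

lemma psi_G: "v \<in> letters (L []) \<Longrightarrow> y \<in> G (subenv L [v]) \<Longrightarrow> T_valued L \<Longrightarrow> psi \<alpha> v y \<in> G L"
  unfolding G_def
proof (intro INT_I)
  fix m assume v: "v \<in> letters (L [])" and y: "y \<in> (\<Inter>m. level_cells (subenv L [v]) m)" and L: "T_valued L"
  have "psi \<alpha> v y \<in> level_cells L (Suc m)" unfolding level_cells_Suc using v y by blast
  then show "psi \<alpha> v y \<in> level_cells L m" using level_cells_mono[OF L] by blast
qed

lemma psi_word_G: "T_valued L \<Longrightarrow> w \<in> Wt L m \<Longrightarrow> y \<in> G (subenv L w) \<Longrightarrow> psi_word \<alpha> w y \<in> G L"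
proof (induction w arbitrary: L m)
  case (Cons v w)
  then obtain m' where m: "m = Suc m'" using Wt_length by (cases m) fastforce+
  then have vw: "v \<in> letters (L [])" "w \<in> Wt (subenv L [v]) m'" using Cons.prems(2) by (auto simp: Wt_Cons_iff simp del: Wt.simps)
  have okv: "T_valued (subenv L [v])" using T_valued_sh1[OF Cons.prems(1) vw(1)] .
  have "psi_word \<alpha> w y \<in> G (subenv L [v])" using Cons.IH[OF okv vw(2)] Cons.prems(3) by simp
  then show ?case using psi_G[OF vw(1) _ Cons.prems(1)] by simp
qed simp

text \<open>The word and the preimage of the point are chosen together. Keeping the preimage in
  \<open>G\<close> of the shifted environment is what allows the next letter to be chosen.\<close>

lemma G_subset_gasket:
  assumes L: "T_valued L" shows "G L \<subseteq> gasket p \<alpha> T L"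
proof
  fix z assume z: "z \<in> G L"
  have "\<exists>f. \<forall>n. (fst (f n) \<in> Wt L n \<and> snd (f n) \<in> G (subenv L (fst (f n))) \<and> z = psi_word \<alpha> (fst (f n)) (snd (f n))) \<and>
     (\<exists>v. fst (f (Suc n)) = fst (f n) @ [v])"
  proof (rule dependent_nat_choice)
    show "\<exists>x. fst x \<in> Wt L 0 \<and> snd x \<in> G (subenv L (fst x)) \<and> z = psi_word \<alpha> (fst x) (snd x)"
      using z by (intro exI[of _ "([], z)"]) auto
  next
    fix x :: "letter list \<times> plane" and n
    assume x: "fst x \<in> Wt L n \<and> snd x \<in> G (subenv L (fst x)) \<and> z = psi_word \<alpha> (fst x) (snd x)"
    obtain v y where vy: "v \<in> letters (subenv L (fst x) [])" "y \<in> G (subenv (subenv L (fst x)) [v])" "snd x = psi \<alpha> v y"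
      using G_step[OF T_valued_sh_Wt[OF L], of "fst x" n "snd x"] x by blast
    then show "\<exists>y. (fst y \<in> Wt L (Suc n) \<and> snd y \<in> G (subenv L (fst y)) \<and> z = psi_word \<alpha> (fst y) (snd y)) \<and> (\<exists>v. fst y = fst x @ [v])"
      using x by (intro exI[of _ "(fst x @ [v], y)"]) (auto simp: psi_word_append)
  qed
  then obtain f where f: "\<And>n. fst (f n) \<in> Wt L n" "\<And>n. snd (f n) \<in> G (subenv L (fst (f n)))"
    "\<And>n. z = psi_word \<alpha> (fst (f n)) (snd (f n))" "\<And>n. \<exists>v. fst (f (Suc n)) = fst (f n) @ [v]" by blast
  define \<omega> where "\<omega> n = last (fst (f (Suc n)))" for n
  have pre: "prefix_of \<omega> n = fst (f n)" for n
  proof (induction n)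
    case 0 then show ?case using f(1)[of 0] by simp
  next
    case (Suc n)
    then show ?case using f(4)[of n] unfolding prefix_of_Suc \<omega>_def by auto
  qed
  have "prefix_of \<omega> (Suc n) \<in> Words T" for n using pre f(1) Wt_Words[OF L] by metis
  then have \<omega>: "\<omega> \<in> Sigma_sp T" unfolding Sigma_sp_def by (simp add: prefix_of_Suc)
  have \<omega>t: "\<omega> \<in> Sigma_t T L" unfolding Sigma_t_def using \<omega> pre f(1) by auto
  have "snd (f n) \<in> triangle p" for n
    using f(2)[of n] level_cells_0 unfolding G_def by blast
  then have "z \<in> K (prefix_of \<omega> n)" for n using pre[of n] f(3)[of n] by auto
  then have "z = proj p \<alpha> \<omega>" using proj_unique[OF \<omega>] by metis
  then show "z \<in> gasket p \<alpha> T L" unfolding gasket_def using \<omega>t by blast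
qed

lemma gasket_eq: "T_valued L \<Longrightarrow> gasket p \<alpha> T L = G L"
proof
  assume L: "T_valued L"
  show "G L \<subseteq> gasket p \<alpha> T L" by (rule G_subset_gasket[OF L])
  show "gasket p \<alpha> T L \<subseteq> G L"
    unfolding gasket_def G_def level_cells_def Sigma_t_def using proj_mem by fastforce
qed

lemma Sigma_t_sp: "\<omega> \<in> Sigma_t T L \<Longrightarrow> \<omega> \<in> Sigma_sp T"
  and Sigma_t_Wt: "\<omega> \<in> Sigma_t T L \<Longrightarrow> prefix_of \<omega> m \<in> Wt L m"
  by (auto simp: Sigma_t_def)

lemma p_in_G: "T_valued L \<Longrightarrow> a \<in> S0 \<Longrightarrow> p a \<in> G L"
proof -
  assume a: "a \<in> S0"
  have "T_valued L \<Longrightarrow> p a \<in> level_cells L m" for L m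
  proof (induction m arbitrary: L)
    case 0 then show ?case using a by (simp add: level_cells_0 p_in_triangle)
  next
    case (Suc m)
    note 2 = T_valued_2[OF Suc.prems]
    have v: "(L [], a) \<in> letters (L [])" using S0_letters[OF 2 a] .
    have okv: "T_valued (subenv L [(L [], a)])" using T_valued_sh1[OF Suc.prems v] .
    have "p a = psi \<alpha> (L [], a) (p a)" using psi_fix[OF 2 a] by simp
    then show ?case unfolding level_cells_Suc using Suc.IH[OF okv] v by blast
  qed
  then show "T_valued L \<Longrightarrow> p a \<in> G L" unfolding G_def by blast
qed

section \<open>Vertices and overlaps of cells\<close>

definition all_vertices :: "(letter list \<Rightarrow> nat) \<Rightarrow> plane set" where
  "all_vertices L = {psi_word \<alpha> w (p a) | w a. w \<in> Wt_all L \<and> a \<in> S0}"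

lemma countable_Vst: "countable (all_vertices L)"
proof -
  have "all_vertices L = (\<lambda>(w, a). psi_word \<alpha> w (p a)) ` (Wt_all L \<times> S0)" unfolding all_vertices_def by auto
  moreover have "countable (Wt_all L)" unfolding Wt_all_def by (intro countable_UN) (auto intro: countable_finite)
  ultimately show ?thesis by (auto intro: countable_finite)
qed

text \<open>Stripping the common prefix leads to two different letters, whose cells meet only in
  vertices. Hence a point of the gasket that is not a vertex determines the prefix of any sequence
  coding it.\<close>

lemma K_inter:
  assumes "T_valued L" "w \<in> Wt L m" "w' \<in> Wt L m" "w \<noteq> w'" "z \<in> K w" "z \<in> K w'"
  shows "z \<in> all_vertices L"
  using assms
proof (induction m arbitrary: L w w' z)
  case (Suc m)
  obtain v u where w: "w = v # u" "v \<in> letters (L [])" "u \<in> Wt (subenv L [v]) m" using Suc.prems(2) by (rule Wt_SucE)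
  obtain v' u' where w': "w' = v' # u'" "v' \<in> letters (L [])" "u' \<in> Wt (subenv L [v']) m" using Suc.prems(3) by (rule Wt_SucE)
  note 2 = T_valued_2[OF Suc.prems(1)]
  have okv: "T_valued (subenv L [v])" using T_valued_sh1[OF Suc.prems(1) w(2)] .
  have okv': "T_valued (subenv L [v'])" using T_valued_sh1[OF Suc.prems(1) w'(2)] .
  obtain y where y: "y \<in> K u" "z = psi \<alpha> v y" using Suc.prems(5) w(1) by auto
  obtain y' where y': "y' \<in> K u'" "z = psi \<alpha> v' y'" using Suc.prems(6) w'(1) by auto
  show ?case
  proof (cases "v = v'")
    case True
    then have "y = y'" using y(2) y'(2) psi_inj[OF 2 w(2)] by simp
    then have "y \<in> all_vertices (subenv L [v])" using Suc.IH[OF okv w(3), of u' y] w' True y y' Suc.prems(4) w(1) by auto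
    then obtain s a where s: "s \<in> Wt_all (subenv L [v])" "a \<in> S0" "y = psi_word \<alpha> s (p a)" unfolding all_vertices_def by blast
    have "v # s \<in> Wt_all L" using s(1) w(2) unfolding Wt_all_iff by (simp add: Wt_Cons_iff del: Wt.simps)
    moreover have "z = psi_word \<alpha> (v # s) (p a)" using s(3) y(2) by simp
    ultimately show ?thesis unfolding all_vertices_def using s(2) by blast
  next
    case False
    have "y \<in> triangle p" "y' \<in> triangle p"
      using y(1) y'(1) psi_word_triangle Wt_Words[OF okv w(3)] Wt_Words[OF okv' w'(3)] by auto
    then obtain a where a: "a \<in> S0" "y = p a"
      using cell_inter[OF 2 w(2) w'(2) False] y(2) y'(2) by metis
    have "[v] \<in> Wt_all L" using w(2) unfolding Wt_all_iff by simp
    moreover have "z = psi_word \<alpha> [v] (p a)" using a(2) y(2) by simp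
    ultimately show ?thesis unfolding all_vertices_def using a(1) by blast
  qed
qed simp

end

section \<open>Energies on the gasket\<close>

context gasket_letters
begin

definition cell_values :: "(plane \<Rightarrow> real) \<Rightarrow> letter list \<Rightarrow> nat \<Rightarrow> real" where
  "cell_values f w = (\<lambda>a. f (psi_word \<alpha> w (p a)))"

abbreviation rw :: "letter list \<Rightarrow> real" where
  "rw \<equiv> r_word p \<alpha>"

abbreviation EL :: "(letter list \<Rightarrow> nat) \<Rightarrow> nat \<Rightarrow> (plane \<Rightarrow> real) \<Rightarrow> (plane \<Rightarrow> real) \<Rightarrow> real" where
  "EL \<equiv> energy_lvl p \<alpha>"

lemma EL_eq: "EL L m f g = (\<Sum>w\<in>Wt L m. 1 / rw w * qf (cell_values f w) (cell_values g w))"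
  by (simp add: energy_lvl_def Q_eq_qf cell_values_def)

lemma rw_pos: "w \<in> Words T \<Longrightarrow> 0 < rw w"
proof (induction w)
  case (Cons v w)
  then have "0 < renorm p \<alpha> (fst v)" using alphabet_letters[of v] T2 by (auto intro: renorm_pos)
  then show ?case using Cons by (simp add: r_word_def)
qed simp

lemma cell_values_append: "cell_values f (w @ w') = cell_values (f \<circ> psi_word \<alpha> w) w'"
  by (simp add: cell_values_def psi_word_append)

lemma EL_shift:
  "(\<Sum>w'\<in>Wt (subenv L w) n. 1 / rw (w @ w') * qf (cell_values f (w @ w')) (cell_values g (w @ w'))) =
    1 / rw w * EL (subenv L w) n (f \<circ> psi_word \<alpha> w) (g \<circ> psi_word \<alpha> w)"
  unfolding EL_eq cell_values_append r_word_append by (simp add: sum_distrib_left mult.assoc)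

lemma EL_add: "EL L (m + n) f g =
    (\<Sum>w\<in>Wt L m. 1 / rw w * EL (subenv L w) n (f \<circ> psi_word \<alpha> w) (g \<circ> psi_word \<alpha> w))"
  unfolding EL_eq[of L] sum_Wt_add EL_shift ..

lemma EL_nonneg: "T_valued L \<Longrightarrow> 0 \<le> EL L m f f"
  unfolding EL_eq by (intro sum_nonneg mult_nonneg_nonneg) (auto simp: qf_nonneg less_imp_le[OF rw_pos] Wt_Words)

lemma EL_0: "EL L 0 f f = qf (cell_values f []) (cell_values f [])"
  by (simp add: EL_eq)

lemma EL_1_ge:
  assumes L: "T_valued L" shows "EL L 0 f f \<le> EL L (Suc 0) f f"
proof -
  note 2 = T_valued_2[OF L]
  have "EL L (Suc 0) f f = (\<Sum>v\<in>letters (L []). 1 / renorm p \<alpha> (L []) * qf (\<lambda>a. f (psi \<alpha> v (p a))) (\<lambda>a. f (psi \<alpha> v (p a))))"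
    unfolding EL_eq sum_Wt_1 by (intro sum.cong) (auto simp: cell_values_def letters_fst)
  also have "\<dots> = 1 / renorm p \<alpha> (L []) * D (L []) f f"
    by (simp add: D_def sum_distrib_left)
  also have "\<dots> \<ge> qf (cell_values f []) (cell_values f [])"
    using D_ge[OF 2, of f] resistance_pos[OF 2] unfolding renorm_eq[OF 2] by (simp add: cell_values_def field_simps)
  finally show ?thesis unfolding EL_0 .
qed

text \<open>The decomposition into cells reduces the step from level \<open>m\<close> to the step
  from level 0 in each shifted environment.\<close>

lemma EL_mono_Suc: "T_valued L \<Longrightarrow> EL L m f f \<le> EL L (Suc m) f f"
proof -
  assume L: "T_valued L"
  have "EL L (m + 0) f f \<le> EL L (m + Suc 0) f f"
    unfolding EL_add
    by (intro sum_mono mult_left_mono EL_1_ge) (auto simp: T_valued_sh_Wt[OF L] less_imp_le[OF rw_pos] Wt_Words[OF L])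
  then show ?thesis by simp
qed

lemma EL_incseq: "T_valued L \<Longrightarrow> incseq (\<lambda>m. EL L m f f)"
  by (simp add: incseq_Suc_iff EL_mono_Suc)

section \<open>Limit energies and their localization to cells\<close>

definition finite_energy :: "(letter list \<Rightarrow> nat) \<Rightarrow> (plane \<Rightarrow> real) \<Rightarrow> bool" where
  "finite_energy L f \<longleftrightarrow> convergent (\<lambda>m. EL L m f f)"

lemma finI_bounded:
  assumes "T_valued L" "\<And>m. EL L m f f \<le> B" shows "finite_energy L f"
  unfolding finite_energy_def using incseq_convergent[OF EL_incseq[OF assms(1)]] assms(2) convergent_def by metis

definition total_energy :: "(letter list \<Rightarrow> nat) \<Rightarrow> (plane \<Rightarrow> real) \<Rightarrow> real" where
  "total_energy L f = lim (\<lambda>m. EL L m f f)"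

lemma total_energy_tendsto: "finite_energy L f \<Longrightarrow> (\<lambda>m. EL L m f f) \<longlonglongrightarrow> total_energy L f"
  unfolding finite_energy_def total_energy_def by (simp add: convergent_LIMSEQ_iff)

lemma EL_le_Eng: "T_valued L \<Longrightarrow> finite_energy L f \<Longrightarrow> EL L m f f \<le> total_energy L f"
  using incseq_le[OF EL_incseq total_energy_tendsto] by blast

lemma total_energy_nonneg: "T_valued L \<Longrightarrow> finite_energy L f \<Longrightarrow> 0 \<le> total_energy L f"
  using EL_nonneg EL_le_Eng order_trans by blast

lemma finite_energy_sub:
  assumes L: "T_valued L" and f: "finite_energy L f" and w: "w \<in> Wt L m"
  shows "finite_energy (subenv L w) (f \<circ> psi_word \<alpha> w)"
proof (rule finI_bounded[OF T_valued_sh_Wt[OF L w]])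
  fix n
  have rp: "0 < rw w" using rw_pos Wt_Words[OF L w] by blast
  have "1 / rw w * EL (subenv L w) n (f \<circ> psi_word \<alpha> w) (f \<circ> psi_word \<alpha> w) \<le> EL L (m + n) f f"
    unfolding EL_add
    by (rule member_le_sum[OF w, of "\<lambda>w. 1 / rw w * EL (subenv L w) n (f \<circ> psi_word \<alpha> w) (f \<circ> psi_word \<alpha> w)"])
       (auto intro!: divide_nonneg_nonneg EL_nonneg simp: T_valued_sh_Wt[OF L] less_imp_le[OF rw_pos] Wt_Words[OF L])
  also have "\<dots> \<le> total_energy L f" by (rule EL_le_Eng[OF L f])
  finally show "EL (subenv L w) n (f \<circ> psi_word \<alpha> w) (f \<circ> psi_word \<alpha> w) \<le> rw w * total_energy L f"
    using rp by (simp add: field_simps)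
qed

text \<open>The energy that \<open>f\<close> carries inside the cell of \<open>w\<close>. Additivity
  over subcells makes this a consistent family of cylinder masses.\<close>

definition cell_energy :: "(letter list \<Rightarrow> nat) \<Rightarrow> (plane \<Rightarrow> real) \<Rightarrow> letter list \<Rightarrow> real" where
  "cell_energy L f w = 1 / rw w * total_energy (subenv L w) (f \<circ> psi_word \<alpha> w)"

lemma cell_energy_nonneg: "T_valued L \<Longrightarrow> finite_energy L f \<Longrightarrow> w \<in> Wt L m \<Longrightarrow> 0 \<le> cell_energy L f w"
  unfolding cell_energy_def by (intro mult_nonneg_nonneg total_energy_nonneg finite_energy_sub)
    (auto simp: T_valued_sh_Wt less_imp_le[OF rw_pos] Wt_Words)

lemma cell_energy_ge: "T_valued L \<Longrightarrow> finite_energy L f \<Longrightarrow> w \<in> Wt L m \<Longrightarrow> 1 / rw w * qf (cell_values f w) (cell_values f w) \<le> cell_energy L f w"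
proof -
  assume L: "T_valued L" and f: "finite_energy L f" and w: "w \<in> Wt L m"
  have "qf (cell_values f w) (cell_values f w) \<le> total_energy (subenv L w) (f \<circ> psi_word \<alpha> w)"
    using EL_le_Eng[OF T_valued_sh_Wt[OF L w] finite_energy_sub[OF L f w], of 0] unfolding EL_0 by (simp add: cell_values_def)
  then show ?thesis unfolding cell_energy_def using rw_pos[OF Wt_Words[OF L w]] by (intro mult_left_mono) auto
qed

lemma sum_ce: "T_valued L \<Longrightarrow> finite_energy L f \<Longrightarrow> (\<Sum>w\<in>Wt L m. cell_energy L f w) = total_energy L f"
proof -
  assume L: "T_valued L" and f: "finite_energy L f"
  have "(\<lambda>n. EL L (m + n) f f) \<longlonglongrightarrow> (\<Sum>w\<in>Wt L m. cell_energy L f w)"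
    unfolding EL_add cell_energy_def by (intro tendsto_sum tendsto_mult tendsto_const total_energy_tendsto finite_energy_sub[OF L f])
  moreover have "(\<lambda>n. EL L (m + n) f f) \<longlonglongrightarrow> total_energy L f"
    using LIMSEQ_ignore_initial_segment[OF total_energy_tendsto[OF f], of m] by (simp add: add.commute)
  ultimately show ?thesis by (rule LIMSEQ_unique)
qed

lemma cell_energy_append: "cell_energy L f (w @ w') = 1 / rw w * cell_energy (subenv L w) (f \<circ> psi_word \<alpha> w) w'"
  by (simp add: cell_energy_def r_word_append psi_word_append comp_assoc)

lemma sum_ce_children: "T_valued L \<Longrightarrow> finite_energy L f \<Longrightarrow> w \<in> Wt L m \<Longrightarrow> (\<Sum>v\<in>letters (L w). cell_energy L f (w @ [v])) = cell_energy L f w"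
proof -
  assume L: "T_valued L" and f: "finite_energy L f" and w: "w \<in> Wt L m"
  have "(\<Sum>v\<in>letters (L w). cell_energy L f (w @ [v])) = 1 / rw w * (\<Sum>w'\<in>Wt (subenv L w) (Suc 0). cell_energy (subenv L w) (f \<circ> psi_word \<alpha> w) w')"
    unfolding sum_Wt_1 cell_energy_append by (simp add: sum_distrib_left)
  then show ?thesis unfolding sum_ce[OF T_valued_sh_Wt[OF L w] finite_energy_sub[OF L f w]] by (simp add: cell_energy_def[of L f w])
qed

lemma EL_linear:
  "EL L m (\<lambda>z. f z + g z) h = EL L m f h + EL L m g h"
  "EL L m (\<lambda>z. f z - g z) h = EL L m f h - EL L m g h"
  "EL L m (\<lambda>z. c * f z) h = c * EL L m f h"
  unfolding EL_eq cell_values_def by (simp_all add: qf_linear sum.distrib sum_subtractf sum_distrib_left algebra_simps)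

lemma EL_sym: "EL L m f g = EL L m g f"
  unfolding EL_eq by (simp add: qf_sym)

lemma EL_linear_right:
  "EL L m h (\<lambda>z. f z + g z) = EL L m h f + EL L m h g"
  "EL L m h (\<lambda>z. f z - g z) = EL L m h f - EL L m h g"
  "EL L m h (\<lambda>z. c * f z) = c * EL L m h f"
  using EL_linear(1,2)[of L m f g h] EL_linear(3)[of L m c f h] by (simp_all add: EL_sym)

lemma finite_energy_add:
  assumes L: "T_valued L" and "finite_energy L f" "finite_energy L g" shows "finite_energy L (\<lambda>z. f z + g z)"
proof (rule finI_bounded[OF L])
  fix m
  have "0 \<le> EL L m (\<lambda>z. f z - g z) (\<lambda>z. f z - g z)" by (rule EL_nonneg[OF L])
  then have "EL L m (\<lambda>z. f z + g z) (\<lambda>z. f z + g z) \<le> 2 * EL L m f f + 2 * EL L m g g"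
    unfolding EL_linear EL_linear_right using EL_sym[of L m f g] by simp
  also have "\<dots> \<le> 2 * total_energy L f + 2 * total_energy L g" using EL_le_Eng[OF L] assms by (intro add_mono) auto
  finally show "EL L m (\<lambda>z. f z + g z) (\<lambda>z. f z + g z) \<le> 2 * total_energy L f + 2 * total_energy L g" .
qed

lemma finite_energy_const: "finite_energy L (\<lambda>z. c)"
  by (simp add: finite_energy_def EL_eq cell_values_def qf_def convergent_const)

lemma EL_bilinear_convergent:
  assumes L: "T_valued L" and f: "finite_energy L f" and g: "finite_energy L g" shows "convergent (\<lambda>m. EL L m f g)"
proof -
  have e: "EL L m f g = (1/2) * (EL L m (\<lambda>z. f z + g z) (\<lambda>z. f z + g z) - EL L m f f - EL L m g g)" for m
    unfolding EL_linear EL_linear_right using EL_sym[of L m f g] by simp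
  show ?thesis unfolding e using finite_energy_add[OF assms] f g unfolding finite_energy_def
    by (intro convergent_mult convergent_const convergent_diff)
qed

lemma vertex_in_G: "T_valued L \<Longrightarrow> w \<in> Wt L m \<Longrightarrow> a \<in> S0 \<Longrightarrow> psi_word \<alpha> w (p a) \<in> G L"
  by (rule psi_word_G) (auto simp: p_in_G T_valued_sh_Wt)

lemma EL_cong: "T_valued L \<Longrightarrow> (\<And>z. z \<in> G L \<Longrightarrow> f z = f' z) \<Longrightarrow> (\<And>z. z \<in> G L \<Longrightarrow> g z = g' z) \<Longrightarrow> EL L m f g = EL L m f' g'"
  unfolding EL_eq cell_values_def by (intro sum.cong refl arg_cong2[of _ _ _ _ "(*)"] qf_cong) (auto simp: vertex_in_G)

text \<open>On each edge the Leibniz rule a*c - b*d = (a - b)*c + b*(c - d) applies. Products are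
  needed twice: the energy measure is characterized through \<open>f * g\<close> and the square of
  \<open>f\<close>, and the density argument works with an algebra of functions.\<close>

lemma finite_energy_mult:
  assumes L: "T_valued L" and f: "finite_energy L f" and g: "finite_energy L g"
    and B: "\<And>z. z \<in> G L \<Longrightarrow> \<bar>f z\<bar> \<le> B" "\<And>z. z \<in> G L \<Longrightarrow> \<bar>g z\<bar> \<le> B"
  shows "finite_energy L (\<lambda>z. f z * g z)"
proof (rule finI_bounded[OF L])
  fix m
  have edge: "(a * c - b * d) * (a * c - b * d) \<le> 2 * B\<^sup>2 * ((a - b) * (a - b)) + 2 * B\<^sup>2 * ((c - d) * (c - d))"
    if "\<bar>c\<bar> \<le> B" "\<bar>b\<bar> \<le> B" for a b c d :: real
  proof -
    have "a * c - b * d = (a - b) * c + b * (c - d)" by algebra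
    then have "(a * c - b * d) * (a * c - b * d) = ((a - b) * c + b * (c - d))\<^sup>2" by (simp add: power2_eq_square)
    also have "\<dots> \<le> 2 * ((a - b) * c)\<^sup>2 + 2 * (b * (c - d))\<^sup>2"
      using zero_le_power2[of "(a - b) * c - b * (c - d)"] by (simp add: power2_eq_square algebra_simps)
    also have "\<dots> = 2 * (c\<^sup>2 * (a - b)\<^sup>2) + 2 * (b\<^sup>2 * (c - d)\<^sup>2)" by (simp add: power_mult_distrib)
    also have "\<dots> \<le> 2 * (B\<^sup>2 * (a - b)\<^sup>2) + 2 * (B\<^sup>2 * (c - d)\<^sup>2)"
      using that abs_le_square_iff[of c B] abs_le_square_iff[of b B]
      by (intro add_mono mult_left_mono mult_right_mono) auto
    finally show ?thesis by (simp add: power2_eq_square mult.assoc)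
  qed
  have q: "qf (\<lambda>a. x a * y a) (\<lambda>a. x a * y a) \<le> 2 * B\<^sup>2 * qf x x + 2 * B\<^sup>2 * qf y y"
    if "\<And>a. a \<in> S0 \<Longrightarrow> \<bar>x a\<bar> \<le> B" "\<And>a. a \<in> S0 \<Longrightarrow> \<bar>y a\<bar> \<le> B" for x y :: "nat \<Rightarrow> real"
  proof -
    have S: "1 \<in> S0" "2 \<in> S0" "3 \<in> S0" by (auto simp: S0_def)
    show ?thesis unfolding qf_def
      using edge[OF that(2)[OF S(1)] that(1)[OF S(2)], of "x 1" "y 2"] edge[OF that(2)[OF S(2)] that(1)[OF S(3)], of "x 2" "y 3"]
        edge[OF that(2)[OF S(3)] that(1)[OF S(1)], of "x 3" "y 1"]
      unfolding distrib_left by linarith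
  qed
  have "EL L m (\<lambda>z. f z * g z) (\<lambda>z. f z * g z) \<le>
    (\<Sum>w\<in>Wt L m. 1 / rw w * (2 * B\<^sup>2 * qf (cell_values f w) (cell_values f w) + 2 * B\<^sup>2 * qf (cell_values g w) (cell_values g w)))"
    unfolding EL_eq
    by (intro sum_mono mult_left_mono) (auto simp: cell_values_def less_imp_le[OF rw_pos] Wt_Words[OF L] intro!: q B vertex_in_G[OF L])
  also have "\<dots> = 2 * B\<^sup>2 * EL L m f f + 2 * B\<^sup>2 * EL L m g g"
    unfolding EL_eq by (simp add: sum.distrib sum_distrib_left algebra_simps)
  also have "\<dots> \<le> 2 * B\<^sup>2 * total_energy L f + 2 * B\<^sup>2 * total_energy L g"
    using EL_le_Eng[OF L f] EL_le_Eng[OF L g] by (intro add_mono mult_left_mono) auto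
  finally show "EL L m (\<lambda>z. f z * g z) (\<lambda>z. f z * g z) \<le> 2 * B\<^sup>2 * total_energy L f + 2 * B\<^sup>2 * total_energy L g" .
qed

text \<open>A discrete carre du champ: each edge contributes the squared difference of
  \<open>f\<close> times the sum of the two end values of \<open>g\<close>. For small cells this sum
  is close to twice the value of \<open>g\<close>, which is the origin of the factor 2 in the masses
  of the energy measure.\<close>

lemma EL_product_rule:
  "2 * EL L m f (\<lambda>z. f z * g z) - EL L m (\<lambda>z. (f z)\<^sup>2) g =
    (\<Sum>w\<in>Wt L m. 1 / rw w * ((cell_values f w 1 - cell_values f w 2)\<^sup>2 * (cell_values g w 1 + cell_values g w 2) +
       (cell_values f w 2 - cell_values f w 3)\<^sup>2 * (cell_values g w 2 + cell_values g w 3) + (cell_values f w 3 - cell_values f w 1)\<^sup>2 * (cell_values g w 3 + cell_values g w 1)))"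
proof -
  have "2 * qf x (\<lambda>a. x a * y a) - qf (\<lambda>a. (x a)\<^sup>2) y =
     (x 1 - x 2)\<^sup>2 * (y 1 + y 2) + (x 2 - x 3)\<^sup>2 * (y 2 + y 3) + (x 3 - x 1)\<^sup>2 * (y 3 + y 1)" for x y
    unfolding qf_def by algebra
  then have "2 * (1 / rw w * qf (cell_values f w) (\<lambda>a. cell_values f w a * cell_values g w a)) - 1 / rw w * qf (\<lambda>a. (cell_values f w a)\<^sup>2) (cell_values g w) =
    1 / rw w * ((cell_values f w 1 - cell_values f w 2)\<^sup>2 * (cell_values g w 1 + cell_values g w 2) +
       (cell_values f w 2 - cell_values f w 3)\<^sup>2 * (cell_values g w 2 + cell_values g w 3) + (cell_values f w 3 - cell_values f w 1)\<^sup>2 * (cell_values g w 3 + cell_values g w 1))" for w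
    by (simp only: right_diff_distrib[symmetric] mult.left_commute[of 2])
  moreover have "cell_values (\<lambda>z. f z * g z) w = (\<lambda>a. cell_values f w a * cell_values g w a)" "cell_values (\<lambda>z. (f z)\<^sup>2) w = (\<lambda>a. (cell_values f w a)\<^sup>2)" for w
    by (simp_all add: cell_values_def)
  ultimately show ?thesis unfolding EL_eq by (simp only: sum_distrib_left sum_subtractf[symmetric])
qed

section \<open>Piecewise harmonic functions\<close>

definition pinv :: "letter \<Rightarrow> plane \<Rightarrow> plane" where
  "pinv v z = real (fst v) *\<^sub>R (z - \<alpha> (fst v) (snd v))"

lemma pinv_psi: "fst v \<ge> 2 \<Longrightarrow> pinv v (psi \<alpha> v z) = z"
  by (simp add: pinv_def psi_def)

text \<open>On overlaps the cell is an arbitrary choice. Agreement of the pieces at the vertices,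
  expressed in \<open>glue_psi\<close> through a common function \<open>y\<close>, makes the choice
  immaterial.\<close>

definition glue :: "nat \<Rightarrow> (letter \<Rightarrow> plane \<Rightarrow> real) \<Rightarrow> plane \<Rightarrow> real" where
  "glue \<nu> f z = (let v = (SOME v. v \<in> letters \<nu> \<and> z \<in> psi \<alpha> v ` triangle p) in f v (pinv v z))"

lemma glue_psi:
  assumes \<nu>: "\<nu> \<ge> 2" and y: "\<And>v a. v \<in> letters \<nu> \<Longrightarrow> a \<in> S0 \<Longrightarrow> f v (p a) = y (psi \<alpha> v (p a))"
    and v: "v \<in> letters \<nu>" and z: "z \<in> triangle p"
  shows "glue \<nu> f (psi \<alpha> v z) = f v z"
proof -
  define v' where "v' = (SOME v'. v' \<in> letters \<nu> \<and> psi \<alpha> v z \<in> psi \<alpha> v' ` triangle p)"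
  have "v' \<in> letters \<nu> \<and> psi \<alpha> v z \<in> psi \<alpha> v' ` triangle p"
    unfolding v'_def by (rule someI[of _ v]) (use v z in auto)
  then obtain z' where v': "v' \<in> letters \<nu>" and z': "z' \<in> triangle p" "psi \<alpha> v z = psi \<alpha> v' z'" by blast
  have "glue \<nu> f (psi \<alpha> v z) = f v' z'"
    unfolding glue_def v'_def[symmetric] Let_def using z'(2) pinv_psi[of v' z'] \<nu> letters_fst[OF v'] by simp
  also have "\<dots> = f v z"
  proof (cases "v' = v")
    case True then show ?thesis using z'(2) psi_inj[OF \<nu> v] by simp
  next
    case False
    then obtain a b where "a \<in> S0" "b \<in> S0" "z = p a" "z' = p b"
      using cell_inter[OF \<nu> v v' _ z z'] by metis
    then show ?thesis using y v v' z'(2) by simp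
  qed
  finally show ?thesis .
qed

text \<open>The domain is built from compact parts \<open>B v\<close> of the triangle, because the
  lemma is applied both to unions of cells and to gaskets of the shifted environments.\<close>

lemma glue_continuous:
  assumes \<nu>: "\<nu> \<ge> 2" and y: "\<And>v a. v \<in> letters \<nu> \<Longrightarrow> a \<in> S0 \<Longrightarrow> f v (p a) = y (psi \<alpha> v (p a))"
    and B: "\<And>v. v \<in> letters \<nu> \<Longrightarrow> compact (B v)" "\<And>v. v \<in> letters \<nu> \<Longrightarrow> B v \<subseteq> triangle p"
    and f: "\<And>v. v \<in> letters \<nu> \<Longrightarrow> continuous_on (B v) (f v)"
  shows "continuous_on (\<Union>v\<in>letters \<nu>. psi \<alpha> v ` B v) (glue \<nu> f)"
proof (rule continuous_on_closed_Union)
  show "finite (letters \<nu>)" by simp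
  fix v assume v: "v \<in> letters \<nu>"
  show "closed (psi \<alpha> v ` B v)"
    by (intro compact_imp_closed compact_continuous_image continuous_psi B v)
  have fv: "fst v \<ge> 2" using letters_fst[OF v] \<nu> by simp
  have "continuous_on (psi \<alpha> v ` B v) (\<lambda>z. f v (pinv v z))"
  proof (rule continuous_on_compose2[OF f[OF v]])
    show "continuous_on (psi \<alpha> v ` B v) (pinv v)" unfolding pinv_def by (intro continuous_intros)
    show "pinv v ` psi \<alpha> v ` B v \<subseteq> B v" using pinv_psi[OF fv] by auto
  qed
  moreover have "glue \<nu> f z = f v (pinv v z)" if "z \<in> psi \<alpha> v ` B v" for z
    using that glue_psi[where y = y, OF \<nu> y v] B(2)[OF v] pinv_psi[OF fv] by auto
  ultimately show "continuous_on (psi \<alpha> v ` B v) (glue \<nu> f)" by (simp cong: continuous_on_cong)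
qed

text \<open>Harmonic on the vertices of the first \<open>m\<close> levels and affine inside the
  cells of level \<open>m\<close>. The recursion peels off the first letter, after which each cell
  continues in its own environment.\<close>

primrec harm_approx :: "nat \<Rightarrow> (letter list \<Rightarrow> nat) \<Rightarrow> (nat \<Rightarrow> real) \<Rightarrow> plane \<Rightarrow> real" where
  "harm_approx 0 L x z = (\<Sum>a\<in>S0. bary_coord a z * x a)"
| "harm_approx (Suc m) L x z = glue (L []) (\<lambda>v. harm_approx m (subenv L [v]) (harm_restr v x)) z"

lemma bary_coord_p_sum: "a \<in> S0 \<Longrightarrow> (\<Sum>b\<in>S0. bary_coord b (p a) * x b) = x a"
proof -
  assume a: "a \<in> S0"
  then have "(\<Sum>b\<in>S0. bary_coord b (p a) * x b) = (\<Sum>b\<in>S0. if b = a then x b else 0)"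
    by (intro sum.cong) (auto simp: bary_coord_p)
  then show ?thesis using a by simp
qed

text \<open>The two facts belong together: gluing at level \<open>Suc m\<close> needs the corner
  values at level \<open>m\<close> in all environments, and the corner values at level
  \<open>Suc m\<close> come from gluing.\<close>

lemma harm_approx_corner: "T_valued L \<Longrightarrow> a \<in> S0 \<Longrightarrow> harm_approx m L x (p a) = x a"
  and harm_approx_psi: "T_valued L \<Longrightarrow> v \<in> letters (L []) \<Longrightarrow> z \<in> triangle p \<Longrightarrow> harm_approx (Suc m) L x (psi \<alpha> v z) = harm_approx m (subenv L [v]) (harm_restr v x) z"
proof -
  have step: "harm_approx (Suc m) L x (psi \<alpha> v z) = harm_approx m (subenv L [v]) (harm_restr v x) z"
    if L: "T_valued L" and IH: "\<And>L x a. T_valued L \<Longrightarrow> a \<in> S0 \<Longrightarrow> harm_approx m L x (p a) = x a" and v: "v \<in> letters (L [])" and z: "z \<in> triangle p" for m L x v z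
    unfolding harm_approx.simps
    by (rule glue_psi[OF T_valued_2[OF L], of _ "H (L []) x"])
       (use v z in \<open>auto simp: IH T_valued_sh1[OF L] harm_restr_def letters_fst\<close>)
  have c: "T_valued L \<Longrightarrow> a \<in> S0 \<Longrightarrow> harm_approx m L x (p a) = x a" for L x a m
  proof (induction m arbitrary: L x a)
    case 0 then show ?case by (simp add: bary_coord_p_sum)
  next
    case (Suc m)
    note 2 = T_valued_2[OF Suc.prems(1)]
    have v: "(L [], a) \<in> letters (L [])" by (rule S0_letters[OF 2 Suc.prems(2)])
    have "harm_approx (Suc m) L x (p a) = harm_approx (Suc m) L x (psi \<alpha> (L [], a) (p a))" using psi_fix[OF 2 Suc.prems(2)] by simp
    also have "\<dots> = harm_approx m (subenv L [(L [], a)]) (harm_restr (L [], a) x) (p a)"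
      by (rule step[OF Suc.prems(1) Suc.IH v p_in_triangle[OF Suc.prems(2)]])
    also have "\<dots> = x a"
      using Suc.IH[OF T_valued_sh1[OF Suc.prems(1) v] Suc.prems(2)] harm_restr_fix[OF 2 Suc.prems(2)] by simp
    finally show ?case .
  qed
  show "T_valued L \<Longrightarrow> a \<in> S0 \<Longrightarrow> harm_approx m L x (p a) = x a" by (rule c)
  show "T_valued L \<Longrightarrow> v \<in> letters (L []) \<Longrightarrow> z \<in> triangle p \<Longrightarrow> harm_approx (Suc m) L x (psi \<alpha> v z) = harm_approx m (subenv L [v]) (harm_restr v x) z"
    by (rule step[OF _ c])
qed

lemma level_cells_triangle: "T_valued L \<Longrightarrow> level_cells L m \<subseteq> triangle p"
  using Wt_Words psi_word_triangle unfolding level_cells_def by blast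

lemma harm_approx_continuous: "T_valued L \<Longrightarrow> continuous_on (level_cells L m) (harm_approx m L x)"
proof (induction m arbitrary: L x)
  case 0
  show ?case by (simp, intro continuous_intros continuous_bary)
next
  case (Suc m)
  have "continuous_on (\<Union>v\<in>letters (L []). psi \<alpha> v ` level_cells (subenv L [v]) m) (glue (L []) (\<lambda>v. harm_approx m (subenv L [v]) (harm_restr v x)))"
  proof (rule glue_continuous[OF T_valued_2[OF Suc.prems], of _ "H (L []) x"])
    fix v assume v: "v \<in> letters (L [])"
    note okv = T_valued_sh1[OF Suc.prems v]
    show "a \<in> S0 \<Longrightarrow> harm_approx m (subenv L [v]) (harm_restr v x) (p a) = H (L []) x (psi \<alpha> v (p a))" for a
      using harm_approx_corner[OF okv] letters_fst[OF v] by (simp add: harm_restr_def)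
    show "compact (level_cells (subenv L [v]) m)" by (rule compact_Bset)
    show "level_cells (subenv L [v]) m \<subseteq> triangle p" by (rule level_cells_triangle[OF okv])
    show "continuous_on (level_cells (subenv L [v]) m) (harm_approx m (subenv L [v]) (harm_restr v x))" by (rule Suc.IH[OF okv])
  qed
  then show ?case unfolding level_cells_Suc by (simp cong: continuous_on_cong)
qed

lemma level_cells_SucE:
  assumes "T_valued L" "z \<in> level_cells L (Suc m)"
  obtains v y where "v \<in> letters (L [])" "y \<in> level_cells (subenv L [v]) m" "y \<in> triangle p" "z = psi \<alpha> v y"
proof -
  obtain v y where v: "v \<in> letters (L [])" "y \<in> level_cells (subenv L [v]) m" "z = psi \<alpha> v y"
    using assms(2) unfolding level_cells_Suc by blast
  moreover have "y \<in> triangle p" using level_cells_triangle[OF T_valued_sh1[OF assms(1) v(1)]] v(2) by blast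
  ultimately show ?thesis using that by blast
qed

lemma harm_approx_ge: "T_valued L \<Longrightarrow> z \<in> level_cells L m \<Longrightarrow> (\<And>a. a \<in> S0 \<Longrightarrow> c \<le> x a) \<Longrightarrow> c \<le> harm_approx m L x z"
proof (induction m arbitrary: L x z)
  case 0
  from 0(2) have "z \<in> triangle p" by (simp add: level_cells_0)
  then obtain t where t: "z = bary_point t" "\<And>a. a \<in> S0 \<Longrightarrow> 0 \<le> t a" "sum t S0 = 1" by (rule triangle_obtain) blast
  have "c = (\<Sum>a\<in>S0. t a * c)" using t(3) by (simp flip: sum_distrib_right)
  also have "\<dots> \<le> (\<Sum>a\<in>S0. t a * x a)" using 0(3) t(2) by (intro sum_mono mult_left_mono) auto
  also have "\<dots> = harm_approx 0 L x z" using bary_coord_pt[OF t(3)] t(1) by simp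
  finally show ?case .
next
  case (Suc m)
  obtain v y where v: "v \<in> letters (L [])" "y \<in> level_cells (subenv L [v]) m" "y \<in> triangle p" "z = psi \<alpha> v y"
    using level_cells_SucE[OF Suc.prems(1,2)] by blast
  have "c \<le> harm_approx m (subenv L [v]) (harm_restr v x) y"
    by (rule Suc.IH[OF T_valued_sh1[OF Suc.prems(1) v(1)] v(2)]) (rule harm_restr_ge[OF T_valued_2[OF Suc.prems(1)] v(1) _ Suc.prems(3)])
  then show ?case using harm_approx_psi[OF Suc.prems(1) v(1,3)] v(4) by (simp del: harm_approx.simps)
qed

lemma harm_approx_neg: "T_valued L \<Longrightarrow> z \<in> level_cells L m \<Longrightarrow> harm_approx m L (\<lambda>a. - x a) z = - harm_approx m L x z"
proof (induction m arbitrary: L x z)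
  case 0 then show ?case by (simp add: sum_negf)
next
  case (Suc m)
  obtain v y where v: "v \<in> letters (L [])" "y \<in> level_cells (subenv L [v]) m" "y \<in> triangle p" "z = psi \<alpha> v y"
    using level_cells_SucE[OF Suc.prems(1,2)] by blast
  then show ?case using harm_approx_psi[OF Suc.prems(1) v(1,3), of m] Suc.IH[OF T_valued_sh1[OF Suc.prems(1) v(1)] v(2)]
    by (simp del: harm_approx.simps add: harm_restr_neg)
qed

lemma harm_approx_le: "T_valued L \<Longrightarrow> z \<in> level_cells L m \<Longrightarrow> (\<And>a. a \<in> S0 \<Longrightarrow> x a \<le> c) \<Longrightarrow> harm_approx m L x z \<le> c"
  using harm_approx_ge[of L z m "- c" "\<lambda>a. - x a"] harm_approx_neg[of L z m x] by simp

lemma uniform_contraction: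
  obtains d where "0 < d" "d < 1"
    "\<And>\<nu> v x a b c. \<nu> \<in> T \<Longrightarrow> v \<in> letters \<nu> \<Longrightarrow> a \<in> S0 \<Longrightarrow> b \<in> S0 \<Longrightarrow>
       (\<And>a b. a \<in> S0 \<Longrightarrow> b \<in> S0 \<Longrightarrow> \<bar>x a - x b\<bar> \<le> c) \<Longrightarrow> \<bar>harm_restr v x a - harm_restr v x b\<bar> \<le> (1 - d) * c"
proof -
  have "\<forall>\<nu>\<in>T. \<exists>d. 0 < d \<and> d < 1 \<and> (\<forall>v x a b c. v \<in> letters \<nu> \<longrightarrow> a \<in> S0 \<longrightarrow> b \<in> S0 \<longrightarrow>
       (\<forall>a\<in>S0. \<forall>b\<in>S0. \<bar>x a - x b\<bar> \<le> c) \<longrightarrow> \<bar>harm_restr v x a - harm_restr v x b\<bar> \<le> (1 - d) * c)"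
  proof
    fix \<nu> assume "\<nu> \<in> T"
    from harm_restr_contract[OF T2[OF this]] obtain d where "0 < d" "d < 1"
      "\<And>v x a b c. v \<in> letters \<nu> \<Longrightarrow> a \<in> S0 \<Longrightarrow> b \<in> S0 \<Longrightarrow>
       (\<And>a b. a \<in> S0 \<Longrightarrow> b \<in> S0 \<Longrightarrow> \<bar>x a - x b\<bar> \<le> c) \<Longrightarrow> \<bar>harm_restr v x a - harm_restr v x b\<bar> \<le> (1 - d) * c" by metis
    then show "\<exists>d. 0 < d \<and> d < 1 \<and> (\<forall>v x a b c. v \<in> letters \<nu> \<longrightarrow> a \<in> S0 \<longrightarrow> b \<in> S0 \<longrightarrow>
       (\<forall>a\<in>S0. \<forall>b\<in>S0. \<bar>x a - x b\<bar> \<le> c) \<longrightarrow> \<bar>harm_restr v x a - harm_restr v x b\<bar> \<le> (1 - d) * c)"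
      by (intro exI[of _ d]) simp
  qed
  from bchoice[OF this] obtain e where e: "\<And>\<nu>. \<nu> \<in> T \<Longrightarrow> 0 < e \<nu> \<and> e \<nu> < 1" and
    ec: "\<And>\<nu> v x a b c. \<nu> \<in> T \<Longrightarrow> v \<in> letters \<nu> \<Longrightarrow> a \<in> S0 \<Longrightarrow> b \<in> S0 \<Longrightarrow>
       (\<forall>a\<in>S0. \<forall>b\<in>S0. \<bar>x a - x b\<bar> \<le> c) \<Longrightarrow> \<bar>harm_restr v x a - harm_restr v x b\<bar> \<le> (1 - e \<nu>) * c" by blast
  define d where "d = Min (e ` T)"
  have "d \<in> e ` T" unfolding d_def using finT neT by (intro Min_in) auto
  then have d: "0 < d" "d < 1" using e by auto
  show ?thesis
  proof (rule that[OF d])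
    fix \<nu> v x a b c assume \<nu>: "\<nu> \<in> T" and v: "v \<in> letters \<nu>" and ab: "a \<in> S0" "b \<in> S0"
      and c: "\<And>a b. a \<in> S0 \<Longrightarrow> b \<in> S0 \<Longrightarrow> \<bar>x a - x b :: real\<bar> \<le> c"
    have "\<bar>harm_restr v x a - harm_restr v x b\<bar> \<le> (1 - e \<nu>) * c" by (rule ec[OF \<nu> v ab]) (use c in blast)
    also have "\<dots> \<le> (1 - d) * c"
    proof (rule mult_right_mono)
      show "1 - e \<nu> \<le> 1 - d" unfolding d_def using finT \<nu> by simp
      show "0 \<le> c" using c[OF ab(1) ab(1)] by simp
    qed
    finally show "\<bar>harm_restr v x a - harm_restr v x b\<bar> \<le> (1 - d) * c" .
  qed
qed

lemma G_Bset: "z \<in> G L \<Longrightarrow> z \<in> level_cells L m"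
  unfolding G_def by blast

lemma G_triangle: "z \<in> G L \<Longrightarrow> z \<in> triangle p"
  using G_Bset[of z L 0] by (simp add: level_cells_0)

text \<open>Consecutive approximations differ at most by the oscillation of the corner values of a
  cell, which shrinks by a fixed factor per level whatever the types are. The differences are thus
  dominated by a geometric series.\<close>

lemma harm_approx_uniform:
  assumes L: "T_valued L"
  shows "uniform_limit (G L) (\<lambda>m. harm_approx m L x) (\<lambda>z. lim (\<lambda>m. harm_approx m L x z)) sequentially"
proof -
  obtain d where d: "0 < d" "d < 1"
    "\<And>\<nu> v x a b c. \<nu> \<in> T \<Longrightarrow> v \<in> letters \<nu> \<Longrightarrow> a \<in> S0 \<Longrightarrow> b \<in> S0 \<Longrightarrow>
       (\<And>a b. a \<in> S0 \<Longrightarrow> b \<in> S0 \<Longrightarrow> \<bar>x a - x b\<bar> \<le> c) \<Longrightarrow> \<bar>harm_restr v x a - harm_restr v x b\<bar> \<le> (1 - d) * c"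
    using uniform_contraction by blast
  have step: "\<bar>harm_approx (Suc m) L x z - harm_approx m L x z\<bar> \<le> (1 - d) ^ m * c"
    if "T_valued L" "z \<in> G L" "\<And>a b. a \<in> S0 \<Longrightarrow> b \<in> S0 \<Longrightarrow> \<bar>x a - x b\<bar> \<le> c" for m L x z c
    using that
  proof (induction m arbitrary: L x z c)
    case 0
    obtain i where i: "i \<in> S0" "\<And>a. a \<in> S0 \<Longrightarrow> x i \<le> x a"
      using finite_S0 arg_min_if_finite(1)[of S0 x] arg_min_least[of S0 _ x] by (metis S0_def insert_not_empty)
    have up: "x a \<le> x i + c" if "a \<in> S0" for a using 0(3)[OF that i(1)] by linarith
    \<comment> \<open>Approximations of every level stay in an interval containing the corner
      values, so two of them differ by at most its length.\<close>
    have "x i \<le> harm_approx m L x z \<and> harm_approx m L x z \<le> x i + c" for m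
      by (intro conjI harm_approx_ge harm_approx_le 0(1) G_Bset 0(2)) (auto intro: i up)
    from this[of 0] this[of "Suc 0"] show ?case by (simp only: power_0) linarith
  next
    case (Suc m)
    obtain v y where v: "v \<in> letters (L [])" "y \<in> G (subenv L [v])" "z = psi \<alpha> v y"
      using G_step[OF Suc.prems(1,2)] by blast
    have e: "harm_approx (Suc m) L x z = harm_approx m (subenv L [v]) (harm_restr v x) y" for m
      unfolding v(3) by (rule harm_approx_psi[OF Suc.prems(1) v(1) G_triangle[OF v(2)]])
    have "\<bar>harm_approx (Suc m) (subenv L [v]) (harm_restr v x) y - harm_approx m (subenv L [v]) (harm_restr v x) y\<bar> \<le> (1 - d) ^ m * ((1 - d) * c)"
    proof (rule Suc.IH[OF T_valued_sh1[OF Suc.prems(1) v(1)] v(2)])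
      have "L [] \<in> T" by (rule T_valued_T[OF Suc.prems(1)]) simp
      then show "a \<in> S0 \<Longrightarrow> b \<in> S0 \<Longrightarrow> \<bar>harm_restr v x a - harm_restr v x b\<bar> \<le> (1 - d) * c" for a b
        by (rule d(3)[OF _ v(1) _ _ Suc.prems(3)])
    qed
    then show ?case unfolding e by (simp del: harm_approx.simps add: mult_ac)
  qed
  define c where "c = (\<Sum>a\<in>S0. 2 * \<bar>x a\<bar>)"
  have c: "\<bar>x a - x b\<bar> \<le> c" if "a \<in> S0" "b \<in> S0" for a b
  proof -
    have "2 * \<bar>x a\<bar> \<le> c" "2 * \<bar>x b\<bar> \<le> c"
      unfolding c_def by (rule member_le_sum[OF that(1), of "\<lambda>a. 2 * \<bar>x a\<bar>"]) (auto intro: member_le_sum[OF that(2), of "\<lambda>a. 2 * \<bar>x a\<bar>"])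
    then show ?thesis by linarith
  qed
  have "uniformly_convergent_on (G L) (\<lambda>n z. \<Sum>m<n. harm_approx (Suc m) L x z - harm_approx m L x z)"
  proof (rule Weierstrass_m_test'[of _ _ "\<lambda>m. (1 - d) ^ m * c"])
    show "norm (harm_approx (Suc n) L x z - harm_approx n L x z) \<le> (1 - d) ^ n * c" if "z \<in> G L" for n z
      unfolding real_norm_def by (rule step[OF L that c])
    show "summable (\<lambda>m. (1 - d) ^ m * c)"
      using d(1,2) by (intro summable_mult2 summable_geometric) auto
  qed
  then obtain l where l: "uniform_limit (G L) (\<lambda>n z. \<Sum>m<n. harm_approx (Suc m) L x z - harm_approx m L x z) l sequentially"
    unfolding uniformly_convergent_on_def by blast
  have "uniform_limit (G L) (\<lambda>n z. harm_approx 0 L x z + (\<Sum>m<n. harm_approx (Suc m) L x z - harm_approx m L x z)) (\<lambda>z. harm_approx 0 L x z + l z) sequentially"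
    by (intro uniform_limit_add l uniform_limit_const)
  moreover have "harm_approx 0 L x z + (\<Sum>m<n. harm_approx (Suc m) L x z - harm_approx m L x z) = harm_approx n L x z" for n z
    using sum_lessThan_telescope[of "\<lambda>m. harm_approx m L x z" n] by simp
  ultimately have u: "uniform_limit (G L) (\<lambda>n. harm_approx n L x) (\<lambda>z. harm_approx 0 L x z + l z) sequentially" by simp
  then have "uniformly_convergent_on (G L) (\<lambda>n. harm_approx n L x)" unfolding uniformly_convergent_on_def by blast
  then show ?thesis unfolding uniformly_convergent_uniform_limit_iff .
qed

section \<open>Harmonic functions on the gasket\<close>

definition harm_ext :: "(letter list \<Rightarrow> nat) \<Rightarrow> (nat \<Rightarrow> real) \<Rightarrow> plane \<Rightarrow> real" where
  "harm_ext L x z = lim (\<lambda>m. harm_approx m L x z)"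

lemma harm_ext_tendsto: "T_valued L \<Longrightarrow> z \<in> G L \<Longrightarrow> (\<lambda>m. harm_approx m L x z) \<longlonglongrightarrow> harm_ext L x z"
  unfolding harm_ext_def using tendsto_uniform_limitI[OF harm_approx_uniform] by blast

lemma harm_ext_continuous: "T_valued L \<Longrightarrow> continuous_on (G L) (harm_ext L x)"
  unfolding harm_ext_def[abs_def]
  by (rule uniform_limit_theorem[OF _ harm_approx_uniform])
     (auto intro!: always_eventually continuous_on_subset[OF harm_approx_continuous] simp: G_Bset)

lemma harm_ext_corner: "T_valued L \<Longrightarrow> a \<in> S0 \<Longrightarrow> harm_ext L x (p a) = x a"
  by (simp add: harm_ext_def harm_approx_corner)

lemma harm_ext_ge: "T_valued L \<Longrightarrow> z \<in> G L \<Longrightarrow> (\<And>a. a \<in> S0 \<Longrightarrow> c \<le> x a) \<Longrightarrow> c \<le> harm_ext L x z"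
  by (rule LIMSEQ_le_const[OF harm_ext_tendsto]) (auto intro!: harm_approx_ge G_Bset)

lemma harm_ext_le: "T_valued L \<Longrightarrow> z \<in> G L \<Longrightarrow> (\<And>a. a \<in> S0 \<Longrightarrow> x a \<le> c) \<Longrightarrow> harm_ext L x z \<le> c"
  by (rule LIMSEQ_le_const2[OF harm_ext_tendsto]) (auto intro!: harm_approx_le G_Bset)

lemma harm_ext_psi:
  assumes L: "T_valued L" and v: "v \<in> letters (L [])" and z: "z \<in> G (subenv L [v])"
  shows "harm_ext L x (psi \<alpha> v z) = harm_ext (subenv L [v]) (harm_restr v x) z"
proof (rule LIMSEQ_unique)
  show "(\<lambda>m. harm_approx (Suc m) L x (psi \<alpha> v z)) \<longlonglongrightarrow> harm_ext L x (psi \<alpha> v z)"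
    by (rule LIMSEQ_Suc[OF harm_ext_tendsto[OF L psi_G[OF v z L]]])
  show "(\<lambda>m. harm_approx (Suc m) L x (psi \<alpha> v z)) \<longlonglongrightarrow> harm_ext (subenv L [v]) (harm_restr v x) z"
    unfolding harm_approx_psi[OF L v G_triangle[OF z]] by (rule harm_ext_tendsto[OF T_valued_sh1[OF L v] z])
qed

lemma EL_Suc_front: "EL L (Suc m) f g = (\<Sum>v\<in>letters (L []). 1 / renorm p \<alpha> (L []) * EL (subenv L [v]) m (f \<circ> psi \<alpha> v) (g \<circ> psi \<alpha> v))"
  using EL_add[of L "Suc 0" m f g] unfolding sum_Wt_1 by (simp add: letters_fst)

text \<open>Pairing any function with a harmonic one gives the same value at every level: in each
  first-level cell the induction hypothesis applies in the shifted environment, and the one-step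
  identity \<open>sum_qf_Hm_ext\<close> collapses the rest to the corners.\<close>

lemma EL_Finf_right: "T_valued L \<Longrightarrow> EL L m g (harm_ext L x) = qf (\<lambda>a. g (p a)) x"
proof (induction m arbitrary: L x g)
  case 0 then show ?case unfolding EL_eq by (simp add: cell_values_def) (intro qf_cong, auto simp: harm_ext_corner)
next
  case (Suc m)
  note 2 = T_valued_2[OF Suc.prems]
  have "EL (subenv L [v]) m (g \<circ> psi \<alpha> v) (harm_ext L x \<circ> psi \<alpha> v) = qf (\<lambda>a. g (psi \<alpha> v (p a))) (harm_restr v x)" if v: "v \<in> letters (L [])" for v
  proof -
    note okv = T_valued_sh1[OF Suc.prems v]
    have "EL (subenv L [v]) m (g \<circ> psi \<alpha> v) (harm_ext L x \<circ> psi \<alpha> v) = EL (subenv L [v]) m (g \<circ> psi \<alpha> v) (harm_ext (subenv L [v]) (harm_restr v x))"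
      by (rule EL_cong[OF okv]) (simp_all add: harm_ext_psi[OF Suc.prems v])
    then show ?thesis using Suc.IH[OF okv] by simp
  qed
  then have "EL L (Suc m) g (harm_ext L x) = 1 / renorm p \<alpha> (L []) * (\<Sum>v\<in>letters (L []). qf (harm_restr v x) (\<lambda>a. g (psi \<alpha> v (p a))))"
    unfolding EL_Suc_front by (simp add: sum_distrib_left qf_sym)
  then show ?case unfolding sum_qf_Hm_ext[OF 2] using renorm_pos[OF 2] by (simp add: qf_sym)
qed

lemma EL_Finf: "T_valued L \<Longrightarrow> EL L m (harm_ext L x) (harm_ext L x) = qf x x"
  unfolding EL_Finf_right by (intro qf_cong) (auto simp: harm_ext_corner)

text \<open>Interpolates \<open>f\<close> from the vertices of level \<open>n\<close>: on each cell
  of that level it is the harmonic function with the values of \<open>f\<close> at the corners of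
  the cell, as \<open>pw_harm_word\<close> states.\<close>

primrec pw_harm :: "nat \<Rightarrow> (letter list \<Rightarrow> nat) \<Rightarrow> (plane \<Rightarrow> real) \<Rightarrow> plane \<Rightarrow> real" where
  "pw_harm 0 L f z = harm_ext L (\<lambda>a. f (p a)) z"
| "pw_harm (Suc n) L f z = glue (L []) (\<lambda>v. pw_harm n (subenv L [v]) (f \<circ> psi \<alpha> v)) z"

lemma pw_harm_corner: "T_valued L \<Longrightarrow> a \<in> S0 \<Longrightarrow> pw_harm n L f (p a) = f (p a)"
  and pw_harm_psi: "T_valued L \<Longrightarrow> v \<in> letters (L []) \<Longrightarrow> z \<in> triangle p \<Longrightarrow> pw_harm (Suc n) L f (psi \<alpha> v z) = pw_harm n (subenv L [v]) (f \<circ> psi \<alpha> v) z"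
proof -
  have step: "pw_harm (Suc n) L f (psi \<alpha> v z) = pw_harm n (subenv L [v]) (f \<circ> psi \<alpha> v) z"
    if L: "T_valued L" and IH: "\<And>L f a. T_valued L \<Longrightarrow> a \<in> S0 \<Longrightarrow> pw_harm n L f (p a) = f (p a)" and v: "v \<in> letters (L [])" and z: "z \<in> triangle p" for n L f v z
    unfolding pw_harm.simps
    by (rule glue_psi[OF T_valued_2[OF L], of _ f]) (use v z in \<open>auto simp: IH T_valued_sh1[OF L]\<close>)
  have c: "T_valued L \<Longrightarrow> a \<in> S0 \<Longrightarrow> pw_harm n L f (p a) = f (p a)" for L f a n
  proof (induction n arbitrary: L f a)
    case 0 then show ?case by (simp add: harm_ext_corner)
  next
    case (Suc n)
    note 2 = T_valued_2[OF Suc.prems(1)]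
    have v: "(L [], a) \<in> letters (L [])" by (rule S0_letters[OF 2 Suc.prems(2)])
    have "pw_harm (Suc n) L f (p a) = pw_harm (Suc n) L f (psi \<alpha> (L [], a) (p a))" using psi_fix[OF 2 Suc.prems(2)] by simp
    also have "\<dots> = pw_harm n (subenv L [(L [], a)]) (f \<circ> psi \<alpha> (L [], a)) (p a)"
      by (rule step[OF Suc.prems(1) Suc.IH v p_in_triangle[OF Suc.prems(2)]])
    also have "\<dots> = f (p a)"
      using Suc.IH[OF T_valued_sh1[OF Suc.prems(1) v] Suc.prems(2)] psi_fix[OF 2 Suc.prems(2)] by simp
    finally show ?case .
  qed
  show "T_valued L \<Longrightarrow> a \<in> S0 \<Longrightarrow> pw_harm n L f (p a) = f (p a)" by (rule c)
  show "T_valued L \<Longrightarrow> v \<in> letters (L []) \<Longrightarrow> z \<in> triangle p \<Longrightarrow> pw_harm (Suc n) L f (psi \<alpha> v z) = pw_harm n (subenv L [v]) (f \<circ> psi \<alpha> v) z"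
    by (rule step[OF _ c])
qed

lemma G_Union: "T_valued L \<Longrightarrow> G L = (\<Union>v\<in>letters (L []). psi \<alpha> v ` G (subenv L [v]))"
proof (intro equalityI subsetI)
  fix z assume L: "T_valued L" and "z \<in> G L"
  then obtain v y where "v \<in> letters (L [])" "y \<in> G (subenv L [v])" "z = psi \<alpha> v y" by (rule G_step)
  then show "z \<in> (\<Union>v\<in>letters (L []). psi \<alpha> v ` G (subenv L [v]))" by blast
qed (auto intro: psi_G)

lemma pw_harm_continuous: "T_valued L \<Longrightarrow> continuous_on (G L) (pw_harm n L f)"
proof (induction n arbitrary: L f)
  case 0 then show ?case using harm_ext_continuous by (simp cong: continuous_on_cong)
next
  case (Suc n)
  have "continuous_on (\<Union>v\<in>letters (L []). psi \<alpha> v ` G (subenv L [v])) (glue (L []) (\<lambda>v. pw_harm n (subenv L [v]) (f \<circ> psi \<alpha> v)))"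
  proof (rule glue_continuous[OF T_valued_2[OF Suc.prems], of _ f])
    fix v assume v: "v \<in> letters (L [])"
    note okv = T_valued_sh1[OF Suc.prems v]
    show "a \<in> S0 \<Longrightarrow> pw_harm n (subenv L [v]) (f \<circ> psi \<alpha> v) (p a) = f (psi \<alpha> v (p a))" for a
      using pw_harm_corner[OF okv] by simp
    show "compact (G (subenv L [v]))" by (rule compact_G)
    show "G (subenv L [v]) \<subseteq> triangle p" using G_triangle by blast
    show "continuous_on (G (subenv L [v])) (pw_harm n (subenv L [v]) (f \<circ> psi \<alpha> v))" by (rule Suc.IH[OF okv])
  qed
  then show ?case unfolding G_Union[OF Suc.prems] by (simp cong: continuous_on_cong)
qed

lemma pw_harm_word: "T_valued L \<Longrightarrow> w \<in> Wt L n \<Longrightarrow> z \<in> G (subenv L w) \<Longrightarrow> pw_harm n L f (psi_word \<alpha> w z) = harm_ext (subenv L w) (cell_values f w) z"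
proof (induction n arbitrary: L w f)
  case 0 then show ?case by (simp add: cell_values_def)
next
  case (Suc n)
  obtain v u where w: "w = v # u" "v \<in> letters (L [])" "u \<in> Wt (subenv L [v]) n" using Suc.prems(2) by (rule Wt_SucE)
  note okv = T_valued_sh1[OF Suc.prems(1) w(2)]
  have zG: "z \<in> G (subenv (subenv L [v]) u)" using Suc.prems(3) w(1) by simp
  have "psi_word \<alpha> u z \<in> triangle p" using psi_word_G[OF okv w(3) zG] by (rule G_triangle)
  then have "pw_harm (Suc n) L f (psi_word \<alpha> w z) = pw_harm n (subenv L [v]) (f \<circ> psi \<alpha> v) (psi_word \<alpha> u z)"
    using pw_harm_psi[OF Suc.prems(1) w(2)] by (simp add: w(1) del: pw_harm.simps)
  also have "\<dots> = harm_ext (subenv (subenv L [v]) u) (cell_values (f \<circ> psi \<alpha> v) u) z" by (rule Suc.IH[OF okv w(3) zG])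
  also have "\<dots> = harm_ext (subenv L w) (cell_values f w) z"
    by (simp add: w(1) cell_values_def comp_def)
  finally show ?case .
qed

lemma finite_energy_Pn: "T_valued L \<Longrightarrow> finite_energy L (pw_harm n L f)"
proof -
  assume L: "T_valued L"
  have "EL L (n + m) (pw_harm n L f) (pw_harm n L f) = (\<Sum>w\<in>Wt L n. 1 / rw w * qf (cell_values f w) (cell_values f w))" for m
    unfolding EL_add
  proof (intro sum.cong refl arg_cong2[of _ _ _ _ "(*)"])
    fix w assume w: "w \<in> Wt L n"
    have "EL (subenv L w) m (pw_harm n L f \<circ> psi_word \<alpha> w) (pw_harm n L f \<circ> psi_word \<alpha> w) = EL (subenv L w) m (harm_ext (subenv L w) (cell_values f w)) (harm_ext (subenv L w) (cell_values f w))"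
      by (rule EL_cong[OF T_valued_sh_Wt[OF L w]]) (simp_all add: pw_harm_word[OF L w])
    then show "EL (subenv L w) m (pw_harm n L f \<circ> psi_word \<alpha> w) (pw_harm n L f \<circ> psi_word \<alpha> w) = qf (cell_values f w) (cell_values f w)"
      using EL_Finf[OF T_valued_sh_Wt[OF L w]] by simp
  qed
  then have "convergent (\<lambda>m. EL L (m + n) (pw_harm n L f) (pw_harm n L f))" by (simp add: add.commute convergent_const)
  then show ?thesis unfolding finite_energy_def by (subst (asm) convergent_ignore_initial_segment)
qed

lemma G_word: "T_valued L \<Longrightarrow> z \<in> G L \<Longrightarrow> \<exists>w\<in>Wt L n. \<exists>y\<in>G (subenv L w). z = psi_word \<alpha> w y"
proof (induction n)
  case 0 then show ?case by auto
next
  case (Suc n)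
  then obtain w y where w: "w \<in> Wt L n" "y \<in> G (subenv L w)" "z = psi_word \<alpha> w y" by blast
  obtain v y' where "v \<in> letters (subenv L w [])" "y' \<in> G (subenv (subenv L w) [v])" "y = psi \<alpha> v y'"
    using G_step[OF T_valued_sh_Wt[OF Suc.prems(1) w(1)] w(2)] by blast
  then show ?case using w by (intro bexI[of _ "w @ [v]"] bexI[of _ y']) (auto simp: psi_word_append)
qed

lemma dom_F_eq: "T_valued L \<Longrightarrow> dom_F p \<alpha> T L = {f. continuous_on (G L) f \<and> finite_energy L f}"
  unfolding dom_F_def finite_energy_def by (simp add: gasket_eq)

text \<open>Interpolate harmonically the indicator of the union of all level-\<open>n\<close> cells
  containing \<open>x\<close>. If two cell diameters are less than the distance from
  \<open>x\<close> to \<open>y\<close>, the corner values are all 1 on a cell around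
  \<open>x\<close> and all 0 on a cell around \<open>y\<close>, and the maximum principle carries
  these values to the two points.\<close>

lemma separation:
  assumes L: "T_valued L" and x: "x \<in> G L" and y: "y \<in> G L" and ne: "x \<noteq> y"
  shows "\<exists>f\<in>dom_F p \<alpha> T L. f x \<noteq> f y"
proof -
  have "0 < dist x y" using ne by simp
  then obtain n where n: "(1/2) ^ n * (2 * diameter (triangle p)) < dist x y" using eventually_small by blast
  define f where "f = (indicator {z. \<exists>w\<in>Wt L n. x \<in> K w \<and> z \<in> K w} :: plane \<Rightarrow> real)"
  obtain w x' where w: "w \<in> Wt L n" "x' \<in> G (subenv L w)" "x = psi_word \<alpha> w x'" using G_word[OF L x] by blast
  obtain u y' where u: "u \<in> Wt L n" "y' \<in> G (subenv L u)" "y = psi_word \<alpha> u y'" using G_word[OF L y] by blast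
  have xK: "x \<in> K w" and yK: "y \<in> K u" using w u G_triangle by auto
  have c1: "cell_values f w a = 1" if "a \<in> S0" for a
    using that w(1) xK p_in_triangle by (auto simp: f_def cell_values_def indicator_def)
  have c0: "cell_values f u a = 0" if a: "a \<in> S0" for a
  proof (rule ccontr)
    assume "cell_values f u a \<noteq> 0"
    then obtain s where s: "s \<in> Wt L n" "x \<in> K s" "psi_word \<alpha> u (p a) \<in> K s"
      by (auto simp: cell_values_def f_def indicator_def split: if_splits)
    have "dist x (psi_word \<alpha> u (p a)) \<le> (1/2) ^ n * diameter (triangle p)"
      using diam_K[OF Wt_Words[OF L s(1)] s(2,3)] Wt_length[OF s(1)] by simp
    moreover have "dist (psi_word \<alpha> u (p a)) y \<le> (1/2) ^ n * diameter (triangle p)"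
      using diam_K[OF Wt_Words[OF L u(1)] imageI[OF p_in_triangle[OF a]] yK] Wt_length[OF u(1)] by simp
    ultimately show False using n dist_triangle[of x y "psi_word \<alpha> u (p a)"] by simp
  qed
  have "pw_harm n L f x = 1"
    unfolding w(3) pw_harm_word[OF L w(1,2)]
    using harm_ext_ge[OF T_valued_sh_Wt[OF L w(1)] w(2), of 1 "cell_values f w"] harm_ext_le[OF T_valued_sh_Wt[OF L w(1)] w(2), of "cell_values f w" 1] c1 by simp
  moreover have "pw_harm n L f y = 0"
    unfolding u(3) pw_harm_word[OF L u(1,2)]
    using harm_ext_ge[OF T_valued_sh_Wt[OF L u(1)] u(2), of 0 "cell_values f u"] harm_ext_le[OF T_valued_sh_Wt[OF L u(1)] u(2), of "cell_values f u" 0] c0 by simp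
  ultimately have "pw_harm n L f x \<noteq> pw_harm n L f y" by simp
  moreover have "pw_harm n L f \<in> dom_F p \<alpha> T L" unfolding dom_F_eq[OF L] using pw_harm_continuous[OF L] finite_energy_Pn[OF L] by simp
  ultimately show ?thesis by blast
qed

end

section \<open>Measures on the sequence space with prescribed cylinder masses\<close>

abbreviation seq_space :: "letter set \<Rightarrow> (nat \<Rightarrow> letter) measure" where
  "seq_space A \<equiv> (\<Pi>\<^sub>M n\<in>UNIV. count_space A)"

lemma space_seq_space: "space (seq_space A) = {\<omega>. \<forall>n. \<omega> n \<in> A}"
  by (auto simp: space_PiM)

lemma measurable_coord: "(\<lambda>\<omega>. \<omega> n) \<in> measurable (seq_space A) (count_space A)"
  by (rule measurable_component_singleton) simp

lemma measurable_prefix: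
  assumes "finite A"
  shows "(\<lambda>\<omega>. prefix_of \<omega> n) \<in> measurable (seq_space A) (count_space (lists A))"
proof (induction n)
  case 0 then show ?case by simp
next
  case (Suc n)
  have cA: "countable (lists A)" using assms by (intro countable_lists countable_finite)
  have "(\<lambda>\<omega>. prefix_of \<omega> n @ [\<omega> n]) \<in> measurable (seq_space A) (count_space (lists A))"
  proof (rule measurable_compose_countable'[OF _ Suc cA])
    fix w assume "w \<in> lists A"
    then have "(\<lambda>v. w @ [v]) \<in> measurable (count_space A) (count_space (lists A))" by auto
    then show "(\<lambda>\<omega>. w @ [\<omega> n]) \<in> measurable (seq_space A) (count_space (lists A))"
      by (rule measurable_compose[OF measurable_coord])
  qed
  then show ?case by (simp add: prefix_of_Suc)
qed

lemma sets_prefix: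
  assumes "finite A"
  shows "{\<omega> \<in> space (seq_space A). prefix_of \<omega> n \<in> X} \<in> sets (seq_space A)"
proof -
  have "{\<omega> \<in> space (seq_space A). prefix_of \<omega> n \<in> X} = (\<lambda>\<omega>. prefix_of \<omega> n) -` (X \<inter> lists A) \<inter> space (seq_space A)"
    by (auto simp: prefix_of_def space_seq_space)
  moreover have X: "X \<inter> lists A \<in> sets (count_space (lists A))" by simp
  ultimately show ?thesis using measurable_sets[OF measurable_prefix[OF assms] X, of n] by (simp only:)
qed

text \<open>\<open>c\<close> prescribes a successor for every word, and the path obeys it. This
  serves twice: for measures built from independent letters, and later for the corner paths dictated
  by an environment.\<close>

primrec choice_path :: "(letter list \<Rightarrow> letter) \<Rightarrow> nat \<Rightarrow> letter list" where
  "choice_path c 0 = []"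
| "choice_path c (Suc n) = choice_path c n @ [c (choice_path c n)]"

lemma length_choice_path [simp]: "length (choice_path c n) = n"
  by (induction n) auto

lemma prefix_of_choice_path: "prefix_of (\<lambda>n. c (choice_path c n)) n = choice_path c n"
  by (induction n) (auto simp: prefix_of_Suc)

lemma choice_path_eq_iff: "length w = n \<Longrightarrow> choice_path c n = w \<longleftrightarrow> (\<forall>j<n. c (take j w) = w ! j)"
proof (induction n arbitrary: w)
  case (Suc n)
  then obtain u v where w: "w = u @ [v]" "length u = n" by (cases w rule: rev_cases) auto
  have "choice_path c (Suc n) = w \<longleftrightarrow> choice_path c n = u \<and> c u = v" using w by auto
  also have "\<dots> \<longleftrightarrow> (\<forall>j<Suc n. c (take j w) = w ! j)"
    unfolding Suc.IH[OF w(2)] using w by (auto simp: less_Suc_eq nth_append)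
  finally show ?case .
qed simp

text \<open>Attach to every word an independent random letter, distributed by the conditional masses
  of \<open>m\<close>, and push the product measure forward along the random path. A word cylinder
  then involves finitely many of the independent letters, and the conditional masses
  telescope.\<close>

lemma tree_measure_exists:
  assumes A: "finite A" "A \<noteq> {}"
    and nn: "\<And>w. w \<in> lists A \<Longrightarrow> 0 \<le> m w"
    and add: "\<And>w. w \<in> lists A \<Longrightarrow> (\<Sum>v\<in>A. m (w @ [v])) = m w"
  shows "\<exists>M. sets M = sets (seq_space A) \<and> finite_measure M \<and>
    (\<forall>w\<in>lists A. measure M {\<omega> \<in> space (seq_space A). prefix_of \<omega> (length w) = w} = m w)"
proof -
  \<comment> \<open>The uniform default below words of mass 0 keeps each \<open>N w\<close> a
    probability measure. It cannot disturb the masses, since additivity forces mass 0 on all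
    extensions of such words.\<close>
  define k where "k w v = (if w \<in> lists A \<and> 0 < m w then m (w @ [v]) / m w else 1 / real (card A))" for w v
  have k0: "0 \<le> k w v" if "v \<in> A" for w v
    using that nn[of "w @ [v]"] by (auto simp: k_def)
  have k1: "(\<Sum>v\<in>A. k w v) = 1" for w
  proof (cases "w \<in> lists A \<and> 0 < m w")
    case True
    then have "(\<Sum>v\<in>A. k w v) = (\<Sum>v\<in>A. m (w @ [v])) / m w" by (simp add: k_def sum_divide_distrib)
    then show ?thesis using add[of w] True by simp
  next
    case False
    then have "k w v = 1 / real (card A)" for v unfolding k_def by (simp only: if_False)
    then show ?thesis using A by simp
  qed
  define N where "N w = point_measure A (\<lambda>v. ennreal (k w v))" for w
  have eN: "emeasure (N w) X = ennreal (\<Sum>v\<in>X. k w v)" if "X \<subseteq> A" for w X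
    unfolding N_def using A(1) that k0 by (subst emeasure_point_measure_finite) (auto intro!: sum_ennreal)
  interpret N: prob_space "N w" for w
    by (rule prob_spaceI) (use eN[of A w] k1 in \<open>simp add: N_def space_point_measure\<close>)
  interpret product_prob_space N UNIV ..
  let ?\<Omega> = "PiM UNIV N"
  have sN: "space (N w) = A" "sets (N w) = Pow A" for w by (simp_all add: N_def space_point_measure sets_point_measure)
  have s\<Omega>: "space ?\<Omega> = {c. \<forall>w. c w \<in> A}" by (auto simp: space_PiM sN)
  have cA: "countable (lists A)" using A by (intro countable_lists countable_finite)
  have comp: "(\<lambda>c. c w) \<in> measurable ?\<Omega> (count_space A)" for w
  proof -
    have "(\<lambda>c. c w) \<in> measurable ?\<Omega> (N w)" by (rule measurable_component_singleton) simp
    moreover have "sets (N w) = sets (count_space A)" by (simp add: sN)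
    ultimately show ?thesis using measurable_cong_sets[OF refl] by metis
  qed
  have mp: "(\<lambda>c. choice_path c n) \<in> measurable ?\<Omega> (count_space (lists A))" for n
  proof (induction n)
    case (Suc n)
    have "(\<lambda>c. choice_path c n @ [c (choice_path c n)]) \<in> measurable ?\<Omega> (count_space (lists A))"
    proof (rule measurable_compose_countable'[OF _ Suc cA])
      fix w assume "w \<in> lists A"
      then have "(\<lambda>v. w @ [v]) \<in> measurable (count_space A) (count_space (lists A))" by auto
      then show "(\<lambda>c. w @ [c w]) \<in> measurable ?\<Omega> (count_space (lists A))"
        by (rule measurable_compose[OF comp])
    qed
    then show ?case by simp
  qed simp
  define \<omega> where "\<omega> c n = c (choice_path c n)" for c :: "letter list \<Rightarrow> letter" and n
  have m\<omega>: "\<omega> \<in> measurable ?\<Omega> (seq_space A)"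
  proof (rule measurable_PiM_single')
    fix n
    show "(\<lambda>c. \<omega> c n) \<in> measurable ?\<Omega> (count_space A)"
      unfolding \<omega>_def by (rule measurable_compose_countable'[OF comp mp cA])
    show "\<omega> \<in> space ?\<Omega> \<rightarrow> (\<Pi>\<^sub>E i\<in>UNIV. space (count_space A))"
      by (auto simp: \<omega>_def s\<Omega>)
  qed
  have pre: "prefix_of (\<omega> c) n = choice_path c n" for c n
    using prefix_of_choice_path[of c n] by (simp add: \<omega>_def[abs_def])
  have prob: "emeasure ?\<Omega> {c \<in> space ?\<Omega>. choice_path c (length w) = w} = ennreal (\<Prod>j<length w. k (take j w) (w ! j))" if w: "w \<in> lists A" for w
  proof -
    let ?J = "(\<lambda>j. take j w) ` {..<length w}"
    have wj: "w ! j \<in> A" if "j < length w" for j using w that by (simp add: in_listsD)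
    have "{c \<in> space ?\<Omega>. choice_path c (length w) = w} = {c \<in> space ?\<Omega>. \<forall>u\<in>?J. c u \<in> {w ! length u}}"
      by (auto simp: choice_path_eq_iff)
    also have "emeasure ?\<Omega> \<dots> = (\<Prod>u\<in>?J. emeasure (N u) {w ! length u})"
      by (rule emeasure_PiM_Collect) (auto simp: sN wj)
    also have "\<dots> = (\<Prod>j<length w. emeasure (N (take j w)) {w ! j})"
    proof (subst prod.reindex)
      show "inj_on (\<lambda>j. take j w) {..<length w}"
      proof (rule inj_onI)
        fix i j assume "i \<in> {..<length w}" "j \<in> {..<length w}" "take i w = take j w"
        then have "length (take i w) = length (take j w)" by simp
        then show "i = j" using \<open>i \<in> _\<close> \<open>j \<in> _\<close> by simp
      qed
    qed (auto intro!: prod.cong)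
    also have "\<dots> = (\<Prod>j<length w. ennreal (k (take j w) (w ! j)))"
      by (intro prod.cong refl) (simp add: eN wj)
    also have "\<dots> = ennreal (\<Prod>j<length w. k (take j w) (w ! j))"
      by (rule prod_ennreal) (simp add: k0 wj)
    finally show ?thesis .
  qed
  have prodm: "w \<in> lists A \<Longrightarrow> m [] * (\<Prod>j<length w. k (take j w) (w ! j)) = m w" for w
  proof (induction w rule: rev_induct)
    case (snoc v w)
    then have w: "w \<in> lists A" "v \<in> A" by auto
    have "(\<Prod>j<length (w @ [v]). k (take j (w @ [v])) ((w @ [v]) ! j)) = (\<Prod>j<length w. k (take j w) (w ! j)) * k w v"
      by (simp add: nth_append)
    then have "m [] * (\<Prod>j<length (w @ [v]). k (take j (w @ [v])) ((w @ [v]) ! j)) = m w * k w v"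
      using snoc.IH[OF w(1)] by (simp only: mult.assoc[symmetric])
    also have "\<dots> = m (w @ [v])"
    proof (cases "m w = 0")
      case True
      have "\<forall>v\<in>A. m (w @ [v]) = 0"
        using add[OF w(1)] nn w(1) A(1) by (subst (asm) True, subst (asm) sum_nonneg_eq_0_iff) auto
      then show ?thesis using w(2) True by simp
    next
      case False
      then have "0 < m w" using nn[OF w(1)] by simp
      then show ?thesis using w(1) by (simp add: k_def)
    qed
    finally show ?case .
  qed simp
  \<comment> \<open>The path measure has total mass 1; scaling by the mass of the empty word
    restores the prescribed total.\<close>
  define M where "M = scale_measure (ennreal (m [])) (distr ?\<Omega> (seq_space A) \<omega>)"
  have sM: "sets M = sets (seq_space A)" by (simp add: M_def)
  have eM: "emeasure M {x \<in> space (seq_space A). prefix_of x (length w) = w} = ennreal (m w)" if w: "w \<in> lists A" for w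
  proof -
    have s: "{x \<in> space (seq_space A). prefix_of x (length w) = w} \<in> sets (seq_space A)"
      using sets_prefix[OF A(1), of "length w" "{w}"] by simp
    have "\<omega> -` {x \<in> space (seq_space A). prefix_of x (length w) = w} \<inter> space ?\<Omega> = {c \<in> space ?\<Omega>. choice_path c (length w) = w}"
      using measurable_space[OF m\<omega>] by (auto simp: pre)
    then have "emeasure M {x \<in> space (seq_space A). prefix_of x (length w) = w} = ennreal (m []) * ennreal (\<Prod>j<length w. k (take j w) (w ! j))"
      unfolding M_def using s by (simp add: emeasure_distr[OF m\<omega>] prob[OF w])
    also have "\<dots> = ennreal (m w)"
      using prodm[OF w] nn[of "[]"] by (simp flip: ennreal_mult')
    finally show ?thesis .
  qed
  have "finite_measure M"
  proof (rule finite_measureI)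
    have "space M = {x \<in> space (seq_space A). prefix_of x (length []) = []}"
      using sets_eq_imp_space_eq[OF sM] by (auto simp: prefix_of_def)
    then have "emeasure M (space M) = ennreal (m [])" using eM[of "[]"] by simp
    then show "emeasure M (space M) \<noteq> \<infinity>" by simp
  qed
  moreover have "measure M {x \<in> space (seq_space A). prefix_of x (length w) = w} = m w" if "w \<in> lists A" for w
    using eM[OF that] nn[OF that] by (simp add: measure_def)
  ultimately show ?thesis using sM by blast
qed

text \<open>A product set restricted in finitely many coordinates is a finite disjoint union of
  cylinders of words longer than all these coordinates, so the word cylinders decide the measure on
  a generator.\<close>

lemma tree_measure_unique:
  assumes A: "finite A" and sets: "sets M = sets (seq_space A)" "sets N = sets (seq_space A)"
    and fn: "finite_measure M" "finite_measure N"
    and eq: "\<And>w. w \<in> lists A \<Longrightarrow> measure M {\<omega> \<in> space (seq_space A). prefix_of \<omega> (length w) = w} =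
       measure N {\<omega> \<in> space (seq_space A). prefix_of \<omega> (length w) = w}"
  shows "M = N"
proof (rule measure_eqI_PiM_infinite[OF sets])
  show "finite_measure M" by fact
  interpret M: finite_measure M by fact
  interpret N: finite_measure N by fact
  fix X and J :: "nat set" assume J: "finite J" and X: "\<And>i. i \<in> J \<Longrightarrow> X i \<in> sets (count_space A)"
  define n where "n = Suc (Max (insert 0 J))"
  have Jn: "j < n" if "j \<in> J" for j
    unfolding n_def using J that by (simp add: less_Suc_eq_le)
  let ?P = "prod_emb UNIV (\<lambda>n. count_space A) J (Pi\<^sub>E J X)"
  let ?C = "\<lambda>w. {\<omega> \<in> space (seq_space A). prefix_of \<omega> (length w) = w}"
  define W where "W = {w \<in> lists A. length w = n \<and> (\<forall>j\<in>J. w ! j \<in> X j)}"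
  have fW: "finite W"
    using finite_lists_length_eq[OF A, of n] by (rule rev_finite_subset) (auto simp: W_def)
  have P: "?P = (\<Union>w\<in>W. ?C w)"
  proof (intro equalityI subsetI)
    fix \<omega> assume "\<omega> \<in> ?P"
    then have \<omega>: "\<omega> \<in> space (seq_space A)" "\<And>j. j \<in> J \<Longrightarrow> \<omega> j \<in> X j"
      by (auto simp: prod_emb_def space_seq_space PiE_iff)
    then have "prefix_of \<omega> n \<in> W" unfolding W_def
      by (auto simp: prefix_of_def space_seq_space Jn)
    then show "\<omega> \<in> (\<Union>w\<in>W. ?C w)" using \<omega>(1) by (intro UN_I[of "prefix_of \<omega> n"]) auto
  next
    fix \<omega> assume "\<omega> \<in> (\<Union>w\<in>W. ?C w)"
    then obtain w where w: "w \<in> W" "\<omega> \<in> space (seq_space A)" "prefix_of \<omega> (length w) = w" by blast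
    then have l: "length w = n" by (simp add: W_def)
    have "\<omega> j \<in> X j" if "j \<in> J" for j
    proof -
      have "w ! j = \<omega> j" using w(3) Jn[OF that] l by (metis add_0 diff_zero length_upt nth_map nth_upt prefix_of_def)
      then show ?thesis using w(1) that by (auto simp: W_def)
    qed
    then show "\<omega> \<in> ?P" using w(2) by (auto simp: prod_emb_def space_seq_space PiE_iff restrict_def extensional_def)
  qed
  have disj: "disjoint_family_on ?C W"
    by (auto simp: disjoint_family_on_def W_def)
  have s: "?C w \<in> sets (seq_space A)" for w using sets_prefix[OF A, of "length w" "{w}"] by simp
  have "emeasure M ?P = (\<Sum>w\<in>W. emeasure M (?C w))"
    unfolding P using s sets fW disj by (intro sum_emeasure[symmetric]) auto
  also have "\<dots> = (\<Sum>w\<in>W. emeasure N (?C w))"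
    using eq by (intro sum.cong refl) (auto simp: M.emeasure_eq_measure N.emeasure_eq_measure W_def)
  also have "\<dots> = emeasure N ?P"
    unfolding P using s sets fW disj by (intro sum_emeasure) auto
  finally show "emeasure M ?P = emeasure N ?P" .
qed

section \<open>Uniqueness of finite Borel measures\<close>

lemma borel_measure_eqI_closed:
  fixes M N :: "'a::metric_space measure"
  assumes sets: "sets M = sets borel" "sets N = sets borel" and fn: "finite_measure M"
    and eq: "\<And>C. closed C \<Longrightarrow> emeasure M C = emeasure N C"
  shows "M = N"
proof (rule measure_eqI_generator_eq[where E="Collect closed" and \<Omega>=UNIV and A="\<lambda>_. UNIV"])
  show "Int_stable (Collect closed)" by (auto simp: Int_stable_def closed_Int)
  show "sets M = sigma_sets UNIV (Collect closed)" "sets N = sigma_sets UNIV (Collect closed)"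
    using sets unfolding borel_eq_closed by simp_all
  interpret finite_measure M by fact
  show "emeasure M UNIV \<noteq> \<infinity>" for i :: nat by simp
qed (use eq in auto)

text \<open>The functions \<open>h n\<close> decrease to the indicator of the closed set, so
  integrals of continuous functions determine the measure on closed sets, a generator stable under
  intersection. The comparison is made for the images under the inclusion into the whole
  space.\<close>

lemma restrict_measure_eqI:
  fixes G :: "'a::metric_space set"
  assumes sets: "sets M = sets (restrict_space borel G)" "sets N = sets (restrict_space borel G)"
    and fn: "finite_measure M" "finite_measure N"
    and eq: "\<And>h. continuous_on UNIV h \<Longrightarrow> (\<And>z. 0 \<le> h z \<and> h z \<le> 1) \<Longrightarrow> (\<integral>z. h z \<partial>M) = (\<integral>z. h z \<partial>N :: real)"
  shows "M = N"
proof -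
  interpret M: finite_measure M by fact
  interpret N: finite_measure N by fact
  have id: "(\<lambda>z. z) \<in> measurable (restrict_space borel G) borel"
    by (intro measurable_restrict_space1) simp
  have idM: "(\<lambda>z. z) \<in> measurable M borel" and idN: "(\<lambda>z. z) \<in> measurable N borel"
    using id measurable_cong_sets[OF sets(1) refl] measurable_cong_sets[OF sets(2) refl] by blast+
  have spM: "space M = G" and spN: "space N = G"
    using sets_eq_imp_space_eq[OF sets(1)] sets_eq_imp_space_eq[OF sets(2)] by (simp_all add: space_restrict_space)
  have closed: "measure M (C \<inter> G) = measure N (C \<inter> G)" if C: "closed C" for C
  proof (cases "C = {}")
    case False
    define h where "h n z = max 0 (1 - real n * infdist z C)" for n z
    have h: "continuous_on UNIV (h n)" "0 \<le> h n z \<and> h n z \<le> 1" for n z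
      unfolding h_def by (auto intro!: continuous_intros simp: infdist_nonneg)
    have lim: "(\<lambda>n. h n z) \<longlonglongrightarrow> indicator C z" for z
    proof (cases "z \<in> C")
      case True then show ?thesis by (simp add: h_def)
    next
      case z: False
      then have pos: "0 < infdist z C" using infdist_pos_not_in_closed[OF C False] by simp
      obtain k :: nat where k: "1 / infdist z C < k" using reals_Archimedean2 by blast
      have "h n z = 0" if "n \<ge> k" for n
      proof -
        have "1 < real k * infdist z C" using k pos by (simp add: field_simps)
        also have "\<dots> \<le> real n * infdist z C" using that pos by (intro mult_right_mono) auto
        finally show ?thesis by (simp add: h_def)
      qed
      then have "eventually (\<lambda>n. h n z = 0) sequentially" by (auto simp: eventually_sequentially)
      then show ?thesis using z by (simp add: tendsto_eventually)
    qed
    have conv: "(\<lambda>n. \<integral>z. h n z \<partial>K) \<longlonglongrightarrow> measure K (C \<inter> G)"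
      if K: "finite_measure K" "(\<lambda>z. z) \<in> measurable K borel" "space K = G" for K
    proof -
      interpret K: finite_measure K by fact
      have hm: "h n \<in> borel_measurable K" for n
        using measurable_compose[OF K(2), of "h n" borel] h(1) by (simp add: borel_measurable_continuous_onI)
      have cm: "(\<lambda>z. indicator C z :: real) \<in> borel_measurable K"
        using measurable_compose[OF K(2), of "indicator C" borel] C by simp
      have "(\<lambda>n. \<integral>z. h n z \<partial>K) \<longlonglongrightarrow> (\<integral>z. indicator C z \<partial>K)"
        by (rule integral_dominated_convergence[where w = "\<lambda>_. 1"]) (auto simp: hm cm lim h(2))
      moreover have "(\<integral>z. indicator C z \<partial>K) = measure K (C \<inter> G)"
        using K(3) by (simp add: Int_commute)
      ultimately show ?thesis by simp
    qed
    have "(\<lambda>n. \<integral>z. h n z \<partial>M) = (\<lambda>n. \<integral>z. h n z \<partial>N)" using eq h by blast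
    then show ?thesis
      using conv[OF fn(1) idM spM] conv[OF fn(2) idN spN] LIMSEQ_unique by metis
  qed simp
  have "distr M borel (\<lambda>z. z) = distr N borel (\<lambda>z. z)"
  proof (rule borel_measure_eqI_closed)
    show "finite_measure (distr M borel (\<lambda>z. z))" by (rule M.finite_measure_distr[OF idM])
    fix C :: "'a set" assume C: "closed C"
    then have "emeasure (distr M borel (\<lambda>z. z)) C = emeasure M (C \<inter> G)" "emeasure (distr N borel (\<lambda>z. z)) C = emeasure N (C \<inter> G)"
      using idM idN spM spN by (simp_all add: emeasure_distr)
    then show "emeasure (distr M borel (\<lambda>z. z)) C = emeasure (distr N borel (\<lambda>z. z)) C"
      using closed[OF C] by (simp add: M.emeasure_eq_measure N.emeasure_eq_measure)
  qed simp_all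
  then have e: "emeasure (distr M borel (\<lambda>z. z)) A = emeasure (distr N borel (\<lambda>z. z)) A" for A by simp
  show ?thesis
  proof (rule measure_eqI)
    show "sets M = sets N" using sets by simp
    fix A assume "A \<in> sets M"
    then obtain B where B: "B \<in> sets borel" "A = B \<inter> G" unfolding sets sets_restrict_space by auto
    then show "emeasure M A = emeasure N A"
      using e[of B] idM idN spM spN by (simp add: emeasure_distr)
  qed
qed

section \<open>The energy measure\<close>

context gasket_letters
begin

lemma space_seq_space_alphabet: "space (seq_space (alphabet T)) = Sigma_sp T"
  by (auto simp: space_seq_space Sigma_sp_def)

lemma cylinder_eq: "cylinder T w = {\<omega> \<in> space (seq_space (alphabet T)). prefix_of \<omega> (length w) = w}"
  by (simp add: cylinder_def space_seq_space_alphabet)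

lemma Wt_all_snoc: "w @ [v] \<in> Wt_all L \<longleftrightarrow> w \<in> Wt_all L \<and> v \<in> letters (L w)"
  unfolding Wt_all_iff by (auto dest: Wt_length)

lemma Wt_all_Words: "T_valued L \<Longrightarrow> w \<in> Wt_all L \<Longrightarrow> w \<in> Words T"
  unfolding Wt_all_iff by (rule Wt_Words)

definition tree_measure :: "(letter list \<Rightarrow> nat) \<Rightarrow> (letter list \<Rightarrow> real) \<Rightarrow> (nat \<Rightarrow> letter) measure \<Rightarrow> bool" where
  "tree_measure L b M \<longleftrightarrow> sets M = sets (seq_space (alphabet T)) \<and> finite_measure M \<and>
     (\<forall>w\<in>Words T. measure M (cylinder T w) = (if w \<in> Wt_all L then b w else 0))"

lemma tree_measure_ex:
  assumes L: "T_valued L" and nn: "\<And>w. w \<in> Wt_all L \<Longrightarrow> 0 \<le> b w"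
    and add: "\<And>w. w \<in> Wt_all L \<Longrightarrow> (\<Sum>v\<in>letters (L w). b (w @ [v])) = b w"
  shows "\<exists>M. tree_measure L b M"
proof -
  let ?m = "\<lambda>w. if w \<in> Wt_all L then b w else 0"
  obtain \<nu> where \<nu>: "\<nu> \<in> T" using neT by blast
  have "alphabet T \<noteq> {}" using letters_alphabet[OF \<nu> S0_letters[OF T2[OF \<nu>], of 1]] by (auto simp: S0_def)
  have "\<exists>M. sets M = sets (seq_space (alphabet T)) \<and> finite_measure M \<and>
    (\<forall>w\<in>lists (alphabet T). measure M {\<omega> \<in> space (seq_space (alphabet T)). prefix_of \<omega> (length w) = w} = ?m w)"
  proof (rule tree_measure_exists[OF finite_alphabet \<open>alphabet T \<noteq> {}\<close>])
    fix w :: "letter list"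
    show "0 \<le> ?m w" using nn by simp
    show "(\<Sum>v\<in>alphabet T. ?m (w @ [v])) = ?m w"
    proof (cases "w \<in> Wt_all L")
      case True
      have sub: "letters (L w) \<subseteq> alphabet T"
        using letters_alphabet[OF T_valued_T[OF L Wt_all_Words[OF L True]]] by blast
      have "(\<Sum>v\<in>alphabet T. ?m (w @ [v])) = (\<Sum>v\<in>alphabet T. if v \<in> letters (L w) then b (w @ [v]) else 0)"
        using True by (simp add: Wt_all_snoc)
      also have "\<dots> = (\<Sum>v\<in>letters (L w). b (w @ [v]))"
        using sub finite_alphabet by (simp add: sum.inter_restrict[symmetric] Int_absorb1)
      finally show ?thesis using add True by simp
    qed (simp add: Wt_all_snoc)
  qed
  then show ?thesis unfolding tree_measure_def cylinder_eq Words_def .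
qed

lemma tree_measure_unique': "tree_measure L b M \<Longrightarrow> tree_measure L b N \<Longrightarrow> M = N"
  unfolding tree_measure_def cylinder_eq Words_def
  by (rule tree_measure_unique[OF finite_alphabet]) auto

lemma weights_nonneg: "q \<in> weights T \<Longrightarrow> w \<in> Words T \<Longrightarrow> 0 < prod_list (map q w)"
  by (induction w) (auto simp: weights_def)

text \<open>Existence and uniqueness resolve the definite description of \<open>lambda_q\<close>. A
  finite measure with these cylinder masses is a probability measure because the empty word has mass
  1.\<close>

lemma tree_measure_lambda:
  assumes L: "T_valued L" and q: "q \<in> weights T"
  shows "tree_measure L (\<lambda>w. prod_list (map q w)) (lambda_q T L q)" "prob_space (lambda_q T L q)"
proof -
  let ?b = "\<lambda>w. prod_list (map q w)"
  let ?P = "\<lambda>M. sets M = sets (\<Pi>\<^sub>M n\<in>UNIV. count_space (alphabet T)) \<and> prob_space M \<and>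
     (\<forall>w\<in>Words T. measure M (cylinder T w) = (if w \<in> Wt_all L then prod_list (map q w) else 0))"
  have "\<exists>M. tree_measure L ?b M"
  proof (rule tree_measure_ex[OF L])
    show "w \<in> Wt_all L \<Longrightarrow> 0 \<le> ?b w" for w using weights_nonneg[OF q Wt_all_Words[OF L]] by (simp add: less_imp_le)
    fix w assume w: "w \<in> Wt_all L"
    have "L w \<in> T" by (rule T_valued_T[OF L Wt_all_Words[OF L w]])
    then show "(\<Sum>v\<in>letters (L w). ?b (w @ [v])) = ?b w"
      using q by (simp add: weights_def flip: sum_distrib_left)
  qed
  then obtain M where M: "tree_measure L ?b M" by blast
  have Nil: "[] \<in> Wt_all L" by (simp add: Wt_all_iff)
  have PT: "?P N \<longleftrightarrow> tree_measure L ?b N" for N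
  proof
    assume "?P N" then show "tree_measure L ?b N"
      unfolding tree_measure_def by (auto simp: prob_space_def)
  next
    assume N: "tree_measure L ?b N"
    interpret finite_measure N using N by (simp add: tree_measure_def)
    have "space N = cylinder T []"
      using N sets_eq_imp_space_eq[of N "seq_space (alphabet T)"] by (auto simp: tree_measure_def cylinder_eq)
    moreover have "measure N (cylinder T []) = 1"
      using N Nil unfolding tree_measure_def by (auto dest!: bspec[of _ _ "[]"])
    ultimately have "prob_space N" by (intro prob_spaceI) (simp add: emeasure_eq_measure)
    then show "?P N" using N unfolding tree_measure_def by blast
  qed
  have "?P (lambda_q T L q)"
    unfolding lambda_q_def
    by (rule theI[of ?P M]) (use M PT tree_measure_unique' in blast)+
  then show "tree_measure L ?b (lambda_q T L q)" "prob_space (lambda_q T L q)" using PT by blast+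
qed

lemma tree_measureD:
  assumes "tree_measure L b M"
  shows "sets M = sets (seq_space (alphabet T))" "finite_measure M" "space M = Sigma_sp T"
    "w \<in> Words T \<Longrightarrow> measure M (cylinder T w) = (if w \<in> Wt_all L then b w else 0)"
  using assms sets_eq_imp_space_eq[of M "seq_space (alphabet T)"]
  by (auto simp: tree_measure_def space_seq_space_alphabet)

lemma sets_prefix_in: "sets M = sets (seq_space (alphabet T)) \<Longrightarrow> {\<omega> \<in> Sigma_sp T. prefix_of \<omega> n \<in> X} \<in> sets M"
  using sets_prefix[OF finite_alphabet, of n X] by (simp add: space_seq_space_alphabet)

lemma sets_Sigma_t: "sets M = sets (seq_space (alphabet T)) \<Longrightarrow> Sigma_t T L \<in> sets M"
proof -
  assume M: "sets M = sets (seq_space (alphabet T))"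
  have "Sigma_t T L = (\<Inter>m. {\<omega> \<in> Sigma_sp T. prefix_of \<omega> m \<in> Wt L m})"
    by (auto simp: Sigma_t_def)
  then show ?thesis using sets_prefix_in[OF M] by (auto intro!: sets.countable_INT')
qed

lemma measure_prefix:
  assumes L: "T_valued L" and M: "tree_measure L b M" and X: "X \<subseteq> Words T" "\<And>w. w \<in> X \<Longrightarrow> length w = n"
  shows "measure M {\<omega> \<in> Sigma_sp T. prefix_of \<omega> n \<in> X} = (\<Sum>w\<in>X \<inter> Wt L n. b w)"
proof -
  interpret finite_measure M using tree_measureD(2)[OF M] .
  have fX: "finite X"
    using finite_lists_length_eq[OF finite_alphabet, of n]
    by (rule rev_finite_subset) (use X in \<open>auto simp: Words_def\<close>)
  have "{\<omega> \<in> Sigma_sp T. prefix_of \<omega> n \<in> X} = (\<Union>w\<in>X. cylinder T w)"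
    using X(2) by (auto simp: cylinder_def)
  then have "measure M {\<omega> \<in> Sigma_sp T. prefix_of \<omega> n \<in> X} = (\<Sum>w\<in>X. measure M (cylinder T w))"
  proof (simp only:, intro finite_measure_finite_Union[OF fX])
    show "cylinder T ` X \<subseteq> sets M"
      using sets_prefix_in[OF tree_measureD(1)[OF M], of "length _" "{_}"] by (auto simp: cylinder_def)
    show "disjoint_family_on (cylinder T) X"
      using X(2) by (auto simp: disjoint_family_on_def cylinder_def)
  qed
  also have "\<dots> = (\<Sum>w\<in>X. if w \<in> Wt L n then b w else 0)"
    using X tree_measureD(4)[OF M] by (intro sum.cong) (auto simp: Wt_all_iff)
  also have "\<dots> = (\<Sum>w\<in>X \<inter> Wt L n. b w)" using fX by (simp add: sum.inter_restrict)
  finally show ?thesis .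
qed

lemma AE_Sigma_t:
  assumes L: "T_valued L" and M: "tree_measure L b M"
  shows "AE \<omega> in M. \<omega> \<in> Sigma_t T L"
proof -
  interpret finite_measure M using tree_measureD(2)[OF M] .
  have "AE \<omega> in M. prefix_of \<omega> m \<in> Wt L m" for m
  proof (rule AE_I')
    let ?X = "{w \<in> Words T. length w = m \<and> w \<notin> Wt L m}"
    have "measure M {\<omega> \<in> Sigma_sp T. prefix_of \<omega> m \<in> ?X} = 0"
      by (subst measure_prefix[OF L M]) (auto intro!: sum.neutral)
    then show "{\<omega> \<in> Sigma_sp T. prefix_of \<omega> m \<in> ?X} \<in> null_sets M"
      using sets_prefix_in[OF tree_measureD(1)[OF M], of m ?X] by (simp add: null_sets_def emeasure_eq_measure)
    show "{\<omega> \<in> space M. prefix_of \<omega> m \<notin> Wt L m} \<subseteq> {\<omega> \<in> Sigma_sp T. prefix_of \<omega> m \<in> ?X}"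
      using tree_measureD(3)[OF M] Sigma_sp_prefix by auto
  qed
  then have "AE \<omega> in M. \<forall>m. prefix_of \<omega> m \<in> Wt L m" by (simp add: AE_all_countable)
  then show ?thesis
    using AE_space by eventually_elim (simp add: Sigma_t_def tree_measureD(3)[OF M])
qed

section \<open>Images of sequence measures on the gasket\<close>

definition gasket_image :: "(letter list \<Rightarrow> nat) \<Rightarrow> (nat \<Rightarrow> letter) measure \<Rightarrow> plane measure" where
  "gasket_image L M = distr (restrict_space M (Sigma_t T L)) (restrict_space borel (gasket p \<alpha> T L)) (proj p \<alpha>)"

lemma proj_Sigma_t: "\<omega> \<in> Sigma_t T L \<Longrightarrow> proj p \<alpha> \<omega> \<in> gasket p \<alpha> T L"
  unfolding gasket_def by blast

lemma prefix_fun_measurable: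
  assumes M: "sets M = sets (seq_space (alphabet T))"
  shows "(\<lambda>\<omega>. f (prefix_of \<omega> m)) \<in> borel_measurable (restrict_space M (Sigma_t T L))"
proof -
  have "(\<lambda>\<omega>. f (prefix_of \<omega> m)) \<in> borel_measurable (seq_space (alphabet T))"
    by (rule measurable_compose[OF measurable_prefix[OF finite_alphabet]]) simp
  then have "(\<lambda>\<omega>. f (prefix_of \<omega> m)) \<in> borel_measurable M" using measurable_cong_sets[OF M refl] by blast
  then show ?thesis by (rule measurable_restrict_space1)
qed

text \<open>The coding map is the pointwise limit of the images of \<open>p 1\<close> under the
  prefix maps, each of which depends on finitely many letters.\<close>

lemma proj_measurable:
  assumes M: "sets M = sets (seq_space (alphabet T))"
  shows "proj p \<alpha> \<in> measurable (restrict_space M (Sigma_t T L)) (restrict_space borel (gasket p \<alpha> T L))"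
proof (rule measurable_restrict_space2)
  have sp: "space (restrict_space M (Sigma_t T L)) = Sigma_t T L"
    using sets.sets_into_space[OF sets_Sigma_t[OF M]] by (auto simp: space_restrict_space)
  show "proj p \<alpha> \<in> space (restrict_space M (Sigma_t T L)) \<rightarrow> gasket p \<alpha> T L"
    unfolding sp using proj_Sigma_t by blast
  show "proj p \<alpha> \<in> borel_measurable (restrict_space M (Sigma_t T L))"
  proof (rule borel_measurable_LIMSEQ_metric)
    show "(\<lambda>\<omega>. psi_word \<alpha> (prefix_of \<omega> m) (p 1)) \<in> borel_measurable (restrict_space M (Sigma_t T L))" for m
      by (rule prefix_fun_measurable[OF M])
    show "\<omega> \<in> space (restrict_space M (Sigma_t T L)) \<Longrightarrow> (\<lambda>m. psi_word \<alpha> (prefix_of \<omega> m) (p 1)) \<longlonglongrightarrow> proj p \<alpha> \<omega>" for \<omega>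
      unfolding sp by (rule proj_tendsto[OF Sigma_t_sp p_in_triangle]) (auto simp: S0_def)
  qed
qed

lemma sets_pm: "sets (gasket_image L M) = sets (restrict_space borel (gasket p \<alpha> T L))"
  by (simp add: gasket_image_def)

lemma finite_measure_restrict:
  assumes "finite_measure M" "sets M = sets (seq_space (alphabet T))"
  shows "finite_measure (restrict_space M (Sigma_t T L))"
proof -
  interpret finite_measure M by fact
  show ?thesis
    by (rule finite_measureI) (use sets_Sigma_t[OF assms(2), of L] sets.sets_into_space[OF sets_Sigma_t[OF assms(2), of L]]
      in \<open>simp add: emeasure_restrict_space space_restrict_space Int_absorb2\<close>)
qed

lemma finite_pm:
  assumes "finite_measure M" "sets M = sets (seq_space (alphabet T))"
  shows "finite_measure (gasket_image L M)"
  unfolding gasket_image_def by (intro finite_measure.finite_measure_distr finite_measure_restrict proj_measurable assms)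

lemma emeasure_pm:
  assumes M: "sets M = sets (seq_space (alphabet T))" and A: "A \<in> sets (restrict_space borel (gasket p \<alpha> T L))"
  shows "emeasure (gasket_image L M) A = emeasure M {\<omega> \<in> Sigma_t T L. proj p \<alpha> \<omega> \<in> A}"
proof -
  have sp: "space (restrict_space M (Sigma_t T L)) = Sigma_t T L"
    using sets.sets_into_space[OF sets_Sigma_t[OF M]] by (auto simp: space_restrict_space)
  have "emeasure (gasket_image L M) A = emeasure (restrict_space M (Sigma_t T L)) (proj p \<alpha> -` A \<inter> Sigma_t T L)"
    unfolding gasket_image_def using emeasure_distr[OF proj_measurable[OF M] A] sp by simp
  also have "\<dots> = emeasure M (proj p \<alpha> -` A \<inter> Sigma_t T L)"
    using sets_Sigma_t[OF M, of L] sets.sets_into_space[OF sets_Sigma_t[OF M, of L]]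
    by (intro emeasure_restrict_space) (auto simp: Int_absorb2)
  finally show ?thesis by (simp add: vimage_def Int_def conj_commute)
qed

lemma continuous_bounded_G:
  assumes "continuous_on (G L) (f :: plane \<Rightarrow> real)"
  obtains B where "0 \<le> B" "\<And>z. z \<in> G L \<Longrightarrow> \<bar>f z\<bar> \<le> B"
proof -
  have "bounded (f ` G L)" by (intro compact_imp_bounded compact_continuous_image assms compact_G)
  then obtain B where "\<And>z. z \<in> G L \<Longrightarrow> \<bar>f z\<bar> \<le> B" unfolding bounded_iff by auto
  then show ?thesis using that[of "max B 0"] by (simp add: le_max_iff_disj)
qed

lemma uniform_on_cells:
  assumes L: "T_valued L" and g: "continuous_on (G L) (g :: plane \<Rightarrow> real)" and e: "0 < e"
  obtains m0 where "\<And>m w x y. m \<ge> m0 \<Longrightarrow> w \<in> Wt L m \<Longrightarrow> x \<in> K w \<Longrightarrow> y \<in> K w \<Longrightarrow> x \<in> G L \<Longrightarrow> y \<in> G L \<Longrightarrow> \<bar>g x - g y\<bar> \<le> e"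
proof -
  have "uniformly_continuous_on (G L) g" by (rule compact_uniformly_continuous[OF g compact_G])
  then obtain d where d: "0 < d" "\<And>x y. x \<in> G L \<Longrightarrow> y \<in> G L \<Longrightarrow> dist x y < d \<Longrightarrow> dist (g x) (g y) < e"
    using e unfolding uniformly_continuous_on_def by metis
  obtain m0 where m0: "(1/2) ^ m0 * diameter (triangle p) < d" using eventually_small[OF d(1)] by blast
  show ?thesis
  proof (rule that[of m0])
    fix m w x y assume m: "m0 \<le> m" and w: "w \<in> Wt L m" and xy: "x \<in> K w" "y \<in> K w" "x \<in> G L" "y \<in> G L"
    have "dist x y \<le> (1/2) ^ m * diameter (triangle p)"
      using diam_K[OF Wt_Words[OF L w] xy(1,2)] Wt_length[OF w] by simp
    also have "\<dots> \<le> (1/2) ^ m0 * diameter (triangle p)"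
      using m by (intro mult_right_mono power_decreasing) (auto simp: diameter_ge_0 compact_imp_bounded[OF compact_triangle])
    finally have "dist x y < d" using m0 by simp
    then show "\<bar>g x - g y\<bar> \<le> e" using d(2)[OF xy(3,4)] by (simp add: dist_real_def less_imp_le)
  qed
qed

text \<open>Replacing the coded point by the vertex with label 1 of its level-\<open>m\<close> cell
  turns the integral into a finite sum over cylinders; dominated convergence removes the
  replacement.\<close>

lemma integral_pm_approx:
  assumes L: "T_valued L" and M: "tree_measure L b M" and g: "continuous_on (G L) (g :: plane \<Rightarrow> real)"
  shows "(\<lambda>m. \<Sum>w\<in>Wt L m. g (psi_word \<alpha> w (p 1)) * b w) \<longlonglongrightarrow> (\<integral>z. g z \<partial>gasket_image L M)"
proof -
  note sM = tree_measureD(1)[OF M]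
  let ?N = "restrict_space M (Sigma_t T L)"
  interpret finite_measure M using tree_measureD(2)[OF M] .
  interpret N: finite_measure ?N by (rule finite_measure_restrict[OF tree_measureD(2)[OF M] sM])
  have sp: "space ?N = Sigma_t T L"
    using sets.sets_into_space[OF sets_Sigma_t[OF sM]] by (auto simp: space_restrict_space)
  obtain B where B: "0 \<le> B" "\<And>z. z \<in> G L \<Longrightarrow> \<bar>g z\<bar> \<le> B" using continuous_bounded_G[OF g] by blast
  have gm: "g \<in> borel_measurable (restrict_space borel (gasket p \<alpha> T L))"
    unfolding gasket_eq[OF L] by (rule borel_measurable_continuous_on_restrict[OF g])
  let ?h = "\<lambda>m \<omega>. g (psi_word \<alpha> (prefix_of \<omega> m) (p 1))"
  have inG: "psi_word \<alpha> (prefix_of \<omega> m) (p 1) \<in> G L" if "\<omega> \<in> Sigma_t T L" for m \<omega>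
    by (rule vertex_in_G[OF L Sigma_t_Wt[OF that]]) (simp add: S0_def)
  have int: "(\<integral>z. g z \<partial>gasket_image L M) = (\<integral>\<omega>. g (proj p \<alpha> \<omega>) \<partial>?N)"
    unfolding gasket_image_def by (rule integral_distr[OF proj_measurable[OF sM] gm])
  have "(\<lambda>m. \<integral>\<omega>. ?h m \<omega> \<partial>?N) \<longlonglongrightarrow> (\<integral>\<omega>. g (proj p \<alpha> \<omega>) \<partial>?N)"
  proof (rule integral_dominated_convergence[where w = "\<lambda>_. B"])
    show "(\<lambda>\<omega>. g (proj p \<alpha> \<omega>)) \<in> borel_measurable ?N"
      by (rule measurable_compose[OF proj_measurable[OF sM] gm])
    show "?h m \<in> borel_measurable ?N" for m by (rule prefix_fun_measurable[OF sM])
    show "integrable ?N (\<lambda>_. B)" by simp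
    show "AE \<omega> in ?N. (\<lambda>m. ?h m \<omega>) \<longlonglongrightarrow> g (proj p \<alpha> \<omega>)"
    proof (rule AE_I2)
      fix \<omega> assume "\<omega> \<in> space ?N"
      then have \<omega>: "\<omega> \<in> Sigma_t T L" by (simp add: sp)
      show "(\<lambda>m. ?h m \<omega>) \<longlonglongrightarrow> g (proj p \<alpha> \<omega>)"
        using proj_tendsto[OF Sigma_t_sp[OF \<omega>] p_in_triangle[of 1]] proj_Sigma_t[OF \<omega>] inG[OF \<omega>]
        by (intro continuous_on_tendsto_compose[OF g]) (auto simp: gasket_eq[OF L] S0_def)
    qed
    show "AE \<omega> in ?N. norm (?h m \<omega>) \<le> B" for m
      by (rule AE_I2) (use B(2)[OF inG] sp in auto)
  qed
  moreover have "(\<integral>\<omega>. ?h m \<omega> \<partial>?N) = (\<Sum>w\<in>Wt L m. g (psi_word \<alpha> w (p 1)) * b w)" for m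
  proof -
    have c: "Sigma_t T L \<inter> cylinder T w \<in> sets M" for w
      using sets_Sigma_t[OF sM, of L] sets_prefix_in[OF sM, of "length w" "{w}"] by (auto simp: cylinder_def)
    have cN: "Sigma_t T L \<inter> cylinder T w \<in> sets ?N" for w
      using c by (subst sets_restrict_space_iff) (use sets_Sigma_t[OF sM, of L] sp in \<open>auto simp: space_restrict_space intro: sets.Int\<close>)
    have mc: "measure ?N (Sigma_t T L \<inter> cylinder T w) = b w" if w: "w \<in> Wt L m" for w
    proof -
      have "measure ?N (Sigma_t T L \<inter> cylinder T w) = measure M (Sigma_t T L \<inter> cylinder T w)"
        using sets_Sigma_t[OF sM, of L] sets.sets_into_space[OF sets_Sigma_t[OF sM, of L]]
        by (intro measure_restrict_space) (auto simp: Int_absorb2)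
      also have "\<dots> = measure M (cylinder T w)"
        using AE_Sigma_t[OF L M] c[of w] sets_prefix_in[OF sM, of "length w" "{w}"]
        by (intro finite_measure_eq_AE) (auto simp: cylinder_def)
      also have "\<dots> = b w" using tree_measureD(4)[OF M Wt_Words[OF L w]] w Wt_length[OF w] by (simp add: Wt_all_iff)
      finally show ?thesis .
    qed
    have "(\<integral>\<omega>. ?h m \<omega> \<partial>?N) = (\<integral>\<omega>. (\<Sum>w\<in>Wt L m. g (psi_word \<alpha> w (p 1)) * indicator (Sigma_t T L \<inter> cylinder T w) \<omega>) \<partial>?N)"
    proof (rule Bochner_Integration.integral_cong[OF refl])
      fix \<omega> assume "\<omega> \<in> space ?N"
      then have \<omega>: "\<omega> \<in> Sigma_t T L" by (simp add: sp)
      have "(\<Sum>w\<in>Wt L m. g (psi_word \<alpha> w (p 1)) * indicator (Sigma_t T L \<inter> cylinder T w) \<omega>) =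
        (\<Sum>w\<in>Wt L m. if w = prefix_of \<omega> m then g (psi_word \<alpha> w (p 1)) else 0)"
        using \<omega> by (intro sum.cong refl) (auto simp: indicator_def cylinder_def Sigma_t_sp dest: Wt_length)
      also have "\<dots> = ?h m \<omega>" using Sigma_t_Wt[OF \<omega>] by simp
      finally show "?h m \<omega> = (\<Sum>w\<in>Wt L m. g (psi_word \<alpha> w (p 1)) * indicator (Sigma_t T L \<inter> cylinder T w) \<omega>)" by simp
    qed
    also have "\<dots> = (\<Sum>w\<in>Wt L m. g (psi_word \<alpha> w (p 1)) * b w)"
      using cN mc by (subst Bochner_Integration.integral_sum)
        (auto simp: sp Int_absorb2 integrable_indicator_iff N.emeasure_eq_measure intro!: integrable_mult_right)
    finally show ?thesis .
  qed
  ultimately show ?thesis unfolding int by simp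
qed

lemma tree_measure_energy:
  assumes L: "T_valued L" and f: "finite_energy L f"
  shows "\<exists>M. tree_measure L (\<lambda>w. 2 * cell_energy L f w) M"
proof (rule tree_measure_ex[OF L])
  show "w \<in> Wt_all L \<Longrightarrow> 0 \<le> 2 * cell_energy L f w" for w
    using cell_energy_nonneg[OF L f, of w "length w"] by (simp add: Wt_all_iff)
  show "w \<in> Wt_all L \<Longrightarrow> (\<Sum>v\<in>letters (L w). 2 * cell_energy L f (w @ [v])) = 2 * cell_energy L f w" for w
    using sum_ce_children[OF L f, of w "length w"] by (simp add: Wt_all_iff flip: sum_distrib_left)
qed

text \<open>The factor 2 is forced by the normalization of the energy measure: its characterization
  with the constant function 1 gives twice the energy as total mass.\<close>

definition energy_seq_measure :: "(letter list \<Rightarrow> nat) \<Rightarrow> (plane \<Rightarrow> real) \<Rightarrow> (nat \<Rightarrow> letter) measure" where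
  "energy_seq_measure L f = (SOME M. tree_measure L (\<lambda>w. 2 * cell_energy L f w) M)"

lemma energy_seq_measure: "T_valued L \<Longrightarrow> finite_energy L f \<Longrightarrow> tree_measure L (\<lambda>w. 2 * cell_energy L f w) (energy_seq_measure L f)"
  unfolding energy_seq_measure_def by (rule someI_ex[OF tree_measure_energy])

text \<open>At level \<open>m\<close> both sides are sums over cells: the product rule expresses the
  right side by level energies, the Riemann sum expresses the left side by cell energies. They
  differ by the oscillation of \<open>g\<close> on cells times the energy, plus the bound of
  \<open>g\<close> times the energy not yet visible at level \<open>m\<close>.\<close>

lemma energy_integral:
  assumes L: "T_valued L" and f: "f \<in> dom_F p \<alpha> T L" and g: "g \<in> dom_F p \<alpha> T L"
  shows "(\<integral>z. g z \<partial>gasket_image L (energy_seq_measure L f)) = 2 * energy p \<alpha> L f (\<lambda>z. f z * g z) - energy p \<alpha> L (\<lambda>z. (f z)\<^sup>2) g"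
proof -
  have fc: "continuous_on (G L) f" "finite_energy L f" and gc: "continuous_on (G L) g" "finite_energy L g"
    using f g unfolding dom_F_eq[OF L] by auto
  obtain Bf where Bf: "0 \<le> Bf" "\<And>z. z \<in> G L \<Longrightarrow> \<bar>f z\<bar> \<le> Bf" using continuous_bounded_G[OF fc(1)] by blast
  obtain Bg where Bg: "0 \<le> Bg" "\<And>z. z \<in> G L \<Longrightarrow> \<bar>g z\<bar> \<le> Bg" using continuous_bounded_G[OF gc(1)] by blast
  have fg: "finite_energy L (\<lambda>z. f z * g z)"
    by (rule finite_energy_mult[OF L fc(2) gc(2), of "max Bf Bg"]) (use Bf Bg in \<open>auto simp: le_max_iff_disj\<close>)
  have ff: "finite_energy L (\<lambda>z. (f z)\<^sup>2)"
    unfolding power2_eq_square by (rule finite_energy_mult[OF L fc(2) fc(2) Bf(2) Bf(2)])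
  define S where "S m = 2 * EL L m f (\<lambda>z. f z * g z) - EL L m (\<lambda>z. (f z)\<^sup>2) g" for m
  have S1: "S \<longlonglongrightarrow> 2 * energy p \<alpha> L f (\<lambda>z. f z * g z) - energy p \<alpha> L (\<lambda>z. (f z)\<^sup>2) g"
    unfolding S_def energy_def
    using EL_bilinear_convergent[OF L fc(2) fg] EL_bilinear_convergent[OF L ff gc(2)]
    by (intro tendsto_diff tendsto_mult tendsto_const) (simp_all add: convergent_LIMSEQ_iff)
  define A where "A m = (\<Sum>w\<in>Wt L m. g (psi_word \<alpha> w (p 1)) * (2 * cell_energy L f w))" for m
  have A: "A \<longlonglongrightarrow> (\<integral>z. g z \<partial>gasket_image L (energy_seq_measure L f))"
    unfolding A_def by (rule integral_pm_approx[OF L energy_seq_measure[OF L fc(2)] gc(1)])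
  have SA: "(\<lambda>m. S m - A m) \<longlonglongrightarrow> 0"
  proof (rule LIMSEQ_I)
    fix r :: real assume r: "0 < r"
    \<comment> \<open>Chosen so that \<open>2 * e * total_energy L f\<close> is at most
      \<open>r / 2\<close>; the summand 1 covers energy 0.\<close>
    define e where "e = r / (2 * (2 * total_energy L f + 1))"
    have En: "0 \<le> total_energy L f" by (rule total_energy_nonneg[OF L fc(2)])
    then have e: "0 < e" using r by (simp add: e_def)
    obtain m0 where m0: "\<And>m w x y. m \<ge> m0 \<Longrightarrow> w \<in> Wt L m \<Longrightarrow> x \<in> K w \<Longrightarrow> y \<in> K w \<Longrightarrow> x \<in> G L \<Longrightarrow> y \<in> G L \<Longrightarrow> \<bar>g x - g y\<bar> \<le> e"
      using uniform_on_cells[OF L gc(1) e] by blast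
    have "(\<lambda>m. 2 * Bg * (total_energy L f - EL L m f f)) \<longlonglongrightarrow> 2 * Bg * (total_energy L f - total_energy L f)"
      by (intro tendsto_intros total_energy_tendsto fc)
    then have "eventually (\<lambda>m. 2 * Bg * (total_energy L f - EL L m f f) < r / 2) sequentially"
      using r by (intro order_tendstoD(2)) auto
    then obtain m1 where m1: "\<And>m. m \<ge> m1 \<Longrightarrow> 2 * Bg * (total_energy L f - EL L m f f) < r / 2"
      unfolding eventually_sequentially by blast
    have "\<bar>S m - A m\<bar> < r" if m: "m \<ge> max m0 m1" for m
    proof -
      let ?F = "cell_values f" and ?g1 = "\<lambda>w. g (psi_word \<alpha> w (p 1))"
      let ?E = "\<lambda>w. 1 / rw w * qf (cell_values f w) (cell_values f w)"
      have cell: "\<bar>1 / rw w * ((?F w 1 - ?F w 2)\<^sup>2 * (cell_values g w 1 + cell_values g w 2) +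
       (?F w 2 - ?F w 3)\<^sup>2 * (cell_values g w 2 + cell_values g w 3) + (?F w 3 - ?F w 1)\<^sup>2 * (cell_values g w 3 + cell_values g w 1)) -
        ?g1 w * (2 * cell_energy L f w)\<bar> \<le> 2 * e * ?E w + 2 * Bg * (cell_energy L f w - ?E w)" if w: "w \<in> Wt L m" for w
      proof -
        have d: "\<bar>cell_values g w a - ?g1 w\<bar> \<le> e" if "a \<in> S0" for a
          unfolding cell_values_def using m that
          by (intro m0[OF _ w]) (auto simp: p_in_triangle S0_def intro!: vertex_in_G[OF L w])
        have edge: "\<bar>u\<^sup>2 * (cell_values g w a + cell_values g w b) - 2 * ?g1 w * u\<^sup>2\<bar> \<le> 2 * e * u\<^sup>2" if "a \<in> S0" "b \<in> S0" for a b u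
        proof -
          have "u\<^sup>2 * (cell_values g w a + cell_values g w b) - 2 * ?g1 w * u\<^sup>2 = u\<^sup>2 * ((cell_values g w a - ?g1 w) + (cell_values g w b - ?g1 w))" by algebra
          moreover have "\<bar>(cell_values g w a - ?g1 w) + (cell_values g w b - ?g1 w)\<bar> \<le> 2 * e" using d[OF that(1)] d[OF that(2)] by linarith
          then have "u\<^sup>2 * \<bar>(cell_values g w a - ?g1 w) + (cell_values g w b - ?g1 w)\<bar> \<le> u\<^sup>2 * (2 * e)" by (rule mult_left_mono) simp
          ultimately show ?thesis by (simp only: abs_mult abs_power2 mult.commute mult.left_commute)
        qed
        have rp: "0 < rw w" by (rule rw_pos[OF Wt_Words[OF L w]])
        let ?X = "(?F w 1 - ?F w 2)\<^sup>2 * (cell_values g w 1 + cell_values g w 2) + (?F w 2 - ?F w 3)\<^sup>2 * (cell_values g w 2 + cell_values g w 3) + (?F w 3 - ?F w 1)\<^sup>2 * (cell_values g w 3 + cell_values g w 1)"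
        have q: "qf (cell_values f w) (cell_values f w) = (?F w 1 - ?F w 2)\<^sup>2 + (?F w 2 - ?F w 3)\<^sup>2 + (?F w 3 - ?F w 1)\<^sup>2"
          by (simp add: qf_def power2_eq_square)
        have "\<bar>?X - 2 * ?g1 w * qf (cell_values f w) (cell_values f w)\<bar> \<le> 2 * e * qf (cell_values f w) (cell_values f w)"
          using edge[of 1 2 "?F w 1 - ?F w 2"] edge[of 2 3 "?F w 2 - ?F w 3"] edge[of 3 1 "?F w 3 - ?F w 1"]
          unfolding q by (simp add: S0_def distrib_left)
        then have "1 / rw w * \<bar>?X - 2 * ?g1 w * qf (cell_values f w) (cell_values f w)\<bar> \<le> 1 / rw w * (2 * e * qf (cell_values f w) (cell_values f w))"
          using rp by (intro mult_left_mono) auto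
        then have 1: "\<bar>1 / rw w * ?X - 2 * ?g1 w * ?E w\<bar> \<le> 2 * e * ?E w"
          using rp by (simp add: abs_mult[symmetric] right_diff_distrib mult.left_commute abs_div_pos diff_divide_distrib[symmetric] del: abs_divide)
        have "\<bar>?g1 w\<bar> \<le> Bg" by (intro Bg vertex_in_G[OF L w]) (simp add: S0_def)
        moreover have "0 \<le> cell_energy L f w - ?E w" using cell_energy_ge[OF L fc(2) w] by simp
        ultimately have "\<bar>?g1 w\<bar> * (cell_energy L f w - ?E w) \<le> Bg * (cell_energy L f w - ?E w)" by (rule mult_right_mono)
        then have 2: "\<bar>2 * ?g1 w * ?E w - ?g1 w * (2 * cell_energy L f w)\<bar> \<le> 2 * Bg * (cell_energy L f w - ?E w)"
        proof -
          have "2 * ?g1 w * ?E w - ?g1 w * (2 * cell_energy L f w) = - (2 * (?g1 w * (cell_energy L f w - ?E w)))" by algebra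
          then show ?thesis using \<open>0 \<le> cell_energy L f w - ?E w\<close> \<open>\<bar>?g1 w\<bar> * (cell_energy L f w - ?E w) \<le> Bg * (cell_energy L f w - ?E w)\<close>
            by (simp only: abs_minus_cancel abs_mult abs_of_nonneg abs_numeral)
        qed
        show ?thesis using 1 2 by linarith
      qed
      have "\<bar>S m - A m\<bar> \<le> (\<Sum>w\<in>Wt L m. 2 * e * ?E w + 2 * Bg * (cell_energy L f w - ?E w))"
        unfolding S_def EL_product_rule A_def sum_subtractf[symmetric]
        by (rule order_trans[OF sum_abs sum_mono]) (rule cell)
      also have "\<dots> = 2 * e * EL L m f f + 2 * Bg * (total_energy L f - EL L m f f)"
        unfolding sum.distrib sum_distrib_left[symmetric] sum_subtractf sum_ce[OF L fc(2)] EL_eq ..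
      also have "2 * e * EL L m f f \<le> 2 * e * total_energy L f"
        using e EL_le_Eng[OF L fc(2)] by (intro mult_left_mono) auto
      also have "2 * e * total_energy L f \<le> r / 2"
        using En r unfolding e_def by (simp add: field_simps)
      finally show ?thesis using m1[of m] m by simp
    qed
    then show "\<exists>no. \<forall>n\<ge>no. norm (S n - A n - 0) < r" by (intro exI[of _ "max m0 m1"]) auto
  qed
  have "(\<lambda>m. (S m - A m) + A m) \<longlonglongrightarrow> 0 + (\<integral>z. g z \<partial>gasket_image L (energy_seq_measure L f))" by (rule tendsto_add[OF SA A])
  then have "S \<longlonglongrightarrow> (\<integral>z. g z \<partial>gasket_image L (energy_seq_measure L f))" by simp
  then show ?thesis using S1 by (rule LIMSEQ_unique)
qed

text \<open>Stone-Weierstrass: finite energy is preserved by sums and by products of continuous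
  functions, constants have energy 0, and piecewise harmonic functions separate points.\<close>

lemma dom_F_dense:
  assumes L: "T_valued L" and h: "continuous_on (G L) h" and e: "0 < e"
  obtains g where "g \<in> dom_F p \<alpha> T L" "\<And>z. z \<in> G L \<Longrightarrow> \<bar>h z - g z\<bar> < e"
proof -
  interpret function_ring_on "dom_F p \<alpha> T L" "G L"
  proof
    show "compact (G L)" by (rule compact_G)
    show "f \<in> dom_F p \<alpha> T L \<Longrightarrow> continuous_on (G L) f" for f unfolding dom_F_eq[OF L] by simp
    show "f \<in> dom_F p \<alpha> T L \<Longrightarrow> g \<in> dom_F p \<alpha> T L \<Longrightarrow> (\<lambda>x. f x + g x) \<in> dom_F p \<alpha> T L" for f g
      unfolding dom_F_eq[OF L] using finite_energy_add[OF L] by (auto intro: continuous_on_add)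
    show "(\<lambda>x. f x * g x) \<in> dom_F p \<alpha> T L" if "f \<in> dom_F p \<alpha> T L" "g \<in> dom_F p \<alpha> T L" for f g
    proof -
      have fc: "continuous_on (G L) f" "finite_energy L f" and gc: "continuous_on (G L) g" "finite_energy L g"
        using that unfolding dom_F_eq[OF L] by auto
      obtain Bf where Bf: "0 \<le> Bf" "\<And>z. z \<in> G L \<Longrightarrow> \<bar>f z\<bar> \<le> Bf" using continuous_bounded_G[OF fc(1)] by blast
      obtain Bg where Bg: "0 \<le> Bg" "\<And>z. z \<in> G L \<Longrightarrow> \<bar>g z\<bar> \<le> Bg" using continuous_bounded_G[OF gc(1)] by blast
      have "finite_energy L (\<lambda>z. f z * g z)"
        by (rule finite_energy_mult[OF L fc(2) gc(2), of "max Bf Bg"]) (use Bf Bg in \<open>auto simp: le_max_iff_disj\<close>)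
      then show ?thesis unfolding dom_F_eq[OF L] using fc gc by (auto intro: continuous_on_mult)
    qed
    show "(\<lambda>_. c) \<in> dom_F p \<alpha> T L" for c unfolding dom_F_eq[OF L] using finite_energy_const by auto
    show "x \<in> G L \<Longrightarrow> y \<in> G L \<Longrightarrow> x \<noteq> y \<Longrightarrow> \<exists>f\<in>dom_F p \<alpha> T L. f x \<noteq> f y" for x y by (rule separation[OF L])
  qed
  show ?thesis using Stone_Weierstrass_basic[OF h e] that by (auto simp: abs_minus_commute)
qed

text \<open>The characterization tests a measure only against functions of finite energy. Their
  uniform density extends the equality of integrals to all continuous functions, and these determine
  a finite Borel measure.\<close>

lemma energy_measure_eq:
  assumes L: "T_valued L" and f: "f \<in> dom_F p \<alpha> T L"
  shows "energy_measure p \<alpha> T L f = gasket_image L (energy_seq_measure L f)"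
  unfolding energy_measure_def
proof (rule the_equality)
  have ff: "finite_energy L f" using f unfolding dom_F_eq[OF L] by simp
  note N = energy_seq_measure[OF L ff]
  note fp = finite_pm[OF tree_measureD(2)[OF N] tree_measureD(1)[OF N], of L]
  show "sets (gasket_image L (energy_seq_measure L f)) = sets (restrict_space borel (gasket p \<alpha> T L)) \<and> finite_measure (gasket_image L (energy_seq_measure L f)) \<and>
    (\<forall>g\<in>dom_F p \<alpha> T L. (\<integral>z. g z \<partial>gasket_image L (energy_seq_measure L f)) = 2 * energy p \<alpha> L f (\<lambda>z. f z * g z) - energy p \<alpha> L (\<lambda>z. (f z)\<^sup>2) g)"
    using sets_pm fp energy_integral[OF L f] by blast
  fix \<mu> assume \<mu>: "sets \<mu> = sets (restrict_space borel (gasket p \<alpha> T L)) \<and> finite_measure \<mu> \<and>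
    (\<forall>g\<in>dom_F p \<alpha> T L. (\<integral>z. g z \<partial>\<mu>) = 2 * energy p \<alpha> L f (\<lambda>z. f z * g z) - energy p \<alpha> L (\<lambda>z. (f z)\<^sup>2) g)"
  have s: "sets \<mu> = sets (restrict_space borel (G L))" "sets (gasket_image L (energy_seq_measure L f)) = sets (restrict_space borel (G L))"
    using \<mu> sets_pm gasket_eq[OF L] by auto
  show "\<mu> = gasket_image L (energy_seq_measure L f)"
  proof (rule restrict_measure_eqI[OF s _ fp])
    show "finite_measure \<mu>" using \<mu> by blast
    fix h :: "plane \<Rightarrow> real" assume h: "continuous_on UNIV h"
    define I where "I K = (\<integral>z. h z \<partial>K)" for K :: "plane measure"
    have hG: "continuous_on (G L) h" using h continuous_on_subset by blast
    have approx: "\<bar>(\<integral>z. h z \<partial>K) - (\<integral>z. g z \<partial>K)\<bar> \<le> e * measure K (space K)"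
      if K: "finite_measure K" "sets K = sets (restrict_space borel (G L))" and g: "continuous_on (G L) g"
        and hg: "\<And>z. z \<in> G L \<Longrightarrow> \<bar>h z - g z\<bar> < e" for K g e
    proof -
      interpret K: finite_measure K by fact
      have sp: "space K = G L" using sets_eq_imp_space_eq[OF K(2)] by (simp add: space_restrict_space)
      have bint: "integrable K k" if k: "continuous_on (G L) k" for k :: "plane \<Rightarrow> real"
      proof -
        obtain B where "0 \<le> B" "\<And>z. z \<in> G L \<Longrightarrow> \<bar>k z\<bar> \<le> B" using continuous_bounded_G[OF k] by blast
        moreover have "k \<in> borel_measurable K"
          using borel_measurable_continuous_on_restrict[OF k] measurable_cong_sets[OF K(2) refl] by blast
        ultimately show ?thesis by (intro K.integrable_const_bound[of _ B] AE_I2) (auto simp: sp)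
      qed
      have "(\<integral>z. h z \<partial>K) - (\<integral>z. g z \<partial>K) = (\<integral>z. h z - g z \<partial>K)"
        using bint[OF hG] bint[OF g] by simp
      also have "\<bar>\<dots>\<bar> \<le> (\<integral>z. \<bar>h z - g z\<bar> \<partial>K)" by (rule integral_abs_bound)
      also have "\<dots> \<le> (\<integral>z. e \<partial>K)"
        using bint[OF hG] bint[OF g] hg by (intro integral_mono) (auto simp: sp less_imp_le)
      finally show ?thesis by (simp add: mult.commute)
    qed
    define c where "c = measure \<mu> (space \<mu>) + measure (gasket_image L (energy_seq_measure L f)) (space (gasket_image L (energy_seq_measure L f)))"
    have "\<bar>(\<integral>z. h z \<partial>\<mu>) - (\<integral>z. h z \<partial>gasket_image L (energy_seq_measure L f))\<bar> \<le> e" if e: "0 < e" for e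
    proof -
      have c0: "0 \<le> c" by (simp add: c_def)
      then have "0 < e / (c + 1)" using e by simp
      then obtain g where g: "g \<in> dom_F p \<alpha> T L" "\<And>z. z \<in> G L \<Longrightarrow> \<bar>h z - g z\<bar> < e / (c + 1)"
        using dom_F_dense[OF L hG] by blast
      have gc: "continuous_on (G L) g" using g(1) unfolding dom_F_eq[OF L] by simp
      have "(\<integral>z. g z \<partial>\<mu>) = (\<integral>z. g z \<partial>gasket_image L (energy_seq_measure L f))" using \<mu> g(1) energy_integral[OF L f g(1)] by simp
      then have "\<bar>(\<integral>z. h z \<partial>\<mu>) - (\<integral>z. h z \<partial>gasket_image L (energy_seq_measure L f))\<bar> \<le> e / (c + 1) * c"
        using approx[OF _ s(1) gc g(2)] approx[OF fp s(2) gc g(2)] \<mu>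
        unfolding c_def distrib_left by (smt (verit))
      also have "\<dots> \<le> e" using c0 e by (simp add: field_simps)
      finally show ?thesis .
    qed
    then show "(\<integral>z. h z \<partial>\<mu>) = (\<integral>z. h z \<partial>gasket_image L (energy_seq_measure L f))"
      by (metis abs_le_zero_iff eq_iff_diff_eq_0 field_le_epsilon add_0)
  qed
qed

end

section \<open>A criterion for singularity\<close>

context gasket_letters
begin

text \<open>A point in the cell at corner \<open>i\<close> has \<open>i\<close>-th barycentric
  coordinate at least (\<nu> - 1)/\<nu>, hence at least 1/2. Three such coordinates cannot sum to
  1.\<close>

lemma cell_missing:
  assumes \<nu>: "\<nu> \<ge> 2" and z: "z \<in> triangle p"
  shows "\<exists>i\<in>S0. z \<notin> psi \<alpha> (\<nu>, i) ` triangle p"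
proof (rule ccontr)
  assume "\<not> ?thesis"
  then have all: "z \<in> psi \<alpha> (\<nu>, i) ` triangle p" if "i \<in> S0" for i using that by blast
  obtain t where t: "z = bary_point t" "sum t S0 = 1" using z by (rule triangle_obtain) blast
  have "1/2 \<le> t i" if i: "i \<in> S0" for i
  proof -
    obtain y where y: "y \<in> triangle p" "z = psi \<alpha> (\<nu>, i) y" using all[OF i] by blast
    obtain s where s: "y = bary_point s" "\<And>a. a \<in> S0 \<Longrightarrow> 0 \<le> s a" "sum s S0 = 1" using y(1) by (rule triangle_obtain) blast
    note l = S0_letters[OF \<nu> i]
    have eq: "bary_point t = bary_point (\<lambda>a. (s a + cell_offset (\<nu>, i) a) / \<nu>)" using t(1) y(2) s(1) psi_pt[OF \<nu> l] by simp
    have "t i = (s i + cell_offset (\<nu>, i) i) / \<nu>" by (rule bary_point_eqD[OF eq t(2) sum_psi[OF \<nu> l s(3)] i])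
    also have "\<dots> = (s i + (real \<nu> - 1)) / \<nu>" using cell_offset_corner[OF \<nu> i i] \<nu> by (simp add: of_nat_diff)
    also have "\<dots> \<ge> 1/2" using s(2)[OF i] \<nu> by (simp add: field_simps)
    finally show ?thesis .
  qed
  from this[of 1] this[of 2] this[of 3] show False using t(2) by (simp add: sum_S0 S0_def)
qed

text \<open>Among the children of any cell containing \<open>z\<close>, one at a corner misses
  \<open>z\<close>. With \<open>c\<close> the least weight of a corner letter, the mass of all
  level-\<open>m\<close> words whose cells contain \<open>z\<close> shrinks by the factor
  \<open>1 - c\<close> per level. The sum runs over all such words because a vertex lies in several
  cells.\<close>

lemma lambda_point_null:
  assumes L: "T_valued L" and q: "q \<in> weights T"
  shows "emeasure (lambda_q T L q) {\<omega> \<in> Sigma_t T L. proj p \<alpha> \<omega> = z} = 0"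
proof -
  let ?M = "lambda_q T L q" and ?b = "\<lambda>w. prod_list (map q w)"
  note M = tree_measure_lambda(1)[OF L q]
  interpret prob_space ?M by (rule tree_measure_lambda(2)[OF L q])
  define c where "c = Min ((\<lambda>(\<nu>, i). q (\<nu>, i)) ` (T \<times> S0))"
  have "c \<in> (\<lambda>(\<nu>, i). q (\<nu>, i)) ` (T \<times> S0)" unfolding c_def using finT neT by (intro Min_in) (auto simp: S0_def)
  then have c: "0 < c" using q letters_alphabet S0_letters T2 by (fastforce simp: weights_def)
  have cle: "c \<le> q (\<nu>, i)" if "\<nu> \<in> T" "i \<in> S0" for \<nu> i
    unfolding c_def using finT that by (intro Min_le) (auto intro!: image_eqI[of _ _ "(\<nu>, i)"])
  define P where "P m = (\<Sum>w\<in>Wt L m \<inter> {w. z \<in> K w}. ?b w)" for m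
  have P: "P m = (\<Sum>w\<in>Wt L m. if z \<in> K w then ?b w else 0)" for m
    unfolding P_def by (subst sum.inter_restrict) auto
  have bpos: "0 < ?b w" if "w \<in> Wt L m" for w m by (rule weights_nonneg[OF q Wt_Words[OF L that]])
  have step: "P (Suc m) \<le> (1 - c) * P m" for m
  proof -
    have "P (Suc m) \<le> (\<Sum>w\<in>Wt L m. (1 - c) * (if z \<in> K w then ?b w else 0))"
      unfolding P sum_Wt_Suc
    proof (rule sum_mono)
      fix w assume w: "w \<in> Wt L m"
      have \<nu>: "L w \<in> T" by (rule T_valued_Wt[OF L w])
      have vW: "v \<in> letters (L w) \<Longrightarrow> [v] \<in> Words T" for v using letters_alphabet[OF \<nu>] by simp
      show "(\<Sum>v\<in>letters (L w). if z \<in> K (w @ [v]) then ?b (w @ [v]) else 0) \<le> (1 - c) * (if z \<in> K w then ?b w else 0)"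
      proof (cases "z \<in> K w")
        case False
        then have "z \<notin> K (w @ [v])" if "v \<in> letters (L w)" for v using K_append[OF vW[OF that], of w] by blast
        then show ?thesis using False by simp
      next
        case True
        then obtain y where y: "y \<in> triangle p" "z = psi_word \<alpha> w y" by blast
        obtain i where i: "i \<in> S0" "y \<notin> psi \<alpha> (L w, i) ` triangle p" using cell_missing[OF T2[OF \<nu>] y(1)] by blast
        let ?v = "(L w, i)"
        have v: "?v \<in> letters (L w)" by (rule S0_letters[OF T2[OF \<nu>] i(1)])
        have nz: "z \<notin> K (w @ [?v])"
          using i(2) y(2) psi_word_inj[OF Wt_Words[OF L w]] by (auto simp: psi_word_append)
        have "(\<Sum>v\<in>letters (L w). if z \<in> K (w @ [v]) then ?b (w @ [v]) else 0) \<le>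
           (\<Sum>v\<in>letters (L w). ?b (w @ [v]) - (if v = ?v then ?b (w @ [v]) else 0))"
        proof (rule sum_mono)
          fix v' assume "v' \<in> letters (L w)"
          then have "w @ [v'] \<in> Wt L (Suc m)" using w Wt_snoc_iff by blast
          then have "0 < ?b (w @ [v'])" by (rule bpos)
          then show "(if z \<in> K (w @ [v']) then ?b (w @ [v']) else 0) \<le> ?b (w @ [v']) - (if v' = ?v then ?b (w @ [v']) else 0)"
            using nz by (cases "v' = ?v") auto
        qed
        also have "\<dots> = (\<Sum>v\<in>letters (L w). ?b (w @ [v])) - ?b (w @ [?v])"
          using v by (simp add: sum_subtractf)
        also have "\<dots> = ?b w * (1 - q ?v)"
          using q \<nu> by (simp add: weights_def right_diff_distrib flip: sum_distrib_left)
        also have "\<dots> \<le> ?b w * (1 - c)" using cle[OF \<nu> i(1)] bpos[OF w] by (intro mult_left_mono) auto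
        finally show ?thesis using True by (simp add: mult.commute)
      qed
    qed
    then show ?thesis by (simp add: P sum_distrib_left)
  qed
  have P0: "P 0 \<le> 1" unfolding P Wt.simps by simp
  have Pnn: "0 \<le> P m" for m unfolding P_def using bpos by (intro sum_nonneg) (auto simp: less_imp_le)
  have "c \<le> 1"
  proof -
    obtain \<nu> where \<nu>: "\<nu> \<in> T" using neT by blast
    have v: "(\<nu>, 1) \<in> letters \<nu>" using S0_letters[OF T2[OF \<nu>], of 1] by (simp add: S0_def)
    have "q (\<nu>, 1) \<le> (\<Sum>v\<in>letters \<nu>. q v)"
      using q letters_alphabet[OF \<nu>] by (intro member_le_sum v) (auto simp: weights_def less_imp_le)
    then show ?thesis using cle[OF \<nu>, of 1] q \<nu> by (simp add: weights_def S0_def)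
  qed
  have Pm: "P m \<le> (1 - c) ^ m" for m
  proof (induction m)
    case (Suc m)
    have "P (Suc m) \<le> (1 - c) * P m" by (rule step)
    also have "\<dots> \<le> (1 - c) * (1 - c) ^ m" using Suc \<open>c \<le> 1\<close> by (intro mult_left_mono) auto
    finally show ?case by simp
  qed (use P0 in simp)
  let ?S = "{\<omega> \<in> Sigma_t T L. proj p \<alpha> \<omega> = z}"
  have "measure ?M ?S \<le> (1 - c) ^ m" for m
  proof -
    have "measure ?M ?S \<le> measure ?M {\<omega> \<in> Sigma_sp T. prefix_of \<omega> m \<in> Wt L m \<inter> {w. z \<in> K w}}"
      using proj_mem Sigma_t_sp Sigma_t_Wt
      by (intro finite_measure_mono sets_prefix_in[OF tree_measureD(1)[OF M]]) fastforce
    also have "\<dots> = P m"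
      by (subst measure_prefix[OF L M]) (auto simp: P_def Wt_Words[OF L] Wt_length intro!: sum.cong)
    finally show ?thesis using Pm[of m] by simp
  qed
  moreover have "(\<lambda>m. (1 - c) ^ m) \<longlonglongrightarrow> 0" using c \<open>c \<le> 1\<close> by (intro LIMSEQ_power_zero) auto
  ultimately have "measure ?M ?S \<le> 0" by (intro LIMSEQ_le_const) auto
  then show ?thesis by (simp add: emeasure_eq_measure measure_le_0_iff)
qed

text \<open>At a level where the affinity is below 2^-k, compare the two masses of each word. Words
  on which the energy mass is the smaller one carry energy mass below 2^-k, the remaining words
  carry reference mass below 2^-k. Borel-Cantelli along a sequence of levels separates the
  measures.\<close>

lemma singular_criterion:
  assumes L: "T_valued L" and q: "q \<in> weights T" and f: "f \<in> dom_F p \<alpha> T L"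
    and Z: "\<And>e. 0 < e \<Longrightarrow> \<exists>m. (\<Sum>w\<in>Wt L m. sqrt (prod_list (map q w) * (2 * cell_energy L f w))) < e"
  shows "mutually_singular (energy_measure p \<alpha> T L f) (mu_q p \<alpha> T L q)"
proof -
  have ff: "finite_energy L f" using f unfolding dom_F_eq[OF L] by simp
  let ?N = "energy_seq_measure L f" and ?M = "lambda_q T L q"
  note N = energy_seq_measure[OF L ff] and M = tree_measure_lambda(1)[OF L q]
  note sN = tree_measureD(1)[OF N] and sM = tree_measureD(1)[OF M]
  interpret M: prob_space ?M by (rule tree_measure_lambda(2)[OF L q])
  interpret N: finite_measure ?N by (rule tree_measureD(2)[OF N])
  let ?b = "\<lambda>w. prod_list (map q w)" and ?e = "\<lambda>w. 2 * cell_energy L f w"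
  have b0: "0 \<le> ?b w" and e0: "0 \<le> ?e w" if "w \<in> Wt L m" for w m
    using weights_nonneg[OF q Wt_Words[OF L that]] cell_energy_nonneg[OF L ff that] by auto
  have "\<forall>k. \<exists>m. (\<Sum>w\<in>Wt L m. sqrt (?b w * ?e w)) < (1/2) ^ k" using Z by simp
  then obtain n where n: "\<And>k. (\<Sum>w\<in>Wt L (n k). sqrt (?b w * ?e w)) < (1/2) ^ k" by metis
  define X where "X k = {w \<in> Wt L (n k). ?e w \<le> ?b w}" for k
  define Y where "Y k = {w \<in> Wt L (n k). \<not> ?e w \<le> ?b w}" for k
  \<comment> \<open>The upper limit of the cells with small energy mass. Off the vertices, lying in
    the cell of \<open>w\<close> means that the coding sequence starts with \<open>w\<close>, so
    statements about prefixes transfer to points; the reference measure loses nothing at the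
    vertices.\<close>
  define A where "A = gasket p \<alpha> T L \<inter> (\<Inter>j. \<Union>k\<in>{j..}. \<Union>w\<in>X k. K w) - all_vertices L"
  have prX: "measure ?N {\<omega> \<in> Sigma_sp T. prefix_of \<omega> (n k) \<in> X k} \<le> (1/2) ^ k" for k
  proof -
    have "measure ?N {\<omega> \<in> Sigma_sp T. prefix_of \<omega> (n k) \<in> X k} = (\<Sum>w\<in>X k \<inter> Wt L (n k). ?e w)"
      by (rule measure_prefix[OF L N]) (auto simp: X_def Wt_Words[OF L] Wt_length)
    also have "\<dots> \<le> (\<Sum>w\<in>Wt L (n k). sqrt (?b w * ?e w))"
    proof (rule sum_le_included[of _ _ _ "\<lambda>w. w"])
      show "\<forall>w\<in>X k \<inter> Wt L (n k). \<exists>w'\<in>Wt L (n k). w' = w \<and> ?e w \<le> sqrt (?b w' * ?e w')"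
      proof
        fix w assume w: "w \<in> X k \<inter> Wt L (n k)"
        \<comment> \<open>The smaller of two nonnegative numbers is at most their geometric
          mean.\<close>
        then have "?e w * ?e w \<le> ?b w * ?e w" using e0 by (intro mult_right_mono) (auto simp: X_def)
        then have "?e w \<le> sqrt (?b w * ?e w)" using e0 w by (intro real_le_rsqrt) (auto simp: power2_eq_square)
        then show "\<exists>w'\<in>Wt L (n k). w' = w \<and> ?e w \<le> sqrt (?b w' * ?e w')" using w by blast
      qed
    qed (use b0 e0 in \<open>auto simp: mult_nonneg_nonneg simp del: mult_numeral_1\<close>)
    finally show ?thesis using n[of k] by simp
  qed
  have prY: "measure ?M {\<omega> \<in> Sigma_sp T. prefix_of \<omega> (n k) \<in> Y k} \<le> (1/2) ^ k" for k
  proof -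
    have "measure ?M {\<omega> \<in> Sigma_sp T. prefix_of \<omega> (n k) \<in> Y k} = (\<Sum>w\<in>Y k \<inter> Wt L (n k). ?b w)"
      by (rule measure_prefix[OF L M]) (auto simp: Y_def Wt_Words[OF L] Wt_length)
    also have "\<dots> \<le> (\<Sum>w\<in>Wt L (n k). sqrt (?b w * ?e w))"
    proof (rule sum_le_included[of _ _ _ "\<lambda>w. w"])
      show "\<forall>w\<in>Y k \<inter> Wt L (n k). \<exists>w'\<in>Wt L (n k). w' = w \<and> ?b w \<le> sqrt (?b w' * ?e w')"
      proof
        fix w assume w: "w \<in> Y k \<inter> Wt L (n k)"
        then have "?b w * ?b w \<le> ?b w * ?e w" using b0 by (intro mult_left_mono) (auto simp: Y_def)
        then have "?b w \<le> sqrt (?b w * ?e w)" using b0 w by (intro real_le_rsqrt) (auto simp: power2_eq_square)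
        then show "\<exists>w'\<in>Wt L (n k). w' = w \<and> ?b w \<le> sqrt (?b w' * ?e w')" using w by blast
      qed
    qed (use b0 e0 in \<open>auto simp: mult_nonneg_nonneg simp del: mult_numeral_1\<close>)
    finally show ?thesis using n[of k] by simp
  qed
  have geo: "summable (\<lambda>k. (1/2::real) ^ k)" by (rule summable_geometric) simp
  have AEN: "AE \<omega> in ?N. eventually (\<lambda>k. \<omega> \<in> space ?N - {\<omega> \<in> Sigma_sp T. prefix_of \<omega> (n k) \<in> X k}) sequentially"
  proof (rule borel_cantelli_AE1)
    show "{\<omega> \<in> Sigma_sp T. prefix_of \<omega> (n k) \<in> X k} \<in> sets ?N" for k by (rule sets_prefix_in[OF sN])
    show "emeasure ?N {\<omega> \<in> Sigma_sp T. prefix_of \<omega> (n k) \<in> X k} < \<infinity>" for k by (simp add: N.emeasure_eq_measure)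
    show "summable (\<lambda>k. measure ?N {\<omega> \<in> Sigma_sp T. prefix_of \<omega> (n k) \<in> X k})"
      by (rule summable_comparison_test'[OF geo]) (use prX in simp)
  qed
  have AEM: "AE \<omega> in ?M. eventually (\<lambda>k. \<omega> \<in> space ?M - {\<omega> \<in> Sigma_sp T. prefix_of \<omega> (n k) \<in> Y k}) sequentially"
  proof (rule borel_cantelli_AE1)
    show "{\<omega> \<in> Sigma_sp T. prefix_of \<omega> (n k) \<in> Y k} \<in> sets ?M" for k by (rule sets_prefix_in[OF sM])
    show "emeasure ?M {\<omega> \<in> Sigma_sp T. prefix_of \<omega> (n k) \<in> Y k} < \<infinity>" for k by (simp add: M.emeasure_eq_measure)
    show "summable (\<lambda>k. measure ?M {\<omega> \<in> Sigma_sp T. prefix_of \<omega> (n k) \<in> Y k})"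
      by (rule summable_comparison_test'[OF geo]) (use prY in simp)
  qed
  have AEV: "AE \<omega> in ?M. \<omega> \<in> Sigma_t T L \<longrightarrow> proj p \<alpha> \<omega> \<notin> all_vertices L"
  proof -
    have pmeas: "{\<omega> \<in> Sigma_t T L. proj p \<alpha> \<omega> = z} \<in> sets ?M" for z
    proof (cases "z \<in> gasket p \<alpha> T L")
      case True
      let ?R = "restrict_space ?M (Sigma_t T L)"
      have sp: "space ?R = Sigma_t T L"
        using sets.sets_into_space[OF sets_Sigma_t[OF sM]] by (auto simp: space_restrict_space)
      have zs: "{z} \<in> sets (restrict_space borel (gasket p \<alpha> T L))"
        using True by (auto simp: sets_restrict_space image_iff intro!: bexI[of _ "{z}"])
      have "{\<omega> \<in> Sigma_t T L. proj p \<alpha> \<omega> = z} = proj p \<alpha> -` {z} \<inter> space ?R"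
        by (auto simp: sp)
      then have "{\<omega> \<in> Sigma_t T L. proj p \<alpha> \<omega> = z} \<in> sets ?R"
        using measurable_sets[OF proj_measurable[OF sM] zs] by metis
      then show ?thesis
        using sets_Sigma_t[OF sM, of L] sets.sets_into_space[OF sets_Sigma_t[OF sM, of L]]
        by (subst (asm) sets_restrict_space_iff) (auto simp: Int_absorb2)
    next
      case False
      then have "{\<omega> \<in> Sigma_t T L. proj p \<alpha> \<omega> = z} = {}" using proj_Sigma_t by blast
      then show ?thesis by (simp only: sets.empty_sets)
    qed
    have "AE \<omega> in ?M. \<forall>z\<in>all_vertices L. \<omega> \<notin> {\<omega> \<in> Sigma_t T L. proj p \<alpha> \<omega> = z}"
      unfolding AE_ball_countable[OF countable_Vst]
    proof
      fix z
      show "AE \<omega> in ?M. \<omega> \<notin> {\<omega> \<in> Sigma_t T L. proj p \<alpha> \<omega> = z}"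
        by (intro AE_not_in) (use pmeas[of z] lambda_point_null[OF L q, of z] in \<open>auto simp: null_sets_def\<close>)
    qed
    then show ?thesis by eventually_elim blast
  qed
  have AS: "A \<in> sets (restrict_space borel (gasket p \<alpha> T L))"
  proof -
    have "countable (all_vertices L)" by (rule countable_Vst)
    then have "all_vertices L \<in> sets borel" by (rule sets.countable[rotated]) auto
    moreover have "(\<Inter>j. \<Union>k\<in>{j..}. \<Union>w\<in>X k. K w) \<in> sets borel"
    proof -
      have "compact (\<Union>w\<in>X k. K w)" for k by (intro compact_UN compact_K) (simp add: X_def)
      then have U: "(\<Union>w\<in>X k. K w) \<in> sets borel" for k by (rule borel_compact)
      have "(\<Union>k\<in>{j..}. \<Union>w\<in>X k. K w) \<in> sets borel" for j
        by (rule sets.countable_UN'') (auto simp: U)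
      then show ?thesis by (intro sets.countable_INT'') auto
    qed
    ultimately have B: "(\<Inter>j. \<Union>k\<in>{j..}. \<Union>w\<in>X k. K w) - all_vertices L \<in> sets borel" by blast
    show ?thesis unfolding A_def sets_restrict_space by (rule image_eqI[OF _ B]) auto
  qed
  have mu: "mu_q p \<alpha> T L q = gasket_image L ?M" by (simp add: mu_q_def gasket_image_def)
  have spm: "space (gasket_image L ?M) = gasket p \<alpha> T L" by (simp add: gasket_image_def space_restrict_space)
  have AC: "gasket p \<alpha> T L - A \<in> sets (restrict_space borel (gasket p \<alpha> T L))"
    using sets.compl_sets[OF AS] by (simp add: space_restrict_space)
  have NA: "emeasure (gasket_image L ?N) A = 0"
  proof -
    have "AE \<omega> in ?N. \<not> (\<omega> \<in> Sigma_t T L \<and> proj p \<alpha> \<omega> \<in> A)"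
      using AEN
    proof eventually_elim
      case (elim \<omega>)
      show ?case
      proof
        assume "\<omega> \<in> Sigma_t T L \<and> proj p \<alpha> \<omega> \<in> A"
        then have \<omega>: "\<omega> \<in> Sigma_t T L" "proj p \<alpha> \<omega> \<in> A" by auto
        obtain j where j: "\<And>k. k \<ge> j \<Longrightarrow> prefix_of \<omega> (n k) \<notin> X k"
          using elim Sigma_t_sp[OF \<omega>(1)] unfolding eventually_sequentially by auto
        have "proj p \<alpha> \<omega> \<in> (\<Union>k\<in>{j..}. \<Union>w\<in>X k. K w)" using \<omega>(2) unfolding A_def by blast
        then obtain k w where kw: "j \<le> k" "w \<in> X k" "proj p \<alpha> \<omega> \<in> K w" by auto
        have wW: "w \<in> Wt L (n k)" using kw(2) by (simp add: X_def)
        have "proj p \<alpha> \<omega> \<notin> all_vertices L" using \<omega>(2) unfolding A_def by blast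
        then have "prefix_of \<omega> (n k) = w"
          using K_inter[OF L Sigma_t_Wt[OF \<omega>(1)] wW _ proj_mem[OF Sigma_t_sp[OF \<omega>(1)]] kw(3)] by blast
        then show False using j[OF kw(1)] kw(2) by simp
      qed
    qed
    then have "emeasure ?N {\<omega> \<in> space ?N. \<omega> \<in> Sigma_t T L \<and> proj p \<alpha> \<omega> \<in> A} = 0" by (rule emeasure_eq_0_AE)
    moreover have "{\<omega> \<in> space ?N. \<omega> \<in> Sigma_t T L \<and> proj p \<alpha> \<omega> \<in> A} = {\<omega> \<in> Sigma_t T L. proj p \<alpha> \<omega> \<in> A}"
      unfolding tree_measureD(3)[OF N] using Sigma_t_sp by blast
    ultimately show ?thesis unfolding emeasure_pm[OF sN AS] by simp
  qed
  have MA: "emeasure (gasket_image L ?M) (gasket p \<alpha> T L - A) = 0"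
  proof -
    have "AE \<omega> in ?M. \<not> (\<omega> \<in> Sigma_t T L \<and> proj p \<alpha> \<omega> \<in> gasket p \<alpha> T L - A)"
      using AEM AEV
    proof eventually_elim
      case (elim \<omega>)
      show ?case
      proof
        assume "\<omega> \<in> Sigma_t T L \<and> proj p \<alpha> \<omega> \<in> gasket p \<alpha> T L - A"
        then have \<omega>: "\<omega> \<in> Sigma_t T L" "proj p \<alpha> \<omega> \<notin> A" by auto
        obtain j where j: "\<And>k. k \<ge> j \<Longrightarrow> prefix_of \<omega> (n k) \<notin> Y k"
          using elim(1) Sigma_t_sp[OF \<omega>(1)] unfolding eventually_sequentially by auto
        have X: "prefix_of \<omega> (n k) \<in> X k" if "k \<ge> j" for k
          using j[OF that] Sigma_t_Wt[OF \<omega>(1), of "n k"] by (auto simp: X_def Y_def)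
        have "proj p \<alpha> \<omega> \<in> (\<Union>k\<in>{i..}. \<Union>w\<in>X k. K w)" for i
          using X[of "max i j"] proj_mem[OF Sigma_t_sp[OF \<omega>(1)], of "n (max i j)"] by (intro UN_I[of "max i j"] UN_I[of "prefix_of \<omega> (n (max i j))"]) auto
        then show False using \<omega> elim(2) proj_Sigma_t[OF \<omega>(1)] unfolding A_def by blast
      qed
    qed
    then have "emeasure ?M {\<omega> \<in> space ?M. \<omega> \<in> Sigma_t T L \<and> proj p \<alpha> \<omega> \<in> gasket p \<alpha> T L - A} = 0" by (rule emeasure_eq_0_AE)
    moreover have "{\<omega> \<in> space ?M. \<omega> \<in> Sigma_t T L \<and> proj p \<alpha> \<omega> \<in> gasket p \<alpha> T L - A} = {\<omega> \<in> Sigma_t T L. proj p \<alpha> \<omega> \<in> gasket p \<alpha> T L - A}"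
      unfolding tree_measureD(3)[OF M] using Sigma_t_sp by blast
    ultimately show ?thesis unfolding emeasure_pm[OF sM AC] by simp
  qed
  show ?thesis
    unfolding mutually_singular_def energy_measure_eq[OF L f] mu spm
    using AS NA MA sets_pm by blast
qed

section \<open>Energy masses of piecewise harmonic functions\<close>

primrec harm_restr_word :: "letter list \<Rightarrow> (nat \<Rightarrow> real) \<Rightarrow> nat \<Rightarrow> real" where
  "harm_restr_word [] x = x"
| "harm_restr_word (v # w) x = harm_restr_word w (harm_restr v x)"

lemma harm_restr_word_append: "harm_restr_word (w @ w') x = harm_restr_word w' (harm_restr_word w x)"
  by (induction w arbitrary: x) auto

lemma harm_restr_word_lin: "harm_restr_word w (\<lambda>a. c * x a + c' * y a) = (\<lambda>a. c * harm_restr_word w x a + c' * harm_restr_word w y a)"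
  by (induction w arbitrary: x y) (auto simp: harm_restr_lin)

lemma EL_Pn_right: "T_valued L \<Longrightarrow> EL L (n + m) g (pw_harm n L f) = EL L n g f"
proof -
  assume L: "T_valued L"
  have "EL L (n + m) g (pw_harm n L f) = (\<Sum>w\<in>Wt L n. 1 / rw w * qf (cell_values g w) (cell_values f w))"
    unfolding EL_add
  proof (intro sum.cong refl arg_cong2[of _ _ _ _ "(*)"])
    fix w assume w: "w \<in> Wt L n"
    have "EL (subenv L w) m (g \<circ> psi_word \<alpha> w) (pw_harm n L f \<circ> psi_word \<alpha> w) = EL (subenv L w) m (g \<circ> psi_word \<alpha> w) (harm_ext (subenv L w) (cell_values f w))"
      by (rule EL_cong[OF T_valued_sh_Wt[OF L w]]) (simp_all add: pw_harm_word[OF L w])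
    also have "\<dots> = qf (cell_values g w) (cell_values f w)" unfolding EL_Finf_right[OF T_valued_sh_Wt[OF L w]] by (simp add: cell_values_def)
    finally show "EL (subenv L w) m (g \<circ> psi_word \<alpha> w) (pw_harm n L f \<circ> psi_word \<alpha> w) = qf (cell_values g w) (cell_values f w)" .
  qed
  then show ?thesis unfolding EL_eq .
qed

text \<open>Pythagoras: the piecewise harmonic interpolation is an orthogonal projection for the
  energy, because pairing with it only sees level \<open>n\<close>. The energy of the error is
  therefore the energy gained after level \<open>n\<close>, which tends to 0.\<close>

lemma EL_diff_Pn: "T_valued L \<Longrightarrow> EL L (n + m) (\<lambda>z. f z - pw_harm n L f z) (\<lambda>z. f z - pw_harm n L f z) = EL L (n + m) f f - EL L n f f"
  unfolding EL_linear EL_linear_right using EL_Pn_right[of L n m f f] EL_Pn_right[of L n m "pw_harm n L f" f]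
    EL_Pn_right[of L n 0 f f] EL_Pn_right[of L n m f f] EL_sym[of L "n + m" f "pw_harm n L f"] EL_sym[of L n "pw_harm n L f" f]
  by simp

lemma total_energy_diff_Pn:
  assumes L: "T_valued L" and f: "finite_energy L f"
  shows "finite_energy L (\<lambda>z. f z - pw_harm n L f z)" "total_energy L (\<lambda>z. f z - pw_harm n L f z) = total_energy L f - EL L n f f"
proof -
  have "(\<lambda>m. EL L (n + m) f f - EL L n f f) \<longlonglongrightarrow> total_energy L f - EL L n f f"
    using LIMSEQ_ignore_initial_segment[OF total_energy_tendsto[OF f], of n]
    by (intro tendsto_diff tendsto_const) (simp add: add.commute)
  then have "(\<lambda>m. EL L (m + n) (\<lambda>z. f z - pw_harm n L f z) (\<lambda>z. f z - pw_harm n L f z)) \<longlonglongrightarrow> total_energy L f - EL L n f f"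
    using EL_diff_Pn[OF L, of n] by (simp add: add.commute)
  then have lim: "(\<lambda>m. EL L m (\<lambda>z. f z - pw_harm n L f z) (\<lambda>z. f z - pw_harm n L f z)) \<longlonglongrightarrow> total_energy L f - EL L n f f"
    by (rule LIMSEQ_offset)
  then show "finite_energy L (\<lambda>z. f z - pw_harm n L f z)" unfolding finite_energy_def convergent_def by blast
  then show "total_energy L (\<lambda>z. f z - pw_harm n L f z) = total_energy L f - EL L n f f"
    using LIMSEQ_unique[OF total_energy_tendsto lim] by blast
qed

lemma harm_ext_word: "T_valued L \<Longrightarrow> w \<in> Wt L m \<Longrightarrow> z \<in> G (subenv L w) \<Longrightarrow> harm_ext L x (psi_word \<alpha> w z) = harm_ext (subenv L w) (harm_restr_word w x) z"
proof (induction m arbitrary: L w x)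
  case (Suc m)
  obtain v u where w: "w = v # u" "v \<in> letters (L [])" "u \<in> Wt (subenv L [v]) m" using Suc.prems(2) by (rule Wt_SucE)
  note okv = T_valued_sh1[OF Suc.prems(1) w(2)]
  have zG: "z \<in> G (subenv (subenv L [v]) u)" using Suc.prems(3) w(1) by simp
  have "harm_ext L x (psi_word \<alpha> w z) = harm_ext (subenv L [v]) (harm_restr v x) (psi_word \<alpha> u z)"
    unfolding w(1) using harm_ext_psi[OF Suc.prems(1) w(2) psi_word_G[OF okv w(3) zG]] by simp
  also have "\<dots> = harm_ext (subenv (subenv L [v]) u) (harm_restr_word u (harm_restr v x)) z" by (rule Suc.IH[OF okv w(3) zG])
  finally show ?case by (simp add: w(1))
qed simp

lemma cell_energy_Pn:
  assumes L: "T_valued L" and w: "w \<in> Wt L n" and u: "u \<in> Wt (subenv L w) m"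
  shows "cell_energy L (pw_harm n L f) (w @ u) = 1 / rw w * (1 / rw u * qf (harm_restr_word u (cell_values f w)) (harm_restr_word u (cell_values f w)))"
proof -
  note okw = T_valued_sh_Wt[OF L w]
  note oku = T_valued_sh_Wt[OF okw u]
  have e: "EL (subenv L (w @ u)) k (pw_harm n L f \<circ> psi_word \<alpha> (w @ u)) (pw_harm n L f \<circ> psi_word \<alpha> (w @ u)) = qf (harm_restr_word u (cell_values f w)) (harm_restr_word u (cell_values f w))" for k
  proof -
    have "pw_harm n L f (psi_word \<alpha> w (psi_word \<alpha> u z)) = harm_ext (subenv (subenv L w) u) (harm_restr_word u (cell_values f w)) z" if z: "z \<in> G (subenv (subenv L w) u)" for z
      using pw_harm_word[OF L w psi_word_G[OF okw u z]] harm_ext_word[OF okw u z] by simp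
    then have "EL (subenv (subenv L w) u) k (pw_harm n L f \<circ> psi_word \<alpha> (w @ u)) (pw_harm n L f \<circ> psi_word \<alpha> (w @ u)) =
       EL (subenv (subenv L w) u) k (harm_ext (subenv (subenv L w) u) (harm_restr_word u (cell_values f w))) (harm_ext (subenv (subenv L w) u) (harm_restr_word u (cell_values f w)))"
      by (intro EL_cong[OF oku]) (simp_all add: psi_word_append del: subenv_sh)
    then show ?thesis using EL_Finf[OF oku] by simp
  qed
  have "total_energy (subenv L (w @ u)) (pw_harm n L f \<circ> psi_word \<alpha> (w @ u)) = qf (harm_restr_word u (cell_values f w)) (harm_restr_word u (cell_values f w))"
    unfolding total_energy_def e by (rule limI[OF tendsto_const])
  then show ?thesis unfolding cell_energy_def r_word_append by simp
qed

lemma cell_energy_le: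
  assumes L: "T_valued L" and f: "finite_energy L f" and g: "finite_energy L g" and d: "finite_energy L (\<lambda>z. f z - g z)" and w: "w \<in> Wt L m"
  shows "cell_energy L f w \<le> 2 * cell_energy L g w + 2 * cell_energy L (\<lambda>z. f z - g z) w"
proof -
  let ?d = "\<lambda>z. f z - g z" and ?L = "subenv L w"
  note okw = T_valued_sh_Wt[OF L w]
  have d': "finite_energy ?L (\<lambda>z. f (psi_word \<alpha> w z) - g (psi_word \<alpha> w z))" using finite_energy_sub[OF L d w] by (simp add: comp_def)
  have f': "finite_energy ?L (\<lambda>z. f (psi_word \<alpha> w z))" and g': "finite_energy ?L (\<lambda>z. g (psi_word \<alpha> w z))"
    using finite_energy_sub[OF L f w] finite_energy_sub[OF L g w] by (simp_all add: comp_def)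
  have "total_energy ?L (\<lambda>z. f (psi_word \<alpha> w z)) \<le> 2 * total_energy ?L (\<lambda>z. g (psi_word \<alpha> w z)) + 2 * total_energy ?L (\<lambda>z. f (psi_word \<alpha> w z) - g (psi_word \<alpha> w z))"
  proof (rule LIMSEQ_le[OF total_energy_tendsto[OF f']])
    show "(\<lambda>m. 2 * EL ?L m (\<lambda>z. g (psi_word \<alpha> w z)) (\<lambda>z. g (psi_word \<alpha> w z)) +
      2 * EL ?L m (\<lambda>z. f (psi_word \<alpha> w z) - g (psi_word \<alpha> w z)) (\<lambda>z. f (psi_word \<alpha> w z) - g (psi_word \<alpha> w z))) \<longlonglongrightarrow>
      2 * total_energy ?L (\<lambda>z. g (psi_word \<alpha> w z)) + 2 * total_energy ?L (\<lambda>z. f (psi_word \<alpha> w z) - g (psi_word \<alpha> w z))"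
      by (intro tendsto_intros total_energy_tendsto d' g')
    have "EL ?L m F F \<le> 2 * EL ?L m H H + 2 * EL ?L m (\<lambda>z. F z - H z) (\<lambda>z. F z - H z)" for m F H
    proof -
      \<comment> \<open>The difference of the two sides of the claim is exactly the energy of
        \<open>F - 2 * H\<close>.\<close>
      have "0 \<le> EL ?L m (\<lambda>z. F z - 2 * H z) (\<lambda>z. F z - 2 * H z)" by (rule EL_nonneg[OF okw])
      then show ?thesis unfolding EL_linear EL_linear_right using EL_sym[of ?L m F H] by simp
    qed
    then show "\<exists>N. \<forall>m\<ge>N. EL ?L m (\<lambda>z. f (psi_word \<alpha> w z)) (\<lambda>z. f (psi_word \<alpha> w z)) \<le> 2 * EL ?L m (\<lambda>z. g (psi_word \<alpha> w z)) (\<lambda>z. g (psi_word \<alpha> w z)) +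
      2 * EL ?L m (\<lambda>z. f (psi_word \<alpha> w z) - g (psi_word \<alpha> w z)) (\<lambda>z. f (psi_word \<alpha> w z) - g (psi_word \<alpha> w z))" by blast
  qed
  then have "1 / rw w * total_energy ?L (\<lambda>z. f (psi_word \<alpha> w z)) \<le> 1 / rw w * (2 * total_energy ?L (\<lambda>z. g (psi_word \<alpha> w z)) + 2 * total_energy ?L (\<lambda>z. f (psi_word \<alpha> w z) - g (psi_word \<alpha> w z)))"
    using rw_pos[OF Wt_Words[OF L w]] by (intro mult_left_mono) auto
  then show ?thesis unfolding cell_energy_def comp_def distrib_left by simp
qed

text \<open>Affinity between the reference measure and the energy of the harmonic function with
  corner values \<open>x\<close>. The factor 2 of the energy measure is left out, which changes the
  affinity only by a constant factor.\<close>

definition hellinger :: "(letter list \<Rightarrow> nat) \<Rightarrow> (letter \<Rightarrow> real) \<Rightarrow> (nat \<Rightarrow> real) \<Rightarrow> nat \<Rightarrow> real" where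
  "hellinger L q x n = (\<Sum>w\<in>Wt L n. sqrt (prod_list (map q w) * (1 / rw w * qf (harm_restr_word w x) (harm_restr_word w x))))"

lemma qf_3: "qf (\<lambda>a. x a + y a + z a) (\<lambda>a. x a + y a + z a) \<le> 3 * qf x x + 3 * qf y y + 3 * qf z z"
proof -
  have "0 \<le> qf (\<lambda>a. x a - y a) (\<lambda>a. x a - y a)" "0 \<le> qf (\<lambda>a. y a - z a) (\<lambda>a. y a - z a)" "0 \<le> qf (\<lambda>a. x a - z a) (\<lambda>a. x a - z a)"
    by (rule qf_nonneg)+
  then show ?thesis unfolding qf_linear using qf_sym[of x y] qf_sym[of x z] qf_sym[of y z] by simp
qed

definition unit_vec :: "nat \<Rightarrow> nat \<Rightarrow> real" where
  "unit_vec a = (\<lambda>b. if b = a then 1 else 0)"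

text \<open>Bounds the affinity of arbitrary corner values by those of three fixed vectors, so that
  an almost sure statement for finitely many functions covers all. The root of 3 comes from
  estimating the square of a sum of three terms.\<close>

lemma hellinger_le:
  assumes L: "T_valued L" and q: "q \<in> weights T"
  shows "hellinger L q x n \<le> (\<Sum>a\<in>S0. sqrt 3 * \<bar>x a\<bar> * hellinger L q (unit_vec a) n)"
proof -
  have "hellinger L q x n \<le> (\<Sum>w\<in>Wt L n. \<Sum>a\<in>S0. sqrt 3 * \<bar>x a\<bar> * sqrt (prod_list (map q w) * (1 / rw w * qf (harm_restr_word w (unit_vec a)) (harm_restr_word w (unit_vec a)))))"
    unfolding hellinger_def
  proof (rule sum_mono)
    fix w assume w: "w \<in> Wt L n"
    let ?c = "prod_list (map q w) * (1 / rw w)" and ?e = "\<lambda>a. harm_restr_word w (unit_vec a)"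
    have c: "0 \<le> ?c" using weights_nonneg[OF q Wt_Words[OF L w]] rw_pos[OF Wt_Words[OF L w]] by simp
    have qe: "qf (harm_restr_word w x) (harm_restr_word w x) = qf (\<lambda>b. x 1 * ?e 1 b + x 2 * ?e 2 b + x 3 * ?e 3 b) (\<lambda>b. x 1 * ?e 1 b + x 2 * ?e 2 b + x 3 * ?e 3 b)"
    \<comment> \<open>\<open>harm_restr\<close> depends only on the values on \<open>S0\<close>, but
      the empty word leaves the function as it is; there only agreement on \<open>S0\<close> is
      available.\<close>
    proof (cases w)
      case Nil
      then show ?thesis by (intro qf_cong) (auto simp: unit_vec_def S0_def)
    next
      case (Cons v u)
      have "harm_restr v x = harm_restr v (\<lambda>b. 1 * (x 1 * unit_vec 1 b + x 2 * unit_vec 2 b) + x 3 * unit_vec 3 b)"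
        by (rule harm_restr_cong) (auto simp: unit_vec_def S0_def)
      then have "harm_restr_word w x = (\<lambda>b. 1 * (x 1 * ?e 1 b + x 2 * ?e 2 b) + x 3 * ?e 3 b)"
        unfolding Cons harm_restr_word.simps by (simp only: harm_restr_lin harm_restr_word_lin)
      then show ?thesis by simp
    qed
    have "qf (harm_restr_word w x) (harm_restr_word w x) \<le> 3 * (x 1)\<^sup>2 * qf (?e 1) (?e 1) + 3 * (x 2)\<^sup>2 * qf (?e 2) (?e 2) + 3 * (x 3)\<^sup>2 * qf (?e 3) (?e 3)"
      unfolding qe by (rule order_trans[OF qf_3]) (simp add: qf_linear power2_eq_square)
    then have "?c * qf (harm_restr_word w x) (harm_restr_word w x) \<le> ?c * (3 * (x 1)\<^sup>2 * qf (?e 1) (?e 1) + 3 * (x 2)\<^sup>2 * qf (?e 2) (?e 2) + 3 * (x 3)\<^sup>2 * qf (?e 3) (?e 3))"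
      using c by (intro mult_left_mono)
    also have "\<dots> = 3 * (x 1)\<^sup>2 * (?c * qf (?e 1) (?e 1)) + 3 * (x 2)\<^sup>2 * (?c * qf (?e 2) (?e 2)) + 3 * (x 3)\<^sup>2 * (?c * qf (?e 3) (?e 3))"
      by (simp only: distrib_left mult_ac)
    finally have le: "?c * qf (harm_restr_word w x) (harm_restr_word w x) \<le> \<dots>" .
    have nn: "0 \<le> 3 * (x a)\<^sup>2 * (?c * qf (?e a) (?e a))" for a
      by (rule mult_nonneg_nonneg[OF _ mult_nonneg_nonneg[OF c qf_nonneg]]) simp
    have s: "sqrt (3 * (x a)\<^sup>2 * (?c * qf (?e a) (?e a))) = sqrt 3 * \<bar>x a\<bar> * sqrt (?c * qf (?e a) (?e a))" for a
      by (simp only: real_sqrt_mult real_sqrt_abs)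
    have "sqrt (?c * qf (harm_restr_word w x) (harm_restr_word w x)) \<le> sqrt (3 * (x 1)\<^sup>2 * (?c * qf (?e 1) (?e 1)) + 3 * (x 2)\<^sup>2 * (?c * qf (?e 2) (?e 2)) + 3 * (x 3)\<^sup>2 * (?c * qf (?e 3) (?e 3)))"
      using le by (rule real_sqrt_le_mono)
    also have "\<dots> \<le> sqrt (3 * (x 1)\<^sup>2 * (?c * qf (?e 1) (?e 1)) + 3 * (x 2)\<^sup>2 * (?c * qf (?e 2) (?e 2))) + sqrt (3 * (x 3)\<^sup>2 * (?c * qf (?e 3) (?e 3)))"
      using nn by (intro sqrt_add_le_add_sqrt add_nonneg_nonneg)
    also have "\<dots> \<le> (sqrt (3 * (x 1)\<^sup>2 * (?c * qf (?e 1) (?e 1))) + sqrt (3 * (x 2)\<^sup>2 * (?c * qf (?e 2) (?e 2)))) + sqrt (3 * (x 3)\<^sup>2 * (?c * qf (?e 3) (?e 3)))"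
      using nn by (intro add_right_mono sqrt_add_le_add_sqrt)
    finally show "sqrt (prod_list (map q w) * (1 / rw w * qf (harm_restr_word w x) (harm_restr_word w x))) \<le>
       (\<Sum>a\<in>S0. sqrt 3 * \<bar>x a\<bar> * sqrt (prod_list (map q w) * (1 / rw w * qf (harm_restr_word w (unit_vec a)) (harm_restr_word w (unit_vec a)))))"
      unfolding s unfolding sum_S0 mult.assoc .
  qed
  also have "\<dots> = (\<Sum>a\<in>S0. sqrt 3 * \<bar>x a\<bar> * hellinger L q (unit_vec a) n)"
    unfolding hellinger_def sum_distrib_left by (rule sum.swap)
  finally show ?thesis .
qed

lemma hellinger_nonneg: "T_valued L \<Longrightarrow> q \<in> weights T \<Longrightarrow> 0 \<le> hellinger L q x n"
  unfolding hellinger_def using weights_nonneg rw_pos Wt_Words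
  by (intro sum_nonneg) (auto intro!: mult_nonneg_nonneg divide_nonneg_nonneg qf_nonneg simp: less_imp_le)

text \<open>The level \<open>n\<close> is fixed first, so that the piecewise harmonic approximation
  has small energy error. Cauchy-Schwarz bounds the contribution of the error by the root of its
  energy at every finer level, so the level can then be refined until the harmonic part is small
  too. Even refinements suffice, since contraction is obtained in steps of two levels.\<close>

theorem singular_from_Hell:
  assumes L: "T_valued L" and q: "q \<in> weights T" and f: "f \<in> dom_F p \<alpha> T L"
    and Hl: "\<And>w a. w \<in> Wt_all L \<Longrightarrow> a \<in> S0 \<Longrightarrow> (\<lambda>k. hellinger (subenv L w) q (unit_vec a) (2 * k)) \<longlonglongrightarrow> 0"
  shows "mutually_singular (energy_measure p \<alpha> T L f) (mu_q p \<alpha> T L q)"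
proof (rule singular_criterion[OF L q f])
  fix e :: real assume e: "0 < e"
  have ff: "finite_energy L f" using f unfolding dom_F_eq[OF L] by simp
  let ?b = "\<lambda>w. prod_list (map q w)"
  have "(\<lambda>n. 2 * sqrt (total_energy L f - EL L n f f)) \<longlonglongrightarrow> 2 * sqrt (total_energy L f - total_energy L f)"
    by (intro tendsto_intros total_energy_tendsto ff)
  then have "eventually (\<lambda>n. 2 * sqrt (total_energy L f - EL L n f f) < e / 2) sequentially"
    by (rule order_tendstoD(2)) (use e in simp)
  then obtain n where n: "2 * sqrt (total_energy L f - EL L n f f) < e / 2" unfolding eventually_sequentially by blast
  let ?h = "pw_harm n L f"
  let ?d = "\<lambda>z. f z - ?h z"
  note d = total_energy_diff_Pn[OF L ff, of n]
  note fh = finite_energy_Pn[OF L, of n f]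
  have Hx: "(\<lambda>k. hellinger (subenv L w) q x (2 * k)) \<longlonglongrightarrow> 0" if w: "w \<in> Wt L n" for w x
  proof (rule tendsto_sandwich[OF always_eventually always_eventually tendsto_const])
    show "\<forall>k. 0 \<le> hellinger (subenv L w) q x (2 * k)" using hellinger_nonneg[OF T_valued_sh_Wt[OF L w] q] by blast
    show "\<forall>k. hellinger (subenv L w) q x (2 * k) \<le> (\<Sum>a\<in>S0. sqrt 3 * \<bar>x a\<bar> * hellinger (subenv L w) q (unit_vec a) (2 * k))"
      using hellinger_le[OF T_valued_sh_Wt[OF L w] q] by blast
    have "w \<in> Wt_all L" using w Wt_length[OF w] by (simp add: Wt_all_iff)
    then have "(\<lambda>k. \<Sum>a\<in>S0. sqrt 3 * \<bar>x a\<bar> * hellinger (subenv L w) q (unit_vec a) (2 * k)) \<longlonglongrightarrow> (\<Sum>a\<in>S0. sqrt 3 * \<bar>x a\<bar> * 0)"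
      by (intro tendsto_sum tendsto_mult tendsto_const Hl)
    then show "(\<lambda>k. \<Sum>a\<in>S0. sqrt 3 * \<bar>x a\<bar> * hellinger (subenv L w) q (unit_vec a) (2 * k)) \<longlonglongrightarrow> 0" by simp
  qed
  have split: "(\<Sum>w\<in>Wt L (n + 2 * k). sqrt (?b w * cell_energy L ?h w)) =
    (\<Sum>w\<in>Wt L n. sqrt (?b w * (1 / rw w)) * hellinger (subenv L w) q (cell_values f w) (2 * k))" for k
    unfolding sum_Wt_add hellinger_def sum_distrib_left
  proof (intro sum.cong refl)
    fix w u assume w: "w \<in> Wt L n" and u: "u \<in> Wt (subenv L w) (2 * k)"
    show "sqrt (?b (w @ u) * cell_energy L ?h (w @ u)) = sqrt (?b w * (1 / rw w)) * sqrt (?b u * (1 / rw u * qf (harm_restr_word u (cell_values f w)) (harm_restr_word u (cell_values f w))))"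
      unfolding cell_energy_Pn[OF L w u] real_sqrt_mult[symmetric] by (simp add: mult_ac)
  qed
  have "(\<lambda>k. 2 * (\<Sum>w\<in>Wt L (n + 2 * k). sqrt (?b w * cell_energy L ?h w))) \<longlonglongrightarrow> 2 * (\<Sum>w\<in>Wt L n. sqrt (?b w * (1 / rw w)) * 0)"
    unfolding split by (intro tendsto_mult tendsto_const tendsto_sum Hx)
  then have "eventually (\<lambda>k. 2 * (\<Sum>w\<in>Wt L (n + 2 * k). sqrt (?b w * cell_energy L ?h w)) < e / 2) sequentially"
    by (rule order_tendstoD(2)) (use e in simp)
  then obtain k where k: "2 * (\<Sum>w\<in>Wt L (n + 2 * k). sqrt (?b w * cell_energy L ?h w)) < e / 2"
    unfolding eventually_sequentially by blast
  let ?m = "n + 2 * k"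
  have b0: "0 \<le> ?b w" if "w \<in> Wt L ?m" for w using weights_nonneg[OF q Wt_Words[OF L that]] by simp
  have h0: "0 \<le> cell_energy L ?h w" and d0: "0 \<le> cell_energy L ?d w" if "w \<in> Wt L ?m" for w
    using cell_energy_nonneg[OF L fh that] cell_energy_nonneg[OF L d(1) that] by auto
  have "(\<Sum>w\<in>Wt L ?m. sqrt (?b w * (2 * cell_energy L f w))) \<le> (\<Sum>w\<in>Wt L ?m. 2 * sqrt (?b w * cell_energy L ?h w) + 2 * (sqrt (?b w) * sqrt (cell_energy L ?d w)))"
  proof (rule sum_mono)
    fix w assume w: "w \<in> Wt L ?m"
    have "?b w * (2 * cell_energy L f w) \<le> ?b w * (2 * (2 * cell_energy L ?h w + 2 * cell_energy L ?d w))"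
      using cell_energy_le[OF L ff fh d(1) w] b0[OF w] by (intro mult_left_mono) auto
    also have "\<dots> = 4 * (?b w * cell_energy L ?h w) + 4 * (?b w * cell_energy L ?d w)" by (simp add: algebra_simps)
    finally have "sqrt (?b w * (2 * cell_energy L f w)) \<le> sqrt (4 * (?b w * cell_energy L ?h w) + 4 * (?b w * cell_energy L ?d w))" by (rule real_sqrt_le_mono)
    also have "\<dots> \<le> sqrt (4 * (?b w * cell_energy L ?h w)) + sqrt (4 * (?b w * cell_energy L ?d w))"
      using b0[OF w] h0[OF w] d0[OF w] by (intro sqrt_add_le_add_sqrt) auto
    finally show "sqrt (?b w * (2 * cell_energy L f w)) \<le> 2 * sqrt (?b w * cell_energy L ?h w) + 2 * (sqrt (?b w) * sqrt (cell_energy L ?d w))"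
      by (simp add: real_sqrt_mult)
  qed
  also have "\<dots> = 2 * (\<Sum>w\<in>Wt L ?m. sqrt (?b w * cell_energy L ?h w)) + 2 * (\<Sum>w\<in>Wt L ?m. sqrt (?b w) * sqrt (cell_energy L ?d w))"
    by (simp add: sum.distrib sum_distrib_left)
  also have "(\<Sum>w\<in>Wt L ?m. sqrt (?b w) * sqrt (cell_energy L ?d w)) \<le> sqrt (total_energy L f - EL L n f f)"
  proof -
    have "(\<Sum>w\<in>Wt L ?m. ?b w) = 1"
    proof -
      note M = tree_measure_lambda[OF L q]
      interpret prob_space "lambda_q T L q" by (rule M(2))
      have "(\<Sum>w\<in>Wt L ?m. ?b w) = measure (lambda_q T L q) {\<omega> \<in> Sigma_sp T. prefix_of \<omega> ?m \<in> Wt L ?m}"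
        by (subst measure_prefix[OF L M(1)]) (auto simp: Wt_Words[OF L] Wt_length)
      also have "\<dots> = 1"
        using AE_Sigma_t[OF L M(1)] by (intro prob_eq_1[THEN iffD2] sets_prefix_in[OF tree_measureD(1)[OF M(1)]])
          (auto elim!: eventually_mono simp: Sigma_t_sp Sigma_t_Wt)
      finally show ?thesis .
    qed
    moreover have "(\<Sum>w\<in>Wt L ?m. cell_energy L ?d w) = total_energy L f - EL L n f f" unfolding sum_ce[OF L d(1)] d(2) ..
    moreover have "(\<Sum>w\<in>Wt L ?m. sqrt (?b w) * sqrt (cell_energy L ?d w))\<^sup>2 \<le> (\<Sum>w\<in>Wt L ?m. (sqrt (?b w))\<^sup>2) * (\<Sum>w\<in>Wt L ?m. (sqrt (cell_energy L ?d w))\<^sup>2)"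
      by (rule Cauchy_Schwarz_ineq_sum)
    moreover have "(\<Sum>w\<in>Wt L ?m. (sqrt (?b w))\<^sup>2) = (\<Sum>w\<in>Wt L ?m. ?b w)" "(\<Sum>w\<in>Wt L ?m. (sqrt (cell_energy L ?d w))\<^sup>2) = (\<Sum>w\<in>Wt L ?m. cell_energy L ?d w)"
      using b0 d0 by (auto intro!: sum.cong)
    ultimately show ?thesis by (intro real_le_rsqrt) simp
  qed
  finally have "(\<Sum>w\<in>Wt L ?m. sqrt (?b w * (2 * cell_energy L f w))) < e" using n k by simp
  then show "\<exists>m. (\<Sum>w\<in>Wt L m. sqrt (?b w * (2 * cell_energy L f w))) < e" by blast
qed

end

section \<open>Contraction of the Hellinger affinity\<close>

context gasket_letters
begin

lemma sum_weights_Wt: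
  assumes L: "T_valued L" and q: "q \<in> weights T"
  shows "(\<Sum>w\<in>Wt L m. prod_list (map q w)) = 1"
proof (induction m)
  case (Suc m)
  have "(\<Sum>w\<in>Wt L (Suc m). prod_list (map q w)) = (\<Sum>w\<in>Wt L m. prod_list (map q w) * (\<Sum>v\<in>letters (L w). q v))"
    unfolding sum_Wt_Suc by (simp add: sum_distrib_left)
  also have "\<dots> = (\<Sum>w\<in>Wt L m. prod_list (map q w))"
    using q T_valued_Wt[OF L] by (intro sum.cong) (auto simp: weights_def)
  finally show ?case using Suc by simp
qed simp

lemma sum_energy_Wt: "T_valued L \<Longrightarrow> (\<Sum>w\<in>Wt L m. 1 / rw w * qf (harm_restr_word w x) (harm_restr_word w x)) = qf x x"
proof (induction m)
  case (Suc m)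
  have "(\<Sum>w\<in>Wt L (Suc m). 1 / rw w * qf (harm_restr_word w x) (harm_restr_word w x)) = (\<Sum>w\<in>Wt L m. 1 / rw w * qf (harm_restr_word w x) (harm_restr_word w x))"
    unfolding sum_Wt_Suc
  proof (rule sum.cong[OF refl])
    fix w assume w: "w \<in> Wt L m"
    note 2 = T2[OF T_valued_Wt[OF Suc.prems w]]
    have "(\<Sum>v\<in>letters (L w). 1 / rw (w @ [v]) * qf (harm_restr_word (w @ [v]) x) (harm_restr_word (w @ [v]) x)) =
      1 / rw w * (1 / renorm p \<alpha> (L w) * (\<Sum>v\<in>letters (L w). qf (harm_restr v (harm_restr_word w x)) (harm_restr v (harm_restr_word w x))))"
      unfolding sum_distrib_left by (intro sum.cong) (auto simp: r_word_append harm_restr_word_append letters_fst)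
    then show "(\<Sum>v\<in>letters (L w). 1 / rw (w @ [v]) * qf (harm_restr_word (w @ [v]) x) (harm_restr_word (w @ [v]) x)) = 1 / rw w * qf (harm_restr_word w x) (harm_restr_word w x)"
      unfolding sum_qf_Hm[OF 2] using renorm_pos[OF 2] by simp
  qed
  then show ?case using Suc by simp
qed simp

text \<open>Cauchy-Schwarz between two conserved totals: the weights of a level sum to 1 and the
  cell energies sum to \<open>qf x x\<close>.\<close>

lemma hellinger_le_1:
  assumes L: "T_valued L" and q: "q \<in> weights T"
  shows "hellinger L q x m \<le> sqrt (qf x x)"
proof -
  let ?b = "\<lambda>w. prod_list (map q w)" and ?e = "\<lambda>w. 1 / rw w * qf (harm_restr_word w x) (harm_restr_word w x)"
  have b0: "0 \<le> ?b w" and e0: "0 \<le> ?e w" if "w \<in> Wt L m" for w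
    using weights_nonneg[OF q Wt_Words[OF L that]] rw_pos[OF Wt_Words[OF L that]] qf_nonneg by simp_all
  have "hellinger L q x m = (\<Sum>w\<in>Wt L m. sqrt (?b w) * sqrt (?e w))" unfolding hellinger_def by (simp only: real_sqrt_mult)
  moreover have "(\<Sum>w\<in>Wt L m. sqrt (?b w) * sqrt (?e w))\<^sup>2 \<le> (\<Sum>w\<in>Wt L m. (sqrt (?b w))\<^sup>2) * (\<Sum>w\<in>Wt L m. (sqrt (?e w))\<^sup>2)"
    by (rule Cauchy_Schwarz_ineq_sum)
  moreover have "(\<Sum>w\<in>Wt L m. (sqrt (?b w))\<^sup>2) = 1"
    using b0 sum_weights_Wt[OF L q, of m] by simp
  moreover have "(\<Sum>w\<in>Wt L m. (sqrt (?e w))\<^sup>2) = qf x x"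
  proof -
    have "(\<Sum>w\<in>Wt L m. (sqrt (?e w))\<^sup>2) = (\<Sum>w\<in>Wt L m. ?e w)" using e0 by (intro sum.cong) auto
    then show ?thesis using sum_energy_Wt[OF L, where m = m and x = x] by simp
  qed
  ultimately show ?thesis by (intro real_le_rsqrt) simp
qed

lemma harm_restr_const: "v \<in> alphabet T \<Longrightarrow> a \<in> S0 \<Longrightarrow> harm_restr v (\<lambda>_. c) a = c"
proof -
  assume v: "v \<in> alphabet T" and a: "a \<in> S0"
  note l = alphabet_letters[OF v]
  have "(\<Sum>b\<in>S0. harm_basis (fst v) b (psi \<alpha> v (p a))) = 1"
    using l vertI[of v "fst v" a] a by (intro harm_basis_sum T2) auto
  then show ?thesis unfolding harm_restr_def H_def by (simp flip: sum_distrib_left)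
qed

lemma harm_restr_word_const: "w \<in> Words T \<Longrightarrow> a \<in> S0 \<Longrightarrow> harm_restr_word w (\<lambda>_. c) a = c"
proof (induction w arbitrary: a rule: rev_induct)
  case (snoc v w)
  have "harm_restr v (harm_restr_word w (\<lambda>_. c)) = harm_restr v (\<lambda>_. c)" using snoc by (intro harm_restr_cong) auto
  then show ?case using snoc harm_restr_const[of v a c] by (simp add: harm_restr_word_append)
qed simp

text \<open>Harmonic restriction is linear and preserves constants, so shifts are invisible to the
  energy in every cell. This permits normalization to a compact set of corner values.\<close>

lemma qf_HmW_affine:
  assumes w: "w \<in> Words T" and x: "\<And>a. a \<in> S0 \<Longrightarrow> x a = c * y a + d"
  shows "qf (harm_restr_word w x) (harm_restr_word w x) = c\<^sup>2 * qf (harm_restr_word w y) (harm_restr_word w y)"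
proof -
  have "harm_restr_word w x a = c * harm_restr_word w y a + d" if a: "a \<in> S0" for a
  proof (cases w)
    case Nil then show ?thesis using x[OF a] by simp
  next
    case (Cons v u)
    have "harm_restr v x = harm_restr v (\<lambda>a. c * y a + d * 1)" using x by (intro harm_restr_cong) simp
    then have "harm_restr_word w x = harm_restr_word w (\<lambda>a. c * y a + d * 1)" by (simp add: Cons)
    then show ?thesis using harm_restr_word_lin[of w c y d "\<lambda>_. 1"] harm_restr_word_const[OF w a, of 1] by simp
  qed
  then have "qf (harm_restr_word w x) (harm_restr_word w x) = qf (\<lambda>a. c * harm_restr_word w y a + d) (\<lambda>a. c * harm_restr_word w y a + d)" by (intro qf_cong) auto
  then show ?thesis by (simp add: qf_def power2_eq_square algebra_simps)
qed

lemma hellinger_affine: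
  assumes L: "T_valued L" and x: "\<And>a. a \<in> S0 \<Longrightarrow> x a = c * y a + d"
  shows "hellinger L q x m = \<bar>c\<bar> * hellinger L q y m"
proof -
  have "sqrt (prod_list (map q w) * (1 / rw w * qf (harm_restr_word w x) (harm_restr_word w x))) = \<bar>c\<bar> * sqrt (prod_list (map q w) * (1 / rw w * qf (harm_restr_word w y) (harm_restr_word w y)))"
    if "w \<in> Wt L m" for w
  proof -
    have "prod_list (map q w) * (1 / rw w * qf (harm_restr_word w x) (harm_restr_word w x)) = c\<^sup>2 * (prod_list (map q w) * (1 / rw w * qf (harm_restr_word w y) (harm_restr_word w y)))"
      using qf_HmW_affine[of w x c y d, OF Wt_Words[OF L that] x] by (simp add: mult_ac)
    then show ?thesis by (simp only: real_sqrt_mult real_sqrt_abs)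
  qed
  then show ?thesis unfolding hellinger_def by (simp add: sum_distrib_left)
qed

lemma hellinger_2: "hellinger L q x 2 = (\<Sum>v\<in>letters (L []). \<Sum>w\<in>letters (L [v]).
   sqrt (q v * q w * (1 / (renorm p \<alpha> (L []) * renorm p \<alpha> (L [v])) * qf (harm_restr w (harm_restr v x)) (harm_restr w (harm_restr v x)))))"
proof -
  have 2: "(2::nat) = Suc (Suc 0)" by simp
  show ?thesis unfolding hellinger_def 2 sum_Wt_Suc[of _ _ "Suc 0"] sum_Wt_1
    by (intro sum.cong refl) (auto simp: r_word_def letters_fst)
qed

text \<open>Equality in Cauchy-Schwarz between masses of equal total means that energy and reference
  mass agree on every word of length two, hence on every single letter. In a cell that repeats the
  same type, the energy ratio at corner \<open>i\<close> would then be the same number in both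
  steps, which only constants allow.\<close>

lemma hellinger_2_strict:
  assumes L: "T_valued L" and \<nu>: "L [] = \<nu>" "\<And>v. v \<in> letters \<nu> \<Longrightarrow> L [v] = \<nu>" and q: "q \<in> weights T" and x: "qf x x = 1"
  shows "hellinger L q x 2 < 1"
proof (rule ccontr)
  assume "\<not> hellinger L q x 2 < 1"
  then have H1: "hellinger L q x 2 = 1" using hellinger_le_1[OF L q, of x 2] x by simp
  have \<nu>T: "\<nu> \<in> T" using T_valued_T[OF L, of "[]"] \<nu>(1) by simp
  note 2 = T2[OF \<nu>T]
  let ?r = "renorm p \<alpha> \<nu>"
  have r: "0 < ?r" by (rule renorm_pos[OF 2])
  let ?b = "\<lambda>w. prod_list (map q w)" and ?e = "\<lambda>w. 1 / rw w * qf (harm_restr_word w x) (harm_restr_word w x)"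
  have b0: "0 \<le> ?b w" and e0: "0 \<le> ?e w" if "w \<in> Wt L 2" for w
    using weights_nonneg[OF q Wt_Words[OF L that]] rw_pos[OF Wt_Words[OF L that]] qf_nonneg by simp_all
  \<comment> \<open>The equality case is made explicit: this sum of squares equals 1 + 1 minus twice
    the affinity.\<close>
  have "(\<Sum>w\<in>Wt L 2. (sqrt (?b w) - sqrt (?e w))\<^sup>2) = (\<Sum>w\<in>Wt L 2. ?b w + ?e w - 2 * sqrt (?b w * ?e w))"
  proof (rule sum.cong[OF refl])
    fix w assume w: "w \<in> Wt L 2"
    have "(sqrt (?b w))\<^sup>2 = ?b w" "(sqrt (?e w))\<^sup>2 = ?e w" using real_sqrt_pow2[OF b0[OF w]] real_sqrt_pow2[OF e0[OF w]] by blast+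
    then show "(sqrt (?b w) - sqrt (?e w))\<^sup>2 = ?b w + ?e w - 2 * sqrt (?b w * ?e w)"
      unfolding power2_diff real_sqrt_mult by simp
  qed
  also have "\<dots> = (\<Sum>w\<in>Wt L 2. ?b w) + (\<Sum>w\<in>Wt L 2. ?e w) - 2 * hellinger L q x 2"
    unfolding hellinger_def by (simp only: sum.distrib sum_subtractf sum_distrib_left)
  also have "\<dots> = 0" unfolding sum_weights_Wt[OF L q] sum_energy_Wt[OF L] x H1 by simp
  finally have "\<forall>w\<in>Wt L 2. (sqrt (?b w) - sqrt (?e w))\<^sup>2 = 0"
    by (subst (asm) sum_nonneg_eq_0_iff) auto
  then have eq: "?b w = ?e w" if "w \<in> Wt L 2" for w using that by fastforce
  have W2: "[v, u] \<in> Wt L 2" if "v \<in> letters \<nu>" "u \<in> letters \<nu>" for v u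
  proof -
    have "[v] \<in> Wt L (Suc 0)" using that \<nu> unfolding Wt_1 by blast
    then have "[v] @ [u] \<in> Wt L (Suc (Suc 0))" using that \<nu> by (subst Wt_snoc_iff) auto
    then show ?thesis by (simp add: numeral_2_eq_2)
  qed
  have e2: "?r\<^sup>2 * (q v * q u) = qf (harm_restr u (harm_restr v x)) (harm_restr u (harm_restr v x))" if "v \<in> letters \<nu>" "u \<in> letters \<nu>" for v u
    using eq[OF W2[OF that]] r that by (simp add: r_word_def letters_fst power2_eq_square field_simps)
  have e1: "?r * q v = qf (harm_restr v x) (harm_restr v x)" if v: "v \<in> letters \<nu>" for v
  proof -
    \<comment> \<open>Summing the equalities for two letters over the second letter gives those for
      one letter, by conservation of energy and of weight.\<close>
    have "?r * qf (harm_restr v x) (harm_restr v x) = (\<Sum>u\<in>letters \<nu>. ?r\<^sup>2 * (q v * q u))"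
      unfolding sum_qf_Hm[OF 2, symmetric] by (intro sum.cong) (auto simp: e2 v)
    also have "\<dots> = ?r\<^sup>2 * q v * (\<Sum>u\<in>letters \<nu>. q u)" by (simp add: sum_distrib_left mult.assoc)
    also have "\<dots> = ?r * (?r * q v)" using q \<nu>T by (simp add: weights_def power2_eq_square)
    finally show ?thesis using r by simp
  qed
  have "qf x x = 0"
  proof (rule energy_ratios_not_multiplicative[OF 2, of x "\<lambda>i. ?r * q (\<nu>, i)"])
    fix i assume i: "i \<in> S0"
    note l = S0_letters[OF 2 i]
    show "qf (harm_restr (\<nu>, i) x) (harm_restr (\<nu>, i) x) = ?r * q (\<nu>, i) * qf x x" using e1[OF l] x by simp
    show "qf (harm_restr (\<nu>, i) (harm_restr (\<nu>, i) x)) (harm_restr (\<nu>, i) (harm_restr (\<nu>, i) x)) = (?r * q (\<nu>, i))\<^sup>2 * qf x x"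
      unfolding e2[OF l l, symmetric] x by (simp add: power2_eq_square)
  qed
  then show False using x by simp
qed

text \<open>Compactness of the unit circle of the energy makes the strict inequality uniform.\<close>

lemma hellinger_2_contract:
  assumes \<nu>T: "\<nu> \<in> T" and q: "q \<in> weights T"
  obtains k where "0 \<le> k" "k < 1"
    "\<And>L x. T_valued L \<Longrightarrow> L [] = \<nu> \<Longrightarrow> (\<And>v. v \<in> letters \<nu> \<Longrightarrow> L [v] = \<nu>) \<Longrightarrow> hellinger L q x 2 \<le> k * sqrt (qf x x)"
proof -
  \<comment> \<open>The affinity over two levels only involves the types at the root and its
    children, so the constant environment represents all environments considered.\<close>
  define L0 where "L0 = (\<lambda>_::letter list. \<nu>)"
  have L0: "T_valued L0" using \<nu>T by (simp add: T_valued_def L0_def)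
  \<comment> \<open>Corner values modulo constants, normalized to vanish at the third corner; on
    this plane \<open>qf\<close> is positive definite.\<close>
  define y :: "real \<times> real \<Rightarrow> nat \<Rightarrow> real" where "y = (\<lambda>(a, b) i. if i = 1 then a else if i = 2 then b else 0)"
  define S where "S = {z. qf (y z) (y z) = 1}"
  have y: "y z 1 = fst z" "y z 2 = snd z" "y z 3 = 0" for z by (auto simp: y_def split: prod.split)
  have qy: "qf (y z) (y z) = (fst z - snd z)\<^sup>2 + (snd z)\<^sup>2 + (fst z)\<^sup>2" for z
    unfolding qf_def y by (simp add: power2_eq_square)
  have cl: "closed S"
    unfolding S_def qy by (intro closed_Collect_eq continuous_intros)
  have "S \<subseteq> cbox (-1, -1) (1, 1)"
  proof
    fix z assume "z \<in> S"
    then have "(fst z)\<^sup>2 \<le> 1" "(snd z)\<^sup>2 \<le> 1"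
      using zero_le_power2[of "fst z - snd z"] zero_le_power2[of "fst z"] zero_le_power2[of "snd z"]
      unfolding S_def qy mem_Collect_eq by linarith+
    then have "\<bar>fst z\<bar> \<le> 1" "\<bar>snd z\<bar> \<le> 1" by (simp_all add: abs_square_le_1)
    then show "z \<in> cbox (-1, -1) (1, 1)" by (cases z) (auto simp: cbox_Pair_eq)
  qed
  then have "bounded S" using bounded_cbox bounded_subset by blast
  then have comp: "compact S" using cl by (simp add: compact_eq_bounded_closed)
  have "(1 / sqrt 2, 0) \<in> S" unfolding S_def mem_Collect_eq qy by (simp add: power_divide)
  then have ne: "S \<noteq> {}" by blast
  have cy: "continuous_on UNIV (\<lambda>z. y z a)" for a
    unfolding y_def split_def
    by (cases "a = 1"; cases "a = 2") (auto intro!: continuous_on_fst continuous_on_snd continuous_on_id)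
  have cH: "continuous_on UNIV (\<lambda>z. harm_restr v (f z) a)" if "\<And>b. continuous_on UNIV (\<lambda>z. f z b)" for f :: "real \<times> real \<Rightarrow> nat \<Rightarrow> real" and v a
    unfolding harm_restr_def H_def using that by (intro continuous_intros)
  have "continuous_on UNIV (\<lambda>z. hellinger L0 q (y z) 2)"
    unfolding hellinger_2 qf_def by (intro continuous_intros cH cy)
  then have "continuous_on S (\<lambda>z. hellinger L0 q (y z) 2)" using continuous_on_subset by blast
  then obtain z0 where z0: "z0 \<in> S" "\<And>z. z \<in> S \<Longrightarrow> hellinger L0 q (y z) 2 \<le> hellinger L0 q (y z0) 2"
    using continuous_attains_sup[OF comp ne] by blast
  define k where "k = hellinger L0 q (y z0) 2"
  have k1: "k < 1" unfolding k_def using z0(1) by (intro hellinger_2_strict[OF L0 _ _ q, of \<nu>]) (auto simp: L0_def S_def)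
  have k0: "0 \<le> k" unfolding k_def by (rule hellinger_nonneg[OF L0 q])
  show ?thesis
  proof (rule that[OF k0 k1])
    fix L x assume L: "T_valued L" and \<nu>: "L [] = \<nu>" "\<And>v. v \<in> letters \<nu> \<Longrightarrow> L [v] = \<nu>"
    have LL: "hellinger L q x 2 = hellinger L0 q x 2" for x
      unfolding hellinger_2 using \<nu> by (auto simp: L0_def intro!: sum.cong)
    show "hellinger L q x 2 \<le> k * sqrt (qf x x)"
    proof (cases "qf x x = 0")
      case True
      then show ?thesis using hellinger_le_1[OF L q, of x 2] by simp
    next
      case False
      define s where "s = sqrt (qf x x)"
      have s: "0 < s" unfolding s_def using False qf_nonneg[of x] by simp
      have s2: "s\<^sup>2 = qf x x" unfolding s_def by (rule real_sqrt_pow2[OF qf_nonneg])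
      define z where "z = ((x 1 - x 3) / s, (x 2 - x 3) / s)"
      have xz: "x a = s * y z a + x 3" if "a \<in> S0" for a
        using that s by (auto simp: S0_def y_def z_def)
      have "qf (harm_restr_word [] x) (harm_restr_word [] x) = s\<^sup>2 * qf (harm_restr_word [] (y z)) (harm_restr_word [] (y z))"
        by (rule qf_HmW_affine[OF _ xz]) auto
      then have "s\<^sup>2 * qf (y z) (y z) = s\<^sup>2" using s2 by simp
      then have "z \<in> S" using s by (simp add: S_def)
      then have "hellinger L0 q (y z) 2 \<le> k" unfolding k_def by (rule z0(2))
      moreover have "hellinger L0 q x 2 = \<bar>s\<bar> * hellinger L0 q (y z) 2" by (rule hellinger_affine[OF L0 xz])
      ultimately show ?thesis unfolding LL using s by (simp add: s_def[symmetric] mult.commute)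
    qed
  qed
qed

section \<open>Comparison with rational weights\<close>

lemma prod_list_mono_weights:
  fixes q q' :: "letter \<Rightarrow> real"
  assumes "\<And>v. v \<in> alphabet T \<Longrightarrow> 0 \<le> q v" "\<And>v. v \<in> alphabet T \<Longrightarrow> q v \<le> c * q' v" "0 \<le> c" "\<And>v. v \<in> alphabet T \<Longrightarrow> 0 \<le> q' v" "w \<in> Words T"
  shows "0 \<le> prod_list (map q w)" "prod_list (map q w) \<le> c ^ length w * prod_list (map q' w)"
proof -
  have "0 \<le> prod_list (map q w) \<and> 0 \<le> prod_list (map q' w) \<and> prod_list (map q w) \<le> c ^ length w * prod_list (map q' w)"
    using assms(5)
  proof (induction w)
    case (Cons v w)
    have "q v * prod_list (map q w) \<le> (c * q' v) * (c ^ length w * prod_list (map q' w))"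
      by (intro mult_mono) (use Cons assms in auto)
    then show ?case using Cons assms by (auto simp: mult_ac)
  qed simp
  then show "0 \<le> prod_list (map q w)" "prod_list (map q w) \<le> c ^ length w * prod_list (map q' w)" by auto
qed

text \<open>Every letter costs at most the factor \<open>c\<close> under the root. With c > 1 the
  contraction passes from \<open>q\<close> to slightly larger weights; with c = 1 the decay comes
  back to \<open>q\<close>.\<close>

lemma hellinger_mono_weights:
  assumes L: "T_valued L" and "\<And>v. v \<in> alphabet T \<Longrightarrow> 0 \<le> q v" "\<And>v. v \<in> alphabet T \<Longrightarrow> q v \<le> c * q' v" "0 \<le> c" "\<And>v. v \<in> alphabet T \<Longrightarrow> 0 \<le> q' v"
  shows "hellinger L q x m \<le> sqrt (c ^ m) * hellinger L q' x m"
  unfolding hellinger_def sum_distrib_left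
proof (rule sum_mono)
  fix w assume w: "w \<in> Wt L m"
  let ?e = "1 / rw w * qf (harm_restr_word w x) (harm_restr_word w x)"
  have e: "0 \<le> ?e" using rw_pos[OF Wt_Words[OF L w]] qf_nonneg by simp
  have "prod_list (map q w) * ?e \<le> c ^ length w * prod_list (map q' w) * ?e"
    using prod_list_mono_weights(2)[OF assms(2-5) Wt_Words[OF L w]] e by (intro mult_right_mono) auto
  then have "sqrt (prod_list (map q w) * ?e) \<le> sqrt (c ^ m * (prod_list (map q' w) * ?e))"
    using Wt_length[OF w] by (intro real_sqrt_le_mono) (simp add: mult.assoc)
  then show "sqrt (prod_list (map q w) * ?e) \<le> sqrt (c ^ m) * sqrt (prod_list (map q' w) * ?e)"
    by (simp only: real_sqrt_mult)
qed

lemma Wt_iff: "w \<in> Wt L m \<longleftrightarrow> length w = m \<and> (\<forall>j<m. w ! j \<in> letters (L (take j w)))"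
proof (induction m arbitrary: w)
  case (Suc m)
  show ?case
  proof (cases w rule: rev_cases)
    case Nil then show ?thesis by simp
  next
    case (snoc u v)
    then show ?thesis unfolding snoc Wt_snoc_iff Suc.IH
      by (auto simp: less_Suc_eq nth_append)
  qed
qed simp

text \<open>Fixing the values outside the finite alphabet makes the set countable. No normalization
  is imposed, because weights that dominate \<open>q\<close> must have larger sums unless they equal
  \<open>q\<close>.\<close>

definition rat_weights :: "(letter \<Rightarrow> real) set" where
  "rat_weights = {q \<in> PiE (alphabet T) (\<lambda>_. \<rat>). \<forall>v\<in>alphabet T. 0 < q v}"

lemma countable_rat_weights: "countable rat_weights"
proof -
  have "countable (PiE (alphabet T) (\<lambda>_. \<rat> :: real set))"
    by (intro countable_PiE finite_alphabet) (simp add: countable_rat)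
  then show ?thesis unfolding rat_weights_def by (rule countable_subset[rotated]) auto
qed

lemma rat_weights_approx:
  assumes q: "q \<in> weights T" and c: "1 < c"
  obtains q0 where "q0 \<in> rat_weights" "\<And>v. v \<in> alphabet T \<Longrightarrow> q v \<le> q0 v" "\<And>v. v \<in> alphabet T \<Longrightarrow> q0 v \<le> c * q v"
proof -
  have pos: "0 < q v" if "v \<in> alphabet T" for v using q that by (auto simp: weights_def)
  have "\<forall>v\<in>alphabet T. \<exists>r\<in>\<rat>. q v < r \<and> r < c * q v"
  proof
    fix v assume "v \<in> alphabet T"
    then have "q v < c * q v" using pos c by simp
    then show "\<exists>r\<in>\<rat>. q v < r \<and> r < c * q v" by (rule Rats_dense_in_real)
  qed
  then obtain g where g: "\<And>v. v \<in> alphabet T \<Longrightarrow> g v \<in> \<rat> \<and> q v < g v \<and> g v < c * q v" by metis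
  show ?thesis
  proof (rule that[of "restrict g (alphabet T)"])
    show "restrict g (alphabet T) \<in> rat_weights" using g pos by (fastforce simp: rat_weights_def)
  qed (use g in \<open>auto simp: less_imp_le\<close>)
qed

end

section \<open>Random environments\<close>

text \<open>Shifting an environment renames its index set injectively; this supplies the
  independence of the environment below a word.\<close>

lemma (in prob_space) indep_vars_reindex_inj:
  assumes inj: "inj_on f I" and ind: "indep_vars M' Y (f ` I)"
  shows "indep_vars (\<lambda>i. M' (f i)) (\<lambda>i. Y (f i)) I"
  unfolding indep_vars_def2
proof (intro conjI ballI)
  show "i \<in> I \<Longrightarrow> random_variable (M' (f i)) (Y (f i))" for i
    using ind unfolding indep_vars_def2 by blast
  have ind': "indep_sets (\<lambda>i. {Y i -` A \<inter> space M | A. A \<in> sets (M' i)}) (f ` I)"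
    using ind unfolding indep_vars_def2 by blast
  show "indep_sets (\<lambda>i. {Y (f i) -` A \<inter> space M | A. A \<in> sets (M' (f i))}) I"
  proof (rule indep_setsI)
    show "i \<in> I \<Longrightarrow> {Y (f i) -` A \<inter> space M | A. A \<in> sets (M' (f i))} \<subseteq> events" for i
      using ind' unfolding indep_sets_def by blast
    fix A J assume J: "J \<noteq> {}" "J \<subseteq> I" "finite J"
      and A: "\<forall>j\<in>J. A j \<in> {Y (f j) -` A \<inter> space M | A. A \<in> sets (M' (f j))}"
    have injJ: "inj_on f J" using inj J(2) by (rule inj_on_subset)
    define B where "B k = A (the_inv_into J f k)" for k
    have B: "B (f j) = A j" if "j \<in> J" for j
      using the_inv_into_f_f[OF injJ that] by (simp add: B_def)
    have "prob (\<Inter>k\<in>f ` J. B k) = (\<Prod>k\<in>f ` J. prob (B k))"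
      using J A B by (intro indep_setsD[OF ind']) auto
    then show "prob (\<Inter>j\<in>J. A j) = (\<Prod>j\<in>J. prob (A j))"
      using B injJ by (simp add: prod.reindex cong: prod.cong)
  qed
qed

lemma finite_PiM_measurable:
  assumes "finite W" "finite T"
  shows "(f :: _ \<Rightarrow> real) \<in> borel_measurable (\<Pi>\<^sub>M w\<in>W. count_space T)"
proof -
  let ?M = "\<Pi>\<^sub>M w\<in>W. count_space T"
  have sp: "space ?M = (\<Pi>\<^sub>E w\<in>W. T)" by (simp add: space_PiM)
  have fn: "finite (\<Pi>\<^sub>E w\<in>W. T)" using assms by (intro finite_PiE) auto
  have single: "{g} \<in> sets ?M" if "g \<in> (\<Pi>\<^sub>E w\<in>W. T)" for g
  proof -
    have "{g} = (\<Pi>\<^sub>E w\<in>W. {g w})" using that PiE_singleton[of g W] by (simp add: PiE_iff)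
    then show ?thesis using that assms(1) by (auto intro!: sets_PiM_I_finite)
  qed
  have "S \<in> sets ?M" if "S \<subseteq> (\<Pi>\<^sub>E w\<in>W. T)" for S
  proof -
    have "(\<Union>g\<in>S. {g}) \<in> sets ?M"
      using that finite_subset[OF that fn] single by (intro sets.finite_UN) auto
    then show ?thesis by simp
  qed
  then show ?thesis by (intro measurableI) (auto simp: sp)
qed

text \<open>Dependence on the coordinates in \<open>W\<close>, stated for functionals of the
  environment without reference to sigma-algebras. For finite sets of words it yields measurability
  and integrability, and independence when the sets are disjoint.\<close>

definition locally_det :: "((letter list \<Rightarrow> nat) \<Rightarrow> 'a) \<Rightarrow> letter list set \<Rightarrow> bool" where
  "locally_det F W \<longleftrightarrow> (\<forall>L L'. (\<forall>w\<in>W. L w = L' w) \<longrightarrow> F L = F L')"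

lemma locally_det_mono: "locally_det F W \<Longrightarrow> W \<subseteq> W' \<Longrightarrow> locally_det F W'"
  unfolding locally_det_def by blast

lemma locally_det_comp2: "locally_det F W \<Longrightarrow> locally_det F' W \<Longrightarrow> locally_det (\<lambda>L. h (F L) (F' L)) W"
  unfolding locally_det_def by metis

lemma locally_det_comp: "locally_det F W \<Longrightarrow> locally_det (\<lambda>L. h (F L)) W"
  unfolding locally_det_def by metis

locale random_gasket = gasket_letters p \<alpha> T + P: prob_space P for p \<alpha> T and P :: "'o measure" +
  fixes \<rho> :: "nat measure" and X :: "letter list \<Rightarrow> 'o \<Rightarrow> nat"
  assumes indep: "P.indep_vars (\<lambda>_. count_space T) X (Words T)"
    and distr: "\<And>w. w \<in> Words T \<Longrightarrow> distr P (count_space T) (X w) = \<rho>"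
    and pos: "\<And>\<nu>. \<nu> \<in> T \<Longrightarrow> measure \<rho> {\<nu>} > 0"
begin

definition env :: "'o \<Rightarrow> letter list \<Rightarrow> nat" where
  "env x = (\<lambda>w. X w x)"

lemma rv: "w \<in> Words T \<Longrightarrow> X w \<in> measurable P (count_space T)"
  using indep unfolding P.indep_vars_def2 by blast

lemma T_valued_env: "x \<in> space P \<Longrightarrow> T_valued (env x)"
  using measurable_space[OF rv] by (auto simp: T_valued_def env_def)

lemma prob_X: "w \<in> Words T \<Longrightarrow> A \<subseteq> T \<Longrightarrow> P.prob {x \<in> space P. X w x \<in> A} = measure \<rho> A"
  using distr[of w] measure_distr[OF rv, of w A] by (simp add: vimage_def Int_def conj_commute)

text \<open>The environment below a fixed word is again independent and identically distributed, so
  almost sure statements at the root transfer to all of the countably many words.\<close>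

lemma shifted: "w \<in> Words T \<Longrightarrow> random_gasket p \<alpha> T P \<rho> (\<lambda>v. X (w @ v))"
proof (intro random_gasket.intro random_gasket_axioms.intro gasket_letters_axioms P.prob_space_axioms)
  assume w: "w \<in> Words T"
  have "P.indep_vars (\<lambda>_. count_space T) X ((@) w ` Words T)"
    using w by (intro P.indep_vars_subset[OF indep]) auto
  then show "P.indep_vars (\<lambda>_. count_space T) (\<lambda>v. X (w @ v)) (Words T)"
    by (intro P.indep_vars_reindex_inj[where f="(@) w"]) (auto simp: inj_on_def)
  show "v \<in> Words T \<Longrightarrow> distr P (count_space T) (X (w @ v)) = \<rho>" for v using w by (intro distr) simp
  show "\<nu> \<in> T \<Longrightarrow> 0 < measure \<rho> {\<nu>}" for \<nu> by (rule pos)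
qed

lemma restrict_measurable:
  "W \<subseteq> Words T \<Longrightarrow> (\<lambda>x. restrict (\<lambda>w. X w x) W) \<in> measurable P (\<Pi>\<^sub>M w\<in>W. count_space T)"
  by (intro measurable_restrict rv) auto

lemma locally_det_restrict: "locally_det F W \<Longrightarrow> F (env x) = F (restrict (\<lambda>w. X w x) W)"
  unfolding locally_det_def by (rule allE, assumption) (simp add: env_def)

lemma local_measurable:
  assumes W: "finite W" "W \<subseteq> Words T" and F: "locally_det (F :: _ \<Rightarrow> real) W"
  shows "(\<lambda>x. F (env x)) \<in> borel_measurable P"
  unfolding locally_det_restrict[OF F]
  by (rule measurable_compose[OF restrict_measurable[OF W(2)] finite_PiM_measurable[OF W(1) finT]])

lemma local_integrable:
  assumes W: "finite W" "W \<subseteq> Words T" and F: "locally_det (F :: _ \<Rightarrow> real) W"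
  shows "integrable P (\<lambda>x. F (env x))"
proof (rule P.integrable_const_bound[OF _ local_measurable[OF assms]])
  let ?E = "\<Pi>\<^sub>E w\<in>W. T"
  have fn: "finite ?E" using W finT by (intro finite_PiE) auto
  show "AE x in P. norm (F (env x)) \<le> (\<Sum>g\<in>?E. \<bar>F g\<bar>)"
  proof (rule AE_I2)
    fix x assume x: "x \<in> space P"
    have "restrict (\<lambda>w. X w x) W \<in> ?E" using measurable_space[OF rv x] W(2) by auto
    then have "\<bar>F (restrict (\<lambda>w. X w x) W)\<bar> \<le> (\<Sum>g\<in>?E. \<bar>F g\<bar>)"
      using fn by (intro member_le_sum[of _ _ "\<lambda>g. \<bar>F g\<bar>"]) auto
    then show "norm (F (env x)) \<le> (\<Sum>g\<in>?E. \<bar>F g\<bar>)" unfolding locally_det_restrict[OF F] by simp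
  qed
qed

lemma local_indep:
  assumes W: "finite W" "W \<subseteq> Words T" and F: "locally_det (F :: _ \<Rightarrow> real) W"
    and W': "finite W'" "W' \<subseteq> Words T" and F': "locally_det (F' :: _ \<Rightarrow> real) W'" and disj: "W \<inter> W' = {}"
  shows "(\<integral>x. F (env x) * F' (env x) \<partial>P) = (\<integral>x. F (env x) \<partial>P) * (\<integral>x. F' (env x) \<partial>P)"
proof (rule P.indep_var_lebesgue_integral)
  have "P.indep_var borel (F \<circ> (\<lambda>x. restrict (\<lambda>w. X w x) W)) borel (F' \<circ> (\<lambda>x. restrict (\<lambda>w. X w x) W'))"
    by (rule P.indep_var_compose[OF P.indep_var_restrict[OF indep disj W(2) W'(2)]])
       (rule finite_PiM_measurable[OF W(1) finT], rule finite_PiM_measurable[OF W'(1) finT])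
  then show "P.indep_var borel (\<lambda>x. F (env x)) borel (\<lambda>x. F' (env x))"
    unfolding locally_det_restrict[OF F] locally_det_restrict[OF F'] by (simp add: comp_def)
qed (rule local_integrable[OF W F], rule local_integrable[OF W' F'])

lemma finite_Words_length: "finite {w \<in> Words T. length w < n}" "finite {w \<in> Words T. length w = n}"
proof -
  have "finite {w. set w \<subseteq> alphabet T \<and> length w \<le> n}" by (rule finite_lists_length_le[OF finite_alphabet])
  then show "finite {w \<in> Words T. length w < n}" "finite {w \<in> Words T. length w = n}"
    by (rule rev_finite_subset; auto simp: Words_def lists_eq_set)+
qed

lemma take_Words: "w \<in> Words T \<Longrightarrow> take j w \<in> Words T"
  by (metis append_take_drop_id append_Words)

lemma Wt_local: "w \<in> Words T \<Longrightarrow> length w \<le> m \<Longrightarrow> locally_det (\<lambda>L. w \<in> Wt L n) {v \<in> Words T. length v < m}"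
proof -
  assume w: "w \<in> Words T" and m: "length w \<le> m"
  have "w \<in> Wt L n \<longleftrightarrow> w \<in> Wt L' n" if "\<forall>v\<in>{v \<in> Words T. length v < m}. L v = L' v" for L L'
  proof (cases "length w = n")
    case True
    have "L (take j w) = L' (take j w)" if "j < n" for j
      using \<open>\<forall>v\<in>_. L v = L' v\<close> take_Words[OF w, of j] that True m by auto
    then show ?thesis unfolding Wt_iff by auto
  next
    case False then show ?thesis unfolding Wt_iff by auto
  qed
  then show ?thesis unfolding locally_det_def by blast
qed

text \<open>\<open>b u\<close> and the admissibility of \<open>u\<close> depend on levels strictly
  above \<open>u\<close>, the event \<open>good u\<close> on the next \<open>l\<close> levels, so
  they are independent. In expectation one block of levels multiplies the total mass by at most
  \<open>(1 - p0) * k1 + p0 * k0\<close>. No independence between different words of one level is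
  used, since only expectations of sums occur.\<close>

theorem branching_decay:
  fixes b :: "letter list \<Rightarrow> (letter list \<Rightarrow> nat) \<Rightarrow> real" and good :: "letter list \<Rightarrow> (letter list \<Rightarrow> nat) \<Rightarrow> bool"
  assumes nn: "\<And>w L. w \<in> Words T \<Longrightarrow> 0 \<le> b w L"
    and bloc: "\<And>w. w \<in> Words T \<Longrightarrow> locally_det (b w) {v \<in> Words T. length v < length w}"
    and gloc: "\<And>u. u \<in> Words T \<Longrightarrow> locally_det (good u) {v \<in> Words T. length u \<le> length v \<and> length v < length u + l}"
    and gp: "\<And>u. u \<in> Words T \<Longrightarrow> p0 \<le> P.prob {x \<in> space P. good u (env x)}"
    and step: "\<And>L u n. T_valued L \<Longrightarrow> u \<in> Wt L (n * l) \<Longrightarrow> (\<Sum>v\<in>Wt (subenv L u) l. b (u @ v) L) \<le> (if good u L then k0 else k1) * b u L"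
    and k: "0 \<le> k0" "k0 \<le> k1" and \<theta>: "(1 - p0) * k1 + p0 * k0 < 1"
  shows "AE x in P. (\<lambda>n. \<Sum>w\<in>Wt (env x) (n * l). b w (env x)) \<longlonglongrightarrow> 0"
proof -
  define W where "W n = {w \<in> Words T. length w = n * l}" for n
  \<comment> \<open>The indicator of admissibility lets the sums run over a fixed finite set of
    words, so that sum and expectation can be exchanged.\<close>
  define F where "F n w L = of_bool (w \<in> Wt L (n * l)) * b w L" for n w L
  define Y where "Y n L = (\<Sum>w\<in>W n. F n w L)" for n L
  define t where "t = (1 - p0) * k1 + p0 * k0"
  have fW: "finite (W n)" for n unfolding W_def by (rule finite_Words_length)
  let ?V = "\<lambda>m. {v \<in> Words T. length v < m}"
  have Floc: "locally_det (F n w) (?V (n * l))" if "w \<in> W n" for n w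
  proof -
    have w: "w \<in> Words T" "length w = n * l" using that by (auto simp: W_def)
    have "locally_det (\<lambda>L. w \<in> Wt L (n * l)) (?V (n * l))" by (rule Wt_local) (use w in auto)
    then show ?thesis using bloc[OF w(1)] unfolding F_def w(2) by (rule locally_det_comp2)
  qed
  have YF: "Y n L = (\<Sum>w\<in>Wt L (n * l). b w L)" if L: "T_valued L" for n L
  proof -
    have "Wt L (n * l) = W n \<inter> Wt L (n * l)" using Wt_Words[OF L] Wt_length by (auto simp: W_def)
    moreover have "Y n L = (\<Sum>w\<in>W n. if w \<in> Wt L (n * l) then b w L else 0)"
      unfolding Y_def F_def by (intro sum.cong) auto
    ultimately show ?thesis using sum.inter_restrict[OF fW[of n], of "\<lambda>w. b w L" "Wt L (n * l)"] by simp
  qed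
  have Fint: "integrable P (\<lambda>x. F n w (env x))" if "w \<in> W n" for n w
    by (rule local_integrable[OF finite_Words_length(1) _ Floc[OF that]]) auto
  have Yint: "integrable P (\<lambda>x. Y n (env x))" for n
    unfolding Y_def using Fint by (intro Bochner_Integration.integrable_sum) auto
  have Fnn: "0 \<le> F n w L" if "w \<in> W n" for n w L using nn that by (auto simp: F_def W_def)
  have Ynn: "0 \<le> Y n L" for n L unfolding Y_def by (intro sum_nonneg Fnn)
  define EY where "EY n = (\<integral>x. Y n (env x) \<partial>P)" for n
  have p01: "p0 \<le> 1" using gp[of "[]"] P.prob_le_1 order_trans Nil_Words by blast
  have Estep: "EY (Suc n) \<le> t * EY n" for n
  proof -
    \<comment> \<open>The two possible factors are written as one affine function of the indicator
      of \<open>good u\<close>; its expectation is at most \<open>t\<close>.\<close>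
    let ?h = "\<lambda>u x. F n u (env x) * (k1 - (k1 - k0) * of_bool (good u (env x)))"
    have g: "locally_det (\<lambda>L. k1 - (k1 - k0) * of_bool (good u L)) {v \<in> Words T. length u \<le> length v \<and> length v < length u + l}"
      and gfin: "finite {v \<in> Words T. length u \<le> length v \<and> length v < length u + l}" if "u \<in> W n" for u
      using gloc[of u] that finite_Words_length(1)[of "length u + l"]
      by (auto simp: W_def intro!: locally_det_comp[of "good u" _ "\<lambda>g. k1 - (k1 - k0) * of_bool g"] elim: rev_finite_subset)
    have ub: "\<bar>k1 - (k1 - k0) * of_bool c\<bar> \<le> k1" for c using k by auto
    have hint: "integrable P (?h u)" if u: "u \<in> W n" for u
    proof -
      have "integrable P (\<lambda>x. (k1 - (k1 - k0) * of_bool (good u (env x))) * F n u (env x))"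
        by (rule Bochner_Integration.integrable_bound[OF integrable_mult_right[OF Fint[OF u], of k1]])
           (use local_measurable[OF gfin[OF u] _ g[OF u]] Fint[OF u] ub k in \<open>auto simp: abs_mult intro!: mult_right_mono\<close>)
      then show ?thesis by (simp add: mult.commute)
    qed
    have "Y (Suc n) (env x) \<le> (\<Sum>u\<in>W n. ?h u x)" if x: "x \<in> space P" for x
    proof -
      note L = T_valued_env[OF x]
      have "Y (Suc n) (env x) = (\<Sum>u\<in>Wt (env x) (n * l). \<Sum>v\<in>Wt (subenv (env x) u) l. b (u @ v) (env x))"
        unfolding YF[OF L] using sum_Wt_add[of "\<lambda>w. b w (env x)" "env x" "n * l" l] by (simp add: add.commute)
      also have "\<dots> \<le> (\<Sum>u\<in>Wt (env x) (n * l). b u (env x) * (k1 - (k1 - k0) * of_bool (good u (env x))))"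
      proof (rule sum_mono)
        fix u assume "u \<in> Wt (env x) (n * l)"
        then show "(\<Sum>v\<in>Wt (subenv (env x) u) l. b (u @ v) (env x)) \<le> b u (env x) * (k1 - (k1 - k0) * of_bool (good u (env x)))"
          using step[OF L, of u n] by (auto simp: mult.commute split: if_splits)
      qed
      also have "\<dots> = (\<Sum>u\<in>W n. ?h u x)"
      proof -
        have "Wt (env x) (n * l) = W n \<inter> Wt (env x) (n * l)" using Wt_Words[OF L] Wt_length by (auto simp: W_def)
        moreover have "(\<Sum>u\<in>W n. ?h u x) = (\<Sum>u\<in>W n. if u \<in> Wt (env x) (n * l) then b u (env x) * (k1 - (k1 - k0) * of_bool (good u (env x))) else 0)"
          unfolding F_def by (intro sum.cong) auto
        ultimately show ?thesis
          using sum.inter_restrict[OF fW[of n], of "\<lambda>u. b u (env x) * (k1 - (k1 - k0) * of_bool (good u (env x)))" "Wt (env x) (n * l)"] by simp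
      qed
      finally show ?thesis .
    qed
    then have "EY (Suc n) \<le> (\<integral>x. (\<Sum>u\<in>W n. ?h u x) \<partial>P)"
      unfolding EY_def using hint by (intro integral_mono Yint Bochner_Integration.integrable_sum) auto
    also have "\<dots> = (\<Sum>u\<in>W n. \<integral>x. ?h u x \<partial>P)"
      using hint by (intro Bochner_Integration.integral_sum) auto
    also have "\<dots> \<le> (\<Sum>u\<in>W n. (\<integral>x. F n u (env x) \<partial>P) * t)"
    proof (rule sum_mono)
      fix u assume u: "u \<in> W n"
      then have uW: "u \<in> Words T" "length u = n * l" by (auto simp: W_def)
      have "(\<integral>x. ?h u x \<partial>P) = (\<integral>x. F n u (env x) \<partial>P) * (\<integral>x. k1 - (k1 - k0) * of_bool (good u (env x)) \<partial>P)"
        by (rule local_indep[OF finite_Words_length(1) _ Floc[OF u] gfin[OF u] _ g[OF u]]) (use uW(2) in auto)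
      also have "(\<integral>x. k1 - (k1 - k0) * of_bool (good u (env x)) \<partial>P) \<le> t"
      proof -
        have gm: "(\<lambda>x. of_bool (good u (env x)) :: real) \<in> borel_measurable P"
          by (rule local_measurable[OF gfin[OF u] _ locally_det_comp[OF gloc[OF uW(1)], of of_bool]]) auto
        have gi: "integrable P (\<lambda>x. of_bool (good u (env x)) :: real)"
          by (rule P.integrable_const_bound[of _ 1]) (use gm in auto)
        have "{x \<in> space P. good u (env x)} \<in> sets P"
        proof -
          have "{x \<in> space P. good u (env x)} = (\<lambda>x. of_bool (good u (env x)) :: real) -` {1} \<inter> space P" by auto
          then show ?thesis using measurable_sets[OF gm, of "{1}"] by simp
        qed
        then have "(\<integral>x. of_bool (good u (env x)) \<partial>P) = P.prob {x \<in> space P. good u (env x)}"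
          by (subst Bochner_Integration.integral_cong[OF refl, of P _ "indicator {x \<in> space P. good u (env x)}"]) (auto simp: indicator_def Int_absorb2)
        then have "(\<integral>x. k1 - (k1 - k0) * of_bool (good u (env x)) \<partial>P) = k1 - (k1 - k0) * P.prob {x \<in> space P. good u (env x)}"
          using gi by (simp add: P.prob_space)
        also have "\<dots> \<le> k1 - (k1 - k0) * p0"
          using gp[OF uW(1)] k by (intro diff_left_mono mult_left_mono) auto
        also have "\<dots> = t" by (simp add: t_def algebra_simps)
        finally show ?thesis .
      qed
      then have "(\<integral>x. F n u (env x) \<partial>P) * (\<integral>x. k1 - (k1 - k0) * of_bool (good u (env x)) \<partial>P) \<le> (\<integral>x. F n u (env x) \<partial>P) * t"
        using Fnn[OF u] by (intro mult_left_mono) (auto intro: integral_nonneg_AE)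
      finally show "(\<integral>x. ?h u x \<partial>P) \<le> (\<integral>x. F n u (env x) \<partial>P) * t" .
    qed
    also have "\<dots> = t * EY n"
      unfolding EY_def Y_def using Fint by (subst Bochner_Integration.integral_sum) (auto simp: sum_distrib_left mult.commute)
    finally show ?thesis .
  qed
  have EYnn: "0 \<le> EY n" for n unfolding EY_def using Ynn by (intro integral_nonneg_AE) auto
  define t' where "t' = max t 0"
  have t': "0 \<le> t'" "t' < 1" using \<theta> by (auto simp: t'_def t_def)
  have EYle: "EY n \<le> t' ^ n * EY 0" for n
  proof (induction n)
    case (Suc n)
    have "EY (Suc n) \<le> t * EY n" by (rule Estep)
    also have "\<dots> \<le> t' * EY n" using EYnn by (intro mult_right_mono) (auto simp: t'_def)
    also have "\<dots> \<le> t' * (t' ^ n * EY 0)" using Suc t' by (intro mult_left_mono)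
    finally show ?case by simp
  qed simp
  \<comment> \<open>Summable expectations give almost sure summability by Tonelli, hence convergence
    to 0 along the whole sequence.\<close>
  have "(\<integral>\<^sup>+x. (\<Sum>n. ennreal (Y n (env x))) \<partial>P) = (\<Sum>n. \<integral>\<^sup>+x. ennreal (Y n (env x)) \<partial>P)"
    using Yint by (intro nn_integral_suminf) auto
  also have "\<dots> = (\<Sum>n. ennreal (EY n))"
    unfolding EY_def using Yint Ynn by (simp add: nn_integral_eq_integral)
  also have "\<dots> \<noteq> \<top>"
  proof -
    have "summable EY"
      using t' EYle EYnn by (intro summable_comparison_test'[of "\<lambda>n. t' ^ n * EY 0" 0 EY] summable_mult2 summable_geometric) auto
    then show ?thesis using EYnn by (simp add: suminf_ennreal2)
  qed
  finally have "AE x in P. (\<Sum>n. ennreal (Y n (env x))) \<noteq> \<infinity>"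
    using Yint by (intro nn_integral_PInf_AE) auto
  then show ?thesis
    using AE_space
  proof eventually_elim
    case (elim x)
    then have "summable (\<lambda>n. Y n (env x))" using Ynn by (intro summable_suminf_not_top) auto
    then have "(\<lambda>n. Y n (env x)) \<longlonglongrightarrow> 0" by (rule summable_LIMSEQ_zero)
    then show ?case unfolding YF[OF T_valued_env[OF elim(2)]] .
  qed
qed

end

section \<open>Almost sure singularity\<close>

context random_gasket
begin

lemma AE_countable_ball: "countable A \<Longrightarrow> (\<And>a. a \<in> A \<Longrightarrow> AE x in P. R a x) \<Longrightarrow> AE x in P. \<forall>a\<in>A. R a x"
  by (simp add: AE_ball_countable)

lemma countable_Words: "countable (Words T)"
  unfolding Words_def by (intro countable_lists countable_finite finite_alphabet)

definition const2 :: "nat \<Rightarrow> (letter list \<Rightarrow> nat) \<Rightarrow> bool" where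
  "const2 \<nu> L \<longleftrightarrow> L [] = \<nu> \<and> (\<forall>v\<in>letters \<nu>. L [v] = \<nu>)"

text \<open>The exponent counts the root and its children, whose types are independent.\<close>

definition p_const2 :: "nat \<Rightarrow> real" where
  "p_const2 \<nu> = measure \<rho> {\<nu>} ^ Suc (card (letters \<nu>))"

lemma const2_local:
  assumes \<nu>: "\<nu> \<in> T" and u: "u \<in> Words T"
  shows "locally_det (\<lambda>L. const2 \<nu> (subenv L u)) {v \<in> Words T. length u \<le> length v \<and> length v < length u + 2}"
proof -
  have "u @ [v] \<in> Words T" if "v \<in> letters \<nu>" for v using u letters_alphabet[OF \<nu> that] by simp
  then show ?thesis using u unfolding locally_det_def const2_def by (auto simp: subenv_apply)
qed

lemma prob_const2:
  assumes \<nu>: "\<nu> \<in> T" and u: "u \<in> Words T"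
  shows "P.prob {x \<in> space P. const2 \<nu> (subenv (env x) u)} = p_const2 \<nu>"
proof -
  define J where "J = insert u ((\<lambda>v. u @ [v]) ` letters \<nu>)"
  have J: "J \<noteq> {}" "finite J" "J \<subseteq> Words T" using u letters_alphabet[OF \<nu>] by (auto simp: J_def)
  have card: "card J = Suc (card (letters \<nu>))"
    unfolding J_def by (subst card_insert_disjoint) (auto simp: card_image inj_on_def)
  have "{x \<in> space P. const2 \<nu> (subenv (env x) u)} = (\<Inter>w\<in>J. X w -` {\<nu>} \<inter> space P)"
    by (auto simp: J_def const2_def subenv_apply env_def)
  moreover have "P.prob (\<Inter>w\<in>J. X w -` {\<nu>} \<inter> space P) = (\<Prod>w\<in>J. P.prob (X w -` {\<nu>} \<inter> space P))"
    using \<nu> by (intro P.indep_varsD[OF indep J]) simp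
  moreover have "P.prob (X w -` {\<nu>} \<inter> space P) = measure \<rho> {\<nu>}" if "w \<in> J" for w
    using prob_X[of w "{\<nu>}"] J(3) that \<nu> by (auto simp: vimage_def Int_def conj_commute)
  ultimately show ?thesis by (simp add: p_const2_def card)
qed

lemma p_const2_pos: "\<nu> \<in> T \<Longrightarrow> 0 < p_const2 \<nu>"
  unfolding p_const2_def by (simp add: pos del: power_Suc)

text \<open>Isolates what the decay theorem needs from the weights. It speaks only about
  \<open>q\<close> and deterministic environments, so the exceptional set of random environments can
  be fixed for all rational weights with this property.\<close>

definition contracting :: "nat \<Rightarrow> real \<Rightarrow> real \<Rightarrow> (letter \<Rightarrow> real) \<Rightarrow> bool" where
  "contracting \<nu> k0 k1 q \<longleftrightarrow> 0 \<le> k0 \<and> k0 \<le> k1 \<and> (1 - p_const2 \<nu>) * k1 + p_const2 \<nu> * k0 < 1 \<and>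
     (\<forall>L y. T_valued L \<longrightarrow> hellinger L q y 2 \<le> (if const2 \<nu> L then k0 else k1) * sqrt (qf y y))"

lemma hellinger_decay:
  assumes \<nu>: "\<nu> \<in> T" and q: "\<And>v. v \<in> alphabet T \<Longrightarrow> 0 < q v" and c: "contracting \<nu> k0 k1 q"
  shows "AE x in P. (\<lambda>n. hellinger (env x) q y (n * 2)) \<longlonglongrightarrow> 0"
proof -
  have qW: "0 < prod_list (map q w)" if "w \<in> Words T" for w using that q by (induction w) auto
  let ?b = "\<lambda>w L. sqrt (prod_list (map q w) * (1 / rw w * qf (harm_restr_word w y) (harm_restr_word w y)))"
  have "AE x in P. (\<lambda>n. \<Sum>w\<in>Wt (env x) (n * 2). ?b w (env x)) \<longlonglongrightarrow> 0"
  proof (rule branching_decay[where good = "\<lambda>u L. const2 \<nu> (subenv L u)" and ?p0.0 = "p_const2 \<nu>" and ?k0.0 = k0 and ?k1.0 = k1])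
    show "0 \<le> ?b w L" if "w \<in> Words T" for w and L :: "letter list \<Rightarrow> nat"
      using qW[OF that] rw_pos[OF that] qf_nonneg by (intro real_sqrt_ge_zero mult_nonneg_nonneg) auto
    show "locally_det (?b w) {v \<in> Words T. length v < length w}" for w by (simp add: locally_det_def)
    show "u \<in> Words T \<Longrightarrow> locally_det (\<lambda>L. const2 \<nu> (subenv L u)) {v \<in> Words T. length u \<le> length v \<and> length v < length u + 2}" for u
      by (rule const2_local[OF \<nu>])
    show "u \<in> Words T \<Longrightarrow> p_const2 \<nu> \<le> P.prob {x \<in> space P. const2 \<nu> (subenv (env x) u)}" for u
      using prob_const2[OF \<nu>] by simp
    show "0 \<le> k0" "k0 \<le> k1" "(1 - p_const2 \<nu>) * k1 + p_const2 \<nu> * k0 < 1" using c by (auto simp: contracting_def)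
    fix L u n assume L: "T_valued L" and u: "u \<in> Wt L (n * 2)"
    have uW: "u \<in> Words T" by (rule Wt_Words[OF L u])
    let ?s = "sqrt (prod_list (map q u) * (1 / rw u))"
    have s0: "0 \<le> ?s" using qW[OF uW] rw_pos[OF uW] by simp
    have "(\<Sum>v\<in>Wt (subenv L u) 2. ?b (u @ v) L) = ?s * hellinger (subenv L u) q (harm_restr_word u y) 2"
      unfolding hellinger_def sum_distrib_left real_sqrt_mult[symmetric]
      by (intro sum.cong refl arg_cong[where f=sqrt]) (simp add: r_word_append harm_restr_word_append mult_ac)
    also have "\<dots> \<le> ?s * ((if const2 \<nu> (subenv L u) then k0 else k1) * sqrt (qf (harm_restr_word u y) (harm_restr_word u y)))"
      using c T_valued_sh[OF L uW] s0 by (intro mult_left_mono) (auto simp: contracting_def)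
    also have "\<dots> = (if const2 \<nu> (subenv L u) then k0 else k1) * ?b u L"
    proof -
      have "?b u L = ?s * sqrt (qf (harm_restr_word u y) (harm_restr_word u y))"
        unfolding real_sqrt_mult[symmetric] by (simp only: mult.assoc)
      then show ?thesis by (simp only: mult_ac)
    qed
    finally show "(\<Sum>v\<in>Wt (subenv L u) 2. ?b (u @ v) L) \<le> (if const2 \<nu> (subenv L u) then k0 else k1) * ?b u L" .
  qed
  then show ?thesis unfolding hellinger_def .
qed

lemma rat_weights_pos: "q \<in> rat_weights \<Longrightarrow> v \<in> alphabet T \<Longrightarrow> 0 < q v"
  by (auto simp: rat_weights_def)

text \<open>The premise on the weights stands inside the almost sure statement: null sets are
  collected over countably many rational weights, words and unit vectors before any \<open>q\<close>
  is considered.\<close>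

lemma AE_Hell_decay:
  assumes \<nu>: "\<nu> \<in> T"
  shows "AE x in P. \<forall>q\<in>rat_weights. \<forall>w\<in>Words T. \<forall>a\<in>S0. (\<exists>k0 k1. contracting \<nu> k0 k1 q) \<longrightarrow>
    (\<lambda>n. hellinger (subenv (env x) w) q (unit_vec a) (n * 2)) \<longlonglongrightarrow> 0"
proof (intro AE_countable_ball countable_rat_weights countable_Words countable_finite[OF finite_S0])
  fix q w a assume q: "q \<in> rat_weights" and w: "w \<in> Words T"
  show "AE x in P. (\<exists>k0 k1. contracting \<nu> k0 k1 q) \<longrightarrow> (\<lambda>n. hellinger (subenv (env x) w) q (unit_vec a) (n * 2)) \<longlonglongrightarrow> 0"
  proof (cases "\<exists>k0 k1. contracting \<nu> k0 k1 q")
    case True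
    then obtain k0 k1 where c: "contracting \<nu> k0 k1 q" by blast
    interpret S: random_gasket p \<alpha> T P \<rho> "\<lambda>v. X (w @ v)" by (rule shifted[OF w])
    have "S.env x = subenv (env x) w" for x by (simp add: S.env_def env_def subenv_def)
    moreover have "AE x in P. (\<lambda>n. hellinger (S.env x) q (unit_vec a) (n * 2)) \<longlonglongrightarrow> 0"
      using c rat_weights_pos[OF q] by (intro S.hellinger_decay[OF \<nu>]) auto
    ultimately show ?thesis by simp
  qed simp
qed

theorem AE_singular:
  "AE x in P. \<forall>q\<in>weights T. \<forall>f\<in>dom_F p \<alpha> T (env x).
     mutually_singular (energy_measure p \<alpha> T (env x) f) (mu_q p \<alpha> T (env x) q)"
proof -
  obtain \<nu> where \<nu>: "\<nu> \<in> T" using neT by blast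
  show ?thesis
    using AE_Hell_decay[OF \<nu>] AE_space
  proof eventually_elim
    case (elim x)
    note L = T_valued_env[OF elim(2)]
    show ?case
    proof (intro ballI)
      fix q f assume q: "q \<in> weights T" and f: "f \<in> dom_F p \<alpha> T (env x)"
      obtain k where k: "0 \<le> k" "k < 1"
        "\<And>L x. T_valued L \<Longrightarrow> L [] = \<nu> \<Longrightarrow> (\<And>v. v \<in> letters \<nu> \<Longrightarrow> L [v] = \<nu>) \<Longrightarrow> hellinger L q x 2 \<le> k * sqrt (qf x x)"
        using hellinger_2_contract[OF \<nu> q] by blast
      \<comment> \<open>With this \<open>s\<close> the mean factor for weights enlarged by at most
        \<open>1 + s\<close> is (1 + s)(1 - s), which is below 1. Since the contraction concerns
        words of length two, the root of the squared loss is exactly \<open>1 + s\<close>.\<close>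
      define s where "s = p_const2 \<nu> * (1 - k)"
      have s: "0 < s" unfolding s_def using p_const2_pos[OF \<nu>] k by simp
      have qpos: "0 < q v" if "v \<in> alphabet T" for v using q that by (auto simp: weights_def)
      obtain q0 where q0: "q0 \<in> rat_weights" "\<And>v. v \<in> alphabet T \<Longrightarrow> q v \<le> q0 v" "\<And>v. v \<in> alphabet T \<Longrightarrow> q0 v \<le> (1 + s) * q v"
        using rat_weights_approx[OF q, of "1 + s"] s by auto
      have q0pos: "0 < q0 v" if "v \<in> alphabet T" for v using rat_weights_pos[OF q0(1) that] .
      have "contracting \<nu> ((1 + s) * k) (1 + s) q0"
        unfolding contracting_def
      proof (intro conjI allI impI)
        show "0 \<le> (1 + s) * k" "(1 + s) * k \<le> 1 + s" using s k by (auto simp: mult_left_le)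
        have "(1 - p_const2 \<nu>) * (1 + s) + p_const2 \<nu> * ((1 + s) * k) = (1 + s) * (1 - s)"
          unfolding s_def by algebra
        also have "\<dots> = 1 - s * s" by algebra
        also have "\<dots> < 1" using s by simp
        finally show "(1 - p_const2 \<nu>) * (1 + s) + p_const2 \<nu> * ((1 + s) * k) < 1" .
        fix L y assume L: "T_valued L"
        have "hellinger L q0 y 2 \<le> sqrt ((1 + s) ^ 2) * hellinger L q y 2"
          using s q0(3) qpos q0pos by (intro hellinger_mono_weights[OF L]) (auto simp: less_imp_le)
        also have "sqrt ((1 + s) ^ 2) = 1 + s" using s by simp
        also have "hellinger L q y 2 \<le> (if const2 \<nu> L then k else 1) * sqrt (qf y y)"
          using k(3)[OF L, of y] hellinger_le_1[OF L q, of y 2] by (auto simp: const2_def)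
        finally show "hellinger L q0 y 2 \<le> (if const2 \<nu> L then (1 + s) * k else 1 + s) * sqrt (qf y y)"
          using s by (auto simp: mult.assoc split: if_splits)
      qed
      then have q0lim: "(\<lambda>n. hellinger (subenv (env x) w) q0 (unit_vec a) (n * 2)) \<longlonglongrightarrow> 0" if "w \<in> Words T" "a \<in> S0" for w a
        using elim(1) q0(1) that by blast
      show "mutually_singular (energy_measure p \<alpha> T (env x) f) (mu_q p \<alpha> T (env x) q)"
      proof (rule singular_from_Hell[OF L q f])
        fix w a assume w: "w \<in> Wt_all (env x)" and a: "a \<in> S0"
        have wW: "w \<in> Words T" by (rule Wt_all_Words[OF L w])
        note okw = T_valued_sh[OF L wW]
        show "(\<lambda>n. hellinger (subenv (env x) w) q (unit_vec a) (2 * n)) \<longlonglongrightarrow> 0"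
        proof (rule tendsto_sandwich[OF always_eventually always_eventually tendsto_const q0lim[OF wW a]])
          show "\<forall>n. 0 \<le> hellinger (subenv (env x) w) q (unit_vec a) (2 * n)" using hellinger_nonneg[OF okw q] by blast
          have "hellinger (subenv (env x) w) q (unit_vec a) (2 * n) \<le> sqrt (1 ^ (2 * n)) * hellinger (subenv (env x) w) q0 (unit_vec a) (2 * n)" for n
            using q0(2) qpos q0pos by (intro hellinger_mono_weights[OF okw, where c = 1]) (simp_all add: less_imp_le)
          then show "\<forall>n. hellinger (subenv (env x) w) q (unit_vec a) (2 * n) \<le> hellinger (subenv (env x) w) q0 (unit_vec a) (n * 2)"
            by (simp add: mult.commute)
        qed
      qed
    qed
  qed
qed

section \<open>Condition (B)\<close>

text \<open>The part of the test word behind its prefix, with types counted from 0; the two blocks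
  at corner \<open>j\<close> are merged.\<close>

definition corner_word :: "nat \<Rightarrow> nat \<Rightarrow> nat \<Rightarrow> nat \<Rightarrow> (nat \<Rightarrow> nat) \<Rightarrow> letter list" where
  "corner_word l0 l i j \<mu> = map (\<lambda>s. (\<mu> s, if s < l0 then i else j)) [0..<l]"

text \<open>The indices are counted from the end of the prefix on, starting with 0, so that goodness of a word
  depends only on the environment seen from there.\<close>

definition goodB :: "nat \<Rightarrow> nat \<Rightarrow> nat \<Rightarrow> (letter list \<Rightarrow> nat) \<Rightarrow> bool" where
  "goodB l0 l1 l2 L \<longleftrightarrow> (\<forall>i\<in>S0. \<forall>j\<in>S0. \<forall>\<mu>. (\<forall>s<l0 + l1 + l2. \<mu> s \<in> T) \<longrightarrow>
     corner_word l0 (l0 + l1 + l2) i j \<mu> \<in> Wt L (l0 + l1 + l2) \<longrightarrow>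
     \<mu> ` {l0..<l0 + l1} \<subseteq> \<mu> ` {l0 + l1..<l0 + l1 + l2})"

lemma letter_in_alphabet: "\<nu> \<in> T \<Longrightarrow> i \<in> S0 \<Longrightarrow> (\<nu>, i) \<in> alphabet T"
  by (rule letters_alphabet[OF _ S0_letters[OF T2]])

lemma goodB_local:
  assumes u: "u \<in> Words T"
  shows "locally_det (\<lambda>L. goodB l0 l1 l2 (subenv L u)) {v \<in> Words T. length u \<le> length v \<and> length v < length u + (l0 + l1 + l2)}"
proof -
  have e: "corner_word l0 (l0 + l1 + l2) i j \<mu> \<in> Wt (subenv L u) (l0 + l1 + l2) \<longleftrightarrow> corner_word l0 (l0 + l1 + l2) i j \<mu> \<in> Wt (subenv L' u) (l0 + l1 + l2)"
    if LL: "\<forall>v\<in>{v \<in> Words T. length u \<le> length v \<and> length v < length u + (l0 + l1 + l2)}. L v = L' v"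
      and ij: "i \<in> S0" "j \<in> S0" and \<mu>: "\<forall>s<l0 + l1 + l2. \<mu> s \<in> T" for L L' :: "letter list \<Rightarrow> nat" and i j \<mu>
  proof -
    let ?w = "corner_word l0 (l0 + l1 + l2) i j \<mu>"
    have "?w \<in> Words T" unfolding Words_def corner_word_def using ij \<mu> by (auto intro!: letter_in_alphabet)
    then have "u @ take s ?w \<in> Words T" for s using u take_Words by simp
    then have "L (u @ take s ?w) = L' (u @ take s ?w)" if "s < l0 + l1 + l2" for s
      using LL that by (auto simp: corner_word_def)
    then show ?thesis unfolding Wt_iff subenv_apply by (auto simp: corner_word_def)
  qed
  show ?thesis
    unfolding locally_det_def
  proof (intro allI impI)
    fix L L' :: "letter list \<Rightarrow> nat"
    assume "\<forall>v\<in>{v \<in> Words T. length u \<le> length v \<and> length v < length u + (l0 + l1 + l2)}. L v = L' v"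
    then show "goodB l0 l1 l2 (subenv L u) = goodB l0 l1 l2 (subenv L' u)"
      unfolding goodB_def by (intro ball_cong all_cong1 imp_cong refl e)
  qed
qed

section \<open>Paths forced by the environment\<close>

lemma choice_path_Words:
  assumes L: "T_valued L" and u: "u \<in> Words T" and ij: "i \<in> S0" "j \<in> S0"
  shows "choice_path (\<lambda>v. (L (u @ v), if length v < l0 then i else j)) n \<in> Words T"
proof (induction n)
  case (Suc n)
  then show ?case using ij T_valued_T[OF L, of "u @ _"] u by (auto intro!: letter_in_alphabet)
qed simp

lemma take_choice_path: "s \<le> n \<Longrightarrow> take s (choice_path c n) = choice_path c s"
  by (induction n) (auto simp: le_Suc_eq)

text \<open>Following prescribed corners, the next letter is dictated by the type found at the
  current word. The type at a word of length \<open>a + n\<close> is independent of everything that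
  led the path there, so each further step avoids type \<open>t\<close> with probability
  \<open>1 - measure \<rho> {t}\<close>.\<close>

lemma prob_avoid:
  fixes l0 a i j :: nat
  assumes u: "u \<in> Words T" and ij: "i \<in> S0" "j \<in> S0" and t: "t \<in> T"
  defines "c \<equiv> \<lambda>L v. (L (u @ v), if length v < l0 then i else j)"
  defines "E \<equiv> \<lambda>n L. (of_bool (\<forall>s\<in>{a..<a + n}. L (u @ choice_path (c L) s) \<noteq> t) :: real)"
  shows "integrable P (\<lambda>x. E n (env x))" "(\<integral>x. E n (env x) \<partial>P) \<le> (1 - measure \<rho> {t}) ^ n"
proof -
  define W where "W n = {w \<in> Words T. length w = a + n}" for n
  \<comment> \<open>The path is itself random, so the event is split according to its value
    \<open>w\<close>; for fixed \<open>w\<close> the types consulted sit at fixed words and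
    \<open>local_indep\<close> applies.\<close>
  define A where "A n w L = (of_bool (choice_path (c L) (a + n) = w \<and> (\<forall>s\<in>{a..<a + n}. L (u @ take s w) \<noteq> t)) :: real)" for n w L
  let ?V = "\<lambda>n. {v \<in> Words T. length v < length u + (a + n)}"
  have fW: "finite (W n)" for n unfolding W_def by (rule finite_Words_length)
  have Aloc: "locally_det (A n w) (?V n)" if w: "w \<in> W n" for n w
    unfolding locally_det_def
  proof (intro allI impI)
    fix L L' :: "letter list \<Rightarrow> nat" assume LL: "\<forall>v\<in>?V n. L v = L' v"
    have e: "L (u @ take s w) = L' (u @ take s w)" if "s < a + n" for s
      using LL that w u take_Words[of w s] by (auto simp: W_def)
    have lw: "length w = a + n" using w by (simp add: W_def)
    show "A n w L = A n w L'"
      unfolding A_def choice_path_eq_iff[OF lw] c_def using e lw by auto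
  qed
  have EA: "E n L = (\<Sum>w\<in>W n. A n w L)" if L: "T_valued L" for n L
  proof -
    have pW: "choice_path (c L) (a + n) \<in> W n" unfolding W_def c_def using choice_path_Words[OF L u ij] by simp
    have "(\<Sum>w\<in>W n. A n w L) = (\<Sum>w\<in>W n. if w = choice_path (c L) (a + n) then E n L else 0)"
    proof (intro sum.cong refl)
      fix w
      show "A n w L = (if w = choice_path (c L) (a + n) then E n L else 0)"
        unfolding A_def E_def by (auto simp: take_choice_path)
    qed
    then show ?thesis using pW fW by simp
  qed
  have Aint: "integrable P (\<lambda>x. A n w (env x))" if "w \<in> W n" for n w
    using finite_Words_length(1) by (intro local_integrable[OF _ _ Aloc[OF that]]) auto
  have Sint: "integrable P (\<lambda>x. \<Sum>w\<in>W n. A n w (env x))" for n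
    using Aint by (intro Bochner_Integration.integrable_sum)
  have Eint: "integrable P (\<lambda>x. E n (env x))" for n
    by (rule Bochner_Integration.integrable_cong[THEN iffD2, OF refl _ Sint[of n]]) (simp add: EA T_valued_env)
  show "integrable P (\<lambda>x. E n (env x))" by (rule Eint)
  have step: "(\<integral>x. E (Suc n) (env x) \<partial>P) = (1 - measure \<rho> {t}) * (\<integral>x. E n (env x) \<partial>P)" for n
  proof -
    have gloc: "locally_det (\<lambda>L. of_bool (L (u @ w) \<noteq> t) :: real) {u @ w}" for w
      by (simp add: locally_det_def)
    have uw: "{u @ w} \<subseteq> Words T" if "w \<in> W n" for w using that u by (simp add: W_def)
    have disj: "?V n \<inter> {u @ w} = {}" if "w \<in> W n" for w using that by (auto simp: W_def)
    have g: "(\<integral>x. of_bool (env x (u @ w) \<noteq> t) \<partial>P) = 1 - measure \<rho> {t}" if w: "w \<in> W n" for w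
    proof -
      have uwW: "u @ w \<in> Words T" using uw[OF w] by simp
      have m: "{x \<in> space P. X (u @ w) x \<in> {t}} \<in> sets P"
      proof -
        have "{x \<in> space P. X (u @ w) x \<in> {t}} = X (u @ w) -` {t} \<inter> space P" by auto
        then show ?thesis using measurable_sets[OF rv[OF uwW], of "{t}"] t by simp
      qed
      have "(\<integral>x. of_bool (env x (u @ w) \<noteq> t) \<partial>P) = (\<integral>x. 1 - indicator {x \<in> space P. X (u @ w) x \<in> {t}} x \<partial>P)"
        by (rule Bochner_Integration.integral_cong) (auto simp: env_def indicator_def)
      also have "\<dots> = 1 - P.prob {x \<in> space P. X (u @ w) x \<in> {t}}"
        using m by (subst Bochner_Integration.integral_diff) (auto simp: P.prob_space integrable_indicator_iff P.emeasure_eq_measure Int_absorb2)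
      finally show ?thesis using prob_X[OF uwW, of "{t}"] t by simp
    qed
    have "(\<integral>x. E (Suc n) (env x) \<partial>P) = (\<integral>x. (\<Sum>w\<in>W n. A n w (env x) * of_bool (env x (u @ w) \<noteq> t)) \<partial>P)"
    proof (rule Bochner_Integration.integral_cong[OF refl])
      fix x assume x: "x \<in> space P"
      note L = T_valued_env[OF x]
      have pW: "choice_path (c (env x)) (a + n) \<in> W n" unfolding W_def c_def using choice_path_Words[OF L u ij] by simp
      have "(\<Sum>w\<in>W n. A n w (env x) * of_bool (env x (u @ w) \<noteq> t)) = (\<Sum>w\<in>W n. if w = choice_path (c (env x)) (a + n) then E (Suc n) (env x) else 0)"
      proof (intro sum.cong refl)
        fix w
        have "{a..<a + Suc n} = insert (a + n) {a..<a + n}" by auto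
        then show "A n w (env x) * of_bool (env x (u @ w) \<noteq> t) = (if w = choice_path (c (env x)) (a + n) then E (Suc n) (env x) else 0)"
          unfolding A_def E_def by (auto simp: take_choice_path)
      qed
      then show "E (Suc n) (env x) = (\<Sum>w\<in>W n. A n w (env x) * of_bool (env x (u @ w) \<noteq> t))" using pW fW by simp
    qed
    also have "\<dots> = (\<Sum>w\<in>W n. \<integral>x. A n w (env x) * of_bool (env x (u @ w) \<noteq> t) \<partial>P)"
    proof (rule Bochner_Integration.integral_sum)
      fix w assume w: "w \<in> W n"
      have loc: "locally_det (\<lambda>L. A n w L * of_bool (L (u @ w) \<noteq> t)) (?V n \<union> {u @ w})"
        by (rule locally_det_comp2[where h = "(*)", OF locally_det_mono[OF Aloc[OF w]] locally_det_mono[OF gloc[of w]]]) auto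
      have f: "finite (?V n \<union> {u @ w})" using finite_Words_length(1)[of "length u + (a + n)"] by simp
      have s: "?V n \<union> {u @ w} \<subseteq> Words T" using uw[OF w] by blast
      show "integrable P (\<lambda>x. A n w (env x) * of_bool (env x (u @ w) \<noteq> t))"
        by (rule local_integrable[OF f s loc])
    qed
    also have "\<dots> = (\<Sum>w\<in>W n. (\<integral>x. A n w (env x) \<partial>P) * (1 - measure \<rho> {t}))"
    proof (rule sum.cong[OF refl])
      fix w assume w: "w \<in> W n"
      have "(\<integral>x. A n w (env x) * of_bool (env x (u @ w) \<noteq> t) \<partial>P) = (\<integral>x. A n w (env x) \<partial>P) * (\<integral>x. of_bool (env x (u @ w) \<noteq> t) \<partial>P)"
        by (rule local_indep[OF finite_Words_length(1) _ Aloc[OF w] _ uw[OF w] gloc disj[OF w]]) auto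
      then show "(\<integral>x. A n w (env x) * of_bool (env x (u @ w) \<noteq> t) \<partial>P) = (\<integral>x. A n w (env x) \<partial>P) * (1 - measure \<rho> {t})"
        unfolding g[OF w] .
    qed
    also have "\<dots> = (1 - measure \<rho> {t}) * (\<integral>x. (\<Sum>w\<in>W n. A n w (env x)) \<partial>P)"
      using Aint by (subst Bochner_Integration.integral_sum) (auto simp: sum_distrib_left mult.commute)
    also have "(\<integral>x. (\<Sum>w\<in>W n. A n w (env x)) \<partial>P) = (\<integral>x. E n (env x) \<partial>P)"
      by (rule Bochner_Integration.integral_cong[OF refl]) (simp add: EA T_valued_env)
    finally show ?thesis .
  qed
  have t1: "measure \<rho> {t} \<le> 1" using prob_X[of "[]" "{t}"] t P.prob_le_1 by (metis Nil_Words empty_subsetI insert_subset)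
  show "(\<integral>x. E n (env x) \<partial>P) \<le> (1 - measure \<rho> {t}) ^ n"
  proof (induction n)
    case 0 show ?case by (simp add: E_def P.prob_space)
  next
    case (Suc n)
    then have "(1 - measure \<rho> {t}) * (\<integral>x. E n (env x) \<partial>P) \<le> (1 - measure \<rho> {t}) * (1 - measure \<rho> {t}) ^ n"
      using t1 by (intro mult_left_mono) auto
    then show ?case unfolding step by simp
  qed
qed

text \<open>Admissibility forces the types of a corner word to be those found along its own path, so
  for given corners there is only one candidate. A violation thus means that this path misses,
  throughout the last block, some type \<open>t\<close> of the middle block.\<close>

lemma not_goodB_choice_path:
  assumes L: "\<not> goodB l0 l1 l2 L"
  obtains i j t where "i \<in> S0" "j \<in> S0" "t \<in> T"
    "\<forall>s\<in>{l0 + l1..<l0 + l1 + l2}. L (choice_path (\<lambda>v. (L v, if length v < l0 then i else j)) s) \<noteq> t"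
proof -
  let ?l = "l0 + l1 + l2"
  obtain i j \<mu> where ij: "i \<in> S0" "j \<in> S0" and \<mu>: "\<forall>s<?l. \<mu> s \<in> T" and w: "corner_word l0 ?l i j \<mu> \<in> Wt L ?l"
    and n: "\<not> \<mu> ` {l0..<l0 + l1} \<subseteq> \<mu> ` {l0 + l1..<?l}"
    using L unfolding goodB_def by blast
  obtain s0 where s0: "s0 \<in> {l0..<l0 + l1}" "\<mu> s0 \<notin> \<mu> ` {l0 + l1..<?l}" using n by blast
  let ?w = "corner_word l0 ?l i j \<mu>" and ?c = "\<lambda>v. (L v, if length v < l0 then i else j)"
  have lw: "length ?w = ?l" by (simp add: corner_word_def)
  have nth: "?w ! s = (\<mu> s, if s < l0 then i else j)" if "s < ?l" for s using that by (simp add: corner_word_def)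
  have fst: "\<mu> s = L (take s ?w)" if "s < ?l" for s
    using w that nth[OF that] letters_fst unfolding Wt_iff by fastforce
  have "choice_path ?c ?l = ?w"
    unfolding choice_path_eq_iff[OF lw] using fst nth lw by auto
  then have "L (choice_path ?c s) = \<mu> s" if "s < ?l" for s
    using take_choice_path[of s ?l ?c] that fst[OF that] by simp
  then have "\<forall>s\<in>{l0 + l1..<?l}. L (choice_path ?c s) \<noteq> \<mu> s0" using s0(2) by (auto simp: image_iff)
  moreover have "\<mu> s0 \<in> T" using \<mu> s0(1) by simp
  ultimately show ?thesis using that[OF ij] by blast
qed

text \<open>Union bound over 9 pairs of corners and \<open>card T\<close> missing types. The bound
  depends on the length \<open>l2\<close> of the last block but not on \<open>l0\<close> and
  \<open>l1\<close>.\<close>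

lemma prob_goodB:
  assumes c: "\<And>t. t \<in> T \<Longrightarrow> c \<le> measure \<rho> {t}" and u: "u \<in> Words T"
  shows "1 - 9 * real (card T) * (1 - c) ^ l2 \<le> P.prob {x \<in> space P. goodB l0 l1 l2 (subenv (env x) u)}"
proof -
  let ?l = "l0 + l1 + l2"
  let ?V = "{v \<in> Words T. length u \<le> length v \<and> length v < length u + ?l}"
  have fV: "finite ?V" by (rule rev_finite_subset[OF finite_Words_length(1)[of "length u + ?l"]]) auto
  let ?g = "\<lambda>x. of_bool (goodB l0 l1 l2 (subenv (env x) u)) :: real"
  have gint: "integrable P ?g"
    by (rule local_integrable[OF fV _ locally_det_comp[OF goodB_local[OF u], of of_bool]]) auto
  have gset: "{x \<in> space P. goodB l0 l1 l2 (subenv (env x) u)} \<in> sets P"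
  proof -
    have "{x \<in> space P. goodB l0 l1 l2 (subenv (env x) u)} = ?g -` {1} \<inter> space P" by auto
    then show ?thesis using measurable_sets[OF borel_measurable_integrable[OF gint], of "{1}"] by simp
  qed
  have gi: "(\<integral>x. ?g x \<partial>P) = P.prob {x \<in> space P. goodB l0 l1 l2 (subenv (env x) u)}"
    using gset by (subst Bochner_Integration.integral_cong[OF refl, of P _ "indicator {x \<in> space P. goodB l0 l1 l2 (subenv (env x) u)}"])
      (auto simp: indicator_def Int_absorb2)
  define E where "E i j t x = (of_bool (\<forall>s\<in>{l0 + l1..<l0 + l1 + l2}. env x (u @ choice_path (\<lambda>v. (env x (u @ v), if length v < l0 then i else j)) s) \<noteq> t) :: real)" for i j t x
  have Eint: "integrable P (E i j t)" and Ele: "(\<integral>x. E i j t x \<partial>P) \<le> (1 - c) ^ l2" if "i \<in> S0" "j \<in> S0" "t \<in> T" for i j t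
  proof -
    show "integrable P (E i j t)" unfolding E_def by (rule prob_avoid(1)[OF u that])
    have "(\<integral>x. E i j t x \<partial>P) \<le> (1 - measure \<rho> {t}) ^ l2" unfolding E_def by (rule prob_avoid(2)[OF u that])
    also have "\<dots> \<le> (1 - c) ^ l2"
    proof (rule power_mono)
      show "1 - measure \<rho> {t} \<le> 1 - c" using c[OF that(3)] by simp
      show "0 \<le> 1 - measure \<rho> {t}" using prob_X[of "[]" "{t}"] that(3) P.prob_le_1 by (metis Nil_Words diff_ge_0_iff_ge empty_subsetI insert_subset)
    qed
    finally show "(\<integral>x. E i j t x \<partial>P) \<le> (1 - c) ^ l2" .
  qed
  have E0: "0 \<le> E i j t x" for i j t x by (simp add: E_def)
  have "1 - ?g x \<le> (\<Sum>i\<in>S0. \<Sum>j\<in>S0. \<Sum>t\<in>T. E i j t x)" for x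
  proof (cases "goodB l0 l1 l2 (subenv (env x) u)")
    case True
    then show ?thesis using E0 by (simp add: sum_nonneg)
  next
    case False
    then obtain i j t where ijt: "i \<in> S0" "j \<in> S0" "t \<in> T"
      "\<forall>s\<in>{l0 + l1..<l0 + l1 + l2}. subenv (env x) u (choice_path (\<lambda>v. (subenv (env x) u v, if length v < l0 then i else j)) s) \<noteq> t"
      by (rule not_goodB_choice_path)
    then have "1 = E i j t x" by (simp add: E_def subenv_apply)
    also have "\<dots> \<le> (\<Sum>t\<in>T. E i j t x)" using finT ijt(3) E0 by (intro member_le_sum) auto
    also have "\<dots> \<le> (\<Sum>j\<in>S0. \<Sum>t\<in>T. E i j t x)"
      using ijt(2) E0 by (intro member_le_sum[of _ _ "\<lambda>j. \<Sum>t\<in>T. E i j t x"]) (auto intro: sum_nonneg)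
    also have "\<dots> \<le> (\<Sum>i\<in>S0. \<Sum>j\<in>S0. \<Sum>t\<in>T. E i j t x)"
      using ijt(1) E0 by (intro member_le_sum[of _ _ "\<lambda>i. \<Sum>j\<in>S0. \<Sum>t\<in>T. E i j t x"]) (auto intro!: sum_nonneg)
    finally show ?thesis using False by simp
  qed
  then have "(\<integral>x. 1 - ?g x \<partial>P) \<le> (\<integral>x. (\<Sum>i\<in>S0. \<Sum>j\<in>S0. \<Sum>t\<in>T. E i j t x) \<partial>P)"
    using gint Eint by (intro integral_mono Bochner_Integration.integrable_sum Bochner_Integration.integrable_diff) auto
  also have "\<dots> = (\<Sum>i\<in>S0. \<Sum>j\<in>S0. \<Sum>t\<in>T. \<integral>x. E i j t x \<partial>P)"
    using Eint by (simp add: Bochner_Integration.integral_sum Bochner_Integration.integrable_sum)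
  also have "\<dots> \<le> (\<Sum>i\<in>S0. \<Sum>j\<in>S0. \<Sum>t\<in>T. (1 - c) ^ l2)"
    using Ele by (intro sum_mono)
  also have "\<dots> = 9 * real (card T) * (1 - c) ^ l2" by (simp add: S0_def)
  finally show ?thesis using gint gi by (simp add: P.prob_space)
qed

text \<open>The mass of \<open>w\<close>, counted only while no complete block boundary along
  \<open>w\<close> has been good; \<open>w\<close> is cut into blocks of length
  \<open>l0 + l1 + l2\<close>.\<close>

definition bad_mass :: "nat \<Rightarrow> nat \<Rightarrow> nat \<Rightarrow> (letter \<Rightarrow> real) \<Rightarrow> (letter list \<Rightarrow> nat) \<Rightarrow> letter list \<Rightarrow> real" where
  "bad_mass l0 l1 l2 q L w = prod_list (map q w) *
     of_bool (\<forall>k. Suc k * (l0 + l1 + l2) \<le> length w \<longrightarrow> \<not> goodB l0 l1 l2 (subenv L (take (k * (l0 + l1 + l2)) w)))"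

text \<open>Good blocks will have probability at least 1/2 and leave no bad mass, so a growth factor
  below 2 on bad blocks still gives a mean factor below 1.\<close>

definition subdoubling :: "nat \<Rightarrow> (letter \<Rightarrow> real) \<Rightarrow> bool" where
  "subdoubling l q \<longleftrightarrow> (\<exists>k<2. \<forall>L. T_valued L \<longrightarrow> (\<Sum>w\<in>Wt L l. prod_list (map q w)) \<le> k)"

text \<open>One good block removes the whole mass below it, so the decay theorem applies with factor
  0 at good words, while elsewhere the unnormalized weights grow by less than 2.\<close>

lemma bad_mass_decay:
  assumes c: "\<And>t. t \<in> T \<Longrightarrow> c \<le> measure \<rho> {t}" and l2: "9 * real (card T) * (1 - c) ^ l2 \<le> 1 / 2" "0 < l2"
    and q: "\<And>v. v \<in> alphabet T \<Longrightarrow> 0 < q v" and s: "subdoubling (l0 + l1 + l2) q"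
  shows "AE x in P. (\<lambda>n. \<Sum>w\<in>Wt (env x) (n * (l0 + l1 + l2)). bad_mass l0 l1 l2 q (env x) w) \<longlonglongrightarrow> 0"
proof -
  let ?l = "l0 + l1 + l2"
  have qW: "0 < prod_list (map q w)" if "w \<in> Words T" for w using that q by (induction w) auto
  obtain k where k: "k < 2" "\<And>L. T_valued L \<Longrightarrow> (\<Sum>w\<in>Wt L ?l. prod_list (map q w)) \<le> k"
    using s unfolding subdoubling_def by blast
  show ?thesis
  proof (rule branching_decay[where b = "\<lambda>w L. bad_mass l0 l1 l2 q L w" and good = "\<lambda>u L. goodB l0 l1 l2 (subenv L u)"
      and ?p0.0 = "1/2" and ?k0.0 = 0 and ?k1.0 = "max k 0"])
    show "w \<in> Words T \<Longrightarrow> 0 \<le> bad_mass l0 l1 l2 q L w" for w L using qW by (simp add: bad_mass_def less_imp_le)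
    show "u \<in> Words T \<Longrightarrow> locally_det (\<lambda>L. goodB l0 l1 l2 (subenv L u)) {v \<in> Words T. length u \<le> length v \<and> length v < length u + ?l}" for u
      by (rule goodB_local)
    show "u \<in> Words T \<Longrightarrow> 1/2 \<le> P.prob {x \<in> space P. goodB l0 l1 l2 (subenv (env x) u)}" for u
      using prob_goodB[OF c, where u = u and ?l0.0 = l0 and ?l1.0 = l1 and ?l2.0 = l2] l2(1) by simp
    show "(0::real) \<le> 0" "0 \<le> max k 0" "(1 - 1/2) * max k 0 + 1/2 * 0 < 1" using k(1) by auto
    show "locally_det (\<lambda>L. bad_mass l0 l1 l2 q L w) {v \<in> Words T. length v < length w}" if w: "w \<in> Words T" for w
      unfolding locally_det_def
    proof (intro allI impI)
      fix L L' :: "letter list \<Rightarrow> nat" assume LL: "\<forall>v\<in>{v \<in> Words T. length v < length w}. L v = L' v"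
      have "goodB l0 l1 l2 (subenv L (take (k * ?l) w)) = goodB l0 l1 l2 (subenv L' (take (k * ?l) w))" if "Suc k * ?l \<le> length w" for k
      proof -
        let ?u = "take (k * ?l) w"
        have "length ?u + ?l \<le> length w" using that by simp
        then have "\<forall>v\<in>{v \<in> Words T. length ?u \<le> length v \<and> length v < length ?u + ?l}. L v = L' v" using LL by auto
        then show ?thesis using goodB_local[OF take_Words[OF w], of l0 l1 l2 "k * ?l"] unfolding locally_det_def by blast
      qed
      then show "bad_mass l0 l1 l2 q L w = bad_mass l0 l1 l2 q L' w" unfolding bad_mass_def by (auto simp: of_bool_def)
    qed
    fix L u n assume L: "T_valued L" and u: "u \<in> Wt L (n * ?l)"
    have lu: "length u = n * ?l" by (rule Wt_length[OF u])
    have b: "bad_mass l0 l1 l2 q L (u @ v) = bad_mass l0 l1 l2 q L u * of_bool (\<not> goodB l0 l1 l2 (subenv L u)) * prod_list (map q v)"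
      if v: "v \<in> Wt (subenv L u) ?l" for v
    proof -
      have lv: "length v = ?l" by (rule Wt_length[OF v])
      have "(\<forall>k. Suc k * ?l \<le> length (u @ v) \<longrightarrow> \<not> goodB l0 l1 l2 (subenv L (take (k * ?l) (u @ v)))) \<longleftrightarrow>
        (\<forall>k<Suc n. \<not> goodB l0 l1 l2 (subenv L (take (k * ?l) (u @ v))))"
      proof -
        have "Suc k * ?l \<le> length (u @ v) \<longleftrightarrow> k < Suc n" for k
        proof -
          have "length (u @ v) = Suc n * ?l" using lu lv by simp
          then have "Suc k * ?l \<le> length (u @ v) \<longleftrightarrow> Suc k \<le> Suc n" using l2(2) by (simp only: mult_le_cancel2) simp
          then show ?thesis by auto
        qed
        then show ?thesis by simp
      qed
      also have "\<dots> \<longleftrightarrow> (\<forall>k<n. \<not> goodB l0 l1 l2 (subenv L (take (k * ?l) u))) \<and> \<not> goodB l0 l1 l2 (subenv L u)"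
      proof -
        have "take (k * ?l) (u @ v) = take (k * ?l) u" if "k \<le> n" for k
          using that lu by (simp add: mult_le_mono1)
        then show ?thesis using lu by (auto simp: less_Suc_eq)
      qed
      also have "(\<forall>k<n. \<not> goodB l0 l1 l2 (subenv L (take (k * ?l) u))) \<longleftrightarrow>
        (\<forall>k. Suc k * ?l \<le> length u \<longrightarrow> \<not> goodB l0 l1 l2 (subenv L (take (k * ?l) u)))"
      proof -
        have "Suc k * ?l \<le> length u \<longleftrightarrow> k < n" for k
        proof -
          have "Suc k * ?l \<le> length u \<longleftrightarrow> Suc k \<le> n" using l2(2) lu by (simp only: mult_le_cancel2) simp
          then show ?thesis by auto
        qed
        then show ?thesis by simp
      qed
      finally have iff: "(\<forall>k. Suc k * ?l \<le> length (u @ v) \<longrightarrow> \<not> goodB l0 l1 l2 (subenv L (take (k * ?l) (u @ v)))) \<longleftrightarrow>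
        (\<forall>k. Suc k * ?l \<le> length u \<longrightarrow> \<not> goodB l0 l1 l2 (subenv L (take (k * ?l) u))) \<and> \<not> goodB l0 l1 l2 (subenv L u)" .
      show ?thesis unfolding bad_mass_def iff of_bool_conj map_append prod_list.append by (simp only: mult_ac)
    qed
    have b0: "0 \<le> bad_mass l0 l1 l2 q L u" using qW[OF Wt_Words[OF L u]] by (simp add: bad_mass_def)
    have "(\<Sum>v\<in>Wt (subenv L u) ?l. bad_mass l0 l1 l2 q L (u @ v)) =
      bad_mass l0 l1 l2 q L u * of_bool (\<not> goodB l0 l1 l2 (subenv L u)) * (\<Sum>v\<in>Wt (subenv L u) ?l. prod_list (map q v))"
      unfolding sum_distrib_left by (intro sum.cong refl b)
    also have "\<dots> \<le> bad_mass l0 l1 l2 q L u * of_bool (\<not> goodB l0 l1 l2 (subenv L u)) * max k 0"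
      using k(2)[OF T_valued_sh_Wt[OF L u]] b0 by (intro mult_left_mono) auto
    finally show "(\<Sum>v\<in>Wt (subenv L u) ?l. bad_mass l0 l1 l2 q L (u @ v)) \<le> (if goodB l0 l1 l2 (subenv L u) then 0 else max k 0) * bad_mass l0 l1 l2 q L u"
      by (auto simp: mult.commute split: if_splits)
  qed
qed

lemma AE_bad_mass_decay:
  assumes c: "\<forall>t\<in>T. c \<le> measure \<rho> {t}" and l2: "9 * real (card T) * (1 - c) ^ l2 \<le> 1 / 2" "0 < l2"
  shows "AE x in P. \<forall>l0\<in>UNIV. \<forall>l1\<in>UNIV. \<forall>q\<in>rat_weights. \<forall>w\<in>Words T. subdoubling (l0 + l1 + l2) q \<longrightarrow>
    (\<lambda>n. \<Sum>v\<in>Wt (subenv (env x) w) (n * (l0 + l1 + l2)). bad_mass l0 l1 l2 q (subenv (env x) w) v) \<longlonglongrightarrow> 0"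
proof (intro AE_countable_ball countable_rat_weights countable_Words)
  fix l0 l1 :: nat and q w assume q: "q \<in> rat_weights" and w: "w \<in> Words T"
  show "AE x in P. subdoubling (l0 + l1 + l2) q \<longrightarrow>
    (\<lambda>n. \<Sum>v\<in>Wt (subenv (env x) w) (n * (l0 + l1 + l2)). bad_mass l0 l1 l2 q (subenv (env x) w) v) \<longlonglongrightarrow> 0"
  proof (cases "subdoubling (l0 + l1 + l2) q")
    case True
    interpret S: random_gasket p \<alpha> T P \<rho> "\<lambda>v. X (w @ v)" by (rule shifted[OF w])
    have e: "S.env x = subenv (env x) w" for x by (simp add: S.env_def env_def subenv_def)
    have "AE x in P. (\<lambda>n. \<Sum>v\<in>Wt (S.env x) (n * (l0 + l1 + l2)). bad_mass l0 l1 l2 q (S.env x) v) \<longlonglongrightarrow> 0"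
      by (rule S.bad_mass_decay[OF _ l2 _ True]) (use c rat_weights_pos[OF q] in auto)
    then show ?thesis unfolding e by eventually_elim simp
  qed simp
qed auto

lemma subdoubling_approx:
  assumes q: "q \<in> weights T"
  obtains q0 where "q0 \<in> rat_weights" "\<And>v. v \<in> alphabet T \<Longrightarrow> q v \<le> q0 v" "subdoubling l q0"
proof -
  \<comment> \<open>The exponent 1/(l + 1) makes the loss over \<open>l\<close> letters 2 to the
    power l/(l + 1), strictly less than 2 and valid also for \<open>l = 0\<close>.\<close>
  define c where "c = (2::real) powr (1 / (real l + 1))"
  have c1: "1 < c" unfolding c_def by simp
  have "c ^ l = 2 powr (real l / (real l + 1))"
    unfolding c_def by (simp add: powr_realpow[symmetric] powr_powr)
  also have "\<dots> < 2 powr 1" by (intro powr_less_mono) (auto simp: field_simps)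
  finally have c2: "c ^ l < 2" by simp
  have qpos: "0 < q v" if "v \<in> alphabet T" for v using q that by (auto simp: weights_def)
  obtain q0 where q0: "q0 \<in> rat_weights" "\<And>v. v \<in> alphabet T \<Longrightarrow> q v \<le> q0 v" "\<And>v. v \<in> alphabet T \<Longrightarrow> q0 v \<le> c * q v"
    using rat_weights_approx[OF q c1] by blast
  have "(\<Sum>w\<in>Wt L l. prod_list (map q0 w)) \<le> c ^ l" if L: "T_valued L" for L
  proof -
    have "prod_list (map q0 w) \<le> c ^ l * prod_list (map q w)" if w: "w \<in> Wt L l" for w
      using prod_list_mono_weights(2)[of q0 c q w] q0(3) rat_weights_pos[OF q0(1)] c1 qpos Wt_Words[OF L w] Wt_length[OF w]
      by (simp add: less_imp_le)
    then have "(\<Sum>w\<in>Wt L l. prod_list (map q0 w)) \<le> (\<Sum>w\<in>Wt L l. c ^ l * prod_list (map q w))" by (rule sum_mono)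
    also have "\<dots> = c ^ l" using sum_weights_Wt[OF L q] by (simp flip: sum_distrib_left)
    finally show ?thesis .
  qed
  then have "subdoubling l q0" unfolding subdoubling_def using c2 by blast
  with q0 that show ?thesis by blast
qed

text \<open>A change of index only: position \<open>k + 1 + s\<close> of the test word is position
  \<open>s\<close> behind the prefix of length \<open>k\<close>.\<close>

lemma condition_B_pattern:
  assumes L: "T_valued L" and g: "goodB l0 l1 l2 (subenv L (prefix_of \<omega> k))" and i: "i \<in> S0" "j \<in> S0"
    and \<nu>: "\<forall>m\<in>{k + 1..k + l0 + l1 + l2}. \<nu> m \<in> T" and w: "test_word \<omega> k l0 l1 l2 i j \<nu> \<in> Wt L (k + l0 + l1 + l2)"
  shows "\<nu> ` {k + l0 + 1..k + l0 + l1} \<subseteq> \<nu> ` {k + l0 + l1 + 1..k + l0 + l1 + l2}"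
proof -
  let ?l = "l0 + l1 + l2"
  define \<mu> where "\<mu> s = \<nu> (k + 1 + s)" for s
  have seg: "map f [k + 1 + a..<k + 1 + b] = map (\<lambda>s. f (k + 1 + s)) [a..<b]" for a b and f :: "nat \<Rightarrow> letter"
    by (rule nth_equalityI) (auto simp del: upt_Suc simp: add.assoc)
  have "corner_word l0 ?l i j \<mu> = map (\<lambda>s. (\<mu> s, i)) [0..<l0] @ map (\<lambda>s. (\<mu> s, j)) [l0..<l0 + l1] @ map (\<lambda>s. (\<mu> s, j)) [l0 + l1..<?l]"
  proof -
    have "[0..<?l] = [0..<l0] @ [l0..<l0 + l1] @ [l0 + l1..<?l]"
      using upt_add_eq_append[of 0 l0 "l1 + l2"] upt_add_eq_append[of l0 "l0 + l1" l2] by (simp add: add.assoc)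
    then show ?thesis unfolding corner_word_def by simp
  qed
  then have "test_word \<omega> k l0 l1 l2 i j \<nu> = prefix_of \<omega> k @ corner_word l0 ?l i j \<mu>"
    unfolding test_word_def \<mu>_def using seg[of "\<lambda>m. (\<nu> m, i)" 0 l0] seg[of "\<lambda>m. (\<nu> m, j)" l0 "l0 + l1"] seg[of "\<lambda>m. (\<nu> m, j)" "l0 + l1" ?l]
    by (simp add: add.assoc add.commute add.left_commute)
  then have "corner_word l0 ?l i j \<mu> \<in> Wt (subenv L (prefix_of \<omega> k)) ?l"
    using w Wt_append_iff[of "prefix_of \<omega> k" k "corner_word l0 ?l i j \<mu>" L ?l] by (simp add: add.assoc)
  moreover have "\<forall>s<?l. \<mu> s \<in> T" using \<nu> by (auto simp: \<mu>_def)
  ultimately have sub: "\<mu> ` {l0..<l0 + l1} \<subseteq> \<mu> ` {l0 + l1..<?l}" using g i unfolding goodB_def by blast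
  have im: "\<mu> ` {a..<b} = \<nu> ` {k + a + 1..k + b}" for a b
  proof -
    have "(\<lambda>s. k + 1 + s) ` {a..<b} = {k + a + 1..k + b}"
    proof (intro equalityI subsetI)
      fix m assume "m \<in> {k + a + 1..k + b}"
      then show "m \<in> (\<lambda>s. k + 1 + s) ` {a..<b}" by (intro image_eqI[of _ _ "m - (k + 1)"]) auto
    qed auto
    then show ?thesis unfolding \<mu>_def by (metis image_image)
  qed
  show ?thesis using sub unfolding im by (simp add: add.assoc)
qed

text \<open>For each starting block \<open>n0\<close> the sequences without a good block from there
  on have mass 0: above level \<open>n0\<close> the masses of \<open>q\<close> are kept, and below
  each word of that level the bad mass of \<open>q0\<close> dominates and decays. This is why decay
  is assumed below all words. Letting \<open>n0\<close> vary gives infinitely many good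
  blocks.\<close>

lemma condition_B_from_decay:
  assumes L: "T_valued L" and q: "q \<in> weights T" and l2: "0 < l2"
    and q0: "\<And>v. v \<in> alphabet T \<Longrightarrow> q v \<le> q0 v"
    and dec: "\<And>w. w \<in> Words T \<Longrightarrow> (\<lambda>n. \<Sum>v\<in>Wt (subenv L w) (n * (l0 + l1 + l2)). bad_mass l0 l1 l2 q0 (subenv L w) v) \<longlonglongrightarrow> 0"
  shows "AE \<omega> in lambda_q T L q. \<exists>\<^sub>\<infinity>k. \<forall>i\<in>S0. \<forall>j\<in>S0. \<forall>\<nu> :: nat \<Rightarrow> nat.
       (\<forall>m\<in>{k + 1..k + l0 + l1 + l2}. \<nu> m \<in> T) \<longrightarrow>
       test_word \<omega> k l0 l1 l2 i j \<nu> \<in> Wt L (k + l0 + l1 + l2) \<longrightarrow>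
       \<nu> ` {k + l0 + 1..k + l0 + l1} \<subseteq> \<nu> ` {k + l0 + l1 + 1..k + l0 + l1 + l2}"
proof -
  let ?l = "l0 + l1 + l2" and ?M = "lambda_q T L q"
  note M = tree_measure_lambda(1)[OF L q]
  note sM = tree_measureD(1)[OF M]
  interpret prob_space ?M by (rule tree_measure_lambda(2)[OF L q])
  have qpos: "0 < q v" if "v \<in> alphabet T" for v using q that by (auto simp: weights_def)
  have q_le: "prod_list (map q w) \<le> prod_list (map q0 w)" if w: "w \<in> Words T" for w
    using prod_list_mono_weights(2)[of q 1 q0 w] q0 qpos w by (fastforce simp: less_imp_le)
  have AEn: "AE \<omega> in ?M. \<exists>n\<ge>n0. goodB l0 l1 l2 (subenv L (prefix_of \<omega> (n * ?l)))" for n0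
  proof -
    \<comment> \<open>Words that avoid good blocks from number \<open>n0\<close> to
      \<open>n0 + N - 1\<close>; the earlier blocks are unrestricted, as infinitely many good ones
      are wanted.\<close>
    define Y where "Y N = {w \<in> Wt L ((n0 + N) * ?l). \<forall>k. n0 \<le> k \<and> k < n0 + N \<longrightarrow> \<not> goodB l0 l1 l2 (subenv L (take (k * ?l) w))}" for N
    define B where "B N = {\<omega> \<in> Sigma_sp T. prefix_of \<omega> ((n0 + N) * ?l) \<in> Y N}" for N
    have mB: "measure ?M (B N) \<le> (\<Sum>w\<in>Wt L (n0 * ?l). prod_list (map q w) * (\<Sum>v\<in>Wt (subenv L w) (N * ?l). bad_mass l0 l1 l2 q0 (subenv L w) v))" for N
    proof -
      have "measure ?M (B N) = (\<Sum>w\<in>Y N \<inter> Wt L ((n0 + N) * ?l). prod_list (map q w))"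
        unfolding B_def by (rule measure_prefix[OF L M]) (auto simp: Y_def Wt_Words[OF L] Wt_length)
      also have "\<dots> = (\<Sum>w\<in>Wt L ((n0 + N) * ?l). if w \<in> Y N then prod_list (map q w) else 0)"
        using sum.inter_restrict[OF finite_Wt, of "\<lambda>w. prod_list (map q w)" L "(n0 + N) * ?l" "Y N"] by (simp add: Int_commute)
      also have "\<dots> = (\<Sum>w\<in>Wt L (n0 * ?l). \<Sum>v\<in>Wt (subenv L w) (N * ?l). if w @ v \<in> Y N then prod_list (map q (w @ v)) else 0)"
        unfolding add_mult_distrib sum_Wt_add ..
      also have "\<dots> \<le> (\<Sum>w\<in>Wt L (n0 * ?l). \<Sum>v\<in>Wt (subenv L w) (N * ?l). prod_list (map q w) * bad_mass l0 l1 l2 q0 (subenv L w) v)"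
      proof (intro sum_mono)
        fix w v assume w: "w \<in> Wt L (n0 * ?l)" and v: "v \<in> Wt (subenv L w) (N * ?l)"
        have wW: "w \<in> Words T" and vW: "v \<in> Words T" using Wt_Words[OF L w] Wt_Words[OF T_valued_sh_Wt[OF L w] v] by auto
        have lw: "length w = n0 * ?l" and lv: "length v = N * ?l" using Wt_length w v by blast+
        have q0v: "0 < prod_list (map q0 v)" using weights_nonneg[OF q vW] q_le[OF vW] by simp
        have wq: "0 < prod_list (map q w)" by (rule weights_nonneg[OF q wW])
        show "(if w @ v \<in> Y N then prod_list (map q (w @ v)) else 0) \<le> prod_list (map q w) * bad_mass l0 l1 l2 q0 (subenv L w) v"
        proof (cases "w @ v \<in> Y N")
          case True
          have "\<not> goodB l0 l1 l2 (subenv (subenv L w) (take (k * ?l) v))" if k: "Suc k * ?l \<le> length v" for k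
          proof -
            have "Suc k \<le> N" using k l2 unfolding lv by (simp only: mult_le_cancel2)
            then have "\<not> goodB l0 l1 l2 (subenv L (take ((n0 + k) * ?l) (w @ v)))" using True by (simp add: Y_def)
            moreover have "take ((n0 + k) * ?l) (w @ v) = w @ take (k * ?l) v"
              unfolding add_mult_distrib using lw by simp
            ultimately show ?thesis by simp
          qed
          then have "bad_mass l0 l1 l2 q0 (subenv L w) v = prod_list (map q0 v)" unfolding bad_mass_def by (simp add: of_bool_def)
          then show ?thesis using True q_le[OF vW] wq by simp
        next
          case False
          then show ?thesis using wq q0v by (simp add: bad_mass_def)
        qed
      qed
      finally show ?thesis by (simp only: sum_distrib_left)
    qed
    have "(\<lambda>N. \<Sum>w\<in>Wt L (n0 * ?l). prod_list (map q w) * (\<Sum>v\<in>Wt (subenv L w) (N * ?l). bad_mass l0 l1 l2 q0 (subenv L w) v)) \<longlonglongrightarrow> (\<Sum>w\<in>Wt L (n0 * ?l). prod_list (map q w) * 0)"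
      by (intro tendsto_sum tendsto_mult tendsto_const dec Wt_Words[OF L])
    then have lim: "(\<lambda>N. \<Sum>w\<in>Wt L (n0 * ?l). prod_list (map q w) * (\<Sum>v\<in>Wt (subenv L w) (N * ?l). bad_mass l0 l1 l2 q0 (subenv L w) v)) \<longlonglongrightarrow> 0" by simp
    have Bs: "B N \<in> sets ?M" for N unfolding B_def by (rule sets_prefix_in[OF sM])
    have Is: "(\<Inter>N. B N) \<in> sets ?M" using Bs by (intro sets.countable_INT) auto
    have "measure ?M (\<Inter>N. B N) \<le> 0"
    proof (rule LIMSEQ_le_const[OF lim])
      have "measure ?M (\<Inter>N. B N) \<le> measure ?M (B N)" for N using Bs by (intro finite_measure_mono) auto
      then show "\<exists>M0. \<forall>N\<ge>M0. measure ?M (\<Inter>N. B N) \<le> (\<Sum>w\<in>Wt L (n0 * ?l). prod_list (map q w) * (\<Sum>v\<in>Wt (subenv L w) (N * ?l). bad_mass l0 l1 l2 q0 (subenv L w) v))"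
        using mB order_trans by blast
    qed
    then have "(\<Inter>N. B N) \<in> null_sets ?M" using Is by (auto simp: null_sets_def emeasure_eq_measure measure_le_0_iff)
    then have "AE \<omega> in ?M. \<omega> \<notin> (\<Inter>N. B N)" by (rule AE_not_in)
    then show ?thesis
      using AE_Sigma_t[OF L M]
    proof eventually_elim
      case (elim \<omega>)
      then obtain N where "\<omega> \<notin> B N" by blast
      then have "prefix_of \<omega> ((n0 + N) * ?l) \<notin> Y N" using Sigma_t_sp[OF elim(2)] by (simp add: B_def)
      then obtain k where k: "n0 \<le> k" "k < n0 + N" "goodB l0 l1 l2 (subenv L (take (k * ?l) (prefix_of \<omega> ((n0 + N) * ?l))))"
        using Sigma_t_Wt[OF elim(2)] by (auto simp: Y_def)
      have "take (k * ?l) (prefix_of \<omega> ((n0 + N) * ?l)) = prefix_of \<omega> (k * ?l)"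
        using k(2) by (intro take_prefix_of mult_le_mono1) simp
      then show ?case using k by auto
    qed
  qed
  then have "AE \<omega> in ?M. \<forall>n0. \<exists>n\<ge>n0. goodB l0 l1 l2 (subenv L (prefix_of \<omega> (n * ?l)))" by (simp add: AE_all_countable)
  then show ?thesis
  proof eventually_elim
    case (elim \<omega>)
    have "\<exists>k\<ge>m. goodB l0 l1 l2 (subenv L (prefix_of \<omega> k))" for m
    proof -
      obtain n where n: "n \<ge> m" "goodB l0 l1 l2 (subenv L (prefix_of \<omega> (n * ?l)))" using elim by blast
      have "m * 1 \<le> n * ?l" using n(1) l2 by (intro mult_le_mono) auto
      then show ?thesis using n(2) by (intro exI[of _ "n * ?l"]) simp
    qed
    then have "\<exists>\<^sub>\<infinity>k. goodB l0 l1 l2 (subenv L (prefix_of \<omega> k))" unfolding INFM_nat_le by blast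
    then show ?case
      by (rule INFM_mono) (intro ballI allI impI, rule condition_B_pattern[OF L])
  qed
qed

text \<open>Since the bound in \<open>prob_goodB\<close> is uniform in \<open>l0\<close> and
  \<open>l1\<close>, one \<open>l2\<close> determined by \<open>\<rho>\<close> and \<open>T\<close>
  serves all of them. The rational weights, in contrast, are chosen anew for each block length,
  because the admissible loss per letter shrinks with it.\<close>

theorem AE_condition_B: "AE x in P. \<forall>q\<in>weights T. condition_B T (env x) q"
proof -
  define c where "c = Min ((\<lambda>t. measure \<rho> {t}) ` T)"
  have "c \<in> (\<lambda>t. measure \<rho> {t}) ` T" unfolding c_def using finT neT by (intro Min_in) auto
  then have c0: "0 < c" using pos by auto
  have c: "\<forall>t\<in>T. c \<le> measure \<rho> {t}" unfolding c_def using finT by simp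
  obtain t where t: "t \<in> T" using neT by blast
  have "measure \<rho> {t} \<le> 1" using prob_X[of "[]" "{t}"] t P.prob_le_1 by (metis Nil_Words empty_subsetI insert_subset)
  then have c1: "c \<le> 1" using c t by force
  have "(\<lambda>n. 9 * real (card T) * (1 - c) ^ n) \<longlonglongrightarrow> 9 * real (card T) * 0"
    using c0 c1 by (intro tendsto_mult tendsto_const LIMSEQ_power_zero) auto
  then have "eventually (\<lambda>n. 9 * real (card T) * (1 - c) ^ n < 1/2) sequentially"
    by (rule order_tendstoD(2)) simp
  then obtain n0 where n0: "\<And>n. n \<ge> n0 \<Longrightarrow> 9 * real (card T) * (1 - c) ^ n < 1/2" unfolding eventually_sequentially by blast
  \<comment> \<open>The successor makes \<open>l2\<close> positive, as (B) requires.\<close>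
  define l2 where "l2 = Suc n0"
  have l2: "9 * real (card T) * (1 - c) ^ l2 \<le> 1/2" "0 < l2" using n0[of l2] by (auto simp: l2_def)
  show ?thesis
    using AE_bad_mass_decay[OF c l2] AE_space
  proof eventually_elim
    case (elim x)
    note L = T_valued_env[OF elim(2)]
    show ?case
    proof
      fix q assume q: "q \<in> weights T"
      show "condition_B T (env x) q"
        unfolding condition_B_def
      proof (intro allI impI exI[of _ l2] conjI)
        show "1 \<le> l2" using l2(2) by simp
        fix l0 l1 :: nat
        obtain q0 where q0: "q0 \<in> rat_weights" "\<And>v. v \<in> alphabet T \<Longrightarrow> q v \<le> q0 v" "subdoubling (l0 + l1 + l2) q0"
          using subdoubling_approx[OF q, of "l0 + l1 + l2"] by blast
        show "AE \<omega> in lambda_q T (env x) q. \<exists>\<^sub>\<infinity>k. \<forall>i\<in>S0. \<forall>j\<in>S0. \<forall>\<nu> :: nat \<Rightarrow> nat.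
           (\<forall>m\<in>{k + 1..k + l0 + l1 + l2}. \<nu> m \<in> T) \<longrightarrow>
           test_word \<omega> k l0 l1 l2 i j \<nu> \<in> Wt (env x) (k + l0 + l1 + l2) \<longrightarrow>
           \<nu> ` {k + l0 + 1..k + l0 + l1} \<subseteq> \<nu> ` {k + l0 + l1 + 1..k + l0 + l1 + l2}"
          using elim(1) q0(1,3) by (intro condition_B_from_decay[OF L q l2(2) q0(2)]) auto
      qed
    qed
  qed
qed

end

theorem theorem2p7:
  fixes p :: "nat \<Rightarrow> plane"
    and \<alpha> :: "nat \<Rightarrow> nat \<Rightarrow> plane"
    and T :: "nat set"
    and \<rho> :: "nat measure"
    and P :: "'o measure"
    and X :: "letter list \<Rightarrow> 'o \<Rightarrow> nat"
  assumes "equilateral p"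
    and "labelling p \<alpha>"
    and "T \<noteq> {}" and "finite T" and "T \<subseteq> {\<nu>. \<nu> \<ge> 2}"
    and "prob_space \<rho>" and "sets \<rho> = sets (count_space T)" and "\<forall>\<nu>\<in>T. measure \<rho> {\<nu>} > 0"
    and "prob_space P"
    and "prob_space.indep_vars P (\<lambda>_. count_space T) X (Words T)"
    and "\<forall>w\<in>Words T. distr P (count_space T) (X w) = \<rho>"
  shows "(AE x in P. \<forall>q\<in>weights T. condition_B T (\<lambda>w. X w x) q) \<and>
         (AE x in P. \<forall>q\<in>weights T. \<forall>f\<in>dom_F p \<alpha> T (\<lambda>w. X w x).
            mutually_singular (energy_measure p \<alpha> T (\<lambda>w. X w x) f) (mu_q p \<alpha> T (\<lambda>w. X w x) q))"
proof -
  interpret random_gasket p \<alpha> T P \<rho> X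
    using assms by (intro random_gasket.intro gasket_letters.intro gasket_letters_axioms.intro gasket_geometry.intro random_gasket_axioms.intro) auto
  show ?thesis using AE_condition_B AE_singular unfolding env_def by blast
qed

end
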